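(* Let $u$ be a subsonic variational solution (as defined in the context) in $\Omega$, let $x^\circ=(x_1^\circ,0)\in\Omega$ with $x_1^\circ\ne0$, and let $\delta=\frac12\min\{x_1^\circ,\operatorname{dist}(x^\circ,\partial\Omega)\}$. Write $t(x)=\frac{|\nabla u(x)|^2}{x_1^2}$ and $H=H(t(x);x_2)$. For $r\in(0,\delta)$ define $$I(r)=\int_{B_r(x^\circ)}x_1\big[F(t;x_2)+\lambda(x_2)\chi_{\{u>0\}}\big]dx,\qquad J(r)=\int_{\partial B_r(x^\circ)}\frac{u^2}{x_1\bar\rho_0}\,d\mathcal{H}^1,$$ $$M^{x_2}(r)=r^{-3}I(r)-\tfrac32r^{-4}J(r).$$ Then for a.e. $r\in(0,\delta)$, $$(M^{x_2})'(r)=2r^{-3}\int_{\partial B_r(x^\circ)}\frac{1}{x_1H}\Big(\nabla u\cdot\nu-\frac32\frac ur\Big)^2d\mathcal{H}^1+\sum_{i=1}^6r^{-4}K_i^{x_2}(r),$$ where $$K_1^{x_2}(r)=\int_{B_r(x^\circ)}x_1\Big[\int_0^{t}\partial_\tau\Big(\tfrac1{H(\tau;x_2)}\Big)\tau\,d\tau-\Big(\int_0^{x_2}\partial_\tau\Big(\tfrac1{H(\tau;x_2)}\Big)\tau\,d\tau\Big)\chi_{\{u>0\}}\Big]dx,$$ $$K_2^{x_2}(r)=\int_{B_r(x^\circ)}x_1\Big[\int_0^{t}\partial_{x_2}\Big(\tfrac1{H(\tau;x_2)}\Big)x_2\,d\tau-\Big(\int_0^{x_2}\partial_{x_2}\Big(\tfrac1{H(\tau;x_2)}\Big)x_2\,d\tau\Big)\chi_{\{u>0\}}\Big]dx,$$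 $$K_3^{x_2}(r)=\int_{B_r(x^\circ)}(x_1-x_1^\circ)\Big[F(t;x_2)-\frac{2t}{H}+\lambda(x_2)\chi_{\{u>0\}}\Big]dx,$$ $$K_4^{x_2}(r)=3\int_{\partial B_r(x^\circ)}\Big(\frac1{x_1H}-\frac1{x_1\bar\rho_0}\Big)u\nabla u\cdot\nu\,d\mathcal{H}^1,$$ $$K_5^{x_2}(r)=\frac9{2r}\int_{\partial B_r(x^\circ)}\Big(\frac1{x_1\bar\rho_0}-\frac1{x_1H}\Big)u^2\,d\mathcal{H}^1,\qquad K_6^{x_2}(r)=\frac3{2r}\int_{\partial B_r(x^\circ)}\frac{x_1-x_1^\circ}{x_1^2\bar\rho_0}u^2\,d\mathcal{H}^1.$$
   Context: Notation. $x=(x_1,x_2)$; $B_r(x^\circ)$ is the open disc in $\mathbb{R}^2$; $\nu=(x-x^\circ)/r$ on $\partial B_r(x^\circ)$; $\chi_A$ is the characteristic function of $A$; $\mathcal{H}^1$ is one-dimensional Hausdorff measure; $\partial\Omega$ is the boundary of $\Omega$ relative to $\{x_1\ge0\}$. $W^{1,2}_{w,loc}(\Omega)$ is the space of $v$ with $\int_K\frac1{x_1}(|v|^2+|\nabla v|^2)dx<\infty$ for all compact $K\subset\Omega$. "Locally" means on each compact subset. Equation of state. $g>0$ and $\bar\rho_0>0$ are constants; $p\in C^{1,\alpha}([0,\infty))$, twice differentiable on $(0,\infty)$, with $p'(\rho)>0$ and $2p'(\rho)+\rho p''(\rho)>0$ for $\rho>0$; $h(\rho)=\int_{\bar\rho_0}^{\rho}\frac{p'(s)}{s}ds$;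 $s_*:=\frac{p'(\bar\rho_0)}{2g}$. For $0\le s<s_*$ let $\rho_{cr}(s)$ be the unique number with $\frac{p'(\rho_{cr}(s))}{2}+h(\rho_{cr}(s))=gs$. For $t\ge0$ let $H(t;s)$ be the unique solution $H>\rho_{cr}(s)$ of $\frac{g\bar\rho_0^2t}{H^2}+h(H)=gs$, whenever it exists; in particular $H(s;s)=\bar\rho_0$. Set $F(t;s)=\int_0^t\frac{d\tau}{H(\tau;s)}$, $\partial_1F=\partial F/\partial t=1/H$, $\partial_2F=\partial F/\partial s$, and $\lambda(s)=\frac{2s}{\bar\rho_0}-F(s;s)$. In $\partial_{x_2}(1/H(\tau;x_2))$ the derivative is in the second argument with $\tau$ fixed. Free boundary problem: $\operatorname{div}\Big(\frac{\nabla u}{x_1H(|\nabla u|^2/x_1^2;x_2)}\Big)=0$ in $\Omega\cap\{u>0\}$, $\frac{|\nabla u|^2}{x_1^2}=x_2$ on $\Omega\cap\partial\{u>0\}$, where $\Omega$ is connected and relatively open in $\{x_1\ge0\}$, contained in $\{x_2<s_*\}$. Subsonic variational solution: $u\in W^{1,2}_{w,loc}(\Omega)$ such that (1) $u\ge0$ in $\Omega$, $u=0$ on $\{x_1=0\}$; (2) $u\in C^0(\Omega)\cap C^2(\Omega\cap\{u>0\})$; (3) for every $x^\circ\in\Omega\cap\{x_1=0\}$, as $x\to x^\circ$ with $x\in\Omega\cap\{u>0\}$, $\frac1{x_1}\partial_{x_2}u\to0$ and $\frac1{x_1}\partial_{x_1}u$ has a limit; (4) there is $\varepsilon_0>0$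 such that $H(\frac{|\nabla u|^2}{x_1^2};x_2)-\rho_{cr}(x_2)\ge\varepsilon_0$ locally in $\Omega\cap\{x_2\ge0\}$; (5) $\{u>0\}$, hence the free surface $\partial\{u>0\}$, is contained in $\{x_1\ge0,x_2\ge0\}$ (all integrands involving $H,F,\lambda$ are read as $0$ where $x_2<0$); (6) for every $\phi=(\phi_1,\phi_2)\in C^1_0(\Omega;\mathbb{R}^2)$ with $\phi_1=0$ on $\{x_1=0\}$, writing $t=|\nabla u|^2/x_1^2$, $$0=\int_\Omega x_1[F(t;x_2)+\lambda(x_2)\chi_{\{u>0\}}]\operatorname{div}\phi-2\int_\Omega\partial_1F(t;x_2)\tfrac1{x_1}\nabla u\,D\phi\,\nabla u+\int_\Omega\big(F(t;x_2)-2\partial_1F(t;x_2)t+\lambda(x_2)\chi_{\{u>0\}}\big)\phi_1+\int_\Omega x_1\big(\partial_2F(t;x_2)+\lambda'(x_2)\chi_{\{u>0\}}\big)\phi_2 .$$ *)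

theory Defs
  imports "HOL-Analysis.Analysis"
begin

section \<open>One-dimensional Hausdorff measure\<close>

text \<open>The normalising constant in dimension one is 1, so a covering set counts with its diameter.
  \<^const>\<open>diameter\<close> is only meaningful on bounded sets, whence the boundedness side condition.\<close>

definition hausdorff1_pre :: "real \<Rightarrow> 'a::metric_space set \<Rightarrow> ennreal" where
  "hausdorff1_pre d A =
     (INF C\<in>{C :: nat \<Rightarrow> 'a set. A \<subseteq> (\<Union>i. C i) \<and> (\<forall>i. bounded (C i) \<and> diameter (C i) \<le> d)}.
        \<Sum>i. ennreal (diameter (C i)))"

definition hausdorff1_outer :: "'a::metric_space set \<Rightarrow> ennreal" where
  "hausdorff1_outer A = (SUP d\<in>{0<..}. hausdorff1_pre d A)"

text \<open>The measure lives on the Caratheodory-measurable sets, so it is complete. This matters below: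
  a weak gradient is only Lebesgue measurable, hence its restriction to a circle need not be
  Borel, not even for almost every radius.\<close>

definition hausdorff1 :: "'a::metric_space measure" where
  "hausdorff1 = measure_of UNIV (lambda_system UNIV (Pow UNIV) hausdorff1_outer) hausdorff1_outer"

text \<open>\<^const>\<open>measure_of\<close> silently returns the zero measure when its argument is not
  countably additive; the following lemmas show that this is not the case here.\<close>

lemma hausdorff1_pre_Union:
  fixes A :: "nat \<Rightarrow> 'a::metric_space set"
  shows "hausdorff1_pre d (\<Union>n. A n) \<le> (\<Sum>n. hausdorff1_pre d (A n))"
proof (rule ennreal_le_epsilon)
  fix e :: real
  assume fin: "(\<Sum>n. hausdorff1_pre d (A n)) < top" and e: "0 < e"
  let ?\<C> = "\<lambda>B. {C :: nat \<Rightarrow> 'a set. B \<subseteq> (\<Union>i. C i) \<and> (\<forall>i. bounded (C i) \<and> diameter (C i) \<le> d)}"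
  have "\<exists>C\<in>?\<C> (A n). (\<Sum>i. ennreal (diameter (C i))) < hausdorff1_pre d (A n) + ennreal (e * (1/2) ^ Suc n)" for n
  proof -
    have "hausdorff1_pre d (A n) < top"
      using fin ennreal_suminf_lessD by blast
    then have "hausdorff1_pre d (A n) < hausdorff1_pre d (A n) + ennreal (e * (1/2) ^ Suc n)"
      using e by (simp add: ennreal_add_left_cancel_less ennreal_zero_less_mult_iff less_top del: power_Suc)
    then show ?thesis
      unfolding hausdorff1_pre_def by (subst (asm) INF_less_iff) blast
  qed
  then have "\<forall>n. \<exists>C. C \<in> ?\<C> (A n) \<and>
      (\<Sum>i. ennreal (diameter (C i))) < hausdorff1_pre d (A n) + ennreal (e * (1/2) ^ Suc n)"
    unfolding Bex_def by (rule allI)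
  from choice[OF this] obtain C where C0: "\<forall>n. C n \<in> ?\<C> (A n) \<and>
      (\<Sum>i. ennreal (diameter (C n i))) < hausdorff1_pre d (A n) + ennreal (e * (1/2) ^ Suc n)" ..
  have C: "C n \<in> ?\<C> (A n)" for n
    by (rule C0[THEN spec, THEN conjunct1])
  have le: "(\<Sum>i. ennreal (diameter (C n i))) < hausdorff1_pre d (A n) + ennreal (e * (1/2) ^ Suc n)" for n
    by (rule C0[THEN spec, THEN conjunct2])
  define D where "D k = (case prod_decode k of (n, i) \<Rightarrow> C n i)" for k
  have "(\<Union>n. A n) \<subseteq> (\<Union>k. D k)"
  proof
    fix x assume "x \<in> (\<Union>n. A n)"
    then obtain n i where "x \<in> C n i" using C by blast
    then have "x \<in> D (prod_encode (n, i))" by (simp add: D_def)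
    then show "x \<in> (\<Union>k. D k)" by blast
  qed
  moreover have "bounded (D k) \<and> diameter (D k) \<le> d" for k
    using C by (auto simp: D_def split: prod.split)
  ultimately have "D \<in> ?\<C> (\<Union>n. A n)" by blast
  then have "hausdorff1_pre d (\<Union>n. A n) \<le> (\<Sum>k. ennreal (diameter (D k)))"
    unfolding hausdorff1_pre_def by (rule INF_lower)
  also have "\<dots> = (\<Sum>k. (\<lambda>(n, i). ennreal (diameter (C n i))) (prod_decode k))"
    by (simp add: D_def case_prod_unfold)
  also have "\<dots> = (\<Sum>n. \<Sum>i. ennreal (diameter (C n i)))"
    by (rule suminf_ennreal_2dimen) simp
  also have "\<dots> \<le> (\<Sum>n. hausdorff1_pre d (A n) + ennreal (e * (1/2) ^ Suc n))"
    by (intro suminf_le less_imp_le le) auto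
  also have "\<dots> = (\<Sum>n. hausdorff1_pre d (A n)) + (\<Sum>n. ennreal (e * (1/2) ^ Suc n))"
    by (intro suminf_add[symmetric]) auto
  also have "(\<Sum>n. ennreal (e * (1/2) ^ Suc n)) = ennreal e"
    using e sums_mult[OF power_half_series, of e]
    by (intro suminf_ennreal_eq) auto
  finally show "hausdorff1_pre d (\<Union>n. A n) \<le> (\<Sum>n. hausdorff1_pre d (A n)) + ennreal e" .
qed

lemma outer_measure_space_hausdorff1:
  "outer_measure_space (Pow UNIV) (hausdorff1_outer :: 'a::metric_space set \<Rightarrow> ennreal)"
  unfolding outer_measure_space_def
proof (intro conjI)
  have "hausdorff1_pre d ({} :: 'a set) = 0" if "0 < d" for d
    unfolding hausdorff1_pre_def
    by (rule antisym[OF INF_lower2[where i = "\<lambda>_. {}"]]) (use that in auto)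
  then have "hausdorff1_outer ({} :: 'a set) \<le> 0"
    unfolding hausdorff1_outer_def by (intro SUP_least) simp
  then show "positive (Pow UNIV) (hausdorff1_outer :: 'a set \<Rightarrow> ennreal)"
    by (simp add: positive_def)
  show "increasing (Pow UNIV) (hausdorff1_outer :: 'a set \<Rightarrow> ennreal)"
    unfolding increasing_def hausdorff1_outer_def hausdorff1_pre_def
    by (intro ballI impI SUP_mono' INF_superset_mono) auto
  show "countably_subadditive (Pow UNIV) (hausdorff1_outer :: 'a set \<Rightarrow> ennreal)"
    unfolding countably_subadditive_def
  proof (intro allI impI)
    fix A :: "nat \<Rightarrow> 'a set"
    show "hausdorff1_outer (\<Union>n. A n) \<le> (\<Sum>n. hausdorff1_outer (A n))"
      unfolding hausdorff1_outer_def[of "\<Union>n. A n"]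
    proof (rule SUP_least)
      fix d :: real assume "d \<in> {0<..}"
      then have "hausdorff1_pre d (A n) \<le> hausdorff1_outer (A n)" for n
        unfolding hausdorff1_outer_def by (rule SUP_upper)
      then have "(\<Sum>n. hausdorff1_pre d (A n)) \<le> (\<Sum>n. hausdorff1_outer (A n))"
        by (intro suminf_le) auto
      then show "hausdorff1_pre d (\<Union>n. A n) \<le> (\<Sum>n. hausdorff1_outer (A n))"
        using hausdorff1_pre_Union[of d A] by (rule order_trans[rotated])
    qed
  qed
qed

lemma measure_space_hausdorff1:
  "measure_space UNIV (lambda_system UNIV (Pow UNIV) hausdorff1_outer)
     (hausdorff1_outer :: 'a::metric_space set \<Rightarrow> ennreal)"
  by (rule sigma_algebra.caratheodory_lemma[OF sigma_algebra_Pow outer_measure_space_hausdorff1])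

lemma sets_hausdorff1:
  "sets (hausdorff1 :: 'a::metric_space measure) = lambda_system UNIV (Pow UNIV) hausdorff1_outer"
proof -
  have "sigma_algebra (UNIV :: 'a set) (lambda_system UNIV (Pow UNIV) hausdorff1_outer)"
    using measure_space_hausdorff1 by (auto simp: measure_space_def)
  then show ?thesis
    unfolding hausdorff1_def by (simp add: sigma_algebra.sigma_sets_eq)
qed

lemma emeasure_hausdorff1:
  assumes "A \<in> sets hausdorff1"
  shows "emeasure hausdorff1 A = hausdorff1_outer (A :: 'a::metric_space set)"
proof -
  have "sigma_algebra (UNIV :: 'a set) (lambda_system UNIV (Pow UNIV) hausdorff1_outer)"
    "positive (lambda_system (UNIV :: 'a set) (Pow UNIV) hausdorff1_outer) hausdorff1_outer"
    "countably_additive (lambda_system (UNIV :: 'a set) (Pow UNIV) hausdorff1_outer) hausdorff1_outer"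
    using measure_space_hausdorff1 by (auto simp: measure_space_def)
  then show ?thesis
    using assms unfolding hausdorff1_def
    by (intro emeasure_measure_of_sigma) (auto simp: sigma_algebra.sigma_sets_eq)
qed


section \<open>Differentiability classes, weak gradients\<close>

definition C1_on ::
  "'a::real_normed_vector set \<Rightarrow> ('a \<Rightarrow> 'b::real_normed_vector) \<Rightarrow> ('a \<Rightarrow> 'a \<Rightarrow>\<^sub>L 'b) \<Rightarrow> bool" where
  "C1_on S f D \<longleftrightarrow>
     (\<forall>x\<in>S. (f has_derivative blinfun_apply (D x)) (at x within S)) \<and> continuous_on S D"

definition C2_on :: "'a::real_normed_vector set \<Rightarrow> ('a \<Rightarrow> 'b::real_normed_vector) \<Rightarrow> bool" where
  "C2_on S f \<longleftrightarrow> (\<exists>D D2. C1_on S f D \<and> C1_on S D D2)"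

definition compactly_supported_in ::
  "'a::topological_space set \<Rightarrow> ('a \<Rightarrow> 'b::zero) \<Rightarrow> bool" where
  "compactly_supported_in S f \<longleftrightarrow> (\<exists>K. compact K \<and> K \<subseteq> S \<and> (\<forall>x\<in>S - K. f x = 0))"

definition weak_gradient_on :: "(real^2) set \<Rightarrow> (real^2 \<Rightarrow> real) \<Rightarrow> (real^2 \<Rightarrow> real^2) \<Rightarrow> bool" where
  "weak_gradient_on U v G \<longleftrightarrow>
     (\<forall>K. compact K \<and> K \<subseteq> U \<longrightarrow> set_integrable lebesgue K v \<and> set_integrable lebesgue K G) \<and>
     (\<forall>\<psi> D. C1_on U \<psi> D \<and> compactly_supported_in U \<psi> \<longrightarrow>
        (\<forall>i. (LINT x:U|lebesgue. v x * D x (axis i 1)) = - (LINT x:U|lebesgue. G x $ i * \<psi> x)))"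

text \<open>The gradient is taken in the open set where the first coordinate is positive; its complement
  in \<^term>\<open>\<Omega>\<close> is a null set. The integrability is required up to the axis.\<close>

definition W12w_loc :: "(real^2) set \<Rightarrow> (real^2 \<Rightarrow> real) \<Rightarrow> (real^2 \<Rightarrow> real^2) \<Rightarrow> bool" where
  "W12w_loc \<Omega> v G \<longleftrightarrow>
     weak_gradient_on (\<Omega> \<inter> {x. 0 < x $ 1}) v G \<and>
     (\<forall>K. compact K \<and> K \<subseteq> \<Omega> \<longrightarrow>
        set_integrable lebesgue K (\<lambda>x. 1 / x $ 1 * ((v x)\<^sup>2 + (norm (G x))\<^sup>2)))"


section \<open>Equation of state\<close>

text \<open>The one-sided derivative at 0 is used there; for positive arguments this is the derivative.
  The Hoelder condition of the class $C^{1,\alpha}([0,\infty))$ is required on bounded intervals only.\<close>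

definition dpress :: "(real \<Rightarrow> real) \<Rightarrow> real \<Rightarrow> real" where
  "dpress p \<rho> = vector_derivative p (at \<rho> within {0..})"

definition equation_of_state :: "real \<Rightarrow> real \<Rightarrow> real \<Rightarrow> (real \<Rightarrow> real) \<Rightarrow> bool" where
  "equation_of_state g \<rho>0 \<alpha> p \<longleftrightarrow>
     0 < g \<and> 0 < \<rho>0 \<and> 0 < \<alpha> \<and> \<alpha> < 1 \<and>
     (\<forall>\<rho>\<ge>0. (p has_real_derivative dpress p \<rho>) (at \<rho> within {0..})) \<and>
     (\<forall>R>0. \<exists>C. \<forall>a\<in>{0..R}. \<forall>b\<in>{0..R}. \<bar>dpress p a - dpress p b\<bar> \<le> C * \<bar>a - b\<bar> powr \<alpha>) \<and>
     (\<forall>\<rho>>0. dpress p differentiable (at \<rho>) \<and> 0 < dpress p \<rho> \<and>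
        0 < 2 * dpress p \<rho> + \<rho> * deriv (dpress p) \<rho>)"

definition enthalpy :: "real \<Rightarrow> (real \<Rightarrow> real) \<Rightarrow> real \<Rightarrow> real" where
  "enthalpy \<rho>0 p \<rho> = (LBINT s=\<rho>0..\<rho>. dpress p s / s)"

definition s_star :: "real \<Rightarrow> real \<Rightarrow> (real \<Rightarrow> real) \<Rightarrow> real" where
  "s_star g \<rho>0 p = dpress p \<rho>0 / (2 * g)"

text \<open>The value 0 is excluded as a candidate: there the improper integral defining the enthalpy may
  diverge, and would then be 0 by convention.\<close>

definition rho_cr :: "real \<Rightarrow> real \<Rightarrow> (real \<Rightarrow> real) \<Rightarrow> real \<Rightarrow> real" where
  "rho_cr g \<rho>0 p s = (THE \<rho>. 0 < \<rho> \<and> dpress p \<rho> / 2 + enthalpy \<rho>0 p \<rho> = g * s)"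

definition subsonic_density ::
  "real \<Rightarrow> real \<Rightarrow> (real \<Rightarrow> real) \<Rightarrow> real \<Rightarrow> real \<Rightarrow> real \<Rightarrow> bool" where
  "subsonic_density g \<rho>0 p t s \<eta> \<longleftrightarrow>
     rho_cr g \<rho>0 p s < \<eta> \<and> g * \<rho>0\<^sup>2 * t / \<eta>\<^sup>2 + enthalpy \<rho>0 p \<eta> = g * s"

definition Hfun :: "real \<Rightarrow> real \<Rightarrow> (real \<Rightarrow> real) \<Rightarrow> real \<Rightarrow> real \<Rightarrow> real" where
  "Hfun g \<rho>0 p t s = (THE \<eta>. subsonic_density g \<rho>0 p t s \<eta>)"

definition Ffun :: "real \<Rightarrow> real \<Rightarrow> (real \<Rightarrow> real) \<Rightarrow> real \<Rightarrow> real \<Rightarrow> real" where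
  "Ffun g \<rho>0 p t s = (LBINT \<tau>=0..t. 1 / Hfun g \<rho>0 p \<tau> s)"

definition d1F :: "real \<Rightarrow> real \<Rightarrow> (real \<Rightarrow> real) \<Rightarrow> real \<Rightarrow> real \<Rightarrow> real" where
  "d1F g \<rho>0 p t s = 1 / Hfun g \<rho>0 p t s"

text \<open>The two-sided derivative in \<^term>\<open>s\<close> (also that of \<open>lam\<close>) is only unreliable for
  \<^term>\<open>s = (0::real)\<close>, the endpoint of the range of \<^term>\<open>s\<close>; wherever it is integrated this
  concerns a null set.\<close>

definition d2F :: "real \<Rightarrow> real \<Rightarrow> (real \<Rightarrow> real) \<Rightarrow> real \<Rightarrow> real \<Rightarrow> real" where
  "d2F g \<rho>0 p t s = deriv (\<lambda>\<sigma>. Ffun g \<rho>0 p t \<sigma>) s"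

definition lam :: "real \<Rightarrow> real \<Rightarrow> (real \<Rightarrow> real) \<Rightarrow> real \<Rightarrow> real" where
  "lam g \<rho>0 p s = 2 * s / \<rho>0 - Ffun g \<rho>0 p s s"


section \<open>Subsonic variational solutions\<close>

text \<open>Integrands involving \<^const>\<open>Hfun\<close>, \<^const>\<open>Ffun\<close> or \<^const>\<open>lam\<close> are read as 0 where the second
  coordinate is negative; this is rendered by integrating over the intersection with the
  following half-plane.\<close>

definition upper :: "(real^2) set" where
  "upper = {x. 0 \<le> x $ 2}"

definition rel_boundary :: "(real^2) set \<Rightarrow> (real^2) set" where
  "rel_boundary \<Omega> = (top_of_set {x. 0 \<le> x $ 1}) frontier_of \<Omega>"

definition admissible_domain :: "real \<Rightarrow> real \<Rightarrow> (real \<Rightarrow> real) \<Rightarrow> (real^2) set \<Rightarrow> bool" where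
  "admissible_domain g \<rho>0 p \<Omega> \<longleftrightarrow>
     connected \<Omega> \<and> openin (top_of_set {x. 0 \<le> x $ 1}) \<Omega> \<and> \<Omega> \<subseteq> {x. x $ 2 < s_star g \<rho>0 p}"

definition tfun :: "(real^2 \<Rightarrow> real^2) \<Rightarrow> real^2 \<Rightarrow> real" where
  "tfun G x = (norm (G x))\<^sup>2 / (x $ 1)\<^sup>2"

definition partial_deriv :: "(real^2 \<Rightarrow> real) \<Rightarrow> 2 \<Rightarrow> real^2 \<Rightarrow> real" where
  "partial_deriv u i x = frechet_derivative u (at x) (axis i 1)"

definition domain_variation_formula ::
  "real \<Rightarrow> real \<Rightarrow> (real \<Rightarrow> real) \<Rightarrow> (real^2) set \<Rightarrow> (real^2 \<Rightarrow> real) \<Rightarrow> (real^2 \<Rightarrow> real^2) \<Rightarrow>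
   (real^2 \<Rightarrow> real^2) \<Rightarrow> (real^2 \<Rightarrow> ((real^2) \<Rightarrow>\<^sub>L (real^2))) \<Rightarrow> bool" where
  "domain_variation_formula g \<rho>0 p \<Omega> u G \<phi> D \<longleftrightarrow>
     (let t = tfun G; F = Ffun g \<rho>0 p; \<Lambda> = lam g \<rho>0 p;
          F1 = d1F g \<rho>0 p; F2 = d2F g \<rho>0 p;
          chi = indicat_real {x\<in>\<Omega>. 0 < u x} in
      0 = (LINT x:\<Omega> \<inter> upper|lebesgue.
             x $ 1 * (F (t x) (x $ 2) + \<Lambda> (x $ 2) * chi x) * trace (matrix (blinfun_apply (D x))))
        - 2 * (LINT x:\<Omega> \<inter> upper|lebesgue.
             F1 (t x) (x $ 2) * (1 / x $ 1) * (G x \<bullet> D x (G x)))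
        + (LINT x:\<Omega> \<inter> upper|lebesgue.
             (F (t x) (x $ 2) - 2 * F1 (t x) (x $ 2) * t x + \<Lambda> (x $ 2) * chi x) * \<phi> x $ 1)
        + (LINT x:\<Omega> \<inter> upper|lebesgue.
             x $ 1 * (F2 (t x) (x $ 2) + deriv \<Lambda> (x $ 2) * chi x) * \<phi> x $ 2))"

text \<open>\<^term>\<open>G\<close> is any representative of the weak gradient of \<^term>\<open>u\<close>. Accordingly
  the uniform subsonicity condition is an almost-everywhere statement; it includes the existence
  of the subsonic density. The constant may depend on the compact set. The condition at the axis is
  pointwise, and stated with the classical derivatives, which exist where \<^term>\<open>u\<close> is positive.\<close>

definition subsonic_variational_solution ::
  "real \<Rightarrow> real \<Rightarrow> (real \<Rightarrow> real) \<Rightarrow> (real^2) set \<Rightarrow> (real^2 \<Rightarrow> real) \<Rightarrow> (real^2 \<Rightarrow> real^2) \<Rightarrow> bool" where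
  "subsonic_variational_solution g \<rho>0 p \<Omega> u G \<longleftrightarrow>
     W12w_loc \<Omega> u G \<and>
     (\<forall>x\<in>\<Omega>. 0 \<le> u x) \<and> (\<forall>x\<in>\<Omega>. x $ 1 = 0 \<longrightarrow> u x = 0) \<and>
     continuous_on \<Omega> u \<and> C2_on {x\<in>\<Omega>. 0 < u x} u \<and>
     (\<forall>z\<in>\<Omega>. z $ 1 = 0 \<longrightarrow>
        ((\<lambda>x. 1 / x $ 1 * partial_deriv u 2 x) \<longlongrightarrow> 0) (at z within {x\<in>\<Omega>. 0 < u x}) \<and>
        (\<exists>l. ((\<lambda>x. 1 / x $ 1 * partial_deriv u 1 x) \<longlongrightarrow> l) (at z within {x\<in>\<Omega>. 0 < u x}))) \<and>
     (\<forall>K. compact K \<and> K \<subseteq> \<Omega> \<inter> upper \<longrightarrow>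
        (\<exists>\<epsilon>>0. AE x in lebesgue. x \<in> K \<longrightarrow>
           (\<exists>\<eta>. subsonic_density g \<rho>0 p (tfun G x) (x $ 2) \<eta>) \<and>
           \<epsilon> \<le> Hfun g \<rho>0 p (tfun G x) (x $ 2) - rho_cr g \<rho>0 p (x $ 2))) \<and>
     {x\<in>\<Omega>. 0 < u x} \<subseteq> {x. 0 \<le> x $ 1 \<and> 0 \<le> x $ 2} \<and>
     (\<forall>\<phi> D. C1_on \<Omega> \<phi> D \<and> compactly_supported_in \<Omega> \<phi> \<and> (\<forall>x\<in>\<Omega>. x $ 1 = 0 \<longrightarrow> \<phi> x $ 1 = 0) \<longrightarrow>
        domain_variation_formula g \<rho>0 p \<Omega> u G \<phi> D)"

end

theory Submission
  imports Defs
begin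

text \<open>Let \<open>P = {u > 0} \<inter> B\<^sub>\<delta>(x0)\<close>. The subsonicity margin and compactness make the density \<open>\<eta>\<close>
  a continuously differentiable function on \<open>P\<close>, bounded away from the critical density, and
  \<open>\<nabla>u = 0\<close> almost everywhere outside \<open>P\<close>; so every integral in the statement is the integral of a
  bounded continuous function over the part of a disc or a circle in \<open>P\<close>, with integrands that are
  explicit in \<open>x\<close>, \<open>u\<close>, \<open>\<nabla>u\<close> and \<open>\<eta>\<close>.

  Three identities hold on almost every circle. The domain variation formula with the
  field \<open>\<zeta>(\<bar>x - x0\<bar>\<^sup>2) (x - x0)\<close> expresses \<open>I'\<close> by \<open>I\<close>, the Dirichlet energy and the normal derivative.
  The energy is the flux of \<open>u V\<close>, where \<open>V = \<nabla>u / (x\<^sub>1 \<eta>)\<close> is divergence free: domain variations supported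
  in \<open>P\<close> give \<open>\<nabla>u div V = 0\<close>, and on the open set where \<open>div V \<noteq> 0\<close> both \<open>\<nabla>u\<close> and \<open>V\<close> would vanish. The
  divergence theorem for \<open>u\<^sup>2 (x - x0) / (x\<^sub>1 \<rho>0)\<close> turns \<open>J\<close> into an area integral. No regularity of the free
  boundary is needed, as \<open>u\<close> is continuous and may be cut off where it is small. Differentiating
  the area integrals in polar coordinates and completing the square gives the formula.\<close>

section \<open>The Hausdorff measure of circles\<close>

text \<open>The constants belong to functions homogeneous of degree 3/2 about \<open>x0\<close>:
  their squared gradient has degree 1, like the value x_2 prescribed on the free boundary, so that
  \<open>I\<close> scales like r^3 and \<open>J\<close> like r^4 to leading order, and the square in
  the formula vanishes. \<open>K 1\<close>, \<open>K 2\<close>, \<open>K 4\<close>,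
  \<open>K 5\<close> collect the error of treating the density as \<open>\<rho>0\<close>,
  \<open>K 3\<close> and \<open>K 6\<close> that of treating x_1 as constant. Three obstacles shape
  the proof. The second derivative of \<open>p\<close> may be discontinuous; the partial derivatives
  of \<open>H\<close> are continuous all the same, because they involve \<open>p\<close> only
  through \<open>\<Phi>\<close>. The gradient of \<open>u\<close> is not known beforehand to be
  bounded near the free boundary; the Bernoulli equation with a density in a compact interval bounds
  it. And the circle identities hold for almost every radius only, while differentiating
  \<open>J\<close> compares neighbouring radii; continuity in the radius extends the identity for
  \<open>J\<close> to all of them.\<close>

lemma hausdorff1_pre_antimono:
  "d \<le> d' \<Longrightarrow> hausdorff1_pre d' A \<le> hausdorff1_pre d A"
  unfolding hausdorff1_pre_def by (rule INF_superset_mono) (auto intro: order_trans)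

lemma hausdorff1_pre_le_outer: "0 < d \<Longrightarrow> hausdorff1_pre d A \<le> hausdorff1_outer A"
  unfolding hausdorff1_outer_def by (rule SUP_upper) simp

lemma hausdorff1_outer_mono: "A \<subseteq> B \<Longrightarrow> hausdorff1_outer A \<le> hausdorff1_outer B"
  using outer_measure_space_hausdorff1 unfolding outer_measure_space_def increasing_def by blast

lemma hausdorff1_outer_empty: "hausdorff1_outer {} = 0"
  using outer_measure_space_hausdorff1 unfolding outer_measure_space_def positive_def by blast

lemma hausdorff1_outer_UN:
  fixes A :: "nat \<Rightarrow> 'a::metric_space set"
  shows "hausdorff1_outer (\<Union>n. A n) \<le> (\<Sum>n. hausdorff1_outer (A n))"
  unfolding hausdorff1_outer_def[of "\<Union>n. A n"]
proof (rule SUP_least)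
  fix d :: real assume "d \<in> {0<..}"
  then have "(\<Sum>n. hausdorff1_pre d (A n)) \<le> (\<Sum>n. hausdorff1_outer (A n))"
    by (intro suminf_le hausdorff1_pre_le_outer) auto
  then show "hausdorff1_pre d (\<Union>n. A n) \<le> (\<Sum>n. hausdorff1_outer (A n))"
    using hausdorff1_pre_Union[of d A] by (rule order_trans[rotated])
qed

lemma hausdorff1_outer_Un:
  fixes A B :: "'a::metric_space set"
  shows "hausdorff1_outer (A \<union> B) \<le> hausdorff1_outer A + hausdorff1_outer B"
proof -
  have "(\<Union>n. binaryset A B n) = A \<union> B" by (simp add: UN_binaryset_eq)
  moreover have "(\<Sum>n. hausdorff1_outer (binaryset A B n)) = hausdorff1_outer A + hausdorff1_outer B"
    by (rule suminf_binaryset_eq) (rule hausdorff1_outer_empty)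
  ultimately show ?thesis
    using hausdorff1_outer_UN[of "binaryset A B"] by simp
qed

text \<open>A covering set of diameter at most \<open>d\<close> cannot meet both \<open>A\<close>
  and \<open>B\<close>, so cutting the sets of a cover down to \<open>A\<close> and to
  \<open>B\<close> counts no diameter twice.\<close>

lemma hausdorff1_pre_separated:
  fixes A B :: "'a::metric_space set"
  assumes sep: "\<And>x y. x \<in> A \<Longrightarrow> y \<in> B \<Longrightarrow> d < dist x y"
  shows "hausdorff1_pre d A + hausdorff1_pre d B \<le> hausdorff1_pre d (A \<union> B)"
  unfolding hausdorff1_pre_def[of d "A \<union> B"]
proof (rule INF_greatest)
  fix C :: "nat \<Rightarrow> 'a set"
  assume C: "C \<in> {C. A \<union> B \<subseteq> (\<Union>i. C i) \<and> (\<forall>i. bounded (C i) \<and> diameter (C i) \<le> d)}"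
  have bd: "bounded (C i)" "diameter (C i) \<le> d" for i using C by auto
  have sub: "diameter (C i \<inter> X) \<le> diameter (C i)" for i X
    by (rule diameter_subset) (use bd in auto)
  have "hausdorff1_pre d X \<le> (\<Sum>i. ennreal (diameter (C i \<inter> X)))" if "X \<subseteq> A \<union> B" for X
    unfolding hausdorff1_pre_def
  proof (rule INF_lower)
    have "diameter (C i \<inter> X) \<le> d" for i using sub[of i X] bd[of i] by linarith
    then show "(\<lambda>i. C i \<inter> X) \<in> {C. X \<subseteq> (\<Union>i. C i) \<and> (\<forall>i. bounded (C i) \<and> diameter (C i) \<le> d)}"
      using C that bd by (auto intro: bounded_subset)
  qed
  from this[of A] this[of B]
  have "hausdorff1_pre d A + hausdorff1_pre d B
      \<le> (\<Sum>i. ennreal (diameter (C i \<inter> A))) + (\<Sum>i. ennreal (diameter (C i \<inter> B)))"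
    by (simp add: add_mono)
  also have "\<dots> = (\<Sum>i. ennreal (diameter (C i \<inter> A)) + ennreal (diameter (C i \<inter> B)))"
    by (rule suminf_add) auto
  also have "\<dots> \<le> (\<Sum>i. ennreal (diameter (C i)))"
  proof (rule suminf_le)
    fix i
    have "C i \<inter> A = {} \<or> C i \<inter> B = {}"
    proof (rule ccontr)
      assume "\<not> ?thesis"
      then obtain x y where "x \<in> C i" "x \<in> A" "y \<in> C i" "y \<in> B" by blast
      then have "d < dist x y" "dist x y \<le> diameter (C i)"
        using sep bd diameter_bounded_bound by blast+
      then show False using bd(2)[of i] by linarith
    qed
    then show "ennreal (diameter (C i \<inter> A)) + ennreal (diameter (C i \<inter> B)) \<le> ennreal (diameter (C i))"
      using sub[of i A] sub[of i B] by (auto simp: ennreal_leI)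
  qed auto
  finally show "hausdorff1_pre d A + hausdorff1_pre d B \<le> (\<Sum>i. ennreal (diameter (C i)))" .
qed

text \<open>The mesh is pushed below the separation \<open>e\<close>, which is harmless as
  \<open>hausdorff1_pre\<close> grows when its mesh shrinks. Two independent meshes \<open>d\<close>
  and \<open>d'\<close> allow the two suprema to be taken one after the other.\<close>

lemma hausdorff1_outer_separated:
  fixes A B :: "'a::metric_space set"
  assumes e: "0 < e" and sep: "\<And>x y. x \<in> A \<Longrightarrow> y \<in> B \<Longrightarrow> e \<le> dist x y"
  shows "hausdorff1_outer A + hausdorff1_outer B \<le> hausdorff1_outer (A \<union> B)"
proof -
  have *: "hausdorff1_pre d A + hausdorff1_pre d' B \<le> hausdorff1_outer (A \<union> B)" if "0 < d" "0 < d'" for d d'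
  proof -
    define m where "m = min (min d d') (e/2)"
    have m: "0 < m" "m \<le> d" "m \<le> d'" "m < e" using that e by (auto simp: m_def)
    have "hausdorff1_pre d A + hausdorff1_pre d' B \<le> hausdorff1_pre m A + hausdorff1_pre m B"
      using m by (intro add_mono hausdorff1_pre_antimono) auto
    also have "\<dots> \<le> hausdorff1_pre m (A \<union> B)"
      using sep m(4) by (intro hausdorff1_pre_separated) (auto intro: less_le_trans)
    also have "\<dots> \<le> hausdorff1_outer (A \<union> B)" by (rule hausdorff1_pre_le_outer[OF m(1)])
    finally show ?thesis .
  qed
  have ne: "{0<..} \<noteq> ({}::real set)" by (auto intro: gt_ex)
  have 1: "hausdorff1_outer A + hausdorff1_pre d' B \<le> hausdorff1_outer (A \<union> B)" if "0 < d'" for d'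
    unfolding hausdorff1_outer_def[of A]
    by (subst ennreal_SUP_add_left[symmetric, OF ne]) (auto intro!: SUP_least * that)
  show ?thesis
    unfolding hausdorff1_outer_def[of B]
    by (subst add.commute, subst ennreal_SUP_add_left[symmetric, OF ne])
       (auto intro!: SUP_least 1 simp: add.commute[of _ "hausdorff1_outer A"])
qed

text \<open>The values of the 1-Lipschitz function \<open>f\<close> on the sets \<open>X k\<close>
  lie in bands that descend with gaps in between. So each new set has positive distance from the
  union of the earlier ones, and finite additivity follows by induction.\<close>

lemma hausdorff1_outer_shells:
  fixes X :: "nat \<Rightarrow> 'a::metric_space set" and f :: "'a \<Rightarrow> real"
  assumes lip: "\<And>x y. \<bar>f x - f y\<bar> \<le> dist x y"
    and a: "\<And>k. b k < a k" "\<And>j k. j < k \<Longrightarrow> a k < b j"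
    and X: "\<And>k x. x \<in> X k \<Longrightarrow> b k \<le> f x \<and> f x \<le> a k"
  shows "(\<Sum>k. hausdorff1_outer (X k)) \<le> hausdorff1_outer (\<Union>k. X k)"
proof (rule suminf_le_const)
  fix n
  have "(\<Sum>k<n. hausdorff1_outer (X k)) \<le> hausdorff1_outer (\<Union>k<n. X k)"
  proof (induction n)
    case 0
    then show ?case by simp
  next
    case (Suc n)
    show ?case
    proof (cases "n = 0")
      case True
      then show ?thesis by (simp add: lessThan_Suc)
    next
      case False
      have bmin: "b (n - 1) \<le> b k" if "k < n" for k
      proof (cases "k = n - 1")
        case False
        then have "a (n - 1) < b k" using a(2)[of k "n-1"] that by simp
        then show ?thesis using a(1)[of "n-1"] by linarith
      qed simp
      have "(\<Sum>k<Suc n. hausdorff1_outer (X k)) \<le> hausdorff1_outer (\<Union>k<n. X k) + hausdorff1_outer (X n)"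
        using Suc.IH by (simp add: add_mono)
      also have "\<dots> \<le> hausdorff1_outer ((\<Union>k<n. X k) \<union> X n)"
      proof (rule hausdorff1_outer_separated)
        show "0 < b (n - 1) - a n" using a(2)[of "n-1" n] False by auto
        fix x y assume "x \<in> (\<Union>k<n. X k)" "y \<in> X n"
        then obtain k where k: "k < n" "b k \<le> f x" and y: "f y \<le> a n" using X by auto
        then show "b (n - 1) - a n \<le> dist x y" using bmin[OF k(1)] lip[of x y] by linarith
      qed
      also have "(\<Union>k<n. X k) \<union> X n = (\<Union>k<Suc n. X k)" by (auto simp: less_Suc_eq)
      finally show ?thesis .
    qed
  qed
  also have "\<dots> \<le> hausdorff1_outer (\<Union>k. X k)" by (intro hausdorff1_outer_mono) auto
  finally show "(\<Sum>k<n. hausdorff1_outer (X k)) \<le> hausdorff1_outer (\<Union>k. X k)" .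
qed auto

text \<open>Caratheodory's criterion. Every second of the distance shells around \<open>C\<close> is kept, so that the
  shells of each of the two families \<open>R\<close> and \<open>T\<close> have positive distance from each other.\<close>

lemma closed_in_sets_hausdorff1:
  fixes C :: "'a::metric_space set"
  assumes "closed C"
  shows "C \<in> sets hausdorff1"
proof (cases "C = {}")
  case False
  define f where "f x = infdist x C" for x
  have lip: "\<bar>f x - f y\<bar> \<le> dist x y" for x y
    using infdist_triangle[of x C y] infdist_triangle[of y C x] by (auto simp: f_def dist_commute)
  have fpos: "0 < f x \<longleftrightarrow> x \<notin> C" for x
    using in_closed_iff_infdist_zero[OF assms False, of x] infdist_nonneg[of x C] by (auto simp: f_def)
  have f0: "f x = 0" if "x \<in> C" for x using that by (simp add: f_def)
  have "hausdorff1_outer (X \<inter> C) + hausdorff1_outer (X - C) = hausdorff1_outer X" for X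
  proof (cases "hausdorff1_outer X = top")
    case True
    then show ?thesis
      using hausdorff1_outer_Un[of "X \<inter> C" "X - C"] by (simp add: Int_Diff_Un top_unique)
  next
    case fin: False
    define R where "R k = {x\<in>X. 1 / (real k + 2) \<le> f x \<and> f x \<le> 1 / (real k + 3/2)}" for k
    define T where "T k = {x\<in>X. 1 / (real k + 3/2) \<le> f x \<and> f x \<le> 1 / (real k + 1)}" for k
    define Y where "Y n = {x\<in>X. 1 / (real n + 1) \<le> f x}" for n
    have sR: "(\<Sum>k. hausdorff1_outer (R k)) \<le> hausdorff1_outer (\<Union>k. R k)"
      by (rule hausdorff1_outer_shells[where f=f and b="\<lambda>k. 1 / (real k + 2)" and a="\<lambda>k. 1 / (real k + 3/2)"])
         (auto simp: R_def lip frac_less2)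
    have sT: "(\<Sum>k. hausdorff1_outer (T k)) \<le> hausdorff1_outer (\<Union>k. T k)"
      by (rule hausdorff1_outer_shells[where f=f and b="\<lambda>k. 1 / (real k + 3/2)" and a="\<lambda>k. 1 / (real k + 1)"])
         (auto simp: T_def lip frac_less2)
    have le: "hausdorff1_outer (\<Union>k. R k) \<le> hausdorff1_outer X" "hausdorff1_outer (\<Union>k. T k) \<le> hausdorff1_outer X"
      by (auto intro!: hausdorff1_outer_mono simp: R_def T_def)
    define s where "s k = hausdorff1_outer (T k) + hausdorff1_outer (R k)" for k
    have "(\<Sum>k. s k) = (\<Sum>k. hausdorff1_outer (T k)) + (\<Sum>k. hausdorff1_outer (R k))"
      unfolding s_def by (rule suminf_add[symmetric]) auto
    also have "\<dots> \<le> hausdorff1_outer X + hausdorff1_outer X"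
      by (intro add_mono order_trans[OF sR] order_trans[OF sT] le)
    also have "\<dots> < top" using fin by (simp add: less_top)
    finally have fs: "(\<Sum>k. s k) < top" .
    have tail: "(\<lambda>n. \<Sum>k. s (k + n)) \<longlonglongrightarrow> 0"
    proof -
      have *: "s k < top" for k using ennreal_suminf_lessD[OF fs] .
      have "\<exists>c. s = (\<lambda>k. ennreal (c k)) \<and> (\<forall>k. 0 \<le> c k)"
        by (rule exI[of _ "\<lambda>k. enn2real (s k)"]) (use * in auto)
      then obtain c where c: "s = (\<lambda>k. ennreal (c k))" "\<And>k. 0 \<le> c k" by blast
      have sc: "summable c"
        by (rule summable_suminf_not_top) (use c fs in auto)
      have "(\<lambda>n. ennreal (\<Sum>k. c (k + n))) \<longlonglongrightarrow> ennreal 0"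
        by (intro tendsto_ennrealI suminf_exist_split2 sc)
      moreover have "ennreal (\<Sum>k. c (k + n)) = (\<Sum>k. s (k + n))" for n
        unfolding c using sc c(2) by (subst suminf_ennreal2) (auto simp: summable_iff_shift)
      ultimately show ?thesis by simp
    qed
    \<comment> \<open>\<open>Y n\<close> keeps the distance 1 / (n + 1) from \<open>C\<close>, so
      additivity holds with \<open>Y n\<close> in place of \<open>X - C\<close>. The shells lost in
      this way have measure at most the tail, which tends to 0.\<close>
    have 1: "hausdorff1_outer (X \<inter> C) + hausdorff1_outer (Y n) \<le> hausdorff1_outer X" for n
    proof -
      have "hausdorff1_outer (X \<inter> C) + hausdorff1_outer (Y n) \<le> hausdorff1_outer ((X \<inter> C) \<union> Y n)"
      proof (rule hausdorff1_outer_separated)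
        show "0 < 1 / (real n + 1)" by simp
        fix x y assume "x \<in> X \<inter> C" "y \<in> Y n"
        then show "1 / (real n + 1) \<le> dist x y" using lip[of x y] f0[of x] by (auto simp: Y_def)
      qed
      also have "\<dots> \<le> hausdorff1_outer X" by (rule hausdorff1_outer_mono) (auto simp: Y_def)
      finally show ?thesis .
    qed
    have 2: "hausdorff1_outer (X - C) \<le> hausdorff1_outer (Y n) + (\<Sum>k. s (k + n))" for n
    proof -
      have "X - C \<subseteq> Y n \<union> (\<Union>k. T (k + n) \<union> R (k + n))"
      proof
        fix x assume x: "x \<in> X - C"
        then have fx: "0 < f x" using fpos by auto
        show "x \<in> Y n \<union> (\<Union>k. T (k + n) \<union> R (k + n))"
        proof (cases "x \<in> Y n")
          case False
          then have lt: "f x < 1 / (real n + 1)" using x by (auto simp: Y_def)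
          define m where "m = nat \<lfloor>1 / f x - 1\<rfloor>"
          have big: "real n + 1 < 1 / f x"
            using lt fx by (simp add: field_simps)
          have m: "real m \<le> 1 / f x - 1" "1 / f x - 1 < real m + 1" using big unfolding m_def by linarith+
          have "n \<le> m" using m big by linarith
          then obtain k where k: "m = k + n" using le_iff_add by (metis add.commute)
          have up: "f x \<le> 1 / (real m + 1)" using m(1) fx by (simp add: field_simps)
          have low: "1 / (real m + 2) \<le> f x" using m(2) fx by (simp add: field_simps)
          have "x \<in> T m \<union> R m" using up low x by (auto simp: T_def R_def)
          then show ?thesis using k by blast
        qed auto
      qed
      then have "hausdorff1_outer (X - C) \<le> hausdorff1_outer (Y n \<union> (\<Union>k. T (k + n) \<union> R (k + n)))"
        by (rule hausdorff1_outer_mono)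
      also have "\<dots> \<le> hausdorff1_outer (Y n) + hausdorff1_outer (\<Union>k. T (k + n) \<union> R (k + n))"
        by (rule hausdorff1_outer_Un)
      also have "\<dots> \<le> hausdorff1_outer (Y n) + (\<Sum>k. hausdorff1_outer (T (k + n) \<union> R (k + n)))"
        by (intro add_left_mono hausdorff1_outer_UN)
      also have "\<dots> \<le> hausdorff1_outer (Y n) + (\<Sum>k. s (k + n))"
        unfolding s_def by (intro add_left_mono suminf_le hausdorff1_outer_Un) auto
      finally show ?thesis .
    qed
    have "hausdorff1_outer (X \<inter> C) + hausdorff1_outer (X - C) \<le> hausdorff1_outer X + (\<Sum>k. s (k + n))" for n
    proof -
      have "hausdorff1_outer (X \<inter> C) + hausdorff1_outer (X - C)
          \<le> hausdorff1_outer (X \<inter> C) + (hausdorff1_outer (Y n) + (\<Sum>k. s (k + n)))"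
        by (rule add_left_mono[OF 2])
      also have "\<dots> = (hausdorff1_outer (X \<inter> C) + hausdorff1_outer (Y n)) + (\<Sum>k. s (k + n))"
        by (rule add.assoc[symmetric])
      also have "\<dots> \<le> hausdorff1_outer X + (\<Sum>k. s (k + n))"
        by (rule add_right_mono[OF 1])
      finally show ?thesis .
    qed
    moreover have "(\<lambda>n. hausdorff1_outer X + (\<Sum>k. s (k + n))) \<longlonglongrightarrow> hausdorff1_outer X + 0"
      by (intro tendsto_add tendsto_const tail)
    ultimately have "hausdorff1_outer (X \<inter> C) + hausdorff1_outer (X - C) \<le> hausdorff1_outer X"
      by (intro tendsto_lowerbound[where f="\<lambda>n. hausdorff1_outer X + (\<Sum>k. s (k + n))" and F=sequentially])
         (simp_all only: add_0_right eventually_True simp_thms trivial_limit_sequentially not_False_eq_True)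
    moreover have "hausdorff1_outer X \<le> hausdorff1_outer (X \<inter> C) + hausdorff1_outer (X - C)"
      using hausdorff1_outer_Un[of "X \<inter> C" "X - C"] by (simp add: Int_Diff_Un)
    ultimately show ?thesis by simp
  qed
  moreover have "C \<inter> X = X \<inter> C" "(UNIV - C) \<inter> X = X - C" for X by auto
  ultimately show ?thesis
    by (simp add: sets_hausdorff1 lambda_system_def)
qed simp

lemma borel_subset_sets_hausdorff1: "sets borel \<subseteq> sets (hausdorff1 :: 'a::metric_space measure)"
proof -
  have sp: "space (hausdorff1 :: 'a measure) = UNIV" by (simp add: hausdorff1_def space_measure_of_conv)
  have "sets (borel :: 'a measure) = sigma_sets UNIV (Collect closed)"
    unfolding borel_eq_closed by simp
  also have "\<dots> \<subseteq> sets (hausdorff1 :: 'a measure)"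
    using sets.sigma_sets_subset[of "Collect closed" "hausdorff1 :: 'a measure"] closed_in_sets_hausdorff1
    unfolding sp by blast
  finally show ?thesis .
qed

lemma space_hausdorff1 [simp]: "space hausdorff1 = UNIV"
  by (simp add: hausdorff1_def space_measure_of_conv)

lemma borel_measurable_hausdorff1:
  "f \<in> borel_measurable borel \<Longrightarrow> f \<in> borel_measurable hausdorff1"
  using borel_subset_sets_hausdorff1 by (auto simp: measurable_def)

lemma hausdorff1_null_subset:
  fixes N :: "'a::metric_space set"
  assumes "N \<in> null_sets hausdorff1" "A \<subseteq> N"
  shows "A \<in> null_sets hausdorff1"
proof -
  have "hausdorff1_outer N = 0"
    using assms(1) emeasure_hausdorff1[of N] by (auto simp: null_sets_def)
  then have 0: "hausdorff1_outer B = 0" if "B \<subseteq> A" for B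
    using hausdorff1_outer_mono[of B N] assms(2) that by auto
  have "hausdorff1_outer (A \<inter> x) + hausdorff1_outer ((UNIV - A) \<inter> x) = hausdorff1_outer x" for x
  proof -
    have "hausdorff1_outer x \<le> hausdorff1_outer (A \<inter> x) + hausdorff1_outer ((UNIV - A) \<inter> x)"
      using hausdorff1_outer_Un[of "A \<inter> x" "(UNIV - A) \<inter> x"]
      by (simp add: Int_Un_distrib2[symmetric])
    moreover have "hausdorff1_outer ((UNIV - A) \<inter> x) \<le> hausdorff1_outer x" by (rule hausdorff1_outer_mono) auto
    ultimately show ?thesis using 0[of "A \<inter> x"] by (auto intro: antisym)
  qed
  then have "A \<in> sets hausdorff1" by (auto simp: sets_hausdorff1 lambda_system_def)
  then show ?thesis using 0[of A] by (simp add: null_sets_def emeasure_hausdorff1)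
qed

lemma complete_measure_hausdorff1: "complete_measure (hausdorff1 :: 'a::metric_space measure)"
  by unfold_locales (use hausdorff1_null_subset null_setsD2 in blast)

text \<open>The distance from \<open>a\<close> is 1-Lipschitz, and its values on a connected set
  fill the interval from 0 to \<open>dist a b\<close>; a covering set is mapped into an interval no
  longer than its diameter. Any mesh will do, and 1 is taken.\<close>

lemma hausdorff1_outer_connected_ge:
  fixes A :: "'a::metric_space set"
  assumes A: "connected A" "a \<in> A" "b \<in> A"
  shows "ennreal (dist a b) \<le> hausdorff1_outer A"
proof -
  have "ennreal (dist a b) \<le> hausdorff1_pre 1 A"
    unfolding hausdorff1_pre_def
  proof (rule INF_greatest)
    fix C :: "nat \<Rightarrow> 'a set"
    assume C: "C \<in> {C. A \<subseteq> (\<Union>i. C i) \<and> (\<forall>i. bounded (C i) \<and> diameter (C i) \<le> 1)}"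
    define f where "f x = dist a x" for x
    define l where "l i = (INF x\<in>C i. f x)" for i
    define E where "E i = (if C i = {} then {} else {l i .. l i + diameter (C i)})" for i
    have bd: "bounded (C i)" for i using C by auto
    have sub: "f x \<in> E i" if "x \<in> C i" for x i
    proof -
      have ne: "C i \<noteq> {}" using that by auto
      have "l i \<le> f x" unfolding l_def
        by (rule cINF_lower[OF _ that]) (auto simp: f_def intro!: bdd_belowI[of _ 0])
      moreover have "f x - diameter (C i) \<le> l i" unfolding l_def
      proof (rule cINF_greatest[OF ne])
        fix y assume "y \<in> C i"
        then have "dist x y \<le> diameter (C i)" using that bd diameter_bounded_bound by blast
        then show "f x - diameter (C i) \<le> f y" unfolding f_def using dist_triangle[of a x y] by (simp add: dist_commute)
      qed
      ultimately show ?thesis using ne by (auto simp: E_def)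
    qed
    have conn: "connected (f ` A)"
      unfolding f_def by (intro connected_continuous_image A continuous_intros)
    have "{0..dist a b} \<subseteq> f ` A"
      using connected_contains_Icc[OF conn, of 0 "dist a b"] A by (force simp: f_def)
    also have "\<dots> \<subseteq> (\<Union>i. E i)" using C sub by blast
    finally have "emeasure lborel {0..dist a b} \<le> emeasure lborel (\<Union>i. E i)"
      by (intro emeasure_mono) (auto simp: E_def)
    also have "\<dots> \<le> (\<Sum>i. emeasure lborel (E i))"
      by (rule emeasure_subadditive_countably) (auto simp: E_def)
    also have "\<dots> \<le> (\<Sum>i. ennreal (diameter (C i)))"
      using diameter_ge_0[OF bd] by (intro suminf_le) (auto simp: E_def)
    finally show "ennreal (dist a b) \<le> (\<Sum>i. ennreal (diameter (C i)))" by simp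
  qed
  also have "\<dots> \<le> hausdorff1_outer A" by (rule hausdorff1_pre_le_outer) simp
  finally show ?thesis .
qed

section \<open>Length measure on circles\<close>

definition circ :: "real^2 \<Rightarrow> real \<Rightarrow> real \<Rightarrow> real^2" where
  "circ c r \<theta> = c + r *\<^sub>R vector [cos \<theta>, sin \<theta>]"

lemma circ_nth [simp]: "circ c r \<theta> $ 1 = c $ 1 + r * cos \<theta>" "circ c r \<theta> $ 2 = c $ 2 + r * sin \<theta>"
  by (simp_all add: circ_def)

lemma continuous_on_circ [continuous_intros]:
  fixes f g :: "'a::t2_space \<Rightarrow> real"
  assumes "continuous_on S f" "continuous_on S g"
  shows "continuous_on S (\<lambda>x. circ c (f x) (g x))"
proof -
  have "continuous_on S (\<lambda>x. circ c (f x) (g x) $ i)" for i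
    using exhaust_2[of i] by (elim disjE; simp; intro continuous_intros continuous_on_cos continuous_on_sin assms)
  then show ?thesis by (subst continuous_on_componentwise) (auto simp: Basis_vec_def inner_axis)
qed

lemma norm_real2: "norm (x::real^2) = sqrt ((x$1)\<^sup>2 + (x$2)\<^sup>2)"
  by (simp add: norm_vec_def L2_set_def UNIV_2)

lemma norm_circ: "norm (circ c r \<theta> - c) = \<bar>r\<bar>"
proof -
  have "(r * cos \<theta>)\<^sup>2 + (r * sin \<theta>)\<^sup>2 = r\<^sup>2 * ((sin \<theta>)\<^sup>2 + (cos \<theta>)\<^sup>2)" by algebra
  then show ?thesis by (simp add: norm_real2)
qed

lemma dist_circ: "0 \<le> r \<Longrightarrow> dist (circ c r a) (circ c r b) = 2 * r * \<bar>sin ((a - b) / 2)\<bar>"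
proof -
  assume r: "0 \<le> r"
  have e: "a - b = 2 * ((a - b) / 2)" by simp
  have "cos (a - b) = 1 - 2 * (sin ((a - b) / 2))\<^sup>2"
    by (subst e, rule cos_double_sin)
  then have *: "cos a * cos b + sin a * sin b = 1 - 2 * (sin ((a - b) / 2))\<^sup>2"
    by (simp add: cos_diff)
  have "(r * cos a - r * cos b)\<^sup>2 + (r * sin a - r * sin b)\<^sup>2
     = r\<^sup>2 * (((sin a)\<^sup>2 + (cos a)\<^sup>2) + ((sin b)\<^sup>2 + (cos b)\<^sup>2) - 2 * (cos a * cos b + sin a * sin b))"
    by algebra
  also have "\<dots> = (2 * r * sin ((a - b) / 2))\<^sup>2"
    unfolding * by (simp add: power_mult_distrib)
  finally show ?thesis using r by (simp add: dist_norm norm_real2 abs_mult)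
qed

lemma dist_circ_le: "0 \<le> r \<Longrightarrow> dist (circ c r a) (circ c r b) \<le> r * \<bar>a - b\<bar>"
  using mult_left_mono[OF abs_sin_x_le_abs_x[of "(a-b)/2"], of "2*r"] by (simp add: dist_circ)

lemma circ_surj:
  assumes "x \<in> sphere c r" "0 < r"
  obtains \<theta> where "0 \<le> \<theta>" "\<theta> < 2 * pi" "x = circ c r \<theta>"
proof -
  have "sqrt ((x$1 - c$1)\<^sup>2 + (x$2 - c$2)\<^sup>2) = r"
    using assms by (simp add: dist_norm norm_real2 power2_commute)
  then have *: "(x$1 - c$1)\<^sup>2 + (x$2 - c$2)\<^sup>2 = r\<^sup>2" by (metis real_sqrt_pow2 sum_power2_ge_zero)
  have "((x$1 - c$1)/r)\<^sup>2 + ((x$2 - c$2)/r)\<^sup>2 = 1"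
    using * assms(2) by (simp add: power_divide add_divide_distrib[symmetric])
  then obtain t where "0 \<le> t" "t < 2*pi" "(x$1 - c$1)/r = cos t" "(x$2 - c$2)/r = sin t"
    using sincos_total_2pi by metis
  then show ?thesis using that[of t] assms(2)
    by (auto simp: vec_eq_iff forall_2 field_simps)
qed

lemma inj_on_circ: "0 < r \<Longrightarrow> inj_on (circ c r) {0..<2*pi}"
proof (rule inj_onI)
  fix a b assume ab: "0 < r" "a \<in> {0..<2*pi}" "b \<in> {0..<2*pi}" "circ c r a = circ c r b"
  then have "sin ((a - b) / 2) = 0" using dist_circ[of r c a b] by simp
  moreover have "-pi < (a-b)/2" "(a-b)/2 < pi" using ab by auto
  ultimately show "a = b" using sin_zero_pi_iff[of "(a-b)/2"] by (simp add: abs_less_iff)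
qed

text \<open>The arc is cut into \<open>n\<close> pieces of equal angle \<open>h\<close>, with
  \<open>n\<close> so large that the Lipschitz bound \<open>r * h\<close> for their diameters is at
  most \<open>d\<close>.\<close>

lemma hausdorff1_outer_arc_le:
  assumes r: "0 < r" and ab: "a \<le> b"
  shows "hausdorff1_outer (circ c r ` {a..b}) \<le> ennreal (r * (b - a))"
  unfolding hausdorff1_outer_def
proof (rule SUP_least)
  fix d :: real assume "d \<in> {0<..}"
  then have d: "0 < d" by simp
  obtain n :: nat where n: "r * (b - a) / d < real n" using reals_Archimedean2 by blast
  have n0: "0 < real n"
    using le_less_trans[OF _ n, of 0] r ab d by simp
  define h where "h = (b - a) / real n"
  have h0: "0 \<le> h" using ab n0 by (simp add: h_def)
  have hd: "r * h \<le> d" using n n0 d by (simp add: h_def field_simps)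
  define C where "C i = (if i < n then circ c r ` {a + real i * h .. a + real (Suc i) * h} else {})" for i
  have bd: "bounded (C i)" for i
    unfolding C_def by (auto intro!: compact_imp_bounded compact_continuous_image continuous_intros)
  have dm: "diameter (C i) \<le> (if i < n then r * h else 0)" for i
  proof (cases "i < n")
    case True
    show ?thesis
    proof (rule diameter_le)
      fix x y assume "x \<in> C i" "y \<in> C i"
      then obtain s t where st: "x = circ c r s" "y = circ c r t" "s \<in> {a + real i * h .. a + real (Suc i) * h}"
        "t \<in> {a + real i * h .. a + real (Suc i) * h}" using True by (auto simp: C_def)
      have "\<bar>s - t\<bar> \<le> h" using st by (auto simp: abs_le_iff algebra_simps)
      then have "r * \<bar>s - t\<bar> \<le> r * h" using r by simp
      then show "norm (x - y) \<le> (if i < n then r * h else 0)"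
        using order_trans[OF dist_circ_le[of r c s t]] r st(1,2) True by (simp add: dist_norm)
    qed (use r h0 in auto)
  qed (simp add: C_def)
  have cov: "circ c r ` {a..b} \<subseteq> (\<Union>i. C i)"
  proof clarify
    fix t assume t: "t \<in> {a..b}"
    show "circ c r t \<in> (\<Union>i. C i)"
    proof (cases "t = b \<or> h = 0")
      \<comment> \<open>At the right endpoint the floor used below would give the index
        \<open>n\<close>, one too many; for \<open>h = 0\<close> it would divide by zero. In both
        cases the point is \<open>b\<close> and lies in the last piece.\<close>
      case True
      have "t = b"
        using True t n0 ab by (auto simp: h_def)
      then have "t \<in> {a + real (n-1) * h .. a + real (Suc (n-1)) * h}"
        using n0 h0 ab by (auto simp: h_def field_simps of_nat_diff)
      then have "circ c r t \<in> C (n-1)" using n0 by (auto simp: C_def)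
      then show ?thesis by blast
    next
      case False
      then have hp: "0 < h" "t < b" using h0 t by auto
      define i where "i = nat \<lfloor>(t - a) / h\<rfloor>"
      have q0: "0 \<le> (t - a)/h" using t hp by simp
      have i: "real i \<le> (t - a)/h" "(t - a)/h < real i + 1" unfolding i_def using q0 by linarith+
      have "(t - a)/h < real n" using hp n0 t by (simp add: h_def field_simps)
      then have "i < n" using i by linarith
      moreover have "a + real i * h \<le> t" "t \<le> a + real (Suc i) * h"
        using i hp by (simp_all add: field_simps)
      ultimately have "circ c r t \<in> C i" by (auto simp: C_def)
      then show ?thesis by blast
    qed
  qed
  have "hausdorff1_pre d (circ c r ` {a..b}) \<le> (\<Sum>i. ennreal (diameter (C i)))"
    unfolding hausdorff1_pre_def
  proof (rule INF_lower)
    have "diameter (C i) \<le> d" for i using dm[of i] hd d by (auto split: if_splits intro: order_trans)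
    then show "C \<in> {C. circ c r ` {a..b} \<subseteq> (\<Union>i. C i) \<and> (\<forall>i. bounded (C i) \<and> diameter (C i) \<le> d)}"
      using cov bd by auto
  qed
  also have "\<dots> = (\<Sum>i<n. ennreal (diameter (C i)))"
    by (rule suminf_finite) (auto simp: C_def)
  also have "\<dots> \<le> (\<Sum>i<n. ennreal (r * h))"
    using dm by (intro sum_mono ennreal_leI) (metis lessThan_iff)
  also have "\<dots> = ennreal (r * (b - a))"
    using n0 r h0 by (simp add: ennreal_of_nat_eq_real_of_nat ennreal_mult'[symmetric] h_def)
  finally show "hausdorff1_pre d (circ c r ` {a..b}) \<le> ennreal (r * (b - a))" .
qed

text \<open>Outer regularity of Lebesgue measure: \<open>E\<close> is covered by countably many
  non-overlapping intervals of total length at most that of \<open>E\<close> plus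
  \<open>e / r\<close>, and each interval is mapped to an arc.\<close>

lemma hausdorff1_outer_circ_image_le:
  assumes r: "0 < r" and E: "E \<in> sets borel" "E \<subseteq> {a..b}"
  shows "hausdorff1_outer (circ c r ` E) \<le> ennreal r * emeasure lborel E"
proof (rule ennreal_le_epsilon)
  fix e :: real assume e: "0 < e"
  have El: "E \<in> lmeasurable"
    using E by (intro bounded_set_imp_lmeasurable) (auto intro: bounded_subset[OF bounded_closed_interval])
  have sub: "E \<subseteq> cbox a b" and pos: "0 < e / r" using E(2) e r by (auto simp: cbox_interval)
  obtain D where D: "countable D"
    "\<And>K. K \<in> D \<Longrightarrow> K \<subseteq> cbox a b \<and> K \<noteq> {} \<and> (\<exists>c d. K = cbox c d)"
    "pairwise (\<lambda>A B. interior A \<inter> interior B = {}) D"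
    "E \<subseteq> \<Union>D" "\<Union>D \<in> lmeasurable" "measure lebesgue (\<Union>D) \<le> measure lebesgue E + e / r"
  proof (rule measurable_outer_intervals_bounded[OF El sub pos])
    fix D assume h: "countable D"
      "\<And>K. K \<in> D \<Longrightarrow> K \<subseteq> cbox a b \<and> K \<noteq> {} \<and> (\<exists>c d. K = cbox c d)"
      "pairwise (\<lambda>A B. interior A \<inter> interior B = {}) D"
      "\<And>u v. cbox u v \<in> D \<Longrightarrow> \<exists>n. \<forall>i \<in> Basis. v \<bullet> i - u \<bullet> i = (b \<bullet> i - a \<bullet> i)/2^n"
      "\<And>K. \<lbrakk>K \<in> D; box a b \<noteq> {}\<rbrakk> \<Longrightarrow> interior K \<noteq> {}"
      "E \<subseteq> \<Union>D" "\<Union>D \<in> lmeasurable" "measure lebesgue (\<Union>D) \<le> measure lebesgue E + e / r"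
    show thesis using h(1) h(2) h(3) h(6) h(7) h(8) by (rule that)
  qed
  \<comment> \<open>Every index that does not come from a member of \<open>D\<close> is given the
    empty set, so that the enumeration \<open>g\<close> repeats no interval. Adding
    \<open>{}\<close> makes the enumerated set nonempty.\<close>
  define f where "f = from_nat_into (insert {} D)"
  have cD: "countable (insert {} D)" using D(1) by simp
  define g where "g n = (if n \<in> to_nat_on (insert {} D) ` insert {} D then f n else {})" for n
  have gD: "g n = {} \<or> g n \<in> D" for n
  proof -
    have "f n \<in> insert {} D" unfolding f_def by (rule from_nat_into) simp
    then show ?thesis unfolding g_def by (simp only: split: if_split) blast
  qed
  have rg: "\<Union>(range g) = \<Union>D"
  proof -
    have g: "g (to_nat_on (insert {} D) K) = K" if "K \<in> D" for K
      using that cD by (auto simp: g_def f_def)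
    show ?thesis
    proof (intro equalityI subsetI)
      fix x assume "x \<in> \<Union>(range g)"
      then obtain n where "x \<in> g n" by blast
      then show "x \<in> \<Union>D" using gD[of n] by blast
    next
      fix x assume "x \<in> \<Union>D"
      then obtain K where "K \<in> D" "x \<in> K" by blast
      then have "x \<in> g (to_nat_on (insert {} D) K)" by (simp add: g)
      then show "x \<in> \<Union>(range g)" by blast
    qed
  qed
  have gint: "interior (g m) \<inter> interior (g n) = {}" if "m \<noteq> n" for m n
  proof (cases "g m = {} \<or> g n = {}")
    case False
    then have "m \<in> to_nat_on (insert {} D) ` insert {} D" "n \<in> to_nat_on (insert {} D) ` insert {} D"
      by (auto simp: g_def split: if_splits)
    then have "g m \<noteq> g n"
      using that cD by (auto simp: g_def f_def)
    then show ?thesis using D(3) gD[of m] gD[of n] False by (auto simp: pairwise_def)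
  qed auto
  have gi: "g n = {} \<or> (\<exists>u v. u \<le> v \<and> g n = {u..v})" for n
    using gD[of n] D(2)[of "g n"] by (fastforce simp: cbox_interval)
  have gcl: "emeasure lborel (g n) = emeasure lborel (interior (g n))" for n
    using gi[of n] by (auto simp: interior_atLeastAtMost_real)
  have arc: "hausdorff1_outer (circ c r ` g n) \<le> ennreal r * emeasure lborel (g n)" for n
    using gi[of n] hausdorff1_outer_arc_le[OF r] r
    by (auto simp: hausdorff1_outer_empty ennreal_mult'[symmetric])
  have "hausdorff1_outer (circ c r ` E) \<le> hausdorff1_outer (\<Union>n. circ c r ` g n)"
    using D(4) rg by (intro hausdorff1_outer_mono) blast
  also have "\<dots> \<le> (\<Sum>n. hausdorff1_outer (circ c r ` g n))"
    by (rule hausdorff1_outer_UN)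
  also have "\<dots> \<le> (\<Sum>n. ennreal r * emeasure lborel (g n))"
    by (intro suminf_le arc) auto
  also have "\<dots> = ennreal r * (\<Sum>n. emeasure lborel (interior (g n)))"
    by (simp add: gcl)
  \<comment> \<open>The intervals may share endpoints, so disjointness, and with it additivity, is
    available for their interiors only; these have the same length.\<close>
  also have "(\<Sum>n. emeasure lborel (interior (g n))) = emeasure lborel (\<Union>n. interior (g n))"
    using gint by (intro suminf_emeasure) (auto simp: disjoint_family_on_def)
  also have "\<dots> \<le> emeasure lborel (\<Union>D)"
  proof (rule emeasure_mono)
    show "(\<Union>n. interior (g n)) \<subseteq> \<Union>D" using rg interior_subset by blast
    have "g n \<in> sets borel" for n using gi[of n] by auto
    then show "\<Union>D \<in> sets lborel" unfolding rg[symmetric] by auto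
  qed
  also have "emeasure lborel (\<Union>D) = ennreal (measure lebesgue (\<Union>D))"
  proof -
    have "g n \<in> sets borel" for n using gi[of n] by auto
    then have "\<Union>D \<in> sets borel" unfolding rg[symmetric] by auto
    then have "emeasure lebesgue (\<Union>D) = emeasure lborel (\<Union>D)" by simp
    then show ?thesis using emeasure_eq_measure2[OF D(5)] by simp
  qed
  also have "ennreal (measure lebesgue (\<Union>D)) \<le> ennreal (measure lebesgue E + e / r)"
    using D(6) by (rule ennreal_leI)
  also have "\<dots> = ennreal (measure lebesgue E) + ennreal (e / r)"
    using e r by (intro ennreal_plus) auto
  also have "ennreal (measure lebesgue E) = emeasure lborel E"
    using emeasure_eq_measure2[OF El] E(1) by simp
  also have "ennreal r * (emeasure lborel E + ennreal (e / r)) = ennreal r * emeasure lborel E + ennreal e"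
    using r e by (simp add: distrib_left ennreal_mult'[symmetric])
  finally show "hausdorff1_outer (circ c r ` E) \<le> ennreal r * emeasure lborel E + ennreal e"
    by (simp add: mult_left_mono)
qed

lemma circ_image_eq_sphere: "0 < r \<Longrightarrow> circ c r ` {0..<2*pi} = sphere c r"
  using norm_circ[of c r] by (auto simp: dist_norm norm_minus_commute elim: circ_surj)

text \<open>Inscribed polygons: \<open>n\<close> arcs of half-angle \<open>x n\<close> each measure
  at least their chord \<open>2 * r * sin (x n)\<close>, because they are connected. The factor
  \<open>1 - 1 / real n\<close> shortens the arcs so that they are disjoint and their measures add
  up; it tends to 1.\<close>

lemma hausdorff1_sphere_ge:
  fixes c :: "real^2"
  assumes r: "0 < r"
  shows "ennreal (2 * pi * r) \<le> emeasure hausdorff1 (sphere c r)"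
proof -
  define x where "x n = pi / real n * (1 - 1 / real n)" for n
  have lower: "ennreal (real n * (2 * r * sin (x n))) \<le> emeasure hausdorff1 (sphere c r)" if n: "n \<ge> 2" for n
  proof -
    define A where "A k = circ c r ` {2 * pi * real k / real n .. 2 * pi * real k / real n + 2 * x n}" for k
    have xn: "0 < x n" "2 * x n < 2 * pi / real n" "x n \<le> pi"
    proof -
      have "1 / real n < 1" using n by simp
      then show "0 < x n" using n by (simp add: x_def)
      show "2 * x n < 2 * pi / real n" using n by (simp add: x_def field_simps)
      have "2 * pi / real n \<le> 2 * pi" using n by (simp add: field_simps)
      then show "x n \<le> pi" using \<open>2 * x n < 2 * pi / real n\<close> by linarith
    qed
    have I: "{2 * pi * real k / real n .. 2 * pi * real k / real n + 2 * x n} \<subseteq> {0..<2*pi}" if "k < n" for k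
    proof -
      have "2 * pi * real k / real n + 2 * pi / real n = 2 * pi * (real k + 1) / real n"
        by (simp add: distrib_left add_divide_distrib)
      also have "\<dots> \<le> 2 * pi * real n / real n"
        using that n by (intro divide_right_mono mult_left_mono) auto
      also have "\<dots> = 2 * pi" using n by simp
      finally have "2 * pi * real k / real n + 2 * x n < 2 * pi" using xn by linarith
      moreover have z: "0 \<le> 2 * pi * real k / real n" by simp
      ultimately show ?thesis by (auto intro: order_trans[OF z])
    qed
    have ms: "A k \<in> sets hausdorff1" for k
      unfolding A_def
      by (intro closed_in_sets_hausdorff1 compact_imp_closed compact_continuous_image continuous_intros) auto
    have sepI: "2 * pi * real j / real n + 2 * x n < 2 * pi * real k / real n" if "j < k" for j k
    proof -
      have "2 * pi * (real j + 1) / real n \<le> 2 * pi * real k / real n"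
        using that n by (intro divide_right_mono mult_left_mono) auto
      moreover have "2 * pi * real j / real n + 2 * pi / real n = 2 * pi * (real j + 1) / real n"
        by (simp add: distrib_left add_divide_distrib)
      ultimately show ?thesis using xn by linarith
    qed
    have disj: "disjoint_family_on A {..<n}"
      unfolding disjoint_family_on_def
    proof (intro ballI impI)
      fix j k assume jk: "j \<in> {..<n}" "k \<in> {..<n}" "j \<noteq> k"
      have "{2 * pi * real j / real n .. 2 * pi * real j / real n + 2 * x n} \<inter>
            {2 * pi * real k / real n .. 2 * pi * real k / real n + 2 * x n} = {}"
        using sepI[of j k] sepI[of k j] jk(3) by (cases "j < k") auto
      then show "A j \<inter> A k = {}"
        unfolding A_def using inj_on_image_Int[OF inj_on_circ[OF r, of c] I[of j] I[of k]] jk by auto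
    qed
    have "ennreal (2 * r * sin (x n)) \<le> emeasure hausdorff1 (A k)" for k
    proof -
      have "connected (A k)" unfolding A_def
        by (intro connected_continuous_image continuous_intros) auto
      then have "ennreal (dist (circ c r (2 * pi * real k / real n)) (circ c r (2 * pi * real k / real n + 2 * x n)))
         \<le> hausdorff1_outer (A k)"
        using xn by (intro hausdorff1_outer_connected_ge) (auto simp: A_def)
      then show ?thesis using r xn ms sin_ge_zero[of "x n"] by (simp add: dist_circ emeasure_hausdorff1)
    qed
    then have "(\<Sum>k<n. ennreal (2 * r * sin (x n))) \<le> (\<Sum>k<n. emeasure hausdorff1 (A k))"
      by (intro sum_mono)
    also have "\<dots> = emeasure hausdorff1 (\<Union>k\<in>{..<n}. A k)"
      using ms disj by (intro sum_emeasure) auto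
    also have "\<dots> \<le> emeasure hausdorff1 (sphere c r)"
    proof (rule emeasure_mono)
      show "(\<Union>k\<in>{..<n}. A k) \<subseteq> sphere c r"
        unfolding A_def using I circ_image_eq_sphere[OF r, of c] by blast
    qed (simp add: closed_in_sets_hausdorff1)
    finally show ?thesis
      using r xn sin_ge_zero[of "x n"] by (simp add: ennreal_of_nat_eq_real_of_nat ennreal_mult)
  qed
  have sinc: "((\<lambda>y::real. sin y / y) \<longlongrightarrow> 1) (at 0)"
    using DERIV_sin[of 0] by (simp add: has_field_derivative_iff)
  have inv: "(\<lambda>n. 1 / real n) \<longlonglongrightarrow> 0" by (rule lim_1_over_n)
  have x0: "x \<longlonglongrightarrow> 0"
    unfolding x_def using tendsto_mult[OF tendsto_mult[OF tendsto_const inv, of pi] tendsto_diff[OF tendsto_const inv, of 1]]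
    by simp
  have ev: "eventually (\<lambda>n. n \<ge> 2) sequentially" by (rule eventually_ge_at_top)
  have "eventually (\<lambda>n. x n \<noteq> 0) sequentially"
    using ev by eventually_elim (auto simp: x_def)
  then have "filterlim x (at 0) sequentially" using x0 by (simp add: filterlim_at)
  then have "(\<lambda>n. sin (x n) / x n) \<longlonglongrightarrow> 1" by (rule filterlim_compose[OF sinc])
  then have "(\<lambda>n. 2 * pi * r * (1 - 1 / real n) * (sin (x n) / x n)) \<longlonglongrightarrow> 2 * pi * r * (1 - 0) * 1"
    by (intro tendsto_mult tendsto_const tendsto_diff inv)
  moreover have "eventually (\<lambda>n. 2 * pi * r * (1 - 1 / real n) * (sin (x n) / x n) = real n * (2 * r * sin (x n))) sequentially"
    using ev by eventually_elim (simp add: x_def field_simps)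
  ultimately have "(\<lambda>n. real n * (2 * r * sin (x n))) \<longlonglongrightarrow> 2 * pi * r * (1 - 0) * 1"
    by (rule Lim_transform_eventually)
  then have "(\<lambda>n. real n * (2 * r * sin (x n))) \<longlonglongrightarrow> 2 * pi * r" by simp
  then have "(\<lambda>n. ennreal (real n * (2 * r * sin (x n)))) \<longlonglongrightarrow> ennreal (2 * pi * r)"
    by (rule tendsto_ennrealI)
  then show ?thesis
    by (rule tendsto_upperbound) (rule eventually_mono[OF ev], erule lower, simp)
qed

text \<open>For a general Borel set only the upper bound is known. It is applied to \<open>A\<close>
  and to its complement; were it strict for \<open>A\<close>, the two parts could not add up to the
  length of the circle, which is at least \<open>2 * pi * r\<close>.\<close>

lemma emeasure_hausdorff1_circle:
  fixes c :: "real^2"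
  assumes r: "0 < r" and A: "A \<in> sets borel"
  shows "emeasure hausdorff1 (A \<inter> sphere c r) = ennreal r * emeasure lborel {\<theta>\<in>{0..<2*pi}. circ c r \<theta> \<in> A}"
proof -
  have mc: "circ c r \<in> borel_measurable borel"
    by (intro borel_measurable_continuous_onI continuous_intros)
  define E where "E A = {\<theta>\<in>{0..<2*pi}. circ c r \<theta> \<in> A}" for A
  have Eb: "E A \<in> sets borel" if "A \<in> sets borel" for A
  proof -
    have "E A = {0..<2*pi} \<inter> (circ c r -` A \<inter> space borel)" by (auto simp: E_def)
    then show ?thesis using measurable_sets[OF mc that] by auto
  qed
  have E_sub: "E A \<subseteq> {0..2*pi}" for A by (auto simp: E_def)
  have img: "circ c r ` E A = A \<inter> sphere c r" for A
  proof -
    have "circ c r ` E A = A \<inter> circ c r ` {0..<2*pi}" by (auto simp: E_def)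
    then show ?thesis by (simp add: circ_image_eq_sphere[OF r])
  qed
  have sm: "A \<inter> sphere c r \<in> sets hausdorff1" if "A \<in> sets borel" for A
    by (rule subsetD[OF borel_subset_sets_hausdorff1], rule sets.Int[OF that]) (simp add: borel_closed)
  have le: "emeasure hausdorff1 (A \<inter> sphere c r) \<le> ennreal r * emeasure lborel (E A)" if "A \<in> sets borel" for A
    using hausdorff1_outer_circ_image_le[OF r Eb[OF that], of 0 "2*pi" c] sm[OF that]
    by (simp add: img emeasure_hausdorff1 E_sub)
  have Ac: "- A \<in> sets borel" using A by auto
  have "ennreal r * emeasure lborel (E A) + ennreal r * emeasure lborel (E (- A)) = ennreal r * emeasure lborel (E A \<union> E (- A))"
    using Eb[OF A] Eb[OF Ac] by (subst plus_emeasure[symmetric]) (auto simp: E_def distrib_left)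
  also have "E A \<union> E (- A) = {0..<2*pi}" by (auto simp: E_def)
  also have "ennreal r * emeasure lborel {0..<2*pi} = ennreal (2 * pi * r)"
    using r by (simp add: ennreal_mult'[symmetric] mult_ac)
  also have "\<dots> \<le> emeasure hausdorff1 (sphere c r)" by (rule hausdorff1_sphere_ge[OF r])
  also have "sphere c r = (A \<inter> sphere c r) \<union> (- A \<inter> sphere c r)" by auto
  also have "emeasure hausdorff1 \<dots> = emeasure hausdorff1 (A \<inter> sphere c r) + emeasure hausdorff1 (- A \<inter> sphere c r)"
    by (rule plus_emeasure[symmetric]) (use sm[OF A] sm[OF Ac] in auto)
  finally have tot: "ennreal r * emeasure lborel (E A) + ennreal r * emeasure lborel (E (- A))
    \<le> emeasure hausdorff1 (A \<inter> sphere c r) + emeasure hausdorff1 (- A \<inter> sphere c r)" .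
  have fin: "ennreal r * emeasure lborel (E X) < top" for X
  proof -
    have "emeasure lborel (E X) \<le> emeasure lborel {0..<2*pi}"
      by (rule emeasure_mono) (auto simp: E_def)
    also have "\<dots> < top" by simp
    finally show ?thesis by (simp add: ennreal_mult_less_top)
  qed
  have "ennreal r * emeasure lborel (E A) \<le> emeasure hausdorff1 (A \<inter> sphere c r)"
  proof -
    have "ennreal r * emeasure lborel (E (- A)) + ennreal r * emeasure lborel (E A)
      \<le> ennreal r * emeasure lborel (E (- A)) + emeasure hausdorff1 (A \<inter> sphere c r)"
      using order_trans[OF tot add_left_mono[OF le[OF Ac]]] by (simp only: add.commute)
    moreover have "ennreal r * emeasure lborel (E (- A)) \<noteq> \<infinity>" using fin[of "- A"] by simp
    ultimately show ?thesis by (simp only: ennreal_add_left_cancel_le) blast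
  qed
  then show ?thesis using le[OF A] unfolding E_def by (rule antisym[rotated])
qed

text \<open>As an identity of measures this transfers integrals and integrability together. The
  identity map into \<open>borel\<close> restricts \<open>hausdorff1\<close> to the Borel sets, for
  which the lengths have been computed.\<close>

lemma distr_hausdorff1_sphere:
  assumes r: "0 < r"
  shows "distr (density hausdorff1 (indicator (sphere c r))) borel (\<lambda>x. x)
    = distr (density lborel (\<lambda>\<theta>. ennreal r * indicator {0..<2*pi} \<theta>)) borel (circ c r)"
proof (rule measure_eqI)
  have mc: "circ c r \<in> borel_measurable borel"
    by (intro borel_measurable_continuous_onI continuous_intros)
  fix A assume "A \<in> sets (distr (density hausdorff1 (indicator (sphere c r))) borel (\<lambda>x. x))"
  then have A: "A \<in> sets borel" by simp
  have idm: "(\<lambda>x. x) \<in> measurable (density hausdorff1 (indicator (sphere c r))) borel"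
    using borel_measurable_hausdorff1[of "\<lambda>x. x"] by simp
  have AH: "A \<in> sets hausdorff1" "sphere c r \<in> sets hausdorff1"
    using A borel_subset_sets_hausdorff1 closed_in_sets_hausdorff1[OF closed_sphere] by auto
  have cA: "circ c r -` A \<in> sets borel" using measurable_sets[OF mc A] by simp
  have "emeasure (distr (density hausdorff1 (indicator (sphere c r))) borel (\<lambda>x. x)) A
     = emeasure hausdorff1 (A \<inter> sphere c r)"
    using A AH by (subst emeasure_distr[OF idm A]) (simp add: emeasure_restricted Int_commute)
  also have "\<dots> = ennreal r * emeasure lborel {\<theta>\<in>{0..<2*pi}. circ c r \<theta> \<in> A}"
    by (rule emeasure_hausdorff1_circle[OF r A])
  also have "{\<theta>\<in>{0..<2*pi}. circ c r \<theta> \<in> A} = {0..<2*pi} \<inter> circ c r -` A" by auto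
  also have "ennreal r * emeasure lborel ({0..<2*pi} \<inter> circ c r -` A)
      = (\<integral>\<^sup>+\<theta>. (ennreal r * indicator {0..<2*pi} \<theta>) * indicator (circ c r -` A) \<theta> \<partial>lborel)"
    using cA by (subst nn_integral_cmult_indicator[symmetric]) (auto intro!: nn_integral_cong split: split_indicator)
  also have "\<dots> = emeasure (distr (density lborel (\<lambda>\<theta>. ennreal r * indicator {0..<2*pi} \<theta>)) borel (circ c r)) A"
    using mc cA by (subst emeasure_distr) (auto simp: A emeasure_density)
  finally show "emeasure (distr (density hausdorff1 (indicator (sphere c r))) borel (\<lambda>x. x)) A
     = emeasure (distr (density lborel (\<lambda>\<theta>. ennreal r * indicator {0..<2*pi} \<theta>)) borel (circ c r)) A" .
qed simp

lemma
  fixes f :: "real^2 \<Rightarrow> real"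
  assumes r: "0 < r" and f: "f \<in> borel_measurable borel"
  shows circle_integral: "(LINT x:sphere c r|hausdorff1. f x) = r * (LINT \<theta>:{0..<2*pi}|lborel. f (circ c r \<theta>))"
    and circle_integrable: "set_integrable hausdorff1 (sphere c r) f \<longleftrightarrow>
      set_integrable lborel {0..<2*pi} (\<lambda>\<theta>. f (circ c r \<theta>))"
proof -
  have mc: "circ c r \<in> borel_measurable borel"
    by (intro borel_measurable_continuous_onI continuous_intros)
  have fc: "(\<lambda>\<theta>. f (circ c r \<theta>)) \<in> borel_measurable borel" by (rule measurable_compose[OF mc f])
  have fh: "f \<in> borel_measurable hausdorff1" by (rule borel_measurable_hausdorff1[OF f])
  have idm: "(\<lambda>x. x) \<in> measurable (density hausdorff1 (indicator (sphere c r))) borel"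
    using borel_measurable_hausdorff1[of "\<lambda>x. x"] by simp
  have sH: "sphere c r \<in> sets hausdorff1" by (simp add: closed_in_sets_hausdorff1)
  have e1: "(\<lambda>x. ennreal (indicator (sphere c r) x)) = indicator (sphere c r)"
    by (auto split: split_indicator)
  have e2: "(\<lambda>\<theta>. ennreal (r * indicator {0..<2*pi} \<theta>)) = (\<lambda>\<theta>. ennreal r * indicator {0..<2*pi} \<theta>)"
    by (auto split: split_indicator)
  have m1: "(\<lambda>x. indicator (sphere c r) x :: real) \<in> borel_measurable hausdorff1" using sH by simp
  have "(LINT x:sphere c r|hausdorff1. f x) = (LINT x|density hausdorff1 (\<lambda>x. ennreal (indicator (sphere c r) x)). f x)"
    unfolding set_lebesgue_integral_def using fh m1 by (subst integral_density) auto
  also have "\<dots> = (LINT x|distr (density hausdorff1 (indicator (sphere c r))) borel (\<lambda>x. x). f x)"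
    unfolding e1 using idm f by (subst integral_distr) auto
  also have "\<dots> = (LINT \<theta>|density lborel (\<lambda>\<theta>. ennreal (r * indicator {0..<2*pi} \<theta>)). f (circ c r \<theta>))"
    unfolding distr_hausdorff1_sphere[OF r] e2 using mc f by (subst integral_distr) auto
  also have "\<dots> = (LINT \<theta>|lborel. r * (indicator {0..<2*pi} \<theta> * f (circ c r \<theta>)))"
    using fc r by (subst integral_density) (auto simp: mult.assoc)
  also have "\<dots> = r * (LINT \<theta>:{0..<2*pi}|lborel. f (circ c r \<theta>))"
    unfolding set_lebesgue_integral_def by simp
  finally show "(LINT x:sphere c r|hausdorff1. f x) = r * (LINT \<theta>:{0..<2*pi}|lborel. f (circ c r \<theta>))" .
  have "set_integrable hausdorff1 (sphere c r) f \<longleftrightarrow> integrable (density hausdorff1 (\<lambda>x. ennreal (indicator (sphere c r) x))) f"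
    unfolding set_integrable_def using fh m1 by (subst integrable_density) auto
  also have "\<dots> \<longleftrightarrow> integrable (distr (density hausdorff1 (indicator (sphere c r))) borel (\<lambda>x. x)) f"
    unfolding e1 using idm f by (subst integrable_distr_eq) auto
  also have "\<dots> \<longleftrightarrow> integrable (density lborel (\<lambda>\<theta>. ennreal (r * indicator {0..<2*pi} \<theta>))) (\<lambda>\<theta>. f (circ c r \<theta>))"
    unfolding distr_hausdorff1_sphere[OF r] e2 using mc f by (subst integrable_distr_eq) auto
  also have "\<dots> \<longleftrightarrow> integrable lborel (\<lambda>\<theta>. r * (indicator {0..<2*pi} \<theta> * f (circ c r \<theta>)))"
    using fc r by (subst integrable_density) (auto simp: mult.assoc)
  also have "\<dots> \<longleftrightarrow> set_integrable lborel {0..<2*pi} (\<lambda>\<theta>. f (circ c r \<theta>))"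
    unfolding set_integrable_def using r by simp
  finally show "set_integrable hausdorff1 (sphere c r) f \<longleftrightarrow>
      set_integrable lborel {0..<2*pi} (\<lambda>\<theta>. f (circ c r \<theta>))" .
qed

text \<open>Makes the theorems of Tonelli and Fubini for pairs of reals available on
  \<open>real^2\<close>.\<close>

lemma lborel_real2_eq_distr:
  "(lborel :: (real^2) measure) = distr (lborel \<Otimes>\<^sub>M lborel) borel (\<lambda>p. vector [fst p, snd p])"
proof (rule lborel_eqI)
  have cont: "continuous_on UNIV (\<lambda>p::real\<times>real. vector [fst p, snd p] :: real^2)"
  proof -
    have "continuous_on UNIV (\<lambda>p::real\<times>real. (vector [fst p, snd p] :: real^2) $ i)" for i
      using exhaust_2[of i] by (elim disjE; simp; intro continuous_intros)
    then show ?thesis by (subst continuous_on_componentwise) (auto simp: Basis_vec_def inner_axis)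
  qed
  then have meas: "(\<lambda>p::real\<times>real. vector [fst p, snd p] :: real^2) \<in> borel_measurable (lborel \<Otimes>\<^sub>M lborel)"
    by (simp add: borel_measurable_continuous_onI lborel_prod)
  fix l u :: "real^2"
  assume lu: "\<And>b. b \<in> Basis \<Longrightarrow> l \<bullet> b \<le> u \<bullet> b"
  have le: "l $ i \<le> u $ i" for i
    using lu[of "axis i 1"] by (auto simp: inner_axis)
  have pre: "(\<lambda>p::real\<times>real. vector [fst p, snd p] :: real^2) -` box l u \<inter> space (lborel \<Otimes>\<^sub>M lborel)
      = {l$1<..<u$1} \<times> {l$2<..<u$2}"
    by (auto simp: mem_box_cart forall_2 space_pair_measure)
  have "emeasure (distr (lborel \<Otimes>\<^sub>M lborel) borel (\<lambda>p::real\<times>real. vector [fst p, snd p] :: real^2)) (box l u)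
      = emeasure (lborel \<Otimes>\<^sub>M lborel) ({l$1<..<u$1} \<times> {l$2<..<u$2})"
    using meas pre by (subst emeasure_distr) auto
  also have "\<dots> = ennreal (u$1 - l$1) * ennreal (u$2 - l$2)"
    using le by (subst lborel.emeasure_pair_measure_Times) auto
  also have "\<dots> = ennreal (\<Prod>b\<in>Basis. (u - l) \<bullet> b)"
  proof -
    have "(\<Prod>b\<in>Basis. (u - l) \<bullet> b) = (\<Prod>i\<in>UNIV. (u - l) $ i)"
    proof -
      have "bij_betw (\<lambda>i. axis i (1::real) :: real^2) UNIV Basis"
        by (auto simp: bij_betw_def inj_on_def axis_eq_axis Basis_vec_def)
      from prod.reindex_bij_betw[OF this, of "\<lambda>b. (u - l) \<bullet> b"]
      show ?thesis by (simp add: inner_axis)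
    qed
    also have "\<dots> = (u$1 - l$1) * (u$2 - l$2)" by (simp add: UNIV_2)
    finally show ?thesis using le by (simp add: ennreal_mult)
  qed
  finally show "emeasure (distr (lborel \<Otimes>\<^sub>M lborel) borel (\<lambda>p::real\<times>real. vector [fst p, snd p] :: real^2)) (box l u)
      = ennreal (\<Prod>b\<in>Basis. (u - l) \<bullet> b)" .
qed simp

section \<open>Polar coordinates\<close>

lemma has_derivative_vec2:
  fixes f :: "'a::real_normed_vector \<Rightarrow> real^2"
  assumes "((\<lambda>x. f x $ 1) has_derivative (\<lambda>v. f' v $ 1)) (at x within S)" "((\<lambda>x. f x $ 2) has_derivative (\<lambda>v. f' v $ 2)) (at x within S)"
  shows "(f has_derivative f') (at x within S)"
proof -
  have "((\<lambda>x. f x $ i) has_derivative (\<lambda>v. f' v $ i)) (at x within S)" for i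
    using exhaust_2[of i] assms by auto
  then show ?thesis
    by (subst has_derivative_componentwise_within) (auto simp: Basis_vec_def inner_axis)
qed

lemma circ_has_derivative:
  "((\<lambda>y::real^2. circ c (y $ 1) (y $ 2)) has_derivative
     (\<lambda>v. vector [v $ 1 * cos (y $ 2) - y $ 1 * sin (y $ 2) * v $ 2, v $ 1 * sin (y $ 2) + y $ 1 * cos (y $ 2) * v $ 2])) (at y within S)"
  by (rule has_derivative_vec2)
     (auto intro!: derivative_eq_intros bounded_linear_imp_has_derivative[OF bounded_linear_vec_nth] simp: algebra_simps)

lemma det_circ_derivative:
  "det (matrix (\<lambda>v::real^2. vector [v $ 1 * cos b - a * sin b * v $ 2, v $ 1 * sin b + a * cos b * v $ 2] :: real^2)) = a"
  by (simp add: det_2 matrix_def axis_def) (use sin_cos_squared_add[of b] in algebra)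

context
  fixes c :: "real^2" and R :: real
begin

text \<open>The angle 0 is left out: the set is then open and the polar map injective on it, and the
  missing radius lies in a null line.\<close>

definition polar_dom :: "(real^2) set" where
  "polar_dom = {y. 0 < y $ 1 \<and> y $ 1 < R \<and> 0 < y $ 2 \<and> y $ 2 < 2 * pi}"

lemma inj_on_polar: "inj_on (\<lambda>y::real^2. circ c (y $ 1) (y $ 2)) polar_dom"
proof (rule inj_onI)
  fix y z :: "real^2"
  assume y: "y \<in> polar_dom" and z: "z \<in> polar_dom" and e: "circ c (y $ 1) (y $ 2) = circ c (z $ 1) (z $ 2)"
  then have "\<bar>y $ 1\<bar> = \<bar>z $ 1\<bar>" using norm_circ[of c "y$1" "y$2"] norm_circ[of c "z$1" "z$2"] by simp
  then have e1: "y $ 1 = z $ 1" using y z by (simp add: polar_dom_def)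
  have "y $ 2 = z $ 2"
    by (rule inj_onD[OF inj_on_circ[of "y$1" c]]) (use e e1 y z in \<open>auto simp: polar_dom_def\<close>)
  then show "y = z" using e1 by (simp add: vec_eq_iff forall_2)
qed

lemma open_polar_dom: "open polar_dom"
proof -
  have "polar_dom = box (vector [0, 0]) (vector [R, 2 * pi])"
    by (auto simp: polar_dom_def mem_box_cart forall_2)
  then show ?thesis by (simp add: open_box)
qed

lemma continuous_on_polar: "continuous_on S (\<lambda>y::real^2. circ c (y $ 1) (y $ 2))"
  by (intro continuous_intros)

lemma open_polar_image: "open ((\<lambda>y::real^2. circ c (y $ 1) (y $ 2)) ` polar_dom)"
  by (rule invariance_of_domain[OF continuous_on_polar open_polar_dom inj_on_polar])

lemma polar_image_subset: "(\<lambda>y::real^2. circ c (y $ 1) (y $ 2)) ` polar_dom \<subseteq> ball c R"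
  using norm_circ by (auto simp: polar_dom_def dist_norm norm_minus_commute)

lemma ball_minus_polar_image: "ball c R - (\<lambda>y::real^2. circ c (y $ 1) (y $ 2)) ` polar_dom \<subseteq> {x. x $ 2 = c $ 2}"
proof clarify
  fix x assume x: "x \<in> ball c R" and n: "x \<notin> (\<lambda>y::real^2. circ c (y $ 1) (y $ 2)) ` polar_dom"
  show "x $ 2 = c $ 2"
  proof (rule ccontr)
    assume ne: "x $ 2 \<noteq> c $ 2"
    then have pos: "0 < dist c x" by auto
    obtain \<theta> where t: "0 \<le> \<theta>" "\<theta> < 2 * pi" "x = circ c (dist c x) \<theta>"
      using circ_surj[of x c "dist c x"] pos by auto
    have "\<theta> \<noteq> 0" using t(3) ne by (metis add.right_neutral circ_nth(2) mult_zero_right sin_zero)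
    then have "vector [dist c x, \<theta>] \<in> polar_dom" using t x pos by (simp add: polar_dom_def)
    moreover have "x = circ c ((vector [dist c x, \<theta>] :: real^2) $ 1) ((vector [dist c x, \<theta>] :: real^2) $ 2)" using t(3) by simp
    ultimately show False using n by blast
  qed
qed

lemma null_line: "{x::real^2. x $ 2 = a} \<in> null_sets lborel"
proof -
  have "negligible {x::real^2. axis 2 1 \<bullet> x = a}"
    by (rule negligible_hyperplane) (simp add: axis_eq_0_iff)
  then have n: "{x::real^2. x $ 2 = a} \<in> null_sets lebesgue"
    by (simp add: negligible_iff_null_sets inner_axis' )
  have "closed {x::real^2. x $ 2 = a}" by (intro closed_Collect_eq continuous_intros)
  then show ?thesis using n by (simp add: null_sets_def)
qed

text \<open>The area formula for injective differentiable maps, with the radius as Jacobian by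
  \<open>det_circ_derivative\<close>. Holding for all Borel sets, it identifies Lebesgue measure on
  the ball as an image measure.\<close>

lemma emeasure_ball_polar:
  assumes A: "A \<in> sets borel"
  shows "emeasure lborel (A \<inter> ball c R) =
    (\<integral>\<^sup>+p. ennreal (fst p * indicator {0<..<R} (fst p) * indicator {0<..<2*pi} (snd p)) * indicator A (circ c (fst p) (snd p)) \<partial>(lborel \<Otimes>\<^sub>M lborel))"
proof -
  let ?g = "\<lambda>y::real^2. circ c (y $ 1) (y $ 2)"
  let ?I = "?g ` polar_dom"
  have gm: "?g \<in> borel_measurable borel"
    by (intro borel_measurable_continuous_onI continuous_on_polar)
  have Ib: "?I \<in> sets borel" using open_polar_image by (rule borel_open)
  have AI: "A \<inter> ?I \<in> lmeasurable"
    using A Ib polar_image_subset by (intro bounded_set_imp_lmeasurable) (auto intro: bounded_subset[OF bounded_ball])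
  have eq1: "emeasure lborel (A \<inter> ball c R) = emeasure lborel (A \<inter> ?I)"
  proof (rule emeasure_eq_AE)
    have "AE x in lborel. x \<notin> {x::real^2. x $ 2 = c $ 2}" by (rule AE_not_in[OF null_line])
    then show "AE x in lborel. (x \<in> A \<inter> ball c R) = (x \<in> A \<inter> ?I)"
      by eventually_elim (use ball_minus_polar_image polar_image_subset in auto)
  qed (use A Ib in auto)
  define S where "S = polar_dom \<inter> ?g -` A"
  have Sb: "S \<in> sets borel"
    using measurable_sets[OF gm A] open_polar_dom by (auto simp: S_def intro: borel_open)
  have im: "?g ` S = A \<inter> ?I" by (auto simp: S_def)
  have Sl: "S \<in> sets lebesgue" using Sb by simp
  have "?g ` S \<in> lmeasurable \<and> measure lebesgue (?g ` S) = measure lebesgue (A \<inter> ?I) \<longleftrightarrow>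
     ((\<lambda>y. \<bar>det (matrix (\<lambda>v::real^2. vector [v $ 1 * cos (y $ 2) - y $ 1 * sin (y $ 2) * v $ 2, v $ 1 * sin (y $ 2) + y $ 1 * cos (y $ 2) * v $ 2] :: real^2))\<bar>)
       has_integral measure lebesgue (A \<inter> ?I)) S"
    by (rule has_measure_differentiable_image[OF Sl circ_has_derivative])
       (rule inj_on_subset[OF inj_on_polar], auto simp: S_def)
  then have "((\<lambda>y. \<bar>y $ 1\<bar>) has_integral measure lebesgue (A \<inter> ?I)) S"
    unfolding det_circ_derivative im using AI by simp
  then have "((\<lambda>y. if y \<in> S then \<bar>y $ 1\<bar> else 0) has_integral measure lebesgue (A \<inter> ?I)) UNIV"
    by (simp add: has_integral_restrict_UNIV)
  then have "(\<integral>\<^sup>+y. ennreal (if y \<in> S then \<bar>y $ 1\<bar> else 0) \<partial>lborel) = ennreal (measure lebesgue (A \<inter> ?I))"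
    using Sb by (intro nn_integral_has_integral_lborel) (auto intro!: borel_measurable_continuous_onI continuous_intros)
  also have "\<dots> = emeasure lborel (A \<inter> ?I)"
    using emeasure_eq_measure2[OF AI] A Ib by simp
  finally have "emeasure lborel (A \<inter> ball c R) = (\<integral>\<^sup>+y. ennreal (if y \<in> S then \<bar>y $ 1\<bar> else 0) \<partial>lborel)"
    by (simp add: eq1)
  also have "\<dots> = (\<integral>\<^sup>+p. ennreal (if vector [fst p, snd p] \<in> S then \<bar>fst p\<bar> else 0) \<partial>(lborel \<Otimes>\<^sub>M lborel))"
  proof -
    have "continuous_on UNIV (\<lambda>p::real\<times>real. (vector [fst p, snd p] :: real^2) $ i)" for i
      using exhaust_2[of i] by (elim disjE; simp; intro continuous_intros)
    then have "continuous_on UNIV (\<lambda>p::real\<times>real. vector [fst p, snd p] :: real^2)"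
      by (subst continuous_on_componentwise) (auto simp: Basis_vec_def inner_axis)
    then have m1: "(\<lambda>p. vector [fst p, snd p] :: real^2) \<in> measurable (lborel \<Otimes>\<^sub>M lborel) borel"
      by (simp add: borel_measurable_continuous_onI lborel_prod)
    have m2: "(\<lambda>y. ennreal (if y \<in> S then \<bar>y $ 1\<bar> else 0)) \<in> borel_measurable borel"
      using Sb by (auto intro!: borel_measurable_continuous_onI continuous_intros)
    show ?thesis
      by (subst lborel_real2_eq_distr, subst nn_integral_distr[OF m1]) (use m2 in \<open>simp_all cong: if_cong\<close>)
  qed
  also have "\<dots> = (\<integral>\<^sup>+p. ennreal (fst p * indicator {0<..<R} (fst p) * indicator {0<..<2*pi} (snd p)) * indicator A (circ c (fst p) (snd p)) \<partial>(lborel \<Otimes>\<^sub>M lborel))"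
    by (intro nn_integral_cong) (auto simp: S_def polar_dom_def split: split_indicator)
  finally show ?thesis .
qed

lemma circ_pair_measurable: "(\<lambda>p. circ c (fst p) (snd p)) \<in> measurable (lborel \<Otimes>\<^sub>M lborel) borel"
  by (simp add: lborel_prod) (intro borel_measurable_continuous_onI continuous_intros)

lemma polar_density_measurable:
  "(\<lambda>p. fst p * indicator {0<..<R} (fst p) * indicator {0<..<2*pi} (snd p) :: real) \<in> borel_measurable (lborel \<Otimes>\<^sub>M lborel)"
  by measurable

lemma ball_polar_measure:
  "density lborel (\<lambda>x. ennreal (indicator (ball c R) x)) =
   distr (density (lborel \<Otimes>\<^sub>M lborel) (\<lambda>p. ennreal (fst p * indicator {0<..<R} (fst p) * indicator {0<..<2*pi} (snd p))))
     borel (\<lambda>p. circ c (fst p) (snd p))"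
proof (rule measure_eqI)
  fix A assume "A \<in> sets (density lborel (\<lambda>x. ennreal (indicator (ball c R) x)))"
  then have A: "A \<in> sets borel" by simp
  have "emeasure (density lborel (\<lambda>x. ennreal (indicator (ball c R) x))) A = emeasure lborel (A \<inter> ball c R)"
    using emeasure_restricted[of "ball c R" lborel A] A by (simp add: Int_commute ennreal_indicator)
  also have "\<dots> = emeasure (distr (density (lborel \<Otimes>\<^sub>M lborel) (\<lambda>p. ennreal (fst p * indicator {0<..<R} (fst p) * indicator {0<..<2*pi} (snd p))))
     borel (\<lambda>p. circ c (fst p) (snd p))) A"
    unfolding emeasure_ball_polar[OF A]
    using circ_pair_measurable polar_density_measurable A measurable_sets[OF circ_pair_measurable A]
    by (subst emeasure_distr) (auto simp: emeasure_density indicator_def space_pair_measure intro!: nn_integral_cong)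
  finally show "emeasure (density lborel (\<lambda>x. ennreal (indicator (ball c R) x))) A = emeasure (distr (density (lborel \<Otimes>\<^sub>M lborel) (\<lambda>p. ennreal (fst p * indicator {0<..<R} (fst p) * indicator {0<..<2*pi} (snd p))))
     borel (\<lambda>p. circ c (fst p) (snd p))) A" .
qed simp

lemma
  fixes f :: "real^2 \<Rightarrow> real"
  assumes f: "f \<in> borel_measurable borel" and i: "set_integrable lborel (ball c R) f"
  shows integral_ball_polar: "(LINT x:ball c R|lborel. f x) = (LINT \<rho>:{0<..<R}|lborel. (LINT x:sphere c \<rho>|hausdorff1. f x))" (is ?A)
    and integrable_circle_integrals: "set_integrable lborel {0<..<R} (\<lambda>\<rho>. LINT x:sphere c \<rho>|hausdorff1. f x)" (is ?B)
proof -
  define w where "w p = fst p * indicator {0<..<R} (fst p) * indicator {0<..<2*pi} (snd p)" for p :: "real \<times> real"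
  have wm: "w \<in> borel_measurable (lborel \<Otimes>\<^sub>M lborel)"
    unfolding w_def by (rule polar_density_measurable)
  have w0: "0 \<le> w p" for p by (auto simp: w_def split: split_indicator)
  have fc: "(\<lambda>p. f (circ c (fst p) (snd p))) \<in> borel_measurable (lborel \<Otimes>\<^sub>M lborel)"
    by (rule measurable_compose[OF circ_pair_measurable f])
  have "integrable (density lborel (\<lambda>x. ennreal (indicator (ball c R) x))) f"
    using i f borel_measurable_indicator[of "ball c R" borel] unfolding set_integrable_def
    by (subst integrable_density) (auto simp: borel_open)
  then have "integrable (density (lborel \<Otimes>\<^sub>M lborel) (\<lambda>p. ennreal (w p))) (\<lambda>p. f (circ c (fst p) (snd p)))"
    unfolding ball_polar_measure w_def[symmetric] using circ_pair_measurable f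
    by (subst (asm) integrable_distr_eq) auto
  then have int: "integrable (lborel \<Otimes>\<^sub>M lborel) (\<lambda>p. w p * f (circ c (fst p) (snd p)))"
    using wm w0 fc by (subst (asm) integrable_density) auto
  have inner: "(LINT \<theta>|lborel. w (\<rho>, \<theta>) * f (circ c \<rho> \<theta>)) = indicator {0<..<R} \<rho> * (LINT x:sphere c \<rho>|hausdorff1. f x)" for \<rho>
  proof (cases "\<rho> \<in> {0<..<R}")
    case True
    have "(LINT \<theta>|lborel. w (\<rho>, \<theta>) * f (circ c \<rho> \<theta>)) = (LINT \<theta>|lborel. \<rho> * (indicator {0..<2*pi} \<theta> * f (circ c \<rho> \<theta>)))"
    proof (intro integral_cong_AE)
      have m: "(\<lambda>\<theta>. f (circ c \<rho> \<theta>)) \<in> borel_measurable borel"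
        by (rule measurable_compose[OF _ f]) (intro borel_measurable_continuous_onI continuous_intros)
      then show "(\<lambda>\<theta>. \<rho> * (indicator {0..<2*pi} \<theta> * f (circ c \<rho> \<theta>))) \<in> borel_measurable lborel"
        by simp
      show "(\<lambda>\<theta>. w (\<rho>, \<theta>) * f (circ c \<rho> \<theta>)) \<in> borel_measurable lborel"
        unfolding w_def using m by simp
      show "AE \<theta> in lborel. w (\<rho>, \<theta>) * f (circ c \<rho> \<theta>) = \<rho> * (indicator {0..<2*pi} \<theta> * f (circ c \<rho> \<theta>))"
        using AE_lborel_singleton[of "0::real"]
        by eventually_elim (use True in \<open>auto simp: w_def split: split_indicator\<close>)
    qed
    also have "\<dots> = (LINT x:sphere c \<rho>|hausdorff1. f x)"
      using True circle_integral[OF _ f, of \<rho> c] by (simp add: set_lebesgue_integral_def)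
    finally show ?thesis using True by simp
  qed (auto simp: w_def)
  have "(LINT x:ball c R|lborel. f x) = (LINT x|density lborel (\<lambda>x. ennreal (indicator (ball c R) x)). f x)"
    using f borel_measurable_indicator[of "ball c R" borel] unfolding set_lebesgue_integral_def
    by (subst integral_density) (auto simp: borel_open)
  also have "\<dots> = (LINT p|density (lborel \<Otimes>\<^sub>M lborel) (\<lambda>p. ennreal (w p)). f (circ c (fst p) (snd p)))"
    unfolding ball_polar_measure w_def[symmetric] using circ_pair_measurable f
    by (subst integral_distr) auto
  also have "\<dots> = (LINT p|(lborel \<Otimes>\<^sub>M lborel). w p * f (circ c (fst p) (snd p)))"
    using wm w0 fc by (subst integral_density) auto
  also have "\<dots> = (LINT \<rho>|lborel. LINT \<theta>|lborel. w (\<rho>, \<theta>) * f (circ c \<rho> \<theta>))"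
    using lborel_pair.integral_fst[of "\<lambda>\<rho> \<theta>. w (\<rho>, \<theta>) * f (circ c \<rho> \<theta>)"] int by (simp add: case_prod_unfold)
  also have "\<dots> = (LINT \<rho>:{0<..<R}|lborel. (LINT x:sphere c \<rho>|hausdorff1. f x))"
    unfolding inner set_lebesgue_integral_def by simp
  finally show ?A .
  have "integrable lborel (\<lambda>\<rho>. LINT \<theta>|lborel. w (\<rho>, \<theta>) * f (circ c \<rho> \<theta>))"
    using lborel_pair.integrable_fst[of "\<lambda>\<rho> \<theta>. w (\<rho>, \<theta>) * f (circ c \<rho> \<theta>)"] int by (simp add: case_prod_unfold)
  then show ?B unfolding inner set_integrable_def by simp
qed

text \<open>Carries almost everywhere statements about the weak gradient over to almost every
  circle, where the boundary integrals live. It is Tonelli's theorem for the indicator function of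
  \<open>N\<close> in polar coordinates.\<close>

lemma AE_circle_null_ball:
  assumes N: "N \<in> null_sets lborel"
  shows "AE \<rho> in lborel. \<rho> \<in> {0<..<R} \<longrightarrow> emeasure hausdorff1 (N \<inter> sphere c \<rho>) = 0"
proof -
  have Nb: "N \<in> sets borel" using N by auto
  have "circ c \<rho> \<in> borel_measurable borel" for \<rho>
    by (intro borel_measurable_continuous_onI continuous_intros)
  from measurable_sets[OF this Nb] have Nc: "circ c \<rho> -` N \<in> sets borel" for \<rho>
    by simp
  define w where "w p = ennreal (fst p * indicator {0<..<R} (fst p) * indicator {0<..<2*pi} (snd p)) * indicator N (circ c (fst p) (snd p))" for p :: "real \<times> real"
  have wm: "w \<in> borel_measurable (lborel \<Otimes>\<^sub>M lborel)"
    unfolding w_def using Nb polar_density_measurable circ_pair_measurable by measurable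
  have "emeasure lborel (N \<inter> ball c R) = 0"
    using null_set_Int2[OF N, of "ball c R"] by (auto simp: Int_commute)
  then have "(\<integral>\<^sup>+p. w p \<partial>(lborel \<Otimes>\<^sub>M lborel)) = 0"
    using emeasure_ball_polar[OF Nb] by (simp add: w_def)
  then have "(\<integral>\<^sup>+\<rho>. \<integral>\<^sup>+\<theta>. w (\<rho>, \<theta>) \<partial>lborel \<partial>lborel) = 0"
    by (simp only: lborel.nn_integral_fst[OF wm])
  then have "AE \<rho> in lborel. (\<integral>\<^sup>+\<theta>. w (\<rho>, \<theta>) \<partial>lborel) = 0"
    using wm by (subst (asm) nn_integral_0_iff_AE) auto
  then show ?thesis
  proof eventually_elim
    fix \<rho> assume 0: "(\<integral>\<^sup>+\<theta>. w (\<rho>, \<theta>) \<partial>lborel) = 0"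
    show "\<rho> \<in> {0<..<R} \<longrightarrow> emeasure hausdorff1 (N \<inter> sphere c \<rho>) = 0"
    proof
      assume r: "\<rho> \<in> {0<..<R}"
      have "(\<integral>\<^sup>+\<theta>. w (\<rho>, \<theta>) \<partial>lborel) = (\<integral>\<^sup>+\<theta>. ennreal \<rho> * indicator ({0<..<2*pi} \<inter> circ c \<rho> -` N) \<theta> \<partial>lborel)"
        using r by (intro nn_integral_cong) (auto simp: w_def split: split_indicator)
      also have "\<dots> = ennreal \<rho> * emeasure lborel ({0<..<2*pi} \<inter> circ c \<rho> -` N)"
        using Nc by (intro nn_integral_cmult_indicator) auto
      finally have "emeasure lborel ({0<..<2*pi} \<inter> circ c \<rho> -` N) = 0" using 0 r by simp
      moreover have "emeasure lborel {\<theta> \<in> {0..<2 * pi}. circ c \<rho> \<theta> \<in> N} = emeasure lborel ({0<..<2*pi} \<inter> circ c \<rho> -` N)"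
      proof (rule emeasure_eq_AE)
        show "AE x in lborel. (x \<in> {\<theta> \<in> {0..<2 * pi}. circ c \<rho> \<theta> \<in> N}) = (x \<in> {0<..<2 * pi} \<inter> circ c \<rho> -` N)"
          using AE_lborel_singleton[of "0::real"] by eventually_elim auto
        have "{\<theta> \<in> {0..<2 * pi}. circ c \<rho> \<theta> \<in> N} = {0..<2*pi} \<inter> circ c \<rho> -` N" by auto
        then show "{\<theta> \<in> {0..<2 * pi}. circ c \<rho> \<theta> \<in> N} \<in> sets lborel" using Nc by auto
      qed (use Nc in auto)
      ultimately show "emeasure hausdorff1 (N \<inter> sphere c \<rho>) = 0"
        using emeasure_hausdorff1_circle[OF _ Nb, of \<rho> c] r by simp
    qed
  qed
qed

end

section \<open>Functions determined by their integrals\<close>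

text \<open>Lebesgue's differentiation theorem along the cubes with lower corner \<open>x\<close>:
  for small side they lie in \<open>U\<close>, so the averages that converge to \<open>f x\<close>
  are all zero.\<close>

lemma AE_zero_if_box_integrals_zero:
  fixes f :: "'a::euclidean_space \<Rightarrow> real"
  assumes f: "integrable lborel f" and U: "open U"
    and z: "\<And>a b. cbox a b \<subseteq> U \<Longrightarrow> (LINT x:cbox a b|lborel. f x) = 0"
  shows "AE x in lborel. x \<in> U \<longrightarrow> f x = 0"
proof -
  have int: "set_integrable lborel (cbox a b) f" for a b
    using f unfolding set_integrable_def real_scaleR_def
    by (subst mult.commute, intro integrable_real_mult_indicator) auto
  then have io: "f integrable_on cbox a b" "integral (cbox a b) f = (LINT x:cbox a b|lborel. f x)" for a b
    using set_borel_integral_eq_integral[OF int[of a b]] by auto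
  obtain N where N: "negligible N" and
    *: "\<And>x e. \<lbrakk>x \<notin> N; 0 < e\<rbrakk> \<Longrightarrow> \<exists>d>0. \<forall>h. 0 < h \<and> h < d \<longrightarrow>
            norm (integral (cbox x (x + h *\<^sub>R One)) f /\<^sub>R h ^ DIM('a) - f x) < e"
    using integrable_ccontinuous_explicit[OF io(1)] by blast
  have "f x = 0" if x: "x \<in> U" "x \<notin> N" for x
  proof (rule ccontr)
    assume "f x \<noteq> 0"
    then obtain d where d: "d > 0" "\<And>h. 0 < h \<and> h < d \<Longrightarrow>
        norm (integral (cbox x (x + h *\<^sub>R One)) f /\<^sub>R h ^ DIM('a) - f x) < \<bar>f x\<bar>"
      using *[OF x(2), of "\<bar>f x\<bar>"] by auto
    obtain r where r: "r > 0" "ball x r \<subseteq> U" using U x(1) open_contains_ball by blast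
    define h where "h = min (d/2) (r / (2 * (norm (One::'a) + 1)))"
    have n1: "norm (One::'a) + 1 > 0" by (simp add: add_nonneg_pos)
    then have h: "0 < h" "h < d" using d(1) r(1) by (auto simp: h_def)
    have hr: "h * norm (One::'a) < r"
    proof -
      have "h * norm (One::'a) \<le> h * (norm (One::'a) + 1)" using h by simp
      also have "\<dots> \<le> r / (2 * (norm (One::'a) + 1)) * (norm (One::'a) + 1)"
        using n1 by (intro mult_right_mono) (auto simp: h_def)
      also have "\<dots> = r / 2" using n1 by (simp add: field_simps)
      finally show ?thesis using r(1) by simp
    qed
    have "cbox x (x + h *\<^sub>R One) \<subseteq> U"
    proof
      fix y assume y: "y \<in> cbox x (x + h *\<^sub>R One)"
      have "norm (y - x) \<le> norm (h *\<^sub>R (One::'a))"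
        by (rule norm_le_componentwise) (use y h in \<open>auto simp: mem_box inner_diff_left inner_add_left\<close>)
      then have "dist x y < r" using h hr by (simp add: dist_norm norm_minus_commute)
      then show "y \<in> U" using r by auto
    qed
    then have "integral (cbox x (x + h *\<^sub>R One)) f = 0" using z io by simp
    then show False using d(2)[of h] h by simp
  qed
  then have "AE x in lebesgue. x \<in> U \<longrightarrow> f x = 0"
    using N unfolding negligible_iff_null_sets
    by (auto intro: AE_I' completion.complete2)
  then show ?thesis by (subst (asm) AE_completion_iff) 
qed

text \<open>The differentiation theorem \<open>integrable_ccontinuous_explicit\<close> treats
  averages to the right of a point. Applied to the reflected function \<open>fm\<close>, it yields
  those to the left.\<close>

lemma AE_indefinite_integral_deriv:
  fixes f :: "real \<Rightarrow> real"
  assumes f: "integrable lborel f"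
  shows "AE x in lborel. 0 < x \<longrightarrow> ((\<lambda>y. LINT s:{0<..<y}|lborel. f s) has_real_derivative f x) (at x)"
proof -
  have int: "set_integrable lborel A g" if "integrable lborel g" "A \<in> sets borel" for A and g :: "real \<Rightarrow> real"
    using that unfolding set_integrable_def real_scaleR_def
    by (subst mult.commute, intro integrable_real_mult_indicator) auto
  have io: "g integrable_on cbox a b" "integral (cbox a b) g = (LINT x:cbox a b|lborel. g x)"
    if "integrable lborel g" for a b and g :: "real \<Rightarrow> real"
    using set_borel_integral_eq_integral[OF int[OF that, of "cbox a b"]] by auto
  define fm where "fm x = f (- x)" for x
  have fm: "integrable lborel fm"
    using lborel_integrable_real_affine[OF f, of "-1" 0] by (simp add: fm_def[abs_def])
  obtain N1 where N1: "negligible N1" and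
    r: "\<And>x e. \<lbrakk>x \<notin> N1; 0 < e\<rbrakk> \<Longrightarrow> \<exists>d>0. \<forall>h. 0 < h \<and> h < d \<longrightarrow>
            norm (integral (cbox x (x + h *\<^sub>R One)) f /\<^sub>R h ^ DIM(real) - f x) < e"
    using integrable_ccontinuous_explicit[OF io(1)[OF f]] by blast
  obtain N2 where N2: "negligible N2" and
    l: "\<And>x e. \<lbrakk>x \<notin> N2; 0 < e\<rbrakk> \<Longrightarrow> \<exists>d>0. \<forall>h. 0 < h \<and> h < d \<longrightarrow>
            norm (integral (cbox x (x + h *\<^sub>R One)) fm /\<^sub>R h ^ DIM(real) - fm x) < e"
    using integrable_ccontinuous_explicit[OF io(1)[OF fm]] by blast
  have N2': "negligible (uminus ` N2)"
    using N2 by (intro negligible_differentiable_image_negligible)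
      (auto intro!: derivative_intros differentiable_on_minus differentiable_on_ident)
  have split: "(LINT s:{0<..<b}|lborel. f s) - (LINT s:{0<..<a}|lborel. f s) = integral {a..b} f"
    if "0 < a" "a \<le> b" for a b
  proof -
    have "(LINT s:{0<..<b}|lborel. f s) = (LINT s:{0<..<a} \<union> {a..<b}|lborel. f s)"
      using that by (intro arg_cong2[where f="\<lambda>A g. set_lebesgue_integral lborel A g"]) auto
    also have "\<dots> = (LINT s:{0<..<a}|lborel. f s) + (LINT s:{a..<b}|lborel. f s)"
      by (rule set_integral_Un) (auto intro!: int f)
    also have "(LINT s:{a..<b}|lborel. f s) = (LINT s:{a..b}|lborel. f s)"
    proof (rule set_integral_cong_set)
      show "AE s in lborel. (s \<in> {a..b}) = (s \<in> {a..<b})"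
        using AE_lborel_singleton[of b] by eventually_elim auto
    qed (use f in \<open>auto simp: set_borel_measurable_def\<close>)
    finally show ?thesis using io(2)[OF f, of a b] by (simp add: cbox_interval)
  qed
  have "((\<lambda>y. LINT s:{0<..<y}|lborel. f s) has_real_derivative f x) (at x)"
    if x: "0 < x" "x \<notin> N1" "x \<notin> uminus ` N2" for x
    unfolding has_field_derivative_iff
  proof (rule LIM_I)
    fix e :: real assume e: "0 < e"
    obtain d1 where d1: "d1 > 0" "\<And>h. 0 < h \<and> h < d1 \<Longrightarrow> \<bar>integral {x..x+h} f / h - f x\<bar> < e"
      using r[OF x(2) e] by (auto simp: cbox_interval divide_inverse mult.commute)
    have "- x \<notin> N2" using x(3) by (metis image_eqI minus_minus)
    then obtain d2 where d2: "d2 > 0" "\<And>h. 0 < h \<and> h < d2 \<Longrightarrow> \<bar>integral {-x..-x+h} fm / h - fm (-x)\<bar> < e"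
      using l[of "-x" e] e by (auto simp: cbox_interval divide_inverse mult.commute)
    have refl: "integral {-x..-x+h} fm = integral {x-h..x} f" for h
      using Henstock_Kurzweil_Integration.integral_reflect_real[of "x" "x-h" f] by (simp add: fm_def[abs_def])
    show "\<exists>s>0. \<forall>z. z \<noteq> x \<and> norm (z - x) < s \<longrightarrow>
      norm (((LINT s:{0<..<z}|lborel. f s) - (LINT s:{0<..<x}|lborel. f s)) / (z - x) - f x) < e"
    proof (intro exI[of _ "min x (min d1 d2)"] conjI allI impI)
      show "0 < min x (min d1 d2)" using x d1 d2 by simp
      fix z assume z: "z \<noteq> x \<and> norm (z - x) < min x (min d1 d2)"
      show "norm (((LINT s:{0<..<z}|lborel. f s) - (LINT s:{0<..<x}|lborel. f s)) / (z - x) - f x) < e"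
      proof (cases "x < z")
        case True
        then have "(LINT s:{0<..<z}|lborel. f s) - (LINT s:{0<..<x}|lborel. f s) = integral {x..x+(z-x)} f"
          using split[of x z] x by simp
        then show ?thesis using d1(2)[of "z-x"] z True by simp
      next
        case False
        then have "(LINT s:{0<..<x}|lborel. f s) - (LINT s:{0<..<z}|lborel. f s) = integral {-x..-x+(x-z)} fm"
          unfolding refl using split[of z x] x z by simp
        moreover have "\<bar>integral {-x..-x+(x-z)} fm / (x - z) - f x\<bar> < e"
          using d2(2)[of "x-z"] z False by (simp add: fm_def)
        moreover have "((LINT s:{0<..<z}|lborel. f s) - (LINT s:{0<..<x}|lborel. f s)) / (z - x)
           = ((LINT s:{0<..<x}|lborel. f s) - (LINT s:{0<..<z}|lborel. f s)) / (x - z)"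
          using z by (simp add: field_simps)
        ultimately show ?thesis by simp
      qed
    qed
  qed
  moreover have "N1 \<union> uminus ` N2 \<in> null_sets lebesgue"
    using N1 N2' negligible_Un negligible_iff_null_sets by blast
  ultimately have "AE x in lebesgue. 0 < x \<longrightarrow> ((\<lambda>y. LINT s:{0<..<y}|lborel. f s) has_real_derivative f x) (at x)"
    by (intro AE_I'[of "N1 \<union> uminus ` N2"]) auto
  then show ?thesis by (subst (asm) AE_completion_iff) 
qed

section \<open>The subsonic density\<close>

locale state_eq =
  fixes g \<rho>0 \<alpha> :: real and p :: "real \<Rightarrow> real"
  assumes eos: "equation_of_state g \<rho>0 \<alpha> p"
begin

lemma g_pos: "0 < g" and \<rho>0_pos: "0 < \<rho>0"
  using eos by (auto simp: equation_of_state_def)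

abbreviation "p' \<equiv> dpress p"
abbreviation "h \<equiv> enthalpy \<rho>0 p"

lemma p_deriv: "0 < \<rho> \<Longrightarrow> (p has_real_derivative p' \<rho>) (at \<rho>)"
  using eos at_within_interior[of \<rho> "{0..}"] interior_real_atLeast[of 0]
  by (auto simp: equation_of_state_def dest!: spec[of _ \<rho>])

lemma p'_pos: "0 < \<rho> \<Longrightarrow> 0 < p' \<rho>"
  and p'_differentiable: "0 < \<rho> \<Longrightarrow> p' differentiable (at \<rho>)"
  and p'_convex: "0 < \<rho> \<Longrightarrow> 0 < 2 * p' \<rho> + \<rho> * deriv p' \<rho>"
  using eos by (auto simp: equation_of_state_def)

lemma p'_deriv: "0 < \<rho> \<Longrightarrow> (p' has_real_derivative deriv p' \<rho>) (at \<rho>)"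
  using p'_differentiable DERIV_deriv_iff_real_differentiable by blast

lemma p'_isCont: "0 < \<rho> \<Longrightarrow> isCont p' \<rho>"
  using p'_deriv DERIV_isCont by blast

text \<open>A common lower end \<open>a > 0\<close> avoids the singularity of the integrand at 0 and
  removes the sign convention for \<open>x < \<rho>0\<close>, so that the fundamental theorem of
  calculus applies on both sides of \<open>\<rho>0\<close>.\<close>

lemma h_eq_integral:
  assumes "0 < a" "a \<le> \<rho>0" "a \<le> x"
  shows "h x = integral {a..x} (\<lambda>s. p' s / s) - integral {a..\<rho>0} (\<lambda>s. p' s / s)"
proof -
  have ci: "continuous_on {c..d} (\<lambda>s. p' s / s)" if "0 < c" for c d
    using that by (intro continuous_at_imp_continuous_on ballI continuous_intros p'_isCont) auto
  have hc: "integral {a..c} (\<lambda>s. p' s / s) + integral {c..d} (\<lambda>s. p' s / s) = integral {a..d} (\<lambda>s. p' s / s)"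
    if "a \<le> c" "c \<le> d" for c d
    using that assms by (intro Henstock_Kurzweil_Integration.integral_combine integrable_continuous_real ci) auto
  have le: "(LBINT s=c..d. p' s / s) = integral {c..d} (\<lambda>s. p' s / s)" if "0 < c" "c \<le> d" for c d
    using that by (intro interval_integral_eq_integral borel_integrable_atLeastAtMost') (auto intro: ci)
  show ?thesis
  proof (cases "\<rho>0 \<le> x")
    case True
    then show ?thesis using hc[of \<rho>0 x] assms le[of \<rho>0 x] \<rho>0_pos by (simp add: enthalpy_def)
  next
    case False
    have "h x = - (LBINT s=x..\<rho>0. p' s / s)"
      unfolding enthalpy_def by (rule interval_integral_endpoints_reverse)
    then show ?thesis using False hc[of x \<rho>0] assms le[of x \<rho>0] by simp
  qed
qed

lemma h_deriv: 
  assumes x: "0 < x" shows "(h has_real_derivative p' x / x) (at x)"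
proof -
  define a where "a = min (x/2) (\<rho>0/2)"
  have a: "0 < a" "a \<le> \<rho>0" "a < x" using x \<rho>0_pos by (auto simp: a_def)
  have c: "continuous_on {a..x+1} (\<lambda>s. p' s / s)"
    using a by (intro continuous_at_imp_continuous_on ballI continuous_intros p'_isCont) auto
  have "((\<lambda>y. integral {a..y} (\<lambda>s. p' s / s)) has_real_derivative p' x / x) (at x within {a..x+1})"
    using c a by (intro integral_has_real_derivative) auto
  moreover have "at x within {a..x+1} = at x"
    using a by (intro at_within_interior) (auto simp: interior_atLeastAtMost_real)
  ultimately have "((\<lambda>y. integral {a..y} (\<lambda>s. p' s / s) - integral {a..\<rho>0} (\<lambda>s. p' s / s)) has_real_derivative p' x / x) (at x)"
    by (auto intro!: derivative_eq_intros)
  then show ?thesis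
  proof (rule has_field_derivative_transform_within_open[where S="{a<..}"])
    fix y assume "y \<in> {a<..}"
    then show "integral {a..y} (\<lambda>s. p' s / s) - integral {a..\<rho>0} (\<lambda>s. p' s / s) = h y"
      using h_eq_integral[of a y] a by simp
  qed (use a in auto)
qed

lemma h_\<rho>0 [simp]: "h \<rho>0 = 0"
  by (simp add: enthalpy_def)

lemma h_mono: "0 < x \<Longrightarrow> x < y \<Longrightarrow> h x < h y"
  by (rule DERIV_pos_imp_increasing[of x y]) (auto intro!: exI[of _ "p' _ / _"] h_deriv divide_pos_pos p'_pos)

text \<open>\<open>\<Phi> \<rho> = g s\<close> is the equation defining the critical density.\<close>

definition \<Phi> :: "real \<Rightarrow> real" where "\<Phi> \<rho> = p' \<rho> / 2 + h \<rho>"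

lemma \<Phi>_deriv: "0 < x \<Longrightarrow> (\<Phi> has_real_derivative (2 * p' x + x * deriv p' x) / (2 * x)) (at x)"
  unfolding \<Phi>_def
  by (rule DERIV_cong[OF DERIV_add[OF DERIV_cdivide[OF p'_deriv] h_deriv]]) (auto simp: field_simps)

text \<open>The last condition of the equation of state says precisely that the derivative of
  \<open>\<Phi>\<close> is positive.\<close>

lemma \<Phi>_mono: "0 < x \<Longrightarrow> x < y \<Longrightarrow> \<Phi> x < \<Phi> y"
  by (rule DERIV_pos_imp_increasing[of x y])
     (auto intro!: exI[of _ "(2 * p' _ + _ * deriv p' _) / (2 * _)"] \<Phi>_deriv divide_pos_pos p'_convex)

lemma \<Phi>_isCont: "0 < x \<Longrightarrow> isCont \<Phi> x"
  using \<Phi>_deriv DERIV_isCont by blast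

lemma \<Phi>_less_iff: "0 < x \<Longrightarrow> 0 < y \<Longrightarrow> \<Phi> x < \<Phi> y \<longleftrightarrow> x < y"
  using \<Phi>_mono[of x y] \<Phi>_mono[of y x] by (cases x y rule: linorder_cases) auto

lemma p'_0: "0 \<le> p' 0" "(p' \<longlongrightarrow> p' 0) (at_right 0)"
proof -
  obtain C where C: "\<And>a b. a \<in> {0..1} \<Longrightarrow> b \<in> {0..1} \<Longrightarrow> \<bar>p' a - p' b\<bar> \<le> C * \<bar>a - b\<bar> powr \<alpha>"
    using eos unfolding equation_of_state_def by (metis zero_less_one)
  have a: "0 < \<alpha>" using eos by (auto simp: equation_of_state_def)
  have "((\<lambda>x. C * x powr \<alpha>) \<longlongrightarrow> C * 0) (at_right 0)"
  proof (rule tendsto_mult[OF tendsto_const])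
    show "((\<lambda>x::real. x powr \<alpha>) \<longlongrightarrow> 0) (at_right 0)"
      using a by (intro tendsto_zero_powrI[where b=\<alpha>] tendsto_ident_at tendsto_const) (auto simp: eventually_at_filter)
  qed
  then have "((\<lambda>x. C * x powr \<alpha>) \<longlongrightarrow> 0) (at_right 0)" by simp
  moreover have "eventually (\<lambda>x. norm (p' x - p' 0) \<le> C * x powr \<alpha>) (at_right 0)"
    unfolding eventually_at_right_field
    by (rule exI[of _ 1]) (use C[of _ 0] in force)
  ultimately have "((\<lambda>x. p' x - p' 0) \<longlongrightarrow> 0) (at_right 0)"
    by (rule Lim_null_comparison[rotated])
  then show l: "(p' \<longlongrightarrow> p' 0) (at_right 0)" by (simp add: LIM_zero_iff)
  show "0 \<le> p' 0"
  proof (rule tendsto_lowerbound[OF l])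
    show "eventually (\<lambda>x. 0 \<le> p' x) (at_right 0)"
      unfolding eventually_at_right_field by (rule exI[of _ 1]) (auto intro: less_imp_le p'_pos)
  qed simp
qed

text \<open>Gives the intermediate value theorem a starting point below \<open>g * s\<close> in the
  construction of the critical density. If \<open>p' 0 = 0\<close>, the term \<open>p' / 2\<close>
  tends to 0 while \<open>h\<close> stays below the negative number \<open>h (\<rho>0 / 2)\<close>.
  If \<open>p' 0 > 0\<close>, then \<open>h\<close> tends to minus infinity like a
  logarithm.\<close>

lemma \<Phi>_neg: "\<exists>x>0. \<Phi> x < 0"
proof (cases "p' 0 = 0")
  case True
  have hn: "h (\<rho>0 / 2) < 0" using h_mono[of "\<rho>0/2" \<rho>0] \<rho>0_pos by simp
  have "eventually (\<lambda>x. p' x < - h (\<rho>0/2)) (at_right 0)"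
    using order_tendstoD(2)[OF p'_0(2), of "- h (\<rho>0/2)"] True hn by simp
  then obtain b where b: "b > 0" "\<And>y. 0 < y \<Longrightarrow> y < b \<Longrightarrow> p' y < - h (\<rho>0/2)"
    unfolding eventually_at_right_field by blast
  define x where "x = min (b/2) (\<rho>0/4)"
  have x: "0 < x" "x < b" "x < \<rho>0/2" using b \<rho>0_pos by (auto simp: x_def)
  have "\<Phi> x < 0" using h_mono[OF x(1,3)] b(2)[OF x(1,2)] hn unfolding \<Phi>_def by linarith
  then show ?thesis using x by blast
next
  case False
  then have c: "0 < p' 0" using p'_0 by simp
  define c where "c = p' 0 / 2"
  have cp: "0 < c" using c by (simp add: c_def)
  have "eventually (\<lambda>x. c < p' x \<and> p' x < 2 * p' 0) (at_right 0)"
    using order_tendstoD(1)[OF p'_0(2), of "p' 0 / 2"] order_tendstoD(2)[OF p'_0(2), of "2 * p' 0"] c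
    by (intro eventually_conj) (auto simp: c_def)
  then obtain b where b: "b > 0" "\<And>y. 0 < y \<Longrightarrow> y < b \<Longrightarrow> c < p' y \<and> p' y < 2 * p' 0"
    unfolding eventually_at_right_field by blast
  define x1 where "x1 = b / 2"
  have x1: "0 < x1" "x1 < b" using b by (auto simp: x1_def)
  define K where "K = h x1 + p' 0"
  \<comment> \<open>Going from \<open>x1\<close> down to this point lowers \<open>c * ln\<close> by
    \<open>\<bar>K\<bar> + 1\<close>, and \<open>h\<close> by at least as much. As
    \<open>p' / 2\<close> is below \<open>p' 0\<close> there, \<open>\<Phi>\<close> is below
    \<open>K - \<bar>K\<bar> - 1\<close>.\<close>
  define x where "x = x1 * exp (- (\<bar>K\<bar> + 1) / c)"
  have x: "0 < x" "x \<le> x1" using x1 cp by (auto simp: x_def divide_le_0_iff mult_le_cancel_left1)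
  have "h x - c * ln x \<le> h x1 - c * ln x1"
  proof (rule DERIV_nonneg_imp_nondecreasing[OF x(2)])
    fix y assume y: "x \<le> y" "y \<le> x1"
    then have y0: "0 < y" "y < b" using x x1 by auto
    have "((\<lambda>y. h y - c * ln y) has_real_derivative (p' y / y - c * (1 / y))) (at y)"
      by (rule derivative_eq_intros h_deriv y0 refl | simp add: y0)+
    moreover have "0 \<le> p' y / y - c * (1 / y)"
      using b(2)[OF y0] y0 by (simp add: divide_right_mono diff_divide_distrib[symmetric])
    ultimately show "\<exists>z. ((\<lambda>y. h y - c * ln y) has_real_derivative z) (at y) \<and> 0 \<le> z" by blast
  qed
  moreover have "ln x = ln x1 - (\<bar>K\<bar> + 1) / c"
    using x1 by (simp add: x_def ln_mult diff_divide_distrib add_divide_distrib)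
  ultimately have "h x \<le> h x1 - (\<bar>K\<bar> + 1)" using cp by (simp add: right_diff_distrib)
  moreover have "p' x < 2 * p' 0" using b(2)[of x] x x1 by auto
  ultimately have "\<Phi> x < 0" unfolding \<Phi>_def K_def by linarith
  then show ?thesis using x by blast
qed

abbreviation "smax \<equiv> s_star g \<rho>0 p"

lemma \<Phi>_\<rho>0: "\<Phi> \<rho>0 = g * smax"
  using g_pos by (simp add: \<Phi>_def s_star_def)

lemma rho_cr_eq:
  assumes s: "0 \<le> s" "s < smax"
  shows "0 < rho_cr g \<rho>0 p s" "\<Phi> (rho_cr g \<rho>0 p s) = g * s" "rho_cr g \<rho>0 p s < \<rho>0"
proof -
  obtain x where x: "x > 0" "\<Phi> x < 0" using \<Phi>_neg by blast
  have gs: "0 \<le> g * s" "g * s < \<Phi> \<rho>0" using s g_pos by (auto simp: \<Phi>_\<rho>0)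
  have "x < \<rho>0" using \<Phi>_less_iff[OF x(1) \<rho>0_pos] x gs by linarith
  then have "\<exists>y\<ge>x. y \<le> \<rho>0 \<and> \<Phi> y = g * s"
    using x gs by (intro IVT) (auto intro!: \<Phi>_isCont)
  then obtain y where y: "x \<le> y" "y \<le> \<rho>0" "\<Phi> y = g * s" by blast
  have "rho_cr g \<rho>0 p s = y"
    unfolding rho_cr_def
  proof (rule the_equality)
    show "0 < y \<and> p' y / 2 + h y = g * s" using y x by (simp add: \<Phi>_def)
    fix z assume z: "0 < z \<and> p' z / 2 + h z = g * s"
    then have "\<Phi> z = \<Phi> y" using y by (simp add: \<Phi>_def)
    then show "z = y" using \<Phi>_less_iff[of z y] \<Phi>_less_iff[of y z] z y x by auto
  qed
  moreover have "y \<noteq> \<rho>0" using y gs by auto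
  ultimately show "0 < rho_cr g \<rho>0 p s" "\<Phi> (rho_cr g \<rho>0 p s) = g * s" "rho_cr g \<rho>0 p s < \<rho>0" using y x by auto
qed

lemma rho_cr_less_iff:
  assumes s: "0 \<le> s" "s < smax"
  shows "rho_cr g \<rho>0 p s < \<eta> \<longleftrightarrow> 0 < \<eta> \<and> g * s < \<Phi> \<eta>"
  using rho_cr_eq[OF s] \<Phi>_less_iff[of "rho_cr g \<rho>0 p s" \<eta>] by auto

text \<open>\<open>T \<eta> s\<close> is the value of \<open>t\<close> at which the Bernoulli equation with Bernoulli constant \<open>g s\<close>
  has the solution \<open>\<eta>\<close>; on \<open>subsonic\<close> pairs it is strictly decreasing in \<open>\<eta>\<close>.\<close>

definition T :: "real \<Rightarrow> real \<Rightarrow> real" where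
  "T \<eta> s = \<eta>\<^sup>2 * (g * s - h \<eta>) / (g * \<rho>0\<^sup>2)"

definition subsonic :: "real \<Rightarrow> real \<Rightarrow> bool" where
  "subsonic \<eta> s \<longleftrightarrow> 0 < \<eta> \<and> g * s < \<Phi> \<eta>"

text \<open>The derivative of \<open>T\<close> in its first argument. Since \<open>h\<close> has the
  derivative \<open>p' \<eta> / \<eta>\<close>, it contains \<open>p'\<close> but no derivative of
  \<open>p'\<close>; this is why \<open>H\<close> has continuous partial derivatives.\<close>

definition T\<eta> :: "real \<Rightarrow> real \<Rightarrow> real" where
  "T\<eta> \<eta> s = - 2 * \<eta> * (\<Phi> \<eta> - g * s) / (g * \<rho>0\<^sup>2)"

lemma T\<eta>_neg: "subsonic \<eta> s \<Longrightarrow> T\<eta> \<eta> s < 0"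
  using g_pos \<rho>0_pos by (auto simp: T\<eta>_def subsonic_def divide_less_0_iff mult_less_0_iff)

lemma T_deriv:
  assumes "0 < \<eta>" shows "((\<lambda>\<eta>. T \<eta> s) has_real_derivative T\<eta> \<eta> s) (at \<eta>)"
proof -
  have "((\<lambda>\<eta>. T \<eta> s) has_real_derivative
      (2 * \<eta> * (g * s - h \<eta>) + \<eta>\<^sup>2 * (0 - p' \<eta> / \<eta>)) / (g * \<rho>0\<^sup>2)) (at \<eta>)"
    unfolding T_def
    by (rule DERIV_cdivide) (rule derivative_eq_intros h_deriv assms refl | simp)+
  moreover have "(2 * \<eta> * (g * s - h \<eta>) + \<eta>\<^sup>2 * (0 - p' \<eta> / \<eta>)) / (g * \<rho>0\<^sup>2) = T\<eta> \<eta> s"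
    using assms by (simp add: T\<eta>_def \<Phi>_def power2_eq_square algebra_simps)
  ultimately show ?thesis by simp
qed

lemma subsonic_mono: "subsonic \<eta> s \<Longrightarrow> \<eta> \<le> \<eta>' \<Longrightarrow> subsonic \<eta>' s"
  using \<Phi>_mono[of \<eta> \<eta>'] by (cases "\<eta> = \<eta>'") (auto simp: subsonic_def)

lemma T_antimono: "subsonic \<eta> s \<Longrightarrow> \<eta> < \<eta>' \<Longrightarrow> T \<eta>' s < T \<eta> s"
proof (rule DERIV_neg_imp_decreasing[of \<eta> \<eta>' "\<lambda>\<eta>. T \<eta> s"])
  fix x assume a: "subsonic \<eta> s" "\<eta> < \<eta>'" and x: "\<eta> \<le> x" "x \<le> \<eta>'"
  have "subsonic x s" using subsonic_mono[OF a(1) x(1)] .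
  moreover then have "0 < x" by (simp add: subsonic_def)
  ultimately show "\<exists>y. ((\<lambda>\<eta>. T \<eta> s) has_real_derivative y) (at x) \<and> y < 0"
    using T_deriv T\<eta>_neg by blast
qed

lemma T_inj: "subsonic \<eta> s \<Longrightarrow> subsonic \<eta>' s \<Longrightarrow> T \<eta> s = T \<eta>' s \<Longrightarrow> \<eta> = \<eta>'"
  using T_antimono[of \<eta> s \<eta>'] T_antimono[of \<eta>' s \<eta>] by (cases \<eta> \<eta>' rule: linorder_cases) auto

lemma bernoulli_iff_T: "0 < \<eta> \<Longrightarrow> g * \<rho>0\<^sup>2 * t / \<eta>\<^sup>2 + h \<eta> = g * s \<longleftrightarrow> t = T \<eta> s"
  using g_pos \<rho>0_pos by (auto simp: T_def field_simps)

lemma subsonic_density_iff: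
  assumes "0 \<le> s" "s < smax"
  shows "subsonic_density g \<rho>0 p t s \<eta> \<longleftrightarrow> subsonic \<eta> s \<and> t = T \<eta> s"
  using rho_cr_less_iff[OF assms, of \<eta>] bernoulli_iff_T[of \<eta> t s]
  by (auto simp: subsonic_density_def subsonic_def)

abbreviation "H \<equiv> Hfun g \<rho>0 p"
abbreviation "F \<equiv> Ffun g \<rho>0 p"

lemma H_eq:
  assumes "0 \<le> s" "s < smax" "subsonic \<eta> s"
  shows "H (T \<eta> s) s = \<eta>"
  unfolding Hfun_def by (rule the_equality) (use assms subsonic_density_iff T_inj in auto)

lemma T_\<rho>0: "T \<rho>0 s = s"
  using g_pos \<rho>0_pos by (simp add: T_def)

lemma subsonic_\<rho>0: "s < smax \<Longrightarrow> subsonic \<rho>0 s"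
  using g_pos \<rho>0_pos by (simp add: subsonic_def \<Phi>_\<rho>0)

text \<open>Makes the density at rest exist for all \<open>s\<close> below \<open>smax\<close>. By
  the last condition of the equation of state \<open>y\<^sup>2 * p' y\<close> increases, so
  \<open>p' y\<close> is at least \<open>2 * c / y\<^sup>2\<close>. Integrating
  \<open>p' y / y\<close> bounds \<open>h y\<close> below by
  \<open>p' \<rho>0 / 2 - c / y\<^sup>2\<close>, whose limit \<open>p' \<rho>0 / 2\<close> is
  \<open>g * smax\<close>.\<close>

lemma subsonic_nonneg_bound:
  assumes "s < smax" obtains b where "\<rho>0 \<le> b" "g * s \<le> h b"
proof -
  define c where "c = \<rho>0\<^sup>2 * p' \<rho>0 / 2"
  have mono: "c / y\<^sup>2 \<le> p' y / 2" if y: "\<rho>0 \<le> y" for y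
  proof -
    have "\<rho>0\<^sup>2 * p' \<rho>0 \<le> y\<^sup>2 * p' y"
    proof (rule DERIV_nonneg_imp_nondecreasing[OF y])
      fix x assume "\<rho>0 \<le> x" "x \<le> y"
      then have x: "0 < x" using \<rho>0_pos by simp
      have "((\<lambda>y. y\<^sup>2 * p' y) has_real_derivative (2 * x * p' x + x\<^sup>2 * deriv p' x)) (at x)"
        by (rule derivative_eq_intros p'_deriv x refl | simp)+
      moreover have "2 * x * p' x + x\<^sup>2 * deriv p' x = x * (2 * p' x + x * deriv p' x)"
        by (simp add: power2_eq_square algebra_simps)
      ultimately show "\<exists>z. ((\<lambda>y. y\<^sup>2 * p' y) has_real_derivative z) (at x) \<and> 0 \<le> z"
        using x p'_convex[OF x] by (metis less_eq_real_def mult_pos_pos)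
    qed
    then show ?thesis using y \<rho>0_pos by (simp add: c_def field_simps)
  qed
  have low: "p' \<rho>0 / 2 - c / y\<^sup>2 \<le> h y" if y: "\<rho>0 \<le> y" for y
  proof -
    have "h \<rho>0 + c / \<rho>0\<^sup>2 \<le> h y + c / y\<^sup>2"
    proof (rule DERIV_nonneg_imp_nondecreasing[OF y])
      fix x assume xy: "\<rho>0 \<le> x" "x \<le> y"
      then have x: "0 < x" using \<rho>0_pos by simp
      have "((\<lambda>y. h y + c / y\<^sup>2) has_real_derivative (p' x / x + (0 * x\<^sup>2 - c * (2 * x)) / (x\<^sup>2 * x\<^sup>2))) (at x)"
        by (rule derivative_eq_intros h_deriv x refl | use x in simp)+
      moreover have "p' x / x + (0 * x\<^sup>2 - c * (2 * x)) / (x\<^sup>2 * x\<^sup>2) = 2 / x * (p' x / 2 - c / x\<^sup>2)"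
        using x by (simp add: field_simps power2_eq_square)
      ultimately show "\<exists>z. ((\<lambda>y. h y + c / y\<^sup>2) has_real_derivative z) (at x) \<and> 0 \<le> z"
        using x mono[OF xy(1)] by (metis diff_ge_0_iff_ge divide_nonneg_pos mult_nonneg_nonneg zero_le_numeral)
    qed
    then show ?thesis using \<rho>0_pos by (simp add: c_def)
  qed
  define e where "e = p' \<rho>0 / 2 - g * s"
  have e: "0 < e" using assms g_pos by (simp add: e_def s_star_def field_simps)
  have c: "0 < c" using p'_pos \<rho>0_pos by (simp add: c_def)
  define b where "b = max \<rho>0 (sqrt (c / e))"
  have "c / e \<le> b\<^sup>2"
  proof -
    have "sqrt (c / e) \<le> b" by (simp add: b_def)
    then have "(sqrt (c / e))\<^sup>2 \<le> b\<^sup>2" using c e by (intro power_mono) auto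
    then show ?thesis using c e by simp
  qed
  moreover have b0: "0 < b" "\<rho>0 \<le> b" using \<rho>0_pos by (auto simp: b_def)
  ultimately have "c / b\<^sup>2 \<le> e" using e by (simp add: field_simps)
  then have "g * s \<le> h b" using low[OF b0(2)] by (simp add: e_def)
  then show ?thesis using that b0 by blast
qed

lemma zero_speed_density:
  assumes s: "0 \<le> s" "s < smax"
  shows "subsonic (H 0 s) s" "h (H 0 s) = g * s" "T (H 0 s) s = 0" "\<rho>0 \<le> H 0 s"
proof -
  obtain b where b: "\<rho>0 \<le> b" "g * s \<le> h b" using subsonic_nonneg_bound[OF s(2)] by blast
  have "\<exists>y\<ge>\<rho>0. y \<le> b \<and> h y = g * s"
    using b s g_pos \<rho>0_pos by (intro IVT) (auto intro!: DERIV_isCont[OF h_deriv])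
  then obtain y where y: "\<rho>0 \<le> y" "h y = g * s" by blast
  then have sy: "subsonic y s" using subsonic_mono[OF subsonic_\<rho>0[OF s(2)]] by blast
  have T0: "T y s = 0" using y by (simp add: T_def)
  have "H 0 s = y" using H_eq[OF s sy] T0 by simp
  then show "subsonic (H 0 s) s" "h (H 0 s) = g * s" "T (H 0 s) s = 0" "\<rho>0 \<le> H 0 s"
    using sy y T0 by auto
qed

text \<open>Subsonic solvability at one value of \<open>t\<close> passes to all smaller ones, as
  \<open>T\<close> falls continuously from \<open>T \<eta> s\<close> to 0 between
  \<open>\<eta>\<close> and the density at rest. Integrals over \<open>{0..t}\<close> thus stay
  where \<open>H\<close> is well defined.\<close>

lemma subsonic_intermediate:
  assumes s: "0 \<le> s" "s < smax" and \<eta>: "subsonic \<eta> s" and t: "0 \<le> t" "t \<le> T \<eta> s"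
  obtains \<eta>' where "subsonic \<eta>' s" "T \<eta>' s = t" "\<eta> \<le> \<eta>'" "\<eta>' \<le> H 0 s"
proof -
  note z = zero_speed_density[OF s]
  have le: "\<eta> \<le> H 0 s"
    using T_antimono[OF z(1), of \<eta>] z(3) t by (cases "\<eta> \<le> H 0 s") auto
  have pos: "0 < \<eta>" using \<eta> by (simp add: subsonic_def)
  have "\<exists>x\<ge>\<eta>. x \<le> H 0 s \<and> T x s = t"
    using le t z(3) pos by (intro IVT2) (auto intro!: DERIV_isCont[OF T_deriv])
  then show ?thesis using that subsonic_mono[OF \<eta>] by blast
qed

text \<open>Negative \<open>t\<close> are admitted, which makes \<open>Dom\<close> a neighbourhood of its points with \<open>t = 0\<close>.\<close>

definition Dom :: "(real \<times> real) set" where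
  "Dom = {(t, s). 0 < s \<and> s < smax \<and> (\<exists>\<eta>. subsonic \<eta> s \<and> t = T \<eta> s)}"

lemma Dom_D:
  assumes "(t, s) \<in> Dom"
  shows "0 < s" "s < smax" "subsonic (H t s) s" "T (H t s) s = t" "0 < H t s"
  using assms H_eq[of s] by (auto simp: Dom_def subsonic_def)

lemma Dom_zero: "0 < s \<Longrightarrow> s < smax \<Longrightarrow> (0, s) \<in> Dom"
  using zero_speed_density[of s] by (auto simp: Dom_def intro!: exI[of _ "H 0 s"])

lemma Dom_diag: "0 < s \<Longrightarrow> s < smax \<Longrightarrow> (s, s) \<in> Dom" "0 < s \<Longrightarrow> s < smax \<Longrightarrow> H s s = \<rho>0"
  using subsonic_\<rho>0[of s] T_\<rho>0[of s] H_eq[of s \<rho>0] by (auto simp: Dom_def intro!: exI[of _ \<rho>0])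

lemma Dom_le: 
  assumes "(t, s) \<in> Dom" "0 \<le> \<tau>" "\<tau> \<le> t" shows "(\<tau>, s) \<in> Dom"
  using subsonic_intermediate[of s "H t s" \<tau>] Dom_D[OF assms(1)] assms
  by (auto simp: Dom_def)

lemma T_has_derivative:
  assumes "0 < fst z"
  shows "((\<lambda>z. T (fst z) (snd z)) has_derivative (\<lambda>v. T\<eta> (fst z) (snd z) * fst v + (fst z)\<^sup>2 / \<rho>0\<^sup>2 * snd v)) (at z)"
proof -
  have hd: "((\<lambda>z. h (fst z)) has_derivative (\<lambda>v. p' (fst z) / fst z * fst v)) (at z)"
    using has_derivative_compose[OF has_derivative_fst[OF has_derivative_ident] h_deriv[OF assms, unfolded has_field_derivative_def]]
    by (simp add: mult.commute)
  have "((\<lambda>z. T (fst z) (snd z)) has_derivative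
     (\<lambda>v. ((fst z)\<^sup>2 * (g * snd v - p' (fst z) / fst z * fst v) + (2 * fst z * fst v) * (g * snd z - h (fst z))) / (g * \<rho>0\<^sup>2))) (at z)"
    unfolding T_def divide_inverse[of _ "g * \<rho>0\<^sup>2"]
    by (rule has_derivative_mult_left)
       (auto intro!: derivative_eq_intros hd simp: power2_eq_square algebra_simps)
  moreover have "((fst z)\<^sup>2 * (g * snd v - p' (fst z) / fst z * fst v) + (2 * fst z * fst v) * (g * snd z - h (fst z))) / (g * \<rho>0\<^sup>2)
     = T\<eta> (fst z) (snd z) * fst v + (fst z)\<^sup>2 / \<rho>0\<^sup>2 * snd v" for v
    using g_pos \<rho>0_pos assms by (simp add: T\<eta>_def \<Phi>_def field_simps power2_eq_square)
  ultimately show ?thesis by simp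
qed

definition Usub :: "(real \<times> real) set" where
  "Usub = {z. 0 < snd z \<and> snd z < smax \<and> subsonic (fst z) (snd z)}"

lemma continuous_on_\<Phi>: "continuous_on {0<..} \<Phi>"
  by (intro continuous_at_imp_continuous_on ballI \<Phi>_isCont) auto

lemma open_Usub: "open Usub"
proof -
  have c: "continuous_on ({0<..} \<times> UNIV) (\<lambda>z::real\<times>real. \<Phi> (fst z) - g * snd z)"
    by (intro continuous_intros continuous_on_compose2[OF continuous_on_\<Phi>]) auto
  have "open (({0<..} \<times> UNIV) \<inter> (\<lambda>z::real\<times>real. \<Phi> (fst z) - g * snd z) -` {0<..})"
    using c by (intro continuous_open_preimage) (auto intro!: open_Times)
  moreover have "open ((UNIV::real set) \<times> {0<..<smax})" by (intro open_Times) auto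
  ultimately have "open ((({0<..} \<times> UNIV) \<inter> (\<lambda>z::real\<times>real. \<Phi> (fst z) - g * snd z) -` {0<..}) \<inter> (UNIV \<times> {0<..<smax}))"
    by (rule open_Int)
  also have "(({0<..} \<times> UNIV) \<inter> (\<lambda>z::real\<times>real. \<Phi> (fst z) - g * snd z) -` {0<..}) \<inter> (UNIV \<times> {0<..<smax}) = Usub"
    by (auto simp: Usub_def subsonic_def)
  finally show ?thesis .
qed

lemma Dom_eq_image: "Dom = (\<lambda>z. (T (fst z) (snd z), snd z)) ` Usub"
  unfolding Dom_def Usub_def by (force simp: image_iff)

lemma inj_on_Usub: "inj_on (\<lambda>z. (T (fst z) (snd z), snd z)) Usub"
  by (rule inj_onI) (auto simp: Usub_def prod_eq_iff intro: T_inj)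

text \<open>The pair \<open>(H, s)\<close> inverts the map taking \<open>(\<eta>, s)\<close> to
  \<open>(T \<eta> s, s)\<close>, which is continuous and injective on the open set
  \<open>Usub\<close>. Invariance of domain gives the openness of the image and the continuity of
  the inverse.\<close>

lemma open_Dom: "open Dom"
  and continuous_on_H: "continuous_on Dom (\<lambda>z. (H (fst z) (snd z), snd z))"
proof -
  have cont: "continuous_on Usub (\<lambda>z. (T (fst z) (snd z), snd z))"
    by (intro continuous_on_Pair continuous_on_snd continuous_on_id continuous_at_imp_continuous_on ballI
        has_derivative_continuous[OF T_has_derivative]) (auto simp: Usub_def subsonic_def)
  show "open Dom" unfolding Dom_eq_image
    by (rule invariance_of_domain[OF cont open_Usub inj_on_Usub])
  show "continuous_on Dom (\<lambda>z. (H (fst z) (snd z), snd z))"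
    unfolding Dom_eq_image
  proof (rule continuous_on_inverse_open[OF open_Usub cont])
    fix z assume "z \<in> Usub"
    then show "(H (fst (T (fst z) (snd z), snd z)) (snd (T (fst z) (snd z), snd z)), snd (T (fst z) (snd z), snd z)) = z"
      using H_eq[of "snd z" "fst z"] by (auto simp: Usub_def prod_eq_iff)
  qed (simp_all)
qed

text \<open>The Jacobian matrix of the map to be inverted is triangular with diagonal entries
  \<open>T\<eta> (H t s) s\<close> and 1; the derivative of \<open>H\<close> is the first row of its
  inverse.\<close>

lemma H_has_derivative:
  assumes "(t, s) \<in> Dom"
  shows "((\<lambda>z. H (fst z) (snd z)) has_derivative
    (\<lambda>v. (fst v - (H t s)\<^sup>2 / \<rho>0\<^sup>2 * snd v) / T\<eta> (H t s) s)) (at (t, s))"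
proof -
  define \<eta> where "\<eta> = H t s"
  note D = Dom_D[OF assms, folded \<eta>_def]
  have "((\<lambda>z. (H (fst z) (snd z), snd z)) has_derivative
      (\<lambda>v. ((fst v - \<eta>\<^sup>2 / \<rho>0\<^sup>2 * snd v) / T\<eta> \<eta> s, snd v))) (at (t, s))"
  proof (rule has_derivative_inverse_basic[where f="\<lambda>z. (T (fst z) (snd z), snd z)" and T=Dom
        and f'="\<lambda>v. (T\<eta> \<eta> s * fst v + \<eta>\<^sup>2 / \<rho>0\<^sup>2 * snd v, snd v)"])
    show "((\<lambda>z. (T (fst z) (snd z), snd z)) has_derivative (\<lambda>v. (T\<eta> \<eta> s * fst v + \<eta>\<^sup>2 / \<rho>0\<^sup>2 * snd v, snd v)))
       (at (H (fst (t, s)) (snd (t, s)), snd (t, s)))"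
      using T_has_derivative[of "(\<eta>, s)"] D
      by (auto intro!: derivative_eq_intros simp: \<eta>_def)
    show "bounded_linear (\<lambda>v. ((fst v - \<eta>\<^sup>2 / \<rho>0\<^sup>2 * snd v) / T\<eta> \<eta> s, snd v))"
      by (intro bounded_linear_Pair bounded_linear_divide[THEN bounded_linear_compose] bounded_linear_sub
            bounded_linear_fst bounded_linear_snd bounded_linear_mult_right[THEN bounded_linear_compose])
    show "(\<lambda>v. ((fst v - \<eta>\<^sup>2 / \<rho>0\<^sup>2 * snd v) / T\<eta> \<eta> s, snd v)) \<circ> (\<lambda>v. (T\<eta> \<eta> s * fst v + \<eta>\<^sup>2 / \<rho>0\<^sup>2 * snd v, snd v)) = id"
      using T\<eta>_neg[OF D(3)] by (auto simp: fun_eq_iff)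
    show "continuous (at (t, s)) (\<lambda>z. (H (fst z) (snd z), snd z))"
      using continuous_on_H open_Dom assms continuous_on_eq_continuous_at by blast
    show "(T (fst (H (fst z) (snd z), snd z)) (snd (H (fst z) (snd z), snd z)), snd (H (fst z) (snd z), snd z)) = z"
      if "z \<in> Dom" for z
      using that Dom_D(4)[of "fst z" "snd z"] by (simp add: prod_eq_iff)
  qed (use open_Dom assms in auto)
  from has_derivative_fst[OF this] show ?thesis by (simp add: \<eta>_def)
qed

lemma H_deriv_t:
  assumes "(t, s) \<in> Dom"
  shows "((\<lambda>\<tau>. H \<tau> s) has_real_derivative 1 / T\<eta> (H t s) s) (at t)"
proof -
  have "((\<lambda>\<tau>. (\<tau>, s)) has_derivative (\<lambda>x. (x, 0))) (at t)"
    by (auto intro!: derivative_eq_intros)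
  from has_derivative_compose[OF this H_has_derivative[OF assms]]
  have "((\<lambda>\<tau>. H \<tau> s) has_derivative (\<lambda>x. x / T\<eta> (H t s) s)) (at t)" by simp
  then show ?thesis by (rule has_derivative_imp_has_field_derivative) simp
qed

lemma H_deriv_s:
  assumes "(t, s) \<in> Dom"
  shows "((\<lambda>\<sigma>. H t \<sigma>) has_real_derivative - ((H t s)\<^sup>2 / \<rho>0\<^sup>2) / T\<eta> (H t s) s) (at s)"
proof -
  have "((\<lambda>\<sigma>. (t, \<sigma>)) has_derivative (\<lambda>x. (0, x))) (at s)"
    by (auto intro!: derivative_eq_intros)
  from has_derivative_compose[OF this H_has_derivative[OF assms]]
  have "((\<lambda>\<sigma>. H t \<sigma>) has_derivative (\<lambda>x. - ((H t s)\<^sup>2 / \<rho>0\<^sup>2 * x) / T\<eta> (H t s) s)) (at s)" by simp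
  then show ?thesis by (rule has_derivative_imp_has_field_derivative) simp
qed

text \<open>The Bernoulli equation turns \<open>g * s - h\<close> into a multiple of
  \<open>t\<close>. In this form the factor \<open>1 / T\<eta>\<close> cancels from both partial
  derivatives of \<open>W\<close>.\<close>

lemma T\<eta>_eq:
  assumes "(t, s) \<in> Dom"
  shows "T\<eta> (H t s) s = 2 * t / H t s - H t s * p' (H t s) / (g * \<rho>0\<^sup>2)"
proof -
  note D = Dom_D[OF assms]
  have "2 * t / H t s = 2 * T (H t s) s / H t s" by (simp only: D(4))
  also have "\<dots> = 2 * H t s * (g * s - h (H t s)) / (g * \<rho>0\<^sup>2)"
    using D(5) by (simp add: T_def power2_eq_square)
  finally show ?thesis
    using g_pos \<rho>0_pos by (simp add: T\<eta>_def \<Phi>_def diff_divide_distrib[symmetric] algebra_simps)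
qed

text \<open>Substituting \<open>\<eta> = H \<tau> s\<close> in the integral defining \<open>F\<close> gives \<open>F t s = W t s - W 0 s\<close>.\<close>

definition W :: "real \<Rightarrow> real \<Rightarrow> real" where
  "W t s = 2 * t / H t s + p (H t s) / (g * \<rho>0\<^sup>2)"

lemma W_deriv_t:
  assumes D: "(t, s) \<in> Dom"
  shows "((\<lambda>\<tau>. W \<tau> s) has_real_derivative 1 / H t s) (at t)"
proof -
  define k where "k = T\<eta> (H t s) s"
  have k: "k \<noteq> 0" using T\<eta>_neg Dom_D(3)[OF D] unfolding k_def by force
  have H0: "H t s \<noteq> 0" using Dom_D(5)[OF D] by simp
  have "((\<lambda>\<tau>. W \<tau> s) has_real_derivative
      (2 * H t s - 2 * t * (1 / k)) / (H t s * H t s) + p' (H t s) * (1 / k) / (g * \<rho>0\<^sup>2)) (at t)"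
    unfolding W_def k_def
    by (rule DERIV_add DERIV_cdivide DERIV_chain2[OF p_deriv] Dom_D(5)[OF D] H_deriv_t[OF D] | 
        rule DERIV_cong, rule DERIV_divide, rule DERIV_cmult_Id, rule H_deriv_t[OF D], rule H0, simp)+
  moreover have "(2 * H t s - 2 * t * (1 / k)) / (H t s * H t s) + p' (H t s) * (1 / k) / (g * \<rho>0\<^sup>2)
     = 2 / H t s - (2 * t / H t s - H t s * p' (H t s) / (g * \<rho>0\<^sup>2)) / k / H t s"
    using H0 k g_pos \<rho>0_pos by (simp add: field_simps)
  moreover have "\<dots> = 1 / H t s"
    unfolding T\<eta>_eq[OF D, symmetric] k_def[symmetric] using k H0 by (simp add: field_simps)
  ultimately show ?thesis by simp
qed

lemma W_deriv_s:
  assumes D: "(t, s) \<in> Dom"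
  shows "((\<lambda>\<sigma>. W t \<sigma>) has_real_derivative H t s / \<rho>0\<^sup>2) (at s)"
proof -
  define k where "k = T\<eta> (H t s) s"
  define d where "d = - ((H t s)\<^sup>2 / \<rho>0\<^sup>2) / k"
  have k: "k \<noteq> 0" using T\<eta>_neg Dom_D(3)[OF D] unfolding k_def by force
  have H0: "H t s \<noteq> 0" using Dom_D(5)[OF D] by simp
  have Hd: "((\<lambda>\<sigma>. H t \<sigma>) has_real_derivative d) (at s)"
    using H_deriv_s[OF D] by (simp add: d_def k_def)
  have "((\<lambda>\<sigma>. W t \<sigma>) has_real_derivative
      (0 * H t s - 2 * t * d) / (H t s * H t s) + p' (H t s) * d / (g * \<rho>0\<^sup>2)) (at s)"
    unfolding W_def
    by (rule DERIV_add DERIV_cdivide DERIV_chain2[OF p_deriv] DERIV_divide DERIV_const Dom_D(5)[OF D] Hd H0)+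
  moreover have "(0 * H t s - 2 * t * d) / (H t s * H t s) + p' (H t s) * d / (g * \<rho>0\<^sup>2)
     = - (2 * t / H t s - H t s * p' (H t s) / (g * \<rho>0\<^sup>2)) * d / H t s"
    using H0 g_pos \<rho>0_pos by (simp add: field_simps)
  moreover have "\<dots> = H t s / \<rho>0\<^sup>2"
    unfolding T\<eta>_eq[OF D, symmetric] k_def[symmetric] d_def
    using k H0 \<rho>0_pos by (simp add: field_simps power2_eq_square)
  ultimately show ?thesis by simp
qed

text \<open>The whole segment from \<open>(0, s)\<close> to \<open>(t, s)\<close> lies in
  \<open>Dom\<close> by \<open>Dom_le\<close>, and as \<open>Dom\<close> is open, derivatives on it
  can be two-sided even at 0.\<close>

lemma FTC_Dom:
  assumes D: "(t, s) \<in> Dom" and t: "0 \<le> t"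
    and V: "\<And>\<tau>. (\<tau>, s) \<in> Dom \<Longrightarrow> (V has_real_derivative v \<tau>) (at \<tau>)"
    and c: "continuous_on {0..t} v"
  shows "(LBINT \<tau>=0..t. v \<tau>) = V t - V 0"
proof -
  have "(LBINT \<tau>=ereal 0..ereal t. v \<tau>) = V t - V 0"
  proof (rule interval_integral_FTC_finite)
    show "continuous_on {min 0 t..max 0 t} v" using c t by simp
    fix x assume "min 0 t \<le> x" "x \<le> max 0 t"
    then have "(x, s) \<in> Dom" using Dom_le[OF D] t by simp
    from V[OF this] show "(V has_vector_derivative v x) (at x within {min 0 t..max 0 t})"
      by (simp add: has_real_derivative_iff_has_vector_derivative has_vector_derivative_at_within)
  qed
  then show ?thesis by (simp add: zero_ereal_def)
qed

lemma continuous_on_H_t: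
  assumes D: "(t, s) \<in> Dom"
  shows "continuous_on {0..t} (\<lambda>\<tau>. H \<tau> s)"
  using Dom_le[OF D] by (intro continuous_at_imp_continuous_on ballI DERIV_isCont[OF H_deriv_t]) auto

lemma continuous_on_T\<eta>_t:
  assumes D: "(t, s) \<in> Dom"
  shows "continuous_on {0..t} (\<lambda>\<tau>. T\<eta> (H \<tau> s) s)"
  unfolding T\<eta>_def using Dom_D(5)[OF Dom_le[OF D]] g_pos \<rho>0_pos
  by (intro continuous_intros continuous_on_H_t[OF D] continuous_on_compose2[OF continuous_on_\<Phi>]) auto

lemma F_eq:
  assumes D: "(t, s) \<in> Dom" and t: "0 \<le> t"
  shows "F t s = W t s - W 0 s"
  unfolding Ffun_def using Dom_D(5)[OF Dom_le[OF D]]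
  by (intro FTC_Dom[OF D t W_deriv_t] continuous_intros continuous_on_H_t[OF D]) force+

lemma d2F_eq:
  assumes D: "(t, s) \<in> Dom" and t: "0 \<le> t"
  shows "d2F g \<rho>0 p t s = (H t s - H 0 s) / \<rho>0\<^sup>2"
proof -
  have s: "0 < s" "s < smax" using Dom_D[OF D] by auto
  have "((\<lambda>\<sigma>. W t \<sigma> - W 0 \<sigma>) has_real_derivative H t s / \<rho>0\<^sup>2 - H 0 s / \<rho>0\<^sup>2) (at s)"
    by (intro DERIV_diff W_deriv_s D Dom_zero s)
  moreover have "open {\<sigma>. (t, \<sigma>) \<in> Dom}"
    using open_vimage[OF open_Dom, of "\<lambda>\<sigma>. (t, \<sigma>)"] by (simp add: vimage_def continuous_intros)
  ultimately have "((\<lambda>\<sigma>. F t \<sigma>) has_real_derivative H t s / \<rho>0\<^sup>2 - H 0 s / \<rho>0\<^sup>2) (at s)"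
    by (rule has_field_derivative_transform_within_open) (use D F_eq t in auto)
  then show ?thesis by (simp add: d2F_def DERIV_imp_deriv diff_divide_distrib)
qed

lemma lam_eq:
  assumes s: "0 < s" "s < smax"
  shows "lam g \<rho>0 p s = W 0 s - p \<rho>0 / (g * \<rho>0\<^sup>2)"
  using F_eq[OF Dom_diag(1)[OF s]] Dom_diag(2)[OF s] s by (simp add: lam_def W_def)

text \<open>The term \<open>H 0 s\<close> cancels against the one in \<open>d2F_eq\<close>, so that
  on the positivity set only the actual density remains.\<close>

lemma deriv_lam:
  assumes s: "0 < s" "s < smax"
  shows "deriv (lam g \<rho>0 p) s = H 0 s / \<rho>0\<^sup>2"
proof -
  have "((\<lambda>s. W 0 s - p \<rho>0 / (g * \<rho>0\<^sup>2)) has_real_derivative H 0 s / \<rho>0\<^sup>2 - 0) (at s)"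
    by (intro DERIV_diff W_deriv_s Dom_zero s DERIV_const)
  then have "(lam g \<rho>0 p has_real_derivative H 0 s / \<rho>0\<^sup>2 - 0) (at s)"
    by (rule has_field_derivative_transform_within_open[where S="{0<..<smax}"]) (use s lam_eq in auto)
  then show ?thesis by (simp add: DERIV_imp_deriv)
qed

lemma inverse_H_deriv_t:
  assumes D: "(t, s) \<in> Dom"
  shows "((\<lambda>\<tau>. 1 / H \<tau> s) has_real_derivative - 1 / (T\<eta> (H t s) s * (H t s)\<^sup>2)) (at t)"
  using DERIV_divide[OF DERIV_const[of 1] H_deriv_t[OF D]] Dom_D(5)[OF D]
  by (simp add: power2_eq_square)

lemma inverse_H_deriv_s:
  assumes D: "(t, s) \<in> Dom"
  shows "((\<lambda>\<sigma>. 1 / H t \<sigma>) has_real_derivative 1 / T\<eta> (H t s) s / \<rho>0\<^sup>2) (at s)"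
  using DERIV_divide[OF DERIV_const[of 1] H_deriv_s[OF D]] Dom_D(5)[OF D]
  by (simp add: power2_eq_square mult.commute)

text \<open>Integration by parts, with the primitive
  \<open>\<tau> / H \<tau> s - W \<tau> s\<close>.\<close>

lemma integral_deriv_inverse_H_t:
  assumes D: "(t, s) \<in> Dom" and t: "0 \<le> t"
  shows "(LBINT \<tau>=0..t. deriv (\<lambda>\<sigma>. 1 / H \<sigma> s) \<tau> * \<tau>) = t / H t s - F t s"
proof -
  define w where "w \<tau> = - 1 / (T\<eta> (H \<tau> s) s * (H \<tau> s)\<^sup>2)" for \<tau>
  have w: "deriv (\<lambda>\<sigma>. 1 / H \<sigma> s) \<tau> = w \<tau>" if "(\<tau>, s) \<in> Dom" for \<tau>
    unfolding w_def using inverse_H_deriv_t[OF that] by (rule DERIV_imp_deriv)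
  have "(LBINT \<tau>=0..t. deriv (\<lambda>\<sigma>. 1 / H \<sigma> s) \<tau> * \<tau>) = (\<lambda>t. t * (1 / H t s) - W t s) t - (\<lambda>t. t * (1 / H t s) - W t s) 0"
  proof (rule FTC_Dom[OF D t])
    fix \<tau> assume D': "(\<tau>, s) \<in> Dom"
    have "((\<lambda>t. t * (1 / H t s) - W t s) has_real_derivative (1 * (1 / H \<tau> s) + w \<tau> * \<tau>) - 1 / H \<tau> s) (at \<tau>)"
      unfolding w_def by (intro DERIV_diff DERIV_mult DERIV_ident inverse_H_deriv_t W_deriv_t D')
    then show "((\<lambda>t. t * (1 / H t s) - W t s) has_real_derivative deriv (\<lambda>\<sigma>. 1 / H \<sigma> s) \<tau> * \<tau>) (at \<tau>)"
      by (simp add: w[OF D'])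
  next
    have nz: "T\<eta> (H \<tau> s) s * (H \<tau> s)\<^sup>2 \<noteq> 0" if "\<tau> \<in> {0..t}" for \<tau>
      using Dom_D(3,5)[OF Dom_le[OF D, of \<tau>]] T\<eta>_neg[of "H \<tau> s" s] that by auto
    have "continuous_on {0..t} (\<lambda>\<tau>. w \<tau> * \<tau>)"
      unfolding w_def using nz
      by (intro continuous_intros continuous_on_T\<eta>_t[OF D] continuous_on_H_t[OF D]) auto
    then show "continuous_on {0..t} (\<lambda>\<tau>. deriv (\<lambda>\<sigma>. 1 / H \<sigma> s) \<tau> * \<tau>)"
      using w Dom_le[OF D] by (subst continuous_on_cong[OF refl, of _ _ "\<lambda>\<tau>. w \<tau> * \<tau>"]) auto
  qed
  then show ?thesis using F_eq[OF D t] by simp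
qed

text \<open>The derivative of \<open>1 / H\<close> in the second argument is that of
  \<open>H / \<rho>0\<^sup>2\<close> in the first, since both are multiples of
  \<open>1 / T\<eta>\<close>. So \<open>H \<tau> s / \<rho>0\<^sup>2 * s\<close> is a
  primitive.\<close>

lemma integral_deriv_inverse_H_s:
  assumes D: "(t, s) \<in> Dom" and t: "0 \<le> t"
  shows "(LBINT \<tau>=0..t. deriv (\<lambda>\<sigma>. 1 / H \<tau> \<sigma>) s * s) = s * (H t s - H 0 s) / \<rho>0\<^sup>2"
proof -
  have w: "deriv (\<lambda>\<sigma>. 1 / H \<tau> \<sigma>) s = 1 / T\<eta> (H \<tau> s) s / \<rho>0\<^sup>2" if "(\<tau>, s) \<in> Dom" for \<tau>
    using inverse_H_deriv_s[OF that] by (rule DERIV_imp_deriv)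
  have "(LBINT \<tau>=0..t. deriv (\<lambda>\<sigma>. 1 / H \<tau> \<sigma>) s * s) = (\<lambda>t. H t s / \<rho>0\<^sup>2 * s) t - (\<lambda>t. H t s / \<rho>0\<^sup>2 * s) 0"
  proof (rule FTC_Dom[OF D t])
    fix \<tau> assume D': "(\<tau>, s) \<in> Dom"
    show "((\<lambda>t. H t s / \<rho>0\<^sup>2 * s) has_real_derivative deriv (\<lambda>\<sigma>. 1 / H \<tau> \<sigma>) s * s) (at \<tau>)"
      unfolding w[OF D'] by (intro DERIV_cmult_right DERIV_cdivide H_deriv_t D')
  next
    have nz: "T\<eta> (H \<tau> s) s \<noteq> 0" if "\<tau> \<in> {0..t}" for \<tau>
      using Dom_D(3)[OF Dom_le[OF D, of \<tau>]] T\<eta>_neg[of "H \<tau> s" s] that by auto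
    have "continuous_on {0..t} (\<lambda>\<tau>. 1 / T\<eta> (H \<tau> s) s / \<rho>0\<^sup>2 * s)"
      using nz \<rho>0_pos by (intro continuous_intros continuous_on_T\<eta>_t[OF D]) auto
    then show "continuous_on {0..t} (\<lambda>\<tau>. deriv (\<lambda>\<sigma>. 1 / H \<tau> \<sigma>) s * s)"
      using w Dom_le[OF D] by (subst continuous_on_cong[OF refl, of _ _ "\<lambda>\<tau>. 1 / T\<eta> (H \<tau> s) s / \<rho>0\<^sup>2 * s"]) auto
  qed
  then show ?thesis by (simp add: diff_divide_distrib algebra_simps)
qed

end

section \<open>Integration by parts on the positivity set\<close>

lemma integrable_compact_support:
  fixes f :: "'a::euclidean_space \<Rightarrow> real"
  assumes "f \<in> borel_measurable borel" "bounded S" "\<And>x. x \<notin> S \<Longrightarrow> f x = 0" "\<And>x. \<bar>f x\<bar> \<le> B"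
  shows "integrable lborel f"
proof -
  obtain a b where ab: "S \<subseteq> cbox a b" using bounded_subset_cbox_symmetric[OF assms(2)] by blast
  show ?thesis
  proof (rule Bochner_Integration.integrable_bound)
    show "integrable lborel (\<lambda>x. B * indicator (cbox a b) x :: real)"
      using emeasure_lborel_cbox_finite[of a b] by (intro integrable_mult_right integrable_real_indicator) auto
    have "norm (f x) \<le> norm (B * indicator (cbox a b) x :: real)" for x
      using assms(3)[of x] assms(4)[of x] ab by (auto split: split_indicator)
    then show "AE x in lborel. norm (f x) \<le> norm (B * indicator (cbox a b) x :: real)" by simp
  qed (use assms(1) in simp)
qed

text \<open>By translation invariance the difference quotients of \<open>f\<close> integrate to zero.\<close>

lemma integral_directional_derivative_zero:
  fixes f :: "'a::euclidean_space \<Rightarrow> real"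
  assumes K: "compact K" "\<And>x. x \<notin> K \<Longrightarrow> f x = 0"
    and d: "\<And>x. (f has_derivative f' x) (at x)"
    and c: "continuous_on UNIV (\<lambda>x. f' x e)"
  shows "(LINT x|lborel. f' x e) = 0"
proof -
  have fc: "continuous_on UNIV f"
    using d by (intro continuous_at_imp_continuous_on ballI has_derivative_continuous)
  have lin: "linear (f' x)" for x using d[of x] has_derivative_linear by blast
  have out: "f' x e = 0" if "x \<notin> K" for x
  proof -
    have "(f has_derivative (\<lambda>_. 0)) (at x)"
      by (rule has_derivative_transform_within_open[where f="\<lambda>_. 0" and s="- K"])
         (use that K compact_imp_closed in \<open>auto simp: open_Compl\<close>)
    then show ?thesis using has_derivative_unique[OF d[of x]] by metis
  qed
  obtain B where B: "\<And>x. \<bar>f' x e\<bar> \<le> B"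
  proof -
    have "compact ((\<lambda>x. f' x e) ` K)" by (intro compact_continuous_image K continuous_on_subset[OF c]) auto
    then obtain b where "\<And>y. y \<in> (\<lambda>x. f' x e) ` K \<Longrightarrow> \<bar>y\<bar> \<le> b"
      using compact_imp_bounded bounded_real by metis
    then have "\<bar>f' x e\<bar> \<le> max b 0" for x using out[of x] by (cases "x \<in> K") (auto simp: le_max_iff_disj)
    then show ?thesis using that by blast
  qed
  obtain R where R: "K \<subseteq> cball 0 R"
    using compact_imp_bounded[OF K(1)] by (auto simp: bounded_iff subset_iff)
  define q where "q n x = (f (x + (1 / real (Suc n)) *\<^sub>R e) - f x) / (1 / real (Suc n))" for n x
  have fi: "integrable lborel f"
  proof -
    have "compact (f ` K)" by (intro compact_continuous_image K continuous_on_subset[OF fc]) auto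
    then obtain b where b: "\<And>y. y \<in> f ` K \<Longrightarrow> \<bar>y\<bar> \<le> b"
      using compact_imp_bounded bounded_real by metis
    show ?thesis
    proof (rule integrable_compact_support[where S=K and B="max b 0"])
      show "\<bar>f x\<bar> \<le> max b 0" for x using b K(2)[of x] by (cases "x \<in> K") (auto simp: le_max_iff_disj)
    qed (use K fc compact_imp_bounded borel_measurable_continuous_onI in auto)
  qed
  have tr: "integrable lborel (\<lambda>x. f (x + a))" "(LINT x|lborel. f (x + a)) = (LINT x|lborel. f x)" for a
  proof -
    have "(\<lambda>x. x + a) = (+) a" by (auto simp: add.commute)
    then have l: "distr lborel borel (\<lambda>x. x + a) = lborel" by (simp add: lborel_distr_plus)
    have m: "(\<lambda>x. x + a) \<in> measurable lborel borel" by simp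
    have fb: "f \<in> borel_measurable borel" using fc by (rule borel_measurable_continuous_onI)
    show "integrable lborel (\<lambda>x. f (x + a))"
      using fi integrable_distr_eq[OF m fb] l by simp
    show "(LINT x|lborel. f (x + a)) = (LINT x|lborel. f x)"
      using integral_distr[OF m fb] l by simp
  qed
  have q0: "(LINT x|lborel. q n x) = 0" for n
  proof -
    have "(LINT x|lborel. f (x + (1 / real (Suc n)) *\<^sub>R e) - f x) = 0"
      using tr fi by (subst Bochner_Integration.integral_diff) auto
    then show ?thesis unfolding q_def by simp
  qed
  \<comment> \<open>The step lengths are at most 1, so all difference quotients vanish off the ball
    of radius \<open>R + norm e\<close>; the mean value theorem bounds them by
    \<open>B\<close>.\<close>
  have "(\<lambda>n. LINT x|lborel. q n x) \<longlonglongrightarrow> (LINT x|lborel. f' x e)"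
  proof (rule integral_dominated_convergence[where w="\<lambda>x. B * indicator (cball 0 (R + norm e)) x"])
    show "(\<lambda>x. f' x e) \<in> borel_measurable lborel"
      using borel_measurable_continuous_onI[OF c] by simp
    show "q n \<in> borel_measurable lborel" for n
    proof -
      have "continuous_on UNIV (\<lambda>x. f (x + (1 / real (Suc n)) *\<^sub>R e))"
        by (rule continuous_on_compose2[OF fc]) (intro continuous_intros, simp)
      then have "continuous_on UNIV (q n)"
        unfolding q_def by (intro continuous_intros fc) auto
      then show ?thesis by (simp add: borel_measurable_continuous_onI)
    qed
    show "integrable lborel (\<lambda>x. B * indicator (cball 0 (R + norm e)) x :: real)"
      using emeasure_lborel_cball_finite by (intro integrable_mult_right integrable_real_indicator) auto
    show "AE x in lborel. (\<lambda>n. q n x) \<longlonglongrightarrow> f' x e"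
    proof (rule AE_I2)
      fix x
      have "((\<lambda>s. f (x + s *\<^sub>R e)) has_real_derivative f' x e) (at 0)"
      proof -
        have "((\<lambda>s. x + s *\<^sub>R e) has_derivative (\<lambda>s. s *\<^sub>R e)) (at 0)"
          by (auto intro!: derivative_eq_intros)
        from has_derivative_compose[OF this, of f "f' x"] d[of x]
        have "((\<lambda>s. f (x + s *\<^sub>R e)) has_derivative (\<lambda>s. f' x (s *\<^sub>R e))) (at 0)" by simp
        then show ?thesis using lin[of x]
          by (intro has_derivative_imp_has_field_derivative) (auto simp: linear_cmul)
      qed
      then have "((\<lambda>s. (f (x + s *\<^sub>R e) - f x) / s) \<longlongrightarrow> f' x e) (at 0)"
        by (simp add: has_field_derivative_iff)
      moreover have "filterlim (\<lambda>n. 1 / real (Suc n)) (at 0) sequentially"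
        using LIMSEQ_Suc[OF lim_1_over_n] by (simp add: filterlim_at)
      ultimately show "(\<lambda>n. q n x) \<longlonglongrightarrow> f' x e"
        unfolding q_def by (rule filterlim_compose)
    qed
    show "AE x in lborel. norm (q n x) \<le> B * indicator (cball 0 (R + norm e)) x" for n
    proof (rule AE_I2)
      fix x
      define s where "s = 1 / real (Suc n)"
      have s: "0 < s" "s \<le> 1" by (auto simp: s_def)
      show "norm (q n x) \<le> B * indicator (cball 0 (R + norm e)) x"
      proof (cases "x \<in> cball 0 (R + norm e)")
        case True
        have "\<exists>z>0. z < s \<and> f (x + s *\<^sub>R e) - f (x + 0 *\<^sub>R e) = (s - 0) * f' (x + z *\<^sub>R e) e"
        proof (rule MVT2[OF s(1)])
          fix z
          have "((\<lambda>s. x + s *\<^sub>R e) has_derivative (\<lambda>s. s *\<^sub>R e)) (at z)"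
            by (auto intro!: derivative_eq_intros)
          from has_derivative_compose[OF this d]
          have "((\<lambda>s. f (x + s *\<^sub>R e)) has_derivative (\<lambda>s. f' (x + z *\<^sub>R e) (s *\<^sub>R e))) (at z)" by simp
          then show "((\<lambda>s. f (x + s *\<^sub>R e)) has_real_derivative f' (x + z *\<^sub>R e) e) (at z)"
            using lin[of "x + z *\<^sub>R e"]
            by (intro has_derivative_imp_has_field_derivative) (auto simp: linear_cmul)
        qed
        then obtain z where "f (x + s *\<^sub>R e) - f x = s * f' (x + z *\<^sub>R e) e" by auto
        then have "q n x = f' (x + z *\<^sub>R e) e" using s unfolding q_def s_def[symmetric] by simp
        then show ?thesis using B True by simp
      next
        case False
        have "x \<notin> K"
        proof
          assume "x \<in> K"
          then have "norm x \<le> R" using R by auto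
          then show False using False norm_ge_zero[of e] by simp
        qed
        moreover have "x + s *\<^sub>R e \<notin> K"
        proof
          assume "x + s *\<^sub>R e \<in> K"
          then have "norm (x + s *\<^sub>R e) \<le> R" using R by auto
          moreover have "norm x \<le> norm (x + s *\<^sub>R e) + norm (s *\<^sub>R e)"
            using norm_triangle_ineq4[of "x + s *\<^sub>R e" "s *\<^sub>R e"] by simp
          moreover have "norm (s *\<^sub>R e) \<le> norm e" using s by (simp add: mult_left_le_one_le)
          ultimately show False using False by simp
        qed
        ultimately show ?thesis using K(2) False by (simp add: q_def s_def)
      qed
    qed
  qed
  then show ?thesis unfolding q0 using LIMSEQ_const_iff by (metis)
qed

text \<open>The derivative is extended by zero. It stays continuous because \<open>P\<close> and the
  complement of \<open>K\<close> are open sets that cover the space.\<close>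

lemma integral_directional_derivative_zero_open:
  fixes f :: "'a::euclidean_space \<Rightarrow> real"
  assumes P: "open P" and K: "compact K" "K \<subseteq> P" "\<And>x. x \<notin> K \<Longrightarrow> f x = 0"
    and d: "\<And>x. x \<in> P \<Longrightarrow> (f has_derivative f' x) (at x)"
    and c: "continuous_on P (\<lambda>x. f' x e)"
  shows "(LINT x:P|lborel. f' x e) = 0"
proof -
  define g where "g x = (if x \<in> P then f' x else (\<lambda>_. 0))" for x
  have z: "(f has_derivative (\<lambda>_. 0)) (at x)" if "x \<notin> K" for x
    by (rule has_derivative_transform_within_open[where f="\<lambda>_. 0" and s="- K"])
       (use that K compact_imp_closed in \<open>auto simp: open_Compl\<close>)
  have gd: "(f has_derivative g x) (at x)" for x
    using d[of x] z[of x] K by (auto simp: g_def)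
  have g0: "g x e = 0" if "x \<notin> K" for x
    using has_derivative_unique[OF gd[of x] z[OF that]] by metis
  have "continuous_on (P \<union> - K) (\<lambda>x. g x e)"
  proof (rule continuous_on_open_Un)
    show "continuous_on P (\<lambda>x. g x e)" using c by (rule continuous_on_eq) (simp add: g_def)
    show "continuous_on (- K) (\<lambda>x. g x e)" by (rule continuous_on_eq[OF continuous_on_const]) (simp add: g0)
  qed (use P K compact_imp_closed in auto)
  moreover have "P \<union> - K = UNIV" using K by auto
  ultimately have "(LINT x|lborel. g x e) = 0"
    using integral_directional_derivative_zero[OF K(1,3) gd] by auto
  moreover have "(LINT x:P|lborel. f' x e) = (LINT x|lborel. g x e)"
    unfolding set_lebesgue_integral_def by (intro Bochner_Integration.integral_cong) (auto simp: g_def)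
  ultimately show ?thesis by simp
qed

section \<open>Calculus with explicit gradients\<close>

definition C1grad :: "'a::euclidean_space set \<Rightarrow> ('a \<Rightarrow> real) \<Rightarrow> ('a \<Rightarrow> 'a) \<Rightarrow> bool" where
  "C1grad S f g \<longleftrightarrow> (\<forall>x\<in>S. (f has_derivative (\<lambda>h. g x \<bullet> h)) (at x)) \<and> continuous_on S g"

lemma C1grad_continuous_on: "C1grad S f g \<Longrightarrow> continuous_on S f"
  unfolding C1grad_def by (intro continuous_at_imp_continuous_on ballI) (auto dest: has_derivative_continuous)

lemma C1grad_subset: "C1grad S f g \<Longrightarrow> T \<subseteq> S \<Longrightarrow> C1grad T f g"
  unfolding C1grad_def using continuous_on_subset by blast

lemma C1grad_const: "C1grad S (\<lambda>_. k) (\<lambda>_. 0)"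
  by (simp add: C1grad_def)

lemma C1grad_inner: "C1grad S (\<lambda>x. x \<bullet> a) (\<lambda>_. a)"
  unfolding C1grad_def by (auto intro!: derivative_eq_intros simp: inner_commute)

lemma C1grad_nth: "C1grad S (\<lambda>x::real^2. x $ i) (\<lambda>_. axis i 1)"
  using C1grad_inner[of S "axis i 1"] by (simp add: inner_axis)

lemma C1grad_add:
  assumes "C1grad S f F" "C1grad S k K" shows "C1grad S (\<lambda>x. f x + k x) (\<lambda>x. F x + K x)"
  using assms unfolding C1grad_def
  by (auto intro!: continuous_intros derivative_eq_intros simp: inner_add_left)

lemma C1grad_mult:
  assumes "C1grad S f F" "C1grad S k K" shows "C1grad S (\<lambda>x. f x * k x) (\<lambda>x. f x *\<^sub>R K x + k x *\<^sub>R F x)"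
  using assms C1grad_continuous_on[OF assms(1)] C1grad_continuous_on[OF assms(2)] unfolding C1grad_def
  by (auto intro!: continuous_intros derivative_eq_intros simp: inner_add_left algebra_simps)

lemma C1grad_compose:
  assumes f: "C1grad S f F" and k: "\<And>y. y \<in> f ` S \<Longrightarrow> (k has_real_derivative dk y) (at y)" and c: "continuous_on (f ` S) dk"
  shows "C1grad S (\<lambda>x. k (f x)) (\<lambda>x. dk (f x) *\<^sub>R F x)"
  unfolding C1grad_def
proof (intro conjI ballI)
  fix x assume x: "x \<in> S"
  then have "(f has_derivative (\<lambda>h. F x \<bullet> h)) (at x)" using f by (auto simp: C1grad_def)
  from has_derivative_compose[OF this, of k "(*) (dk (f x))"] k[of "f x"] x
  show "((\<lambda>x. k (f x)) has_derivative (\<lambda>h. (dk (f x) *\<^sub>R F x) \<bullet> h)) (at x)"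
    by (simp add: has_field_derivative_def)
next
  show "continuous_on S (\<lambda>x. dk (f x) *\<^sub>R F x)"
    using f by (intro continuous_intros continuous_on_compose2[OF c] C1grad_continuous_on[OF f]) (auto simp: C1grad_def)
qed

lemma C1grad_C1_on: "C1grad S f g \<Longrightarrow> C1_on S f (\<lambda>x. blinfun_inner_right (g x))"
  unfolding C1grad_def C1_on_def
  by (simp add: bounded_linear.continuous_on[OF bounded_linear_blinfun_inner_right] has_derivative_at_withinI)

lemma integral_gradient_zero:
  assumes "open P" "compact K" "K \<subseteq> P" "\<And>x. x \<notin> K \<Longrightarrow> f x = 0" "C1grad P f (g :: real^2 \<Rightarrow> real^2)"
  shows "(LINT x:P|lborel. g x $ i) = 0"
proof -
  have "(LINT x:P|lborel. (\<lambda>h. g x \<bullet> h) (axis i 1)) = 0"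
    by (rule integral_directional_derivative_zero_open[OF assms(1-4)])
       (use assms(5) in \<open>auto simp: C1grad_def intro!: continuous_intros\<close>)
  then show ?thesis by (simp add: inner_axis)
qed

section \<open>Cut-off functions and the fundamental lemma\<close>

lemma max0_square_deriv: "((\<lambda>s::real. (max 0 s)\<^sup>2) has_real_derivative 2 * max 0 s) (at s)"
proof (cases s "0::real" rule: linorder_cases)
  case less
  have "((\<lambda>s::real. 0) has_real_derivative 0) (at s)" by simp
  then have "((\<lambda>s::real. (max 0 s)\<^sup>2) has_real_derivative 0) (at s)"
    by (rule has_field_derivative_transform_within_open[where S="{..<0}"]) (use less in auto)
  then show ?thesis using less by simp
next
  case greater
  have "((\<lambda>s::real. s\<^sup>2) has_real_derivative 2 * s) (at s)" by (auto intro!: derivative_eq_intros)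
  then have "((\<lambda>s::real. (max 0 s)\<^sup>2) has_real_derivative 2 * s) (at s)"
    by (rule has_field_derivative_transform_within_open[where S="{0<..}"]) (use greater in auto)
  then show ?thesis using greater by simp
next
  case equal
  have "((\<lambda>h::real. (max 0 h)\<^sup>2 / h) \<longlongrightarrow> 0) (at 0)"
  proof (rule Lim_null_comparison)
    show "((\<lambda>h::real. \<bar>h\<bar>) \<longlongrightarrow> 0) (at 0)" using tendsto_rabs[OF tendsto_ident_at[of 0 UNIV]] by simp
    show "eventually (\<lambda>h::real. norm ((max 0 h)\<^sup>2 / h) \<le> \<bar>h\<bar>) (at 0)"
      by (rule always_eventually) (auto simp: max_def power2_eq_square)
  qed
  then show ?thesis using equal by (simp add: has_field_derivative_iff)
qed

text \<open>Continuously differentiable approximations of the positive part, and of the indicator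
  function of the positive half-line.\<close>

definition ppart :: "real \<Rightarrow> real \<Rightarrow> real" where
  "ppart e s = (max 0 s)\<^sup>2 / (max 0 s + e)"

definition dppart :: "real \<Rightarrow> real \<Rightarrow> real" where
  "dppart e s = 1 - (e / (max 0 s + e))\<^sup>2"

lemma ppart_deriv:
  assumes e: "0 < e" shows "(ppart e has_real_derivative dppart e s) (at s)"
proof (cases s "0::real" rule: linorder_cases)
  case less
  have "((\<lambda>s::real. 0) has_real_derivative 0) (at s)" by simp
  then have "(ppart e has_real_derivative 0) (at s)"
    by (rule has_field_derivative_transform_within_open[where S="{..<0}"]) (use less in \<open>auto simp: ppart_def\<close>)
  then show ?thesis using less e by (simp add: dppart_def)
next
  case greater
  have "((\<lambda>s::real. s\<^sup>2 / (s + e)) has_real_derivative (2 * s * (s + e) - s\<^sup>2 * 1) / ((s + e) * (s + e))) (at s)"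
    using greater e by (auto intro!: derivative_eq_intros)
  then have "(ppart e has_real_derivative (2 * s * (s + e) - s\<^sup>2 * 1) / ((s + e) * (s + e))) (at s)"
    by (rule has_field_derivative_transform_within_open[where S="{0<..}"]) (use greater in \<open>auto simp: ppart_def\<close>)
  moreover have "(2 * s * (s + e) - s\<^sup>2 * 1) / ((s + e) * (s + e)) = dppart e s"
  proof -
    have "(2 * s * (s + e) - s\<^sup>2 * 1) = (s + e) * (s + e) - e\<^sup>2" by algebra
    then show ?thesis using greater e by (simp add: dppart_def diff_divide_distrib power_divide power2_eq_square)
  qed
  ultimately show ?thesis by simp
next
  case equal
  have "((\<lambda>h::real. ppart e h / h) \<longlongrightarrow> 0) (at 0)"
  proof (rule Lim_null_comparison)
    show "((\<lambda>h::real. \<bar>h\<bar> / e) \<longlongrightarrow> 0) (at 0)"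
      using tendsto_divide[OF tendsto_rabs[OF tendsto_ident_at[of 0 UNIV]] tendsto_const[of e]] e by simp
    have "norm (ppart e h / h) \<le> \<bar>h\<bar> / e" for h
    proof (cases "0 < h")
      case True
      then have "norm (ppart e h / h) = h / (h + e)" using e by (simp add: ppart_def power2_eq_square)
      also have "\<dots> \<le> \<bar>h\<bar> / e" using True e by (simp add: frac_le)
      finally show ?thesis .
    qed (use e in \<open>auto simp: ppart_def divide_nonpos_pos not_less\<close>)
    then show "eventually (\<lambda>h::real. norm (ppart e h / h) \<le> \<bar>h\<bar> / e) (at 0)" by simp
  qed
  moreover have "ppart e 0 = 0" "dppart e 0 = 0" using e by (auto simp: ppart_def dppart_def)
  ultimately show ?thesis using equal by (simp add: has_field_derivative_iff)
qed

lemma continuous_on_dppart: "0 < e \<Longrightarrow> continuous_on S (dppart e)"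
  unfolding dppart_def
  by (intro continuous_intros) (auto simp: add_nonneg_eq_0_iff max_def)

lemma dppart_bounds: "0 < e \<Longrightarrow> 0 \<le> dppart e s" "0 < e \<Longrightarrow> dppart e s \<le> 1"
  by (auto simp: dppart_def divide_le_eq power_le_one_iff)

lemma ppart_bounds: "0 < e \<Longrightarrow> 0 \<le> ppart e s" "0 < e \<Longrightarrow> ppart e s \<le> max 0 s" "0 < e \<Longrightarrow> s - e \<le> ppart e s"
  "s \<le> 0 \<Longrightarrow> ppart e s = 0" "0 < e \<Longrightarrow> s \<le> 0 \<Longrightarrow> dppart e s = 0"
proof -
  assume e: "0 < e"
  show "0 \<le> ppart e s" using e by (simp add: ppart_def)
  show "ppart e s \<le> max 0 s" using e by (simp add: ppart_def divide_le_eq power2_eq_square mult_left_mono)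
  have "(s - e) * (s + e) \<le> s\<^sup>2" using e by (simp add: power2_eq_square algebra_simps)
  moreover have "s - e \<le> 0" if "s \<le> 0" using that e by simp
  ultimately show "s - e \<le> ppart e s" using e by (cases "0 \<le> s") (auto simp: ppart_def le_divide_eq max_def)
qed (auto simp: ppart_def dppart_def)

definition posind :: "real \<Rightarrow> real \<Rightarrow> real" where
  "posind e s = (max 0 s)\<^sup>2 / ((max 0 s)\<^sup>2 + e)"

definition dposind :: "real \<Rightarrow> real \<Rightarrow> real" where
  "dposind e s = e * (2 * max 0 s) / ((max 0 s)\<^sup>2 + e)\<^sup>2"

lemma posind_deriv:
  assumes e: "0 < e" shows "(posind e has_real_derivative dposind e s) (at s)"
proof -
  have p: "0 < (max 0 s)\<^sup>2 + e" using e by (simp add: add_nonneg_pos)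
  have "((\<lambda>s. (max 0 s)\<^sup>2 / ((max 0 s)\<^sup>2 + e)) has_real_derivative
     (2 * max 0 s * ((max 0 s)\<^sup>2 + e) - (max 0 s)\<^sup>2 * (2 * max 0 s + 0)) / (((max 0 s)\<^sup>2 + e) * ((max 0 s)\<^sup>2 + e))) (at s)"
    by (intro DERIV_divide DERIV_add max0_square_deriv DERIV_const) (use p in simp)
  moreover have "(2 * max 0 s * ((max 0 s)\<^sup>2 + e) - (max 0 s)\<^sup>2 * (2 * max 0 s + 0)) / (((max 0 s)\<^sup>2 + e) * ((max 0 s)\<^sup>2 + e)) = dposind e s"
    by (simp add: dposind_def power2_eq_square algebra_simps)
  ultimately show ?thesis unfolding posind_def[abs_def] by simp
qed

lemma continuous_on_dposind: "0 < e \<Longrightarrow> continuous_on S (dposind e)"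
  unfolding dposind_def
  by (intro continuous_intros) (auto simp: add_nonneg_eq_0_iff)

lemma posind_bounds: "0 < e \<Longrightarrow> 0 \<le> posind e s" "0 < e \<Longrightarrow> posind e s \<le> 1" "s \<le> 0 \<Longrightarrow> posind e s = 0"
  by (auto simp: posind_def divide_le_eq add_nonneg_pos)

lemma posind_tendsto:
  "(\<lambda>n. posind (1 / real (Suc n)) s) \<longlonglongrightarrow> (if 0 < s then 1 else 0)"
proof (cases "0 < s")
  case True
  have "(\<lambda>n. (max 0 s)\<^sup>2 / ((max 0 s)\<^sup>2 + 1 / real (Suc n))) \<longlonglongrightarrow> (max 0 s)\<^sup>2 / ((max 0 s)\<^sup>2 + 0)"
    using True by (intro tendsto_intros LIMSEQ_Suc[OF lim_1_over_n]) auto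
  then show ?thesis using True by (simp add: posind_def)
qed (simp add: posind_bounds)

definition box_bump :: "real \<Rightarrow> real^2 \<Rightarrow> real^2 \<Rightarrow> real^2 \<Rightarrow> real" where
  "box_bump e a b x = posind e (x $ 1 - a $ 1) * posind e (b $ 1 - x $ 1) *
     (posind e (x $ 2 - a $ 2) * posind e (b $ 2 - x $ 2))"

lemma box_bump_C1grad: "0 < e \<Longrightarrow> \<exists>g. C1grad UNIV (box_bump e a b) g"
proof -
  assume e: "0 < e"
  have 1: "\<exists>g. C1grad UNIV (\<lambda>x::real^2. posind e (s * (x $ i) + k)) g" for s k i
  proof -
    have "C1grad UNIV (\<lambda>x::real^2. s * (x $ i) + k) (\<lambda>x. (s *\<^sub>R axis i 1 + (x $ i) *\<^sub>R 0) + 0)"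
      by (intro C1grad_add C1grad_mult C1grad_const C1grad_nth)
    from C1grad_compose[OF this posind_deriv[OF e] continuous_on_dposind[OF e]] show ?thesis by blast
  qed
  have 2: "\<exists>g. C1grad UNIV (\<lambda>x::real^2. posind e (x $ i - k)) g" "\<exists>g. C1grad UNIV (\<lambda>x::real^2. posind e (k - x $ i)) g" for i k
    using 1[of 1 i "-k"] 1[of "-1" i k] by (simp_all add: add.commute)
  have 3: "\<exists>g. C1grad UNIV (\<lambda>x::real^2. f x * k x) g" if "\<exists>g. C1grad UNIV f g" "\<exists>g. C1grad UNIV k g" for f k
    using that C1grad_mult by blast
  show ?thesis unfolding box_bump_def[abs_def] by (intro 2 3)
qed

lemma box_bump_zero: "x \<notin> cbox a b \<Longrightarrow> box_bump e a b x = 0"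
  by (auto simp: box_bump_def mem_box_cart forall_2 posind_bounds(3) not_le)

lemma box_bump_bounds: "0 < e \<Longrightarrow> \<bar>box_bump e a b x\<bar> \<le> 1"
  unfolding box_bump_def abs_mult using posind_bounds[of e]
  by (intro mult_le_one mult_nonneg_nonneg) (auto simp: abs_le_iff)

lemma box_bump_tendsto: "(\<lambda>n. box_bump (1 / real (Suc n)) a b x) \<longlonglongrightarrow> indicator (box a b) x"
proof -
  have "(\<lambda>n. box_bump (1 / real (Suc n)) a b x) \<longlonglongrightarrow> (if 0 < x $ 1 - a $ 1 then 1 else 0) * (if 0 < b $ 1 - x $ 1 then 1 else 0) *
    ((if 0 < x $ 2 - a $ 2 then 1 else 0) * (if 0 < b $ 2 - x $ 2 then 1 else 0))"
    unfolding box_bump_def by (intro tendsto_mult posind_tendsto)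
  also have "(if 0 < x $ 1 - a $ 1 then 1 else 0) * (if 0 < b $ 1 - x $ 1 then 1 else 0) *
    ((if 0 < x $ 2 - a $ 2 then 1 else 0) * (if 0 < b $ 2 - x $ 2 then 1 else 0)) = (indicator (box a b) x :: real)"
    by (auto simp: indicator_def mem_box_cart forall_2)
  finally show ?thesis .
qed

text \<open>Products of smoothed indicators of half-lines are admissible test functions bounded by 1
  that converge to the indicator of an open box. Hence all box integrals vanish, the faces of a box
  being null sets.\<close>

lemma fundamental_lemma:
  fixes f :: "real^2 \<Rightarrow> real"
  assumes U: "open U" and f: "set_integrable lborel U f"
    and z: "\<And>\<psi> g K. C1grad UNIV \<psi> g \<Longrightarrow> compact K \<Longrightarrow> K \<subseteq> U \<Longrightarrow> (\<And>x. x \<notin> K \<Longrightarrow> \<psi> x = 0) \<Longrightarrow>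
       (LINT x:U|lborel. f x * \<psi> x) = 0"
  shows "AE x in lborel. x \<in> U \<longrightarrow> f x = 0"
proof -
  define F where "F x = indicator U x * f x" for x
  have Fi: "integrable lborel F" using f by (simp add: F_def[abs_def] set_integrable_def)
  have "AE x in lborel. x \<in> U \<longrightarrow> F x = 0"
  proof (rule AE_zero_if_box_integrals_zero[OF Fi U])
    fix a b assume ab: "cbox a b \<subseteq> U"
    have "(LINT x|lborel. F x * box_bump (1 / real (Suc n)) a b x) = 0" for n
    proof -
      obtain g where "C1grad UNIV (box_bump (1 / real (Suc n)) a b) g"
        using box_bump_C1grad[of "1 / real (Suc n)" a b] by auto
      from z[OF this compact_cbox ab box_bump_zero] show ?thesis
        by (simp add: set_lebesgue_integral_def F_def mult.assoc)
    qed
    moreover have "(\<lambda>n. LINT x|lborel. F x * box_bump (1 / real (Suc n)) a b x) \<longlonglongrightarrow> (LINT x|lborel. F x * indicator (box a b) x)"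
    proof (rule integral_dominated_convergence[where w="\<lambda>x. \<bar>F x\<bar>"])
      show "(\<lambda>x. F x * box_bump (1 / real (Suc n)) a b x) \<in> borel_measurable lborel" for n
      proof -
        obtain g where "C1grad UNIV (box_bump (1 / real (Suc n)) a b) g"
          using box_bump_C1grad[of "1 / real (Suc n)" a b] by auto
        from C1grad_continuous_on[OF this] show ?thesis
          using Fi by (intro borel_measurable_times) (auto intro: borel_measurable_continuous_onI)
      qed
      show "AE x in lborel. (\<lambda>n. F x * box_bump (1 / real (Suc n)) a b x) \<longlonglongrightarrow> F x * indicator (box a b) x"
        by (intro AE_I2 tendsto_intros box_bump_tendsto)
      show "AE x in lborel. norm (F x * box_bump (1 / real (Suc n)) a b x) \<le> \<bar>F x\<bar>" for n
        by (intro AE_I2) (simp add: abs_mult mult_left_le box_bump_bounds)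
    qed (use Fi in auto)
    ultimately have "(LINT x|lborel. F x * indicator (box a b) x) = 0"
      by (simp add: LIMSEQ_const_iff)
    moreover have "(LINT x:cbox a b|lborel. F x) = (LINT x|lborel. F x * indicator (box a b) x)"
      unfolding set_lebesgue_integral_def
    proof (rule integral_cong_AE)
      have "cbox a b - box a b \<in> null_sets lebesgue" using negligible_frontier_interval negligible_iff_null_sets by blast
      then have "cbox a b - box a b \<in> null_sets lborel" by (simp add: null_sets_def)
      from AE_not_in[OF this] show "AE x in lborel. indicator (cbox a b) x *\<^sub>R F x = F x * indicator (box a b) x"
        by eventually_elim (use box_subset_cbox[of a b] in \<open>auto split: split_indicator\<close>)
    qed (use Fi in auto)
    ultimately show "(LINT x:cbox a b|lborel. F x) = 0" by simp
  qed
  then show ?thesis by (auto simp: F_def elim!: eventually_mono)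
qed

lemma set_integrable_bounded:
  fixes f :: "'a::euclidean_space \<Rightarrow> real"
  assumes "f \<in> borel_measurable borel" "A \<in> sets borel" "bounded A" "\<And>x. x \<in> A \<Longrightarrow> \<bar>f x\<bar> \<le> B"
  shows "set_integrable lborel A f"
  unfolding set_integrable_def
proof (rule integrable_compact_support[where S=A and B="\<bar>B\<bar>"])
  show "\<bar>indicator A x *\<^sub>R f x\<bar> \<le> \<bar>B\<bar>" for x
    using assms(4)[of x] by (auto split: split_indicator)
qed (use assms in auto)

text \<open>The cut-off \<open>\<beta>\<^sub>n = ppart (1/n) (u - 1/n)\<close> vanishes near the boundary of \<open>{u > 0}\<close>, so the field
  \<open>\<beta>\<^sub>n \<psi> w\<close> is continuously differentiable with compact support, whatever the regularity of the
  boundary. The left-hand side of the identity below arises from its divergence as \<open>n\<close> tends to infinity.\<close>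

lemma integral_positivity_set:
  fixes u \<psi> :: "real^2 \<Rightarrow> real" and G g\<psi> :: "real^2 \<Rightarrow> real^2" and w :: "2 \<Rightarrow> real^2 \<Rightarrow> real" and gw :: "2 \<Rightarrow> real^2 \<Rightarrow> real^2"
  assumes B: "open B" and u: "continuous_on B u" and P: "P = {x\<in>B. 0 < u x}"
    and uG: "C1grad P u G" and w: "\<And>i. C1grad P (w i) (gw i)"
    and \<psi>: "C1grad B \<psi> g\<psi>" and K: "compact K" "K \<subseteq> B" "\<And>x. x \<notin> K \<Longrightarrow> \<psi> x = 0"
    and i1: "set_integrable lborel P (\<lambda>x. \<psi> x * (\<Sum>i\<in>UNIV. G x $ i * w i x))"
    and i2: "set_integrable lborel P (\<lambda>x. u x * (\<Sum>i\<in>UNIV. g\<psi> x $ i * w i x))"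
    and i3: "set_integrable lborel P (\<lambda>x. u x * \<psi> x * (\<Sum>i\<in>UNIV. gw i x $ i))"
  shows "(LINT x:P|lborel. \<psi> x * (\<Sum>i\<in>UNIV. G x $ i * w i x)) +
     (LINT x:P|lborel. u x * (\<Sum>i\<in>UNIV. g\<psi> x $ i * w i x)) +
     (LINT x:P|lborel. u x * \<psi> x * (\<Sum>i\<in>UNIV. gw i x $ i)) = 0"
proof -
  have oP: "open P"
    unfolding P using continuous_open_preimage[OF u B, of "{0<..}"] by (simp add: vimage_def Int_def)
  have PB: "P \<subseteq> B" by (auto simp: P)
  define e where "e n = 1 / real (Suc n)" for n
  have e: "0 < e n" for n by (simp add: e_def)
  define b where "b n x = ppart (e n) (u x - e n)" for n x
  define db where "db n x = dppart (e n) (u x - e n)" for n x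
  define f1 where "f1 x = \<psi> x * (\<Sum>i\<in>UNIV. G x $ i * w i x)" for x
  define f2 where "f2 x = (\<Sum>i\<in>UNIV. g\<psi> x $ i * w i x)" for x
  define f3 where "f3 x = \<psi> x * (\<Sum>i\<in>UNIV. gw i x $ i)" for x
  have bC: "C1grad P (b n) (\<lambda>x. db n x *\<^sub>R G x)" for n
  proof -
    have "C1grad P (\<lambda>x. u x + - e n) (\<lambda>x. G x + 0)" by (intro C1grad_add uG C1grad_const)
    then have "C1grad P (\<lambda>x. ppart (e n) (u x + - e n)) (\<lambda>x. dppart (e n) (u x + - e n) *\<^sub>R (G x + 0))"
      by (rule C1grad_compose) (auto intro: ppart_deriv continuous_on_dppart e)
    then show ?thesis by (simp add: b_def[abs_def] db_def)
  qed
  have \<psi>P: "C1grad P \<psi> g\<psi>" using C1grad_subset[OF \<psi> PB] .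
  have cG: "continuous_on P G" and cg\<psi>: "continuous_on P g\<psi>" and cgw: "continuous_on P (gw i)" for i
    using uG \<psi>P w by (auto simp: C1grad_def)
  note cu = C1grad_continuous_on[OF uG] and c\<psi> = C1grad_continuous_on[OF \<psi>P] and cw = C1grad_continuous_on[OF w]
    and cb = C1grad_continuous_on[OF bC]
  have cdb: "continuous_on P (db n)" for n
    unfolding db_def by (intro continuous_on_compose2[OF continuous_on_dppart[OF e, of UNIV]] continuous_intros cu) auto
  have cf: "continuous_on P f1" "continuous_on P f2" "continuous_on P f3"
    unfolding f1_def f2_def f3_def by (intro continuous_intros cG cg\<psi> cgw c\<psi> cw)+
  have zero: "(LINT x:P|lborel. db n x * f1 x + b n x * f2 x + b n x * f3 x) = 0" for n
  proof -
    \<comment> \<open>The shift by \<open>e n\<close> in the cut-off \<open>b n\<close> makes it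
      vanish where \<open>u \<le> e n\<close>. What remains of \<open>K\<close> is a compact subset
      of \<open>P\<close>, although \<open>K\<close> itself may cross the free boundary.\<close>
    define Kn where "Kn = {x\<in>K. e n \<le> u x}"
    have "closed Kn"
      unfolding Kn_def using continuous_closed_preimage[OF continuous_on_subset[OF u K(2)] compact_imp_closed[OF K(1)], of "{e n..}"]
      by (simp add: vimage_def Int_def)
    then have cK: "compact Kn"
      using bounded_subset[OF compact_imp_bounded[OF K(1)], of Kn]
      by (auto simp: compact_eq_bounded_closed Kn_def)
    have KP: "Kn \<subseteq> P" using K(2) less_le_trans[OF e[of n]] by (auto simp: Kn_def P)
    define F where "F i x = (if x \<in> P then b n x * (\<psi> x * w i x) else 0)" for i x
    define gF where "gF i x = b n x *\<^sub>R (\<psi> x *\<^sub>R gw i x + w i x *\<^sub>R g\<psi> x) + (\<psi> x * w i x) *\<^sub>R (db n x *\<^sub>R G x)" for i x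
    have "C1grad P (\<lambda>x. b n x * (\<psi> x * w i x)) (gF i)" for i
      unfolding gF_def by (intro C1grad_mult bC \<psi>P w)
    then have FC: "C1grad P (F i) (gF i)" for i
      unfolding C1grad_def
      using has_derivative_transform_within_open[where f="\<lambda>x. b n x * (\<psi> x * w i x)" and g="F i", OF _ oP]
      by (simp add: F_def)
    have out: "F i x = 0" if "x \<notin> Kn" for i x
      using that K(3)[of x] e[of n] by (auto simp: F_def b_def Kn_def not_le intro!: ppart_bounds(4))
    have z: "(LINT x:P|lborel. gF i x $ i) = 0" for i
      by (rule integral_gradient_zero[OF oP cK KP out FC])
    have int: "set_integrable lborel P (\<lambda>x. gF i x $ i)" for i
    proof -
      have cg: "continuous_on P (\<lambda>x. gF i x $ i)"
        unfolding gF_def by (intro continuous_intros cb c\<psi> cw cgw cg\<psi> cdb cG)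
      have o: "gF i x = 0" if "x \<in> P" "x \<notin> Kn" for x
      proof -
        have "open (P - Kn)" using oP cK compact_imp_closed by (intro open_Diff) auto
        then have "(F i has_derivative (\<lambda>h. 0)) (at x)"
          by (rule has_derivative_transform_within_open[where f="\<lambda>_. 0", OF has_derivative_const]) (use that out in simp_all)
        moreover have "(F i has_derivative (\<lambda>h. gF i x \<bullet> h)) (at x)" using FC[of i] that by (simp add: C1grad_def)
        ultimately have "(\<lambda>h. 0) = (\<lambda>h. gF i x \<bullet> h)" by (rule has_derivative_unique)
        then have "gF i x \<bullet> gF i x = 0" by metis
        then show ?thesis by simp
      qed
      have "compact ((\<lambda>x. gF i x $ i) ` Kn)" by (intro compact_continuous_image cK continuous_on_subset[OF cg KP])
      then obtain M where M: "\<And>y. y \<in> (\<lambda>x. gF i x $ i) ` Kn \<Longrightarrow> \<bar>y\<bar> \<le> M"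
        using compact_imp_bounded bounded_real by metis
      show ?thesis unfolding set_integrable_def
      proof (rule integrable_compact_support[where S=Kn and B="\<bar>M\<bar>"])
        show "(\<lambda>x. indicator P x *\<^sub>R gF i x $ i) \<in> borel_measurable borel"
          using borel_measurable_continuous_on_indicator[OF _ cg] oP by simp
        show "\<bar>indicator P x *\<^sub>R gF i x $ i\<bar> \<le> \<bar>M\<bar>" for x
          using M o[of x] by (cases "x \<in> Kn") (force split: split_indicator)+
      qed (use o cK compact_imp_bounded in \<open>auto split: split_indicator\<close>)
    qed
    have "(LINT x:P|lborel. gF 1 x $ 1 + gF 2 x $ 2) = 0"
      using z int by (simp add: set_integral_add)
    moreover have "gF 1 x $ 1 + gF 2 x $ 2 = db n x * f1 x + b n x * f2 x + b n x * f3 x" for x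
      by (simp add: gF_def f1_def f2_def f3_def UNIV_2 algebra_simps)
    ultimately show ?thesis by simp
  qed
  have j1: "set_integrable lborel P f1" and j2: "set_integrable lborel P (\<lambda>x. u x * f2 x)"
    and j3: "set_integrable lborel P (\<lambda>x. u x * f3 x)"
    using i1 i2 i3 by (simp_all add: f1_def[abs_def] f2_def f3_def mult.assoc)
  \<comment> \<open>The cut-off lies between 0 and \<open>u\<close>, and the factor
    \<open>db n\<close> from its derivative between 0 and 1, which yields the dominating function.
    Pointwise on \<open>P\<close> they tend to \<open>u\<close> and to 1.\<close>
  have "(\<lambda>n. LINT x|lborel. indicator P x *\<^sub>R (db n x * f1 x + b n x * f2 x + b n x * f3 x)) \<longlonglongrightarrow>
     (LINT x|lborel. indicator P x *\<^sub>R (f1 x + u x * f2 x + u x * f3 x))"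
  proof (rule integral_dominated_convergence[where w="\<lambda>x. \<bar>indicator P x *\<^sub>R f1 x\<bar> + \<bar>indicator P x *\<^sub>R (u x * f2 x)\<bar> + \<bar>indicator P x *\<^sub>R (u x * f3 x)\<bar>"])
    show "(\<lambda>x. indicator P x *\<^sub>R (f1 x + u x * f2 x + u x * f3 x)) \<in> borel_measurable lborel"
      using borel_measurable_continuous_on_indicator[of P "\<lambda>x. f1 x + u x * f2 x + u x * f3 x"] oP cf cu
      by (simp add: continuous_intros)
    show "(\<lambda>x. indicator P x *\<^sub>R (db n x * f1 x + b n x * f2 x + b n x * f3 x)) \<in> borel_measurable lborel" for n
      using borel_measurable_continuous_on_indicator[of P "\<lambda>x. db n x * f1 x + b n x * f2 x + b n x * f3 x"] oP cf cb cdb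
      by (simp add: continuous_intros)
    show "integrable lborel (\<lambda>x. \<bar>indicator P x *\<^sub>R f1 x\<bar> + \<bar>indicator P x *\<^sub>R (u x * f2 x)\<bar> + \<bar>indicator P x *\<^sub>R (u x * f3 x)\<bar>)"
      using j1 j2 j3 unfolding set_integrable_def by (intro Bochner_Integration.integrable_add integrable_abs)
    show "AE x in lborel. (\<lambda>n. indicator P x *\<^sub>R (db n x * f1 x + b n x * f2 x + b n x * f3 x)) \<longlonglongrightarrow>
       indicator P x *\<^sub>R (f1 x + u x * f2 x + u x * f3 x)"
    proof (rule AE_I2)
      fix x
      show "(\<lambda>n. indicator P x *\<^sub>R (db n x * f1 x + b n x * f2 x + b n x * f3 x)) \<longlonglongrightarrow>
       indicator P x *\<^sub>R (f1 x + u x * f2 x + u x * f3 x)"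
      proof (cases "x \<in> P")
        case True
        then have ux: "0 < u x" by (simp add: P)
        have e0: "e \<longlonglongrightarrow> 0" unfolding e_def by (rule LIMSEQ_Suc[OF lim_1_over_n])
        have bl: "(\<lambda>n. b n x) \<longlonglongrightarrow> u x"
        proof (rule tendsto_sandwich[of "\<lambda>n. u x - 2 * e n" _ _ "\<lambda>n. u x"])
          show "\<forall>\<^sub>F n in sequentially. u x - 2 * e n \<le> b n x"
            using ppart_bounds(3)[OF e] by (intro always_eventually allI) (simp add: b_def, smt (verit))
          show "\<forall>\<^sub>F n in sequentially. b n x \<le> u x"
          proof (intro always_eventually allI)
            fix n show "b n x \<le> u x" using ppart_bounds(2)[OF e, of n "u x - e n"] e[of n] ux by (simp add: b_def)
          qed
          show "(\<lambda>n. u x - 2 * e n) \<longlonglongrightarrow> u x"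
            using tendsto_diff[OF tendsto_const tendsto_mult[OF tendsto_const e0, of 2], of "u x"] by simp
        qed simp
        have "\<forall>\<^sub>F n in sequentially. e n < u x" using order_tendstoD(2)[OF e0 ux] .
        then have ev: "\<forall>\<^sub>F n in sequentially. 1 - (e n / u x)\<^sup>2 = db n x"
          by eventually_elim (simp add: db_def dppart_def)
        have "(\<lambda>n. 1 - (e n / u x)\<^sup>2) \<longlonglongrightarrow> 1 - (0 / u x)\<^sup>2" using ux by (intro tendsto_intros e0) auto
        then have "(\<lambda>n. 1 - (e n / u x)\<^sup>2) \<longlonglongrightarrow> 1" by simp
        from Lim_transform_eventually[OF this ev] have dl: "(\<lambda>n. db n x) \<longlonglongrightarrow> 1" .
        have "(\<lambda>n. indicator P x *\<^sub>R (db n x * f1 x + b n x * f2 x + b n x * f3 x)) \<longlonglongrightarrow>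
          indicator P x *\<^sub>R (1 * f1 x + u x * f2 x + u x * f3 x)"
          by (intro tendsto_intros bl dl)
        then show ?thesis by simp
      qed simp
    qed
    show "AE x in lborel. norm (indicator P x *\<^sub>R (db n x * f1 x + b n x * f2 x + b n x * f3 x)) \<le>
       \<bar>indicator P x *\<^sub>R f1 x\<bar> + \<bar>indicator P x *\<^sub>R (u x * f2 x)\<bar> + \<bar>indicator P x *\<^sub>R (u x * f3 x)\<bar>" for n
    proof (rule AE_I2)
      fix x
      show "norm (indicator P x *\<^sub>R (db n x * f1 x + b n x * f2 x + b n x * f3 x)) \<le>
       \<bar>indicator P x *\<^sub>R f1 x\<bar> + \<bar>indicator P x *\<^sub>R (u x * f2 x)\<bar> + \<bar>indicator P x *\<^sub>R (u x * f3 x)\<bar>"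
      proof (cases "x \<in> P")
        case True
        then have ux: "0 < u x" by (simp add: P)
        have bb: "0 \<le> b n x" "b n x \<le> u x"
          using ppart_bounds(1,2)[OF e, of n "u x - e n"] e[of n] ux by (simp_all add: b_def)
        have dd: "0 \<le> db n x" "db n x \<le> 1" using dppart_bounds[OF e] by (simp_all add: db_def)
        have "\<bar>db n x * f1 x\<bar> \<le> \<bar>f1 x\<bar>" using dd by (simp add: abs_mult mult_left_le_one_le)
        moreover have "\<bar>b n x * f2 x\<bar> \<le> \<bar>u x * f2 x\<bar>" "\<bar>b n x * f3 x\<bar> \<le> \<bar>u x * f3 x\<bar>"
          using bb by (simp_all add: abs_mult mult_right_mono)
        ultimately show ?thesis
          using True abs_triangle_ineq[of "db n x * f1 x + b n x * f2 x" "b n x * f3 x"]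
            abs_triangle_ineq[of "db n x * f1 x" "b n x * f2 x"] by simp
      qed simp
    qed
  qed
  then have "(LINT x:P|lborel. f1 x + u x * f2 x + u x * f3 x) = 0"
    using zero unfolding set_lebesgue_integral_def by (simp add: LIMSEQ_const_iff)
  then have "(LINT x:P|lborel. f1 x) + (LINT x:P|lborel. u x * f2 x) + (LINT x:P|lborel. u x * f3 x) = 0"
    using j1 j2 j3 by (simp add: set_integral_add)
  then show ?thesis
    by (simp add: f1_def f2_def f3_def mult.assoc)
qed

section \<open>Radial test functions\<close>

text \<open>Test functions \<open>\<zeta>(\<bar>x - c\<bar>\<^sup>2)\<close> are differentiable at \<open>c\<close> as well.
  With \<open>\<zeta> \<sigma> = ppart e (b - \<sigma>)\<close> the hypothesis tends to
  \<open>\<integral> (b - \<bar>x - c\<bar>\<^sup>2) \<alpha> = \<integral> \<beta>\<close> over the ball of squared radius \<open>b\<close>, which is then differentiated in \<open>b\<close>.\<close>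

lemma radial_test_functions:
  fixes \<alpha> \<beta> :: "real^2 \<Rightarrow> real"
  assumes \<alpha>: "\<alpha> \<in> borel_measurable borel" and \<beta>: "\<beta> \<in> borel_measurable borel"
    and bd: "\<And>x. x \<in> ball c \<delta> \<Longrightarrow> \<bar>\<alpha> x\<bar> \<le> M" "\<And>x. x \<in> ball c \<delta> \<Longrightarrow> \<bar>\<beta> x\<bar> \<le> M"
    and test: "\<And>e b. 0 < e \<Longrightarrow> 0 < b \<Longrightarrow> b < \<delta>\<^sup>2 \<Longrightarrow>
      (LINT x:ball c \<delta>|lborel. ppart e (b - (norm (x - c))\<^sup>2) * \<alpha> x) =
      (LINT x:ball c \<delta>|lborel. dppart e (b - (norm (x - c))\<^sup>2) * \<beta> x)"
  shows "AE r in lborel. r \<in> {0<..<\<delta>} \<longrightarrow>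
     2 * r * (LINT x:ball c r|lborel. \<alpha> x) = (LINT x:sphere c r|hausdorff1. \<beta> x)"
proof -
  have bb: "(\<lambda>x. b - (norm (x - c))\<^sup>2) \<in> borel_measurable borel" for b :: real
    by (intro borel_measurable_continuous_onI continuous_intros)
  have int\<alpha>: "set_integrable lborel (ball c r) \<alpha>" "set_integrable lborel (ball c r) \<beta>" if "r \<le> \<delta>" for r
    using that bd by (intro set_integrable_bounded[where B=M] \<alpha> \<beta> borel_open; force)+
  have lim: "(LINT x:ball c R|lborel. (R\<^sup>2 - (norm (x - c))\<^sup>2) * \<alpha> x) = (LINT x:ball c R|lborel. \<beta> x)"
    if R: "0 < R" "R < \<delta>" for R
  proof -
    define e where "e n = 1 / real (Suc n)" for n
    have e: "0 < e n" for n by (simp add: e_def)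
    have e0: "e \<longlonglongrightarrow> 0" unfolding e_def by (rule LIMSEQ_Suc[OF lim_1_over_n])
    have inb: "x \<in> ball c R \<longleftrightarrow> 0 < R\<^sup>2 - (norm (x - c))\<^sup>2" for x
      using R power_mono_iff[of R "norm (x - c)" 2] by (simp add: dist_norm norm_minus_commute not_le[symmetric])
    have sub: "ball c R \<subseteq> ball c \<delta>" using R by auto
    have pm: "ppart e' \<in> borel_measurable borel" "dppart e' \<in> borel_measurable borel" if "0 < e'" for e'
      using DERIV_continuous_on[of UNIV "ppart e'" "dppart e'"] ppart_deriv[OF that] continuous_on_dppart[OF that]
      by (auto intro!: borel_measurable_continuous_onI)
    have L1: "(\<lambda>n. LINT x|lborel. indicator (ball c \<delta>) x *\<^sub>R (ppart (e n) (R\<^sup>2 - (norm (x - c))\<^sup>2) * \<alpha> x)) \<longlonglongrightarrow>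
       (LINT x|lborel. indicator (ball c \<delta>) x *\<^sub>R (max 0 (R\<^sup>2 - (norm (x - c))\<^sup>2) * \<alpha> x))"
    proof (rule integral_dominated_convergence[where w="\<lambda>x. indicator (ball c \<delta>) x *\<^sub>R (\<delta>\<^sup>2 * \<bar>\<alpha> x\<bar>)"])
      show "(\<lambda>x. indicator (ball c \<delta>) x *\<^sub>R (max 0 (R\<^sup>2 - (norm (x - c))\<^sup>2) * \<alpha> x)) \<in> borel_measurable lborel"
        using \<alpha> bb by (intro borel_measurable_scaleR borel_measurable_times borel_measurable_indicator) auto
      show "(\<lambda>x. indicator (ball c \<delta>) x *\<^sub>R (ppart (e n) (R\<^sup>2 - (norm (x - c))\<^sup>2) * \<alpha> x)) \<in> borel_measurable lborel" for n
        using \<alpha> measurable_compose[OF bb pm(1)[OF e]]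
        by (intro borel_measurable_scaleR borel_measurable_times borel_measurable_indicator) auto
      show "integrable lborel (\<lambda>x. indicator (ball c \<delta>) x *\<^sub>R (\<delta>\<^sup>2 * \<bar>\<alpha> x\<bar>))"
        using set_integrable_abs[OF int\<alpha>(1)[of \<delta>]] set_integrable_mult_right[of "\<delta>\<^sup>2"]
        by (simp add: set_integrable_def)
      show "AE x in lborel. (\<lambda>n. indicator (ball c \<delta>) x *\<^sub>R (ppart (e n) (R\<^sup>2 - (norm (x - c))\<^sup>2) * \<alpha> x)) \<longlonglongrightarrow>
         indicator (ball c \<delta>) x *\<^sub>R (max 0 (R\<^sup>2 - (norm (x - c))\<^sup>2) * \<alpha> x)"
      proof (rule AE_I2)
        fix x
        have "(\<lambda>n. ppart (e n) s) \<longlonglongrightarrow> max 0 s" for s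
        proof (rule tendsto_sandwich[of "\<lambda>n. max 0 s - e n" _ _ "\<lambda>n. max 0 s"])
          show "\<forall>\<^sub>F n in sequentially. max 0 s - e n \<le> ppart (e n) s"
          proof (intro always_eventually allI)
            fix n show "max 0 s - e n \<le> ppart (e n) s"
              using ppart_bounds(1)[OF e[of n], of s] ppart_bounds(3)[OF e[of n], of s] e[of n] by (simp add: max_def)
          qed
          show "(\<lambda>n. max 0 s - e n) \<longlonglongrightarrow> max 0 s"
            using tendsto_diff[OF tendsto_const e0, of "max 0 s"] by simp
        qed (auto intro!: always_eventually ppart_bounds(2) e)
        then show "(\<lambda>n. indicator (ball c \<delta>) x *\<^sub>R (ppart (e n) (R\<^sup>2 - (norm (x - c))\<^sup>2) * \<alpha> x)) \<longlonglongrightarrow>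
         indicator (ball c \<delta>) x *\<^sub>R (max 0 (R\<^sup>2 - (norm (x - c))\<^sup>2) * \<alpha> x)"
          by (intro tendsto_intros)
      qed
      show "AE x in lborel. norm (indicator (ball c \<delta>) x *\<^sub>R (ppart (e n) (R\<^sup>2 - (norm (x - c))\<^sup>2) * \<alpha> x))
         \<le> indicator (ball c \<delta>) x *\<^sub>R (\<delta>\<^sup>2 * \<bar>\<alpha> x\<bar>)" for n
      proof (rule AE_I2)
        fix x
        have "\<bar>ppart (e n) (R\<^sup>2 - (norm (x - c))\<^sup>2)\<bar> \<le> \<delta>\<^sup>2"
        proof -
          have "ppart (e n) (R\<^sup>2 - (norm (x - c))\<^sup>2) \<le> max 0 (R\<^sup>2 - (norm (x - c))\<^sup>2)" by (rule ppart_bounds(2)[OF e])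
          also have "\<dots> \<le> R\<^sup>2" by simp
          also have "\<dots> \<le> \<delta>\<^sup>2" using R by (intro power_mono) auto
          finally show ?thesis using ppart_bounds(1)[OF e] by simp
        qed
        then show "norm (indicator (ball c \<delta>) x *\<^sub>R (ppart (e n) (R\<^sup>2 - (norm (x - c))\<^sup>2) * \<alpha> x))
         \<le> indicator (ball c \<delta>) x *\<^sub>R (\<delta>\<^sup>2 * \<bar>\<alpha> x\<bar>)"
          by (auto simp: abs_mult mult_right_mono split: split_indicator)
      qed
    qed
    have L2: "(\<lambda>n. LINT x|lborel. indicator (ball c \<delta>) x *\<^sub>R (dppart (e n) (R\<^sup>2 - (norm (x - c))\<^sup>2) * \<beta> x)) \<longlonglongrightarrow>
       (LINT x|lborel. indicator (ball c R) x *\<^sub>R \<beta> x)"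
    proof (rule integral_dominated_convergence[where w="\<lambda>x. indicator (ball c \<delta>) x *\<^sub>R \<bar>\<beta> x\<bar>"])
      show "(\<lambda>x. indicator (ball c R) x *\<^sub>R \<beta> x) \<in> borel_measurable lborel"
        using \<beta> by (intro borel_measurable_scaleR borel_measurable_indicator) auto
      show "(\<lambda>x. indicator (ball c \<delta>) x *\<^sub>R (dppart (e n) (R\<^sup>2 - (norm (x - c))\<^sup>2) * \<beta> x)) \<in> borel_measurable lborel" for n
        using \<beta> measurable_compose[OF bb pm(2)[OF e]]
        by (intro borel_measurable_scaleR borel_measurable_times borel_measurable_indicator) auto
      show "integrable lborel (\<lambda>x. indicator (ball c \<delta>) x *\<^sub>R \<bar>\<beta> x\<bar>)"
        using set_integrable_abs[OF int\<alpha>(2)[of \<delta>]] by (simp add: set_integrable_def)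
      show "AE x in lborel. (\<lambda>n. indicator (ball c \<delta>) x *\<^sub>R (dppart (e n) (R\<^sup>2 - (norm (x - c))\<^sup>2) * \<beta> x)) \<longlonglongrightarrow>
         indicator (ball c R) x *\<^sub>R \<beta> x"
      proof (rule AE_I2)
        fix x
        have "(\<lambda>n. dppart (e n) (R\<^sup>2 - (norm (x - c))\<^sup>2)) \<longlonglongrightarrow> indicator (ball c R) x"
        proof (cases "x \<in> ball c R")
          case True
          then have s: "0 < R\<^sup>2 - (norm (x - c))\<^sup>2" using inb by blast
          have "(\<lambda>n. 1 - (e n / (max 0 (R\<^sup>2 - (norm (x - c))\<^sup>2) + e n))\<^sup>2) \<longlonglongrightarrow>
             1 - (0 / (max 0 (R\<^sup>2 - (norm (x - c))\<^sup>2) + 0))\<^sup>2"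
            using s by (intro tendsto_intros e0) auto
          then show ?thesis using True by (simp add: dppart_def)
        next
          case False
          then have "R\<^sup>2 - (norm (x - c))\<^sup>2 \<le> 0" using inb[of x] by linarith
          then show ?thesis using False ppart_bounds(5)[OF e] by simp
        qed
        then have "(\<lambda>n. indicator (ball c \<delta>) x *\<^sub>R (dppart (e n) (R\<^sup>2 - (norm (x - c))\<^sup>2) * \<beta> x)) \<longlonglongrightarrow>
         indicator (ball c \<delta>) x *\<^sub>R (indicator (ball c R) x * \<beta> x)"
          by (intro tendsto_intros)
        moreover have "indicator (ball c \<delta>) x *\<^sub>R (indicator (ball c R) x * \<beta> x) = indicator (ball c R) x *\<^sub>R \<beta> x"
          using sub by (auto split: split_indicator)
        ultimately show "(\<lambda>n. indicator (ball c \<delta>) x *\<^sub>R (dppart (e n) (R\<^sup>2 - (norm (x - c))\<^sup>2) * \<beta> x)) \<longlonglongrightarrow>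
         indicator (ball c R) x *\<^sub>R \<beta> x" by (simp only:)
      qed
      show "AE x in lborel. norm (indicator (ball c \<delta>) x *\<^sub>R (dppart (e n) (R\<^sup>2 - (norm (x - c))\<^sup>2) * \<beta> x))
         \<le> indicator (ball c \<delta>) x *\<^sub>R \<bar>\<beta> x\<bar>" for n
        using dppart_bounds[OF e] by (intro AE_I2) (auto simp: abs_mult mult_left_le_one_le split: split_indicator)
    qed
    have eq: "(LINT x|lborel. indicator (ball c \<delta>) x *\<^sub>R (ppart (e n) (R\<^sup>2 - (norm (x - c))\<^sup>2) * \<alpha> x)) =
      (LINT x|lborel. indicator (ball c \<delta>) x *\<^sub>R (dppart (e n) (R\<^sup>2 - (norm (x - c))\<^sup>2) * \<beta> x))" for n
      using test[OF e, of "R\<^sup>2" n] R by (simp add: set_lebesgue_integral_def power_strict_mono)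
    have "(LINT x|lborel. indicator (ball c \<delta>) x *\<^sub>R (max 0 (R\<^sup>2 - (norm (x - c))\<^sup>2) * \<alpha> x)) =
       (LINT x|lborel. indicator (ball c R) x *\<^sub>R \<beta> x)"
      using L1 L2 unfolding eq by (rule LIMSEQ_unique)
    moreover have eq2: "indicator (ball c \<delta>) x *\<^sub>R (max 0 (R\<^sup>2 - (norm (x - c))\<^sup>2) * \<alpha> x) =
        indicator (ball c R) x *\<^sub>R ((R\<^sup>2 - (norm (x - c))\<^sup>2) * \<alpha> x)" for x
      using inb[of x] sub by (auto simp: max_def split: split_indicator)
    ultimately show ?thesis unfolding set_lebesgue_integral_def by (simp only: eq2)
  qed
  define A where "A \<rho> = indicator {0<..<\<delta>} \<rho> * (LINT x:sphere c \<rho>|hausdorff1. \<alpha> x)" for \<rho>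
  define B where "B \<rho> = indicator {0<..<\<delta>} \<rho> * (LINT x:sphere c \<rho>|hausdorff1. \<beta> x)" for \<rho>
  have Ai: "integrable lborel A" "integrable lborel B"
    using integrable_circle_integrals[OF \<alpha> int\<alpha>(1)[of \<delta>]] integrable_circle_integrals[OF \<beta> int\<alpha>(2)[of \<delta>]]
    by (simp_all add: A_def[abs_def] B_def[abs_def] set_integrable_def)
  have A2i: "integrable lborel (\<lambda>\<rho>. \<rho>\<^sup>2 * A \<rho>)"
  proof (rule Bochner_Integration.integrable_bound)
    show "integrable lborel (\<lambda>\<rho>. \<delta>\<^sup>2 * \<bar>A \<rho>\<bar>)" using Ai by simp
    show "(\<lambda>\<rho>. \<rho>\<^sup>2 * A \<rho>) \<in> borel_measurable lborel" using Ai by simp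
    have "\<bar>\<rho>\<^sup>2 * A \<rho>\<bar> \<le> \<delta>\<^sup>2 * \<bar>A \<rho>\<bar>" for \<rho>
      by (cases "\<rho> \<in> {0<..<\<delta>}") (auto simp: A_def abs_mult intro!: mult_right_mono power_mono)
    then show "AE \<rho> in lborel. norm (\<rho>\<^sup>2 * A \<rho>) \<le> norm (\<delta>\<^sup>2 * \<bar>A \<rho>\<bar>)" by (simp add: abs_mult)
  qed
  have IA: "(LINT x:ball c R|lborel. \<alpha> x) = (LINT \<rho>:{0<..<R}|lborel. A \<rho>)"
    and IB: "(LINT x:ball c R|lborel. \<beta> x) = (LINT \<rho>:{0<..<R}|lborel. B \<rho>)"
    and IA2: "(LINT x:ball c R|lborel. (R\<^sup>2 - (norm (x - c))\<^sup>2) * \<alpha> x) =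
        R\<^sup>2 * (LINT \<rho>:{0<..<R}|lborel. A \<rho>) - (LINT \<rho>:{0<..<R}|lborel. \<rho>\<^sup>2 * A \<rho>)"
    if R: "0 < R" "R < \<delta>" for R
  proof -
    have eq: "(LINT \<rho>:{0<..<R}|lborel. (f \<rho> :: real)) = (LINT \<rho>:{0<..<R}|lborel. k \<rho>)"
      if "\<And>\<rho>. 0 < \<rho> \<Longrightarrow> \<rho> < R \<Longrightarrow> f \<rho> = k \<rho>" for f k
      using that by (intro set_lebesgue_integral_cong) auto
    show "(LINT x:ball c R|lborel. \<alpha> x) = (LINT \<rho>:{0<..<R}|lborel. A \<rho>)"
      unfolding integral_ball_polar[OF \<alpha> int\<alpha>(1)[OF less_imp_le[OF R(2)]]]
      by (rule eq) (use R in \<open>simp add: A_def\<close>)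
    show "(LINT x:ball c R|lborel. \<beta> x) = (LINT \<rho>:{0<..<R}|lborel. B \<rho>)"
      unfolding integral_ball_polar[OF \<beta> int\<alpha>(2)[OF less_imp_le[OF R(2)]]]
      by (rule eq) (use R in \<open>simp add: B_def\<close>)
    have m: "(\<lambda>x. (R\<^sup>2 - (norm (x - c))\<^sup>2) * \<alpha> x) \<in> borel_measurable borel"
      using bb[of "R\<^sup>2"] \<alpha> by (intro borel_measurable_times) auto
    have i: "set_integrable lborel (ball c R) (\<lambda>x. (R\<^sup>2 - (norm (x - c))\<^sup>2) * \<alpha> x)"
    proof (rule set_integrable_bounded[OF m, where B="R\<^sup>2 * M"])
      fix x assume x: "x \<in> ball c R"
      then have n: "norm (x - c) < R" by (simp add: dist_norm norm_minus_commute)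
      then have "(norm (x - c))\<^sup>2 \<le> R\<^sup>2" by (intro power_mono) auto
      then have "\<bar>R\<^sup>2 - (norm (x - c))\<^sup>2\<bar> \<le> R\<^sup>2" by simp
      moreover have "\<bar>\<alpha> x\<bar> \<le> M" using x R by (intro bd) auto
      ultimately show "\<bar>(R\<^sup>2 - (norm (x - c))\<^sup>2) * \<alpha> x\<bar> \<le> R\<^sup>2 * M"
        unfolding abs_mult by (intro mult_mono) auto
    qed auto
    have sp: "(LINT x:sphere c \<rho>|hausdorff1. (R\<^sup>2 - (norm (x - c))\<^sup>2) * \<alpha> x) = (R\<^sup>2 - \<rho>\<^sup>2) * (LINT x:sphere c \<rho>|hausdorff1. \<alpha> x)" for \<rho>
    proof -
      have "(LINT x:sphere c \<rho>|hausdorff1. (R\<^sup>2 - (norm (x - c))\<^sup>2) * \<alpha> x) = (LINT x:sphere c \<rho>|hausdorff1. (R\<^sup>2 - \<rho>\<^sup>2) * \<alpha> x)"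
        unfolding set_lebesgue_integral_def
        by (intro Bochner_Integration.integral_cong) (auto simp: dist_norm norm_minus_commute split: split_indicator)
      then show ?thesis by simp
    qed
    have "(LINT x:ball c R|lborel. (R\<^sup>2 - (norm (x - c))\<^sup>2) * \<alpha> x) = (LINT \<rho>:{0<..<R}|lborel. R\<^sup>2 * A \<rho> - \<rho>\<^sup>2 * A \<rho>)"
      unfolding integral_ball_polar[OF m i] sp
      by (rule eq) (use R in \<open>simp add: A_def algebra_simps\<close>)
    also have "\<dots> = R\<^sup>2 * (LINT \<rho>:{0<..<R}|lborel. A \<rho>) - (LINT \<rho>:{0<..<R}|lborel. \<rho>\<^sup>2 * A \<rho>)"
    proof -
      have "set_integrable lborel {0<..<R} A" "set_integrable lborel {0<..<R} (\<lambda>\<rho>. \<rho>\<^sup>2 * A \<rho>)"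
        unfolding set_integrable_def
        by (rule integrable_mult_indicator[OF _ Ai(1)], simp) (rule integrable_mult_indicator[OF _ A2i], simp)
      then show ?thesis by (subst set_integral_diff) auto
    qed
    finally show "(LINT x:ball c R|lborel. (R\<^sup>2 - (norm (x - c))\<^sup>2) * \<alpha> x) =
        R\<^sup>2 * (LINT \<rho>:{0<..<R}|lborel. A \<rho>) - (LINT \<rho>:{0<..<R}|lborel. \<rho>\<^sup>2 * A \<rho>)" .
  qed
  show ?thesis
    using AE_indefinite_integral_deriv[OF Ai(1)] AE_indefinite_integral_deriv[OF Ai(2)] AE_indefinite_integral_deriv[OF A2i]
  proof eventually_elim
    case (elim r)
    show ?case
    proof
      assume r: "r \<in> {0<..<\<delta>}"
      \<comment> \<open>The weight \<open>R\<^sup>2 - \<rho>\<^sup>2\<close> vanishes for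
        \<open>\<rho> = R\<close>, so the two terms \<open>r\<^sup>2 * A r\<close> cancel and only
        the derivative \<open>2 * r\<close> of the weight survives.\<close>
      have "((\<lambda>R. R\<^sup>2 * (LINT \<rho>:{0<..<R}|lborel. A \<rho>) - (LINT \<rho>:{0<..<R}|lborel. \<rho>\<^sup>2 * A \<rho>)) has_real_derivative
         (2 * r * (LINT \<rho>:{0<..<r}|lborel. A \<rho>) + A r * r\<^sup>2) - r\<^sup>2 * A r) (at r)"
        by (intro DERIV_diff DERIV_mult) (use elim r in \<open>auto intro!: derivative_eq_intros\<close>)
      then have "((\<lambda>R. LINT \<rho>:{0<..<R}|lborel. B \<rho>) has_real_derivative
         (2 * r * (LINT \<rho>:{0<..<r}|lborel. A \<rho>) + A r * r\<^sup>2) - r\<^sup>2 * A r) (at r)"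
        by (rule has_field_derivative_transform_within_open[where S="{0<..<\<delta>}"]) (use r IA2 IB lim in auto)
      from DERIV_unique[OF this] elim r have "2 * r * (LINT \<rho>:{0<..<r}|lborel. A \<rho>) + A r * r\<^sup>2 - r\<^sup>2 * A r = B r" by auto
      then show "2 * r * (LINT x:ball c r|lborel. \<alpha> x) = (LINT x:sphere c r|hausdorff1. \<beta> x)"
        using r IA by (simp add: B_def)
    qed
  qed
qed

lemma AE_ball_integral_deriv:
  fixes f :: "real^2 \<Rightarrow> real"
  assumes f: "f \<in> borel_measurable borel" and bd: "\<And>x. x \<in> ball c \<delta> \<Longrightarrow> \<bar>f x\<bar> \<le> M"
  shows "AE r in lborel. r \<in> {0<..<\<delta>} \<longrightarrow>
     ((\<lambda>R. LINT x:ball c R|lborel. f x) has_real_derivative (LINT x:sphere c r|hausdorff1. f x)) (at r)"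
proof -
  have int: "set_integrable lborel (ball c r) f" if "r \<le> \<delta>" for r
    using that bd by (intro set_integrable_bounded[where B=M] f borel_open; force)
  define A where "A \<rho> = indicator {0<..<\<delta>} \<rho> * (LINT x:sphere c \<rho>|hausdorff1. f x)" for \<rho>
  have Ai: "integrable lborel A"
    using integrable_circle_integrals[OF f int[of \<delta>]] by (simp add: A_def[abs_def] set_integrable_def)
  have IA: "(LINT x:ball c R|lborel. f x) = (LINT \<rho>:{0<..<R}|lborel. A \<rho>)" if R: "0 < R" "R < \<delta>" for R
    unfolding integral_ball_polar[OF f int[OF less_imp_le[OF R(2)]]]
    using R by (intro set_lebesgue_integral_cong) (auto simp: A_def)
  show ?thesis
    using AE_indefinite_integral_deriv[OF Ai]
  proof eventually_elim
    case (elim r)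
    show ?case
    proof
      assume r: "r \<in> {0<..<\<delta>}"
      have "((\<lambda>R. LINT \<rho>:{0<..<R}|lborel. A \<rho>) has_real_derivative (LINT x:sphere c r|hausdorff1. f x)) (at r)"
        using elim r by (simp add: A_def)
      then show "((\<lambda>R. LINT x:ball c R|lborel. f x) has_real_derivative (LINT x:sphere c r|hausdorff1. f x)) (at r)"
        by (rule has_field_derivative_transform_within_open[where S="{0<..<\<delta>}"]) (use r IA in auto)
    qed
  qed
qed

section \<open>Second derivatives\<close>

lemma C1grad_mixed_mvt:
  fixes f :: "real^2 \<Rightarrow> real" and f1 f2 :: "real^2 \<Rightarrow> real"
  assumes B: "\<And>a b. a \<in> {0..s} \<Longrightarrow> b \<in> {0..s} \<Longrightarrow> x + a *\<^sub>R axis i 1 + b *\<^sub>R axis j 1 \<in> S"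
    and s: "0 < s" and G: "C1grad S f G" and H: "C1grad S (\<lambda>x. G x $ i) H"
  shows "\<exists>a b. a \<in> {0..s} \<and> b \<in> {0..s} \<and>
    f (x + s *\<^sub>R axis i 1 + s *\<^sub>R axis j 1) - f (x + s *\<^sub>R axis i 1) - f (x + s *\<^sub>R axis j 1) + f x
     = s * (s * H (x + a *\<^sub>R axis i 1 + b *\<^sub>R axis j 1) $ j)"
proof -
  let ?e = "axis i 1 :: real^2" and ?d = "axis j 1 :: real^2"
  define k where "k a = f (x + a *\<^sub>R ?e + s *\<^sub>R ?d) - f (x + a *\<^sub>R ?e)" for a
  have df: "((\<lambda>a. f (x + a *\<^sub>R ?e + b *\<^sub>R ?d)) has_real_derivative G (x + a *\<^sub>R ?e + b *\<^sub>R ?d) $ i) (at a)"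
    if "a \<in> {0..s}" "b \<in> {0..s}" for a b
  proof -
    have 1: "((\<lambda>a. x + a *\<^sub>R ?e + b *\<^sub>R ?d) has_derivative (\<lambda>h. h *\<^sub>R ?e)) (at a)"
      by (auto intro!: derivative_eq_intros)
    have 2: "(f has_derivative (\<lambda>h. G (x + a *\<^sub>R ?e + b *\<^sub>R ?d) \<bullet> h)) (at (x + a *\<^sub>R ?e + b *\<^sub>R ?d))"
      using G B[OF that] by (simp add: C1grad_def)
    show ?thesis using has_derivative_compose[OF 1 2]
      by (intro has_derivative_imp_has_field_derivative) (auto simp: inner_axis)
  qed
  have "\<exists>z>0. z < s \<and> k s - k 0 = (s - 0) * (G (x + z *\<^sub>R ?e + s *\<^sub>R ?d) $ i - G (x + z *\<^sub>R ?e) $ i)"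
  proof (rule MVT2[OF s])
    fix a assume "0 \<le> a" "a \<le> s"
    then show "(k has_real_derivative G (x + a *\<^sub>R ?e + s *\<^sub>R ?d) $ i - G (x + a *\<^sub>R ?e) $ i) (at a)"
      unfolding k_def[abs_def] using df[of a s] df[of a 0] s by (intro DERIV_diff) auto
  qed
  then obtain a where a: "0 < a" "a < s" "k s - k 0 = s * (G (x + a *\<^sub>R ?e + s *\<^sub>R ?d) $ i - G (x + a *\<^sub>R ?e) $ i)" by auto
  have "\<exists>z>0. z < s \<and> G (x + a *\<^sub>R ?e + s *\<^sub>R ?d) $ i - G (x + a *\<^sub>R ?e + 0 *\<^sub>R ?d) $ i = (s - 0) * H (x + a *\<^sub>R ?e + z *\<^sub>R ?d) $ j"
  proof (rule MVT2[OF s])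
    fix b assume b: "0 \<le> b" "b \<le> s"
    have 1: "((\<lambda>b. x + a *\<^sub>R ?e + b *\<^sub>R ?d) has_derivative (\<lambda>h. h *\<^sub>R ?d)) (at b)"
      by (auto intro!: derivative_eq_intros)
    have 2: "((\<lambda>x. G x $ i) has_derivative (\<lambda>h. H (x + a *\<^sub>R ?e + b *\<^sub>R ?d) \<bullet> h)) (at (x + a *\<^sub>R ?e + b *\<^sub>R ?d))"
      using H B[of a b] a b by (simp add: C1grad_def)
    show "((\<lambda>b. G (x + a *\<^sub>R ?e + b *\<^sub>R ?d) $ i) has_real_derivative H (x + a *\<^sub>R ?e + b *\<^sub>R ?d) $ j) (at b)"
      using has_derivative_compose[OF 1 2]
      by (intro has_derivative_imp_has_field_derivative) (auto simp: inner_axis)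
  qed
  then obtain b where b: "0 < b" "b < s" "G (x + a *\<^sub>R ?e + s *\<^sub>R ?d) $ i - G (x + a *\<^sub>R ?e) $ i = s * H (x + a *\<^sub>R ?e + b *\<^sub>R ?d) $ j" by auto
  have "f (x + s *\<^sub>R ?e + s *\<^sub>R ?d) - f (x + s *\<^sub>R ?e) - f (x + s *\<^sub>R ?d) + f x = k s - k 0"
    by (simp add: k_def)
  then show ?thesis using a b by (intro exI[of _ a] exI[of _ b]) auto
qed

text \<open>The second difference of \<open>f\<close> over a small square does not depend on the
  order of the two directions, while two applications of the mean value theorem express it by either
  mixed derivative at some point of the square. The side then shrinks to 0.\<close>

lemma C1grad_symmetric:
  fixes f :: "real^2 \<Rightarrow> real"
  assumes S: "open S" "x \<in> S" and G: "C1grad S f G" and H: "\<And>i. C1grad S (\<lambda>x. G x $ i) (H i)"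
  shows "H i x $ j = H j x $ i"
proof -
  obtain r where r: "r > 0" "ball x r \<subseteq> S" using S open_contains_ball by blast
  \<comment> \<open>With side at most a third of the radius, all points of the square are within
    \<open>2 * r / 3\<close> of \<open>x\<close>.\<close>
  define sq where "sq n = r / 3 / real (Suc n)" for n
  have sq: "0 < sq n" "sq n \<le> r / 3" for n using r by (auto simp: sq_def field_simps)
  have nb: "norm (a *\<^sub>R (axis i 1 :: real^2) + b *\<^sub>R axis j 1) \<le> 2 * sq n" if "a \<in> {0..sq n}" "b \<in> {0..sq n}" for a b n i j
    using norm_triangle_ineq[of "a *\<^sub>R (axis i 1 :: real^2)" "b *\<^sub>R axis j 1"] that by (simp add: norm_axis_1)
  have inS: "x + a *\<^sub>R axis i 1 + b *\<^sub>R axis j 1 \<in> S" if "a \<in> {0..sq n}" "b \<in> {0..sq n}" for a b n i j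
  proof -
    have "dist x (x + a *\<^sub>R axis i 1 + b *\<^sub>R axis j 1) = norm (a *\<^sub>R (axis i 1 :: real^2) + b *\<^sub>R axis j 1)"
      by (subst dist_commute) (simp add: dist_norm algebra_simps)
    also have "\<dots> < r" using nb[OF that, of i j] sq[of n] r by linarith
    finally show ?thesis using r by auto
  qed
  have ex: "\<exists>y z. dist y x \<le> 2 * sq n \<and> dist z x \<le> 2 * sq n \<and> H i y $ j = H j z $ i" for n
  proof -
    have "\<exists>a b. a \<in> {0..sq n} \<and> b \<in> {0..sq n} \<and>
      f (x + sq n *\<^sub>R axis i 1 + sq n *\<^sub>R axis j 1) - f (x + sq n *\<^sub>R axis i 1) - f (x + sq n *\<^sub>R axis j 1) + f x
     = sq n * (sq n * H i (x + a *\<^sub>R axis i 1 + b *\<^sub>R axis j 1) $ j)"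
      by (rule C1grad_mixed_mvt[OF _ sq(1) G H]) (rule inS)
    then obtain a b where ab: "a \<in> {0..sq n}" "b \<in> {0..sq n}"
      "f (x + sq n *\<^sub>R axis i 1 + sq n *\<^sub>R axis j 1) - f (x + sq n *\<^sub>R axis i 1) - f (x + sq n *\<^sub>R axis j 1) + f x
     = sq n * (sq n * H i (x + a *\<^sub>R axis i 1 + b *\<^sub>R axis j 1) $ j)"
      by (elim exE conjE) (rule that)
    have "\<exists>c d. c \<in> {0..sq n} \<and> d \<in> {0..sq n} \<and>
      f (x + sq n *\<^sub>R axis j 1 + sq n *\<^sub>R axis i 1) - f (x + sq n *\<^sub>R axis j 1) - f (x + sq n *\<^sub>R axis i 1) + f x
     = sq n * (sq n * H j (x + c *\<^sub>R axis j 1 + d *\<^sub>R axis i 1) $ i)"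
      by (rule C1grad_mixed_mvt[OF _ sq(1) G H]) (rule inS)
    then obtain c d where cd: "c \<in> {0..sq n}" "d \<in> {0..sq n}"
      "f (x + sq n *\<^sub>R axis j 1 + sq n *\<^sub>R axis i 1) - f (x + sq n *\<^sub>R axis j 1) - f (x + sq n *\<^sub>R axis i 1) + f x
     = sq n * (sq n * H j (x + c *\<^sub>R axis j 1 + d *\<^sub>R axis i 1) $ i)"
      by (elim exE conjE) (rule that)
    have comm: "x + sq n *\<^sub>R axis j 1 + sq n *\<^sub>R axis i 1 = x + sq n *\<^sub>R axis i 1 + sq n *\<^sub>R axis j 1"
      by (simp add: algebra_simps)
    have "sq n * (sq n * H i (x + a *\<^sub>R axis i 1 + b *\<^sub>R axis j 1) $ j) = sq n * (sq n * H j (x + c *\<^sub>R axis j 1 + d *\<^sub>R axis i 1) $ i)"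
      using ab(3) cd(3)[unfolded comm] by linarith
    then have "H i (x + a *\<^sub>R axis i 1 + b *\<^sub>R axis j 1) $ j = H j (x + c *\<^sub>R axis j 1 + d *\<^sub>R axis i 1) $ i"
      using sq(1)[of n] by simp
    then show ?thesis using nb[OF ab(1,2), of i j] nb[OF cd(1,2), of j i]
      by (intro exI[of _ "x + a *\<^sub>R axis i 1 + b *\<^sub>R axis j 1"] exI[of _ "x + c *\<^sub>R axis j 1 + d *\<^sub>R axis i 1"])
         (simp add: dist_norm add.assoc)
  qed
  then obtain Y Z where YZ: "\<And>n. dist (Y n) x \<le> 2 * sq n" "\<And>n. dist (Z n) x \<le> 2 * sq n" "\<And>n. H i (Y n) $ j = H j (Z n) $ i"
    by metis
  have s0: "(\<lambda>n. 2 * sq n) \<longlonglongrightarrow> 0"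
    using tendsto_mult[OF tendsto_const[of "2 * r / 3"] LIMSEQ_Suc[OF lim_1_over_n]] by (simp add: sq_def)
  have lim: "X \<longlonglongrightarrow> x" if "\<And>n. dist (X n) x \<le> 2 * sq n" for X
  proof -
    have "(\<lambda>n. dist (X n) x) \<longlonglongrightarrow> 0"
      by (rule Lim_null_comparison[OF always_eventually s0]) (simp add: that)
    then show ?thesis by (rule tendsto_dist_iff[THEN iffD2])
  qed
  have c: "isCont (H k) x" for k
    using H[of k] S continuous_on_eq_continuous_at[OF S(1)] unfolding C1grad_def by blast
  have c: "(\<lambda>n. H k (X n) $ l) \<longlonglongrightarrow> H k x $ l" if "X \<longlonglongrightarrow> x" for k l X
    by (rule tendsto_vec_nth[OF isCont_tendsto_compose[OF c that]])
  have "(\<lambda>n. H i (Y n) $ j) \<longlonglongrightarrow> H i x $ j" "(\<lambda>n. H j (Z n) $ i) \<longlonglongrightarrow> H j x $ i"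
    by (rule c[OF lim[OF YZ(1)]], rule c[OF lim[OF YZ(2)]])
  then show ?thesis unfolding YZ(3) by (rule LIMSEQ_unique)
qed

lemma C2_on_C1grad:
  fixes u :: "real^2 \<Rightarrow> real"
  assumes "C2_on S u" "open S"
  obtains G gG where "C1grad S u G" "\<And>i. C1grad S (\<lambda>x. G x $ i) (gG i)"
    "\<And>i j x. x \<in> S \<Longrightarrow> gG i x $ j = gG j x $ i"
proof -
  obtain D D2 where D: "C1_on S u D" "C1_on S D D2" using assms by (auto simp: C2_on_def)
  define G :: "real^2 \<Rightarrow> real^2" where "G x = (\<chi> i. D x (axis i 1))" for x
  define gG :: "2 \<Rightarrow> real^2 \<Rightarrow> real^2" where "gG i x = (\<chi> j. D2 x (axis j 1) (axis i 1))" for i x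
  have rep: "v = (\<Sum>i\<in>UNIV. (v $ i) *\<^sub>R axis i 1)" for v :: "real^2"
    by (simp add: vec_eq_iff axis_def UNIV_2 forall_2)
  have lin: "L v = (\<chi> i. L (axis i 1)) \<bullet> v" if "linear L" for L :: "real^2 \<Rightarrow> real" and v
    by (subst rep[of v]) (simp add: linear_sum[OF that] linear_cmul[OF that] inner_vec_def mult.commute)
  have Dc: "continuous_on S D" "continuous_on S D2" 
    using D has_derivative_continuous_on[of S D] by (auto simp: C1_on_def)
  have 1: "C1grad S u G"
    unfolding C1grad_def
  proof (intro conjI ballI)
    fix x assume x: "x \<in> S"
    have "(u has_derivative blinfun_apply (D x)) (at x within S)" using D(1) x by (simp add: C1_on_def)
    then have "(u has_derivative blinfun_apply (D x)) (at x)" using at_within_open[OF x assms(2)] by simp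
    moreover have "blinfun_apply (D x) = (\<lambda>h. G x \<bullet> h)"
      unfolding G_def by (intro ext lin bounded_linear.linear[OF blinfun.bounded_linear_right])
    ultimately show "(u has_derivative (\<lambda>h. G x \<bullet> h)) (at x)" by simp
  next
    show "continuous_on S G" unfolding G_def by (intro continuous_on_vec_lambda blinfun.continuous_on Dc continuous_on_const)
  qed
  have 2: "C1grad S (\<lambda>x. G x $ i) (gG i)" for i
    unfolding C1grad_def
  proof (intro conjI ballI)
    fix x assume x: "x \<in> S"
    have "(D has_derivative blinfun_apply (D2 x)) (at x within S)" using D(2) x by (simp add: C1_on_def)
    then have "(D has_derivative blinfun_apply (D2 x)) (at x)" using at_within_open[OF x assms(2)] by simp
    then have "((\<lambda>x. D x (axis i 1)) has_derivative (\<lambda>h. D2 x h (axis i 1))) (at x)"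
      by (rule blinfun.FDERIV[OF _ has_derivative_const, THEN has_derivative_eq_rhs]) (simp add: blinfun.bilinear_simps)
    moreover have "linear (\<lambda>h. D2 x h (axis i 1))"
      by (rule linearI) (simp_all add: blinfun.bilinear_simps)
    then have "(\<lambda>h. D2 x h (axis i 1)) = (\<lambda>h. gG i x \<bullet> h)"
      unfolding gG_def by (intro ext lin)
    ultimately show "((\<lambda>x. G x $ i) has_derivative (\<lambda>h. gG i x \<bullet> h)) (at x)" by (simp add: G_def)
  next
    show "continuous_on S (gG i)" unfolding gG_def
      by (intro continuous_on_vec_lambda blinfun.continuous_on Dc continuous_on_const)
  qed
  show ?thesis by (rule that[OF 1 2 C1grad_symmetric[OF assms(2) _ 1 2]])
qed

text \<open>\<open>f\<close> may fail to be integrable on \<open>P\<close>, so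
  \<open>fundamental_lemma\<close> is applied in a small ball, where \<open>f\<close> is bounded. By
  continuity an exceptional null set would be open, hence empty.\<close>

lemma continuous_zero_if_test_zero:
  fixes f :: "real^2 \<Rightarrow> real"
  assumes P: "open P" and f: "continuous_on P f"
    and z: "\<And>\<psi> g K. C1grad UNIV \<psi> g \<Longrightarrow> compact K \<Longrightarrow> K \<subseteq> P \<Longrightarrow> (\<And>x. x \<notin> K \<Longrightarrow> \<psi> x = 0) \<Longrightarrow>
       (LINT x:P|lborel. f x * \<psi> x) = 0"
    and x: "x \<in> P"
  shows "f x = 0"
proof (rule ccontr)
  assume ne: "f x \<noteq> 0"
  obtain r where r: "r > 0" "cball x r \<subseteq> P" using P x open_contains_cball by blast
  have sub: "ball x r \<subseteq> P" using r ball_subset_cball by blast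
  have "AE y in lborel. y \<in> ball x r \<longrightarrow> f y = 0"
  proof (rule fundamental_lemma)
    have "compact (f ` cball x r)" by (intro compact_continuous_image continuous_on_subset[OF f r(2)]) auto
    then obtain M where M: "\<And>y. y \<in> f ` cball x r \<Longrightarrow> \<bar>y\<bar> \<le> M" using compact_imp_bounded bounded_real by metis
    have m: "(\<lambda>y. indicator (ball x r) y *\<^sub>R f y) \<in> borel_measurable borel"
      using continuous_on_subset[OF f sub] by (intro borel_measurable_continuous_on_indicator) auto
    show "set_integrable lborel (ball x r) f"
      unfolding set_integrable_def
    proof (rule integrable_compact_support[OF m, where S="ball x r" and B="\<bar>M\<bar>"])
      fix y
      have "\<bar>f y\<bar> \<le> M" if "y \<in> ball x r"
        using that ball_subset_cball by (intro M imageI) blast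
      then show "\<bar>indicator (ball x r) y *\<^sub>R f y\<bar> \<le> \<bar>M\<bar>" by (cases "y \<in> ball x r") auto
    qed auto
    fix \<psi> g K assume k: "C1grad UNIV \<psi> g" "compact K" "K \<subseteq> ball x r" "\<And>x. x \<notin> K \<Longrightarrow> \<psi> x = 0"
    have "(LINT x:P|lborel. f x * \<psi> x) = 0" by (rule z[OF k(1,2) _ k(4)]) (use k sub in auto)
    moreover have "(LINT y:ball x r|lborel. f y * \<psi> y) = (LINT x:P|lborel. f x * \<psi> x)"
      unfolding set_lebesgue_integral_def
    proof (intro Bochner_Integration.integral_cong refl)
      fix y
      have "\<psi> y = 0" if "y \<notin> ball x r" using k(3,4) that by blast
      then show "indicator (ball x r) y *\<^sub>R (f y * \<psi> y) = indicator P y *\<^sub>R (f y * \<psi> y)"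
        using sub by (cases "y \<in> ball x r") auto
    qed
    ultimately show "(LINT y:ball x r|lborel. f y * \<psi> y) = 0" by simp
  qed simp
  define V where "V = ball x r \<inter> f -` (- {0})"
  have oV: "open V" unfolding V_def
    by (intro continuous_open_preimage continuous_on_subset[OF f sub]) auto
  have "AE y in lborel. y \<notin> V" using \<open>AE y in lborel. y \<in> ball x r \<longrightarrow> f y = 0\<close> by eventually_elim (auto simp: V_def)
  then have "V \<in> null_sets lborel" using oV AE_iff_null_sets[of V lborel] by (simp add: borel_open)
  then have "negligible V" using negligible_iff_null_sets null_sets_completionI by blast
  then have "V = {}" using open_not_negligible[OF oV] by blast
  moreover have "x \<in> V" using ne r by (simp add: V_def)
  ultimately show False by blast
qed

text \<open>The integrals of the statement are taken over \<open>lebesgue\<close>, as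
  \<open>Du\<close> is only Lebesgue measurable. Agreement almost everywhere with a Borel function
  suffices, because completeness makes the integrand measurable.\<close>

lemma LINT_lebesgue_eq_lborel:
  fixes f k :: "'a::euclidean_space \<Rightarrow> real"
  assumes P: "P \<in> sets borel" and k: "(\<lambda>x. indicator P x *\<^sub>R k x) \<in> borel_measurable borel"
    and eq: "AE x in lborel. indicator A x *\<^sub>R f x = indicator P x *\<^sub>R k x"
  shows "(LINT x:A|lebesgue. f x) = (LINT x:P|lborel. k x)"
proof -
  have k': "(\<lambda>x. indicator P x *\<^sub>R k x) \<in> borel_measurable lborel" using k by simp
  then have kl: "(\<lambda>x. indicator P x *\<^sub>R k x) \<in> borel_measurable lebesgue" by (rule measurable_completion)
  have eq': "AE x in lebesgue. indicator P x *\<^sub>R k x = indicator A x *\<^sub>R f x"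
    using AE_completion[OF eq] by eventually_elim simp
  have "(LINT x:A|lebesgue. f x) = (LINT x|lebesgue. indicator P x *\<^sub>R k x)"
    unfolding set_lebesgue_integral_def
    by (intro integral_cong_AE borel_measurable_AE[OF kl eq'] kl) (use eq' in eventually_elim, simp)
  then show ?thesis unfolding set_lebesgue_integral_def integral_completion[OF k'] .
qed

lemma C1grad_zero_outside:
  assumes "C1grad UNIV \<psi> g" "closed K" "\<And>x. x \<notin> K \<Longrightarrow> \<psi> x = 0" "x \<notin> K"
  shows "g x = 0"
proof -
  have "(\<psi> has_derivative (\<lambda>_. 0)) (at x)"
    by (rule has_derivative_transform_within_open[where f="\<lambda>_. 0" and s="- K", OF has_derivative_const])
       (use assms in auto)
  moreover have "(\<psi> has_derivative (\<lambda>h. g x \<bullet> h)) (at x)" using assms(1) by (simp add: C1grad_def)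
  ultimately have "(\<lambda>_. 0) = (\<lambda>h. g x \<bullet> h)" by (rule has_derivative_unique)
  then have "g x \<bullet> g x = 0" by metis
  then show ?thesis by simp
qed

lemma C1grad_inverse:
  assumes f: "C1grad S f F" and nz: "\<And>x. x \<in> S \<Longrightarrow> f x \<noteq> 0"
  shows "C1grad S (\<lambda>x. 1 / f x) (\<lambda>x. (- 1 / (f x)\<^sup>2) *\<^sub>R F x)"
proof (rule C1grad_compose[OF f])
  fix y assume "y \<in> f ` S"
  then have y: "y \<noteq> 0" using nz by auto
  show "((\<lambda>y. 1 / y) has_real_derivative - 1 / y\<^sup>2) (at y)"
    using y by (auto intro!: derivative_eq_intros simp: power2_eq_square)
next
  show "continuous_on (f ` S) (\<lambda>y. - 1 / y\<^sup>2)"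
    using nz by (intro continuous_intros) auto
qed

lemma C1grad_transform:
  assumes "C1grad S f F" "open S" "\<And>x. x \<in> S \<Longrightarrow> f x = k x" "\<And>x. x \<in> S \<Longrightarrow> F x = K x"
  shows "C1grad S k K"
  unfolding C1grad_def
proof (intro conjI ballI)
  fix x assume x: "x \<in> S"
  have "(f has_derivative (\<lambda>h. F x \<bullet> h)) (at x)" using assms(1) x by (simp add: C1grad_def)
  then have "(k has_derivative (\<lambda>h. F x \<bullet> h)) (at x)"
    by (rule has_derivative_transform_within_open) (use assms x in auto)
  then show "(k has_derivative (\<lambda>h. K x \<bullet> h)) (at x)" using assms(4)[OF x] by simp
next
  show "continuous_on S K" using assms(1,4) by (auto simp: C1grad_def elim: continuous_on_eq)
qed

section \<open>The solution near the centre\<close>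

locale subsonic_sol = state_eq +
  fixes \<Omega> :: "(real^2) set" and u :: "real^2 \<Rightarrow> real" and Du :: "real^2 \<Rightarrow> real^2" and x0 :: "real^2" and \<delta> :: real
  assumes dom: "admissible_domain g \<rho>0 p \<Omega>"
    and sol: "subsonic_variational_solution g \<rho>0 p \<Omega> u Du"
    and x0: "x0 \<in> \<Omega>" "x0 $ 2 = 0" "x0 $ 1 \<noteq> 0"
    and \<delta>_eq: "\<delta> = 1/2 * min (x0 $ 1) (infdist x0 (rel_boundary \<Omega>))"
    and \<delta>_pos: "0 < \<delta>"
begin

abbreviation "halfplane \<equiv> {x::real^2. 0 \<le> x $ 1}"
abbreviation "U \<equiv> \<Omega> \<inter> {x. 0 < x $ 1}"
abbreviation "B \<equiv> ball x0 \<delta>"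
abbreviation "C \<equiv> cball x0 \<delta>"
definition "S = {x\<in>\<Omega>. 0 < u x}"
definition "P = S \<inter> B"

lemma openin_\<Omega>: "openin (top_of_set halfplane) \<Omega>" and \<Omega>_lt: "x \<in> \<Omega> \<Longrightarrow> x $ 2 < smax"
  using dom by (auto simp: admissible_domain_def)

lemma \<Omega>_halfplane: "\<Omega> \<subseteq> halfplane"
  using openin_\<Omega> openin_imp_subset by blast

lemma x0_1: "2 * \<delta> \<le> x0 $ 1" and boundary_dist: "2 * \<delta> \<le> infdist x0 (rel_boundary \<Omega>)"
  using \<delta>_eq by auto

lemma ball_first_pos: "x \<in> ball x0 (2 * \<delta>) \<Longrightarrow> 0 < x $ 1"
proof -
  assume x: "x \<in> ball x0 (2 * \<delta>)"
  have "\<bar>(x0 - x) $ 1\<bar> \<le> norm (x0 - x)" by (rule component_le_norm_cart)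
  then show ?thesis using x x0_1 by (simp add: dist_norm)
qed

lemma C_first: "x \<in> C \<Longrightarrow> \<delta> \<le> x $ 1"
proof -
  assume x: "x \<in> C"
  have "\<bar>(x0 - x) $ 1\<bar> \<le> norm (x0 - x)" by (rule component_le_norm_cart)
  then show ?thesis using x x0_1 by (simp add: dist_norm)
qed

text \<open>A connected subset of the half-plane meeting both \<open>\<Omega>\<close> and its
  complement would meet the relative boundary, here at a distance below \<open>2 * \<delta>\<close>.
  The factor 1/2 in \<open>\<delta>\<close> thus leaves room for the closed disc \<open>C\<close> in
  \<open>\<Omega>\<close>, on which the first coordinate is at least
  \<open>\<delta>\<close>.\<close>

lemma ball_subset_\<Omega>: "ball x0 (2 * \<delta>) \<subseteq> \<Omega>"
proof (rule ccontr)
  assume n: "\<not> ball x0 (2 * \<delta>) \<subseteq> \<Omega>"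
  have sub: "ball x0 (2 * \<delta>) \<subseteq> halfplane" using ball_first_pos less_imp_le by blast
  have "connectedin (top_of_set halfplane) (ball x0 (2 * \<delta>))"
    using sub by (simp add: connectedin_subtopology)
  moreover have "x0 \<in> ball x0 (2 * \<delta>)" using \<delta>_pos by simp
  then have "ball x0 (2 * \<delta>) \<inter> \<Omega> \<noteq> {}" using x0 by blast
  moreover have "ball x0 (2 * \<delta>) - \<Omega> \<noteq> {}" using n by auto
  ultimately have "ball x0 (2 * \<delta>) \<inter> (top_of_set halfplane) frontier_of \<Omega> \<noteq> {}"
    by (rule connectedin_Int_frontier_of)
  then obtain y where y: "dist x0 y < 2 * \<delta>" "y \<in> rel_boundary \<Omega>" by (auto simp: rel_boundary_def)
  then have "infdist x0 (rel_boundary \<Omega>) < 2 * \<delta>" using infdist_le[OF y(2), of x0] by linarith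
  then show False using boundary_dist by simp
qed

lemma C_subset_ball: "C \<subseteq> ball x0 (2 * \<delta>)" using \<delta>_pos by auto

lemma C_subset_U: "C \<subseteq> U"
  using C_subset_ball ball_subset_\<Omega> ball_first_pos by auto

lemma B_subset_U: "B \<subseteq> U" and B_subset_\<Omega>: "B \<subseteq> \<Omega>"
  using C_subset_U ball_subset_cball by blast+

lemma open_U: "open U"
proof -
  obtain T where "open T" "\<Omega> = halfplane \<inter> T" using openin_\<Omega> openin_open by blast
  then have "U = T \<inter> {x. 0 < x $ 1}" by auto
  then show ?thesis using \<open>open T\<close> by (auto intro!: open_Int open_Collect_less continuous_intros)
qed

lemma u_nonneg: "x \<in> \<Omega> \<Longrightarrow> 0 \<le> u x" and u_axis: "x \<in> \<Omega> \<Longrightarrow> x $ 1 = 0 \<Longrightarrow> u x = 0"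
  and u_cont: "continuous_on \<Omega> u" and u_C2: "C2_on S u" and S_upper: "x \<in> S \<Longrightarrow> 0 \<le> x $ 2"
  and W12: "W12w_loc \<Omega> u Du"
  using sol unfolding subsonic_variational_solution_def S_def by auto

lemma S_subset_U: "S \<subseteq> U"
  using u_axis \<Omega>_halfplane by (fastforce simp: S_def)

lemma open_S: "open S"
proof -
  have "S = U \<inter> u -` {0<..}" using S_subset_U by (auto simp: S_def)
  then show ?thesis
    using continuous_open_preimage[OF continuous_on_subset[OF u_cont, of U] open_U, of "{0<..}"] by simp
qed

lemma open_P: "open P"
  unfolding P_def using open_S by auto

lemma P_eq: "P = {x\<in>B. 0 < u x}"
  using B_subset_\<Omega> by (auto simp: P_def S_def)

lemma P_subset: "P \<subseteq> B" "P \<subseteq> C" "P \<subseteq> S" "P \<subseteq> \<Omega>"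
  using ball_subset_cball by (auto simp: P_def S_def)

lemma u_zero_off_P: "x \<in> B \<Longrightarrow> x \<notin> P \<Longrightarrow> u x = 0"
  using u_nonneg[of x] B_subset_\<Omega> by (force simp: P_eq)

text \<open>An open subset of a closed half-plane misses its edge. So the second argument of
  \<open>H\<close>, \<open>F\<close> and \<open>lam\<close> stays off the endpoint 0 of its range,
  where their derivatives would be unreliable.\<close>

lemma S_second: "x \<in> S \<Longrightarrow> 0 < x $ 2"
proof -
  assume x: "x \<in> S"
  then obtain e where e: "e > 0" "cball x e \<subseteq> S" using open_S open_contains_cball by blast
  define y where "y = x - e *\<^sub>R axis 2 1"
  have "y \<in> cball x e" using e by (simp add: y_def dist_norm norm_axis_1)
  then have "0 \<le> y $ 2" using e S_upper by blast
  then show ?thesis using e by (simp add: y_def)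
qed

lemma S_smax: "x \<in> S \<Longrightarrow> x $ 2 < smax"
  using \<Omega>_lt by (auto simp: S_def)

text \<open>The classical gradient of \<open>u\<close>, kept apart from the weak gradient
  \<open>Du\<close> that the statement is about; the two are compared in \<open>Du_eq_G\<close> and
  \<open>Du_ae\<close>.\<close>

definition G :: "real^2 \<Rightarrow> real^2" where
  "G = (SOME G. \<exists>gG. C1grad S u G \<and> (\<forall>i. C1grad S (\<lambda>x. G x $ i) (gG i)) \<and> (\<forall>i j. \<forall>x\<in>S. gG i x $ j = gG j x $ i))"

definition gG :: "2 \<Rightarrow> real^2 \<Rightarrow> real^2" where
  "gG = (SOME gG. C1grad S u G \<and> (\<forall>i. C1grad S (\<lambda>x. G x $ i) (gG i)) \<and> (\<forall>i j. \<forall>x\<in>S. gG i x $ j = gG j x $ i))"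

lemma G_ex: "C1grad S u G \<and> (\<forall>i. C1grad S (\<lambda>x. G x $ i) (gG i)) \<and> (\<forall>i j. \<forall>x\<in>S. gG i x $ j = gG j x $ i)"
proof -
  have "\<exists>G gG. C1grad S u G \<and> (\<forall>i. C1grad S (\<lambda>x. G x $ i) (gG i)) \<and> (\<forall>i j. \<forall>x\<in>S. gG i x $ j = gG j x $ i)"
    using C2_on_C1grad[OF u_C2 open_S] by metis
  then have "\<exists>gG. C1grad S u G \<and> (\<forall>i. C1grad S (\<lambda>x. G x $ i) (gG i)) \<and> (\<forall>i j. \<forall>x\<in>S. gG i x $ j = gG j x $ i)"
    unfolding G_def by (rule someI_ex)
  then show ?thesis unfolding gG_def by (rule someI_ex)
qed

lemma G_C1: "C1grad S u G" and gG_C1: "C1grad S (\<lambda>x. G x $ i) (gG i)" and gG_sym: "x \<in> S \<Longrightarrow> gG i x $ j = gG j x $ i"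
  using G_ex by blast+

lemma G_P: "C1grad P u G" and gG_P: "C1grad P (\<lambda>x. G x $ i) (gG i)"
  using C1grad_subset[OF G_C1] C1grad_subset[OF gG_C1] P_subset by blast+

text \<open>A Borel representative of a component of \<open>Du\<close> on the closed disc, to which
  \<open>fundamental_lemma\<close>, stated for \<open>lborel\<close>, can be applied.\<close>

definition fDu :: "2 \<Rightarrow> real^2 \<Rightarrow> real" where
  "fDu i = (SOME f. f \<in> borel_measurable borel \<and> integrable lborel f \<and> (AE x in lborel. f x = indicator C x * Du x $ i))"

lemma fDu: "fDu i \<in> borel_measurable borel" "integrable lborel (fDu i)" "AE x in lborel. fDu i x = indicator C x * Du x $ i"
proof -
  have wg: "weak_gradient_on U u Du" using W12 by (simp add: W12w_loc_def)
  then have "set_integrable lebesgue C Du"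
    using C_subset_U compact_cball[of x0 \<delta>] unfolding weak_gradient_on_def by blast
  then have "integrable lebesgue (\<lambda>x. (indicator C x *\<^sub>R Du x) $ i)"
    unfolding set_integrable_def by (rule integrable_bounded_linear[OF bounded_linear_vec_nth])
  then have i: "integrable lebesgue (\<lambda>x. indicator C x * Du x $ i)" by simp
  then have "(\<lambda>x. indicator C x * Du x $ i) \<in> borel_measurable lebesgue" by simp
  then obtain f where f: "f \<in> borel_measurable lborel" "AE x in lborel. indicator C x * Du x $ i = f x"
    using completion_ex_borel_measurable_real by blast
  have "integrable lebesgue f"
    by (rule integrable_cong_AE_imp[OF i]) (use f AE_completion[OF f(2)] in \<open>auto intro: measurable_completion elim: eventually_mono\<close>)
  then have "integrable lborel f" using integrable_completion[OF f(1)] by simp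
  then have "\<exists>f. f \<in> borel_measurable borel \<and> integrable lborel f \<and> (AE x in lborel. f x = indicator C x * Du x $ i)"
    using f by (intro exI[of _ f]) (auto elim: eventually_mono)
  from someI_ex[OF this]
  show "fDu i \<in> borel_measurable borel" "integrable lborel (fDu i)" "AE x in lborel. fDu i x = indicator C x * Du x $ i"
    unfolding fDu_def[symmetric] by auto
qed

lemma indicator_u_measurable: "(\<lambda>x. indicator B x *\<^sub>R u x) \<in> borel_measurable borel"
  by (intro borel_measurable_continuous_on_indicator continuous_on_subset[OF u_cont B_subset_\<Omega>]) auto

lemma C1grad_measurable:
  fixes \<psi> :: "real^2 \<Rightarrow> real"
  assumes "C1grad UNIV \<psi> g\<psi>" shows "\<psi> \<in> borel_measurable borel" "(\<lambda>x. g\<psi> x $ i) \<in> borel_measurable borel"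
  using C1grad_continuous_on[OF assms] assms
  by (auto simp: C1grad_def intro!: borel_measurable_continuous_onI continuous_intros)

lemma weak_gradient_identity:
  assumes \<psi>: "C1grad UNIV \<psi> g\<psi>" and K: "compact K" "K \<subseteq> B" "\<And>x. x \<notin> K \<Longrightarrow> \<psi> x = 0"
  shows "(LINT x:B|lborel. u x * g\<psi> x $ i) = - (LINT x:B|lborel. fDu i x * \<psi> x)"
proof -
  have wg: "weak_gradient_on U u Du" using W12 by (simp add: W12w_loc_def)
  have "C1_on U \<psi> (\<lambda>x. blinfun_inner_right (g\<psi> x))" using C1grad_C1_on C1grad_subset[OF \<psi>] by blast
  moreover have "compactly_supported_in U \<psi>"
    unfolding compactly_supported_in_def using K B_subset_U by (intro exI[of _ K]) auto
  ultimately have "(LINT x:U|lebesgue. u x * blinfun_inner_right (g\<psi> x) (axis i 1)) = - (LINT x:U|lebesgue. Du x $ i * \<psi> x)"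
    using wg unfolding weak_gradient_on_def by blast
  then have e: "(LINT x:U|lebesgue. u x * g\<psi> x $ i) = - (LINT x:U|lebesgue. Du x $ i * \<psi> x)"
    by (simp add: inner_axis)
  have g0: "g\<psi> x = 0" if "x \<notin> K" for x
    using C1grad_zero_outside[OF \<psi> compact_imp_closed[OF K(1)] K(3) that] .
  have "(LINT x:U|lebesgue. u x * g\<psi> x $ i) = (LINT x:B|lborel. u x * g\<psi> x $ i)"
  proof (rule LINT_lebesgue_eq_lborel)
    show "(\<lambda>x. indicator B x *\<^sub>R (u x * g\<psi> x $ i)) \<in> borel_measurable borel"
      using borel_measurable_times[OF indicator_u_measurable C1grad_measurable(2)[OF \<psi>]] by (simp add: mult.assoc)
    show "AE x in lborel. indicator U x *\<^sub>R (u x * g\<psi> x $ i) = indicator B x *\<^sub>R (u x * g\<psi> x $ i)"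
    proof (rule AE_I2)
      fix x show "indicator U x *\<^sub>R (u x * g\<psi> x $ i) = indicator B x *\<^sub>R (u x * g\<psi> x $ i)"
        using g0[of x] K(2) B_subset_U by (cases "x \<in> K") (auto split: split_indicator)
    qed
  qed simp
  moreover have "(LINT x:U|lebesgue. Du x $ i * \<psi> x) = (LINT x:B|lborel. fDu i x * \<psi> x)"
  proof (rule LINT_lebesgue_eq_lborel)
    show "(\<lambda>x. indicator B x *\<^sub>R (fDu i x * \<psi> x)) \<in> borel_measurable borel"
      using fDu(1) C1grad_measurable(1)[OF \<psi>] by (intro borel_measurable_scaleR borel_measurable_times borel_measurable_indicator) auto
    show "AE x in lborel. indicator U x *\<^sub>R (Du x $ i * \<psi> x) = indicator B x *\<^sub>R (fDu i x * \<psi> x)"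
      using fDu(3)[of i]
    proof eventually_elim
      case (elim x)
      then show ?case using K(2,3) B_subset_U ball_subset_cball[of x0 \<delta>]
        by (cases "x \<in> K") (auto split: split_indicator)
    qed
  qed simp
  ultimately show ?thesis using e by simp
qed

text \<open>At this stage nothing bounds \<open>G\<close> near the free boundary. The comparison is
  made on the sets \<open>Pk k\<close>, each contained in a compact subset of \<open>S\<close>,
  where \<open>G\<close> is bounded; they exhaust \<open>P\<close>.\<close>

lemma fDu_eq_G: "AE x in lborel. x \<in> P \<longrightarrow> fDu i x = G x $ i"
proof -
  define Pk where "Pk k = {x\<in>B. 1 / real (Suc k) < u x}" for k
  have ub: "continuous_on B u" using continuous_on_subset[OF u_cont B_subset_\<Omega>] .
  have oPk: "open (Pk k)" for k
  proof -
    have "Pk k = B \<inter> u -` {1 / real (Suc k)<..}" by (auto simp: Pk_def)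
    then show ?thesis using continuous_open_preimage[OF ub open_ball open_greaterThan] by simp
  qed
  have PkP: "Pk k \<subseteq> P" for k
  proof
    fix x assume "x \<in> Pk k"
    then have "x \<in> B" "1 / real (Suc k) < u x" by (auto simp: Pk_def)
    moreover have "0 < 1 / real (Suc k)" by simp
    ultimately have "x \<in> B" "0 < u x" by (blast, blast intro: less_trans)
    then show "x \<in> P" unfolding P_eq by simp
  qed
  have cG: "continuous_on S (\<lambda>x. G x $ i)" using G_C1 by (auto simp: C1grad_def intro!: continuous_intros)
  have "AE x in lborel. x \<in> Pk k \<longrightarrow> fDu i x - G x $ i = 0" for k
  proof (rule fundamental_lemma[OF oPk])
    define Q where "Q = {x\<in>C. 1 / real (Suc k) \<le> u x}"
    have "closed Q" unfolding Q_def
    proof -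
      have "C \<inter> u -` {1 / real (Suc k)..} = {x\<in>C. 1 / real (Suc k) \<le> u x}" by auto
      moreover have "continuous_on C u" using continuous_on_subset[OF u_cont] C_subset_U by blast
      then have "closed (C \<inter> u -` {1 / real (Suc k)..})" by (rule continuous_closed_preimage) auto
      ultimately show "closed {x\<in>C. 1 / real (Suc k) \<le> u x}" by simp
    qed
    moreover have "Q \<subseteq> C" by (auto simp: Q_def)
    ultimately have Qc: "compact Q"
      using bounded_subset[OF bounded_cball] compact_eq_bounded_closed by blast
    have QS: "Q \<subseteq> S"
    proof
      fix x assume "x \<in> Q"
      then have "x \<in> C" "1 / real (Suc k) \<le> u x" by (auto simp: Q_def)
      moreover have "0 < 1 / real (Suc k)" by simp
      ultimately have "x \<in> \<Omega>" "0 < u x" using C_subset_U by (blast, linarith)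
      then show "x \<in> S" by (simp add: S_def)
    qed
    have PkQ: "Pk k \<subseteq> Q" using ball_subset_cball by (auto simp: Pk_def Q_def)
    have "compact ((\<lambda>x. G x $ i) ` Q)" by (intro compact_continuous_image continuous_on_subset[OF cG QS] Qc)
    then obtain M where M: "\<And>y. y \<in> (\<lambda>x. G x $ i) ` Q \<Longrightarrow> \<bar>y\<bar> \<le> M" using compact_imp_bounded bounded_real by metis
    have Gi: "set_integrable lborel (Pk k) (\<lambda>x. G x $ i)"
      unfolding set_integrable_def
    proof (rule integrable_compact_support[where S="Pk k" and B="\<bar>M\<bar>"])
      show "(\<lambda>x. indicator (Pk k) x *\<^sub>R G x $ i) \<in> borel_measurable borel"
        using oPk PkQ QS by (intro borel_measurable_continuous_on_indicator continuous_on_subset[OF cG]) auto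
      show "bounded (Pk k)" by (rule bounded_subset[OF bounded_ball, of _ x0 \<delta>]) (auto simp: Pk_def)
      fix x
      have "\<bar>G x $ i\<bar> \<le> M" if "x \<in> Pk k" using that PkQ by (intro M) auto
      then show "\<bar>indicator (Pk k) x *\<^sub>R G x $ i\<bar> \<le> \<bar>M\<bar>" by (cases "x \<in> Pk k") auto
    qed auto
    have fi: "set_integrable lborel (Pk k) (fDu i)"
      unfolding set_integrable_def using fDu(2) oPk by (intro integrable_mult_indicator) auto
    show "set_integrable lborel (Pk k) (\<lambda>x. fDu i x - G x $ i)" using fi Gi by (rule set_integral_diff)
    fix \<psi> h K assume \<psi>: "C1grad UNIV \<psi> h" "compact K" "K \<subseteq> Pk k" "\<And>x. x \<notin> K \<Longrightarrow> \<psi> x = 0"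
    have KB: "K \<subseteq> B" "K \<subseteq> P" using \<psi>(3) PkP P_subset by blast+
    have h0: "h x = 0" if "x \<notin> K" for x
      using C1grad_zero_outside[OF \<psi>(1) compact_imp_closed[OF \<psi>(2)] \<psi>(4) that] .
    have w: "(LINT x:B|lborel. u x * h x $ i) = - (LINT x:B|lborel. fDu i x * \<psi> x)"
      by (rule weak_gradient_identity[OF \<psi>(1,2) KB(1) \<psi>(4)])
    have "C1grad P (\<lambda>x. u x * \<psi> x) (\<lambda>x. u x *\<^sub>R h x + \<psi> x *\<^sub>R G x)"
      by (intro C1grad_mult G_P C1grad_subset[OF \<psi>(1)]) auto
    then have z: "(LINT x:P|lborel. (u x *\<^sub>R h x + \<psi> x *\<^sub>R G x) $ i) = 0"
      using \<psi> KB by (intro integral_gradient_zero[OF open_P \<psi>(2) KB(2)]) auto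
    have e: "indicator P x *\<^sub>R ((u x *\<^sub>R h x + \<psi> x *\<^sub>R G x) $ i) =
       indicator B x *\<^sub>R (u x * h x $ i) + indicator (Pk k) x *\<^sub>R (G x $ i * \<psi> x)" for x
      using h0[of x] \<psi>(3,4) KB PkP[of k] by (cases "x \<in> K") (auto split: split_indicator)
    have e2: "indicator B x *\<^sub>R (fDu i x * \<psi> x) = indicator (Pk k) x *\<^sub>R (fDu i x * \<psi> x)" for x
      using \<psi>(3,4) KB PkP[of k] by (cases "x \<in> K") (auto split: split_indicator)
    have \<psi>m: "\<psi> \<in> borel_measurable borel" "(\<lambda>x. h x $ i) \<in> borel_measurable borel" using C1grad_measurable[OF \<psi>(1)] by auto
    have cpt: "compact (\<psi> ` K)" "compact ((\<lambda>x. u x * h x $ i) ` K)"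
      using C1grad_continuous_on[OF \<psi>(1)] \<psi>(1,2) KB
      by (auto intro!: compact_continuous_image continuous_intros continuous_on_subset[OF ub] simp: C1grad_def intro: continuous_on_subset)
    obtain M1 where M1: "\<And>y. y \<in> \<psi> ` K \<Longrightarrow> \<bar>y\<bar> \<le> M1" using cpt(1) compact_imp_bounded bounded_real by metis
    obtain M2 where M2: "\<And>y. y \<in> (\<lambda>x. u x * h x $ i) ` K \<Longrightarrow> \<bar>y\<bar> \<le> M2" using cpt(2) compact_imp_bounded bounded_real by metis
    have b1: "\<bar>\<psi> x\<bar> \<le> \<bar>M1\<bar>" for x using M1[of "\<psi> x"] \<psi>(4)[of x] by (cases "x \<in> K") auto
    have int1: "integrable lborel (\<lambda>x. indicator B x *\<^sub>R (u x * h x $ i))"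
    proof (rule integrable_compact_support[where S=K and B="\<bar>M2\<bar>"])
      show "(\<lambda>x. indicator B x *\<^sub>R (u x * h x $ i)) \<in> borel_measurable borel"
        using borel_measurable_times[OF indicator_u_measurable \<psi>m(2)] by (simp add: mult.assoc)
      fix x show "\<bar>indicator B x *\<^sub>R (u x * h x $ i)\<bar> \<le> \<bar>M2\<bar>"
        using M2[of "u x * h x $ i"] h0[of x] by (cases "x \<in> K") (auto split: split_indicator)
    qed (use h0 \<psi>(2) compact_imp_bounded in auto)
    have int2: "integrable lborel (\<lambda>x. indicator (Pk k) x *\<^sub>R (f x * \<psi> x))"
      if f: "set_integrable lborel (Pk k) f" for f :: "real^2 \<Rightarrow> real"
    proof (rule Bochner_Integration.integrable_bound)
      show "integrable lborel (\<lambda>x. \<bar>M1\<bar> * (indicator (Pk k) x *\<^sub>R f x))" using f by (simp add: set_integrable_def)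
      show "(\<lambda>x. indicator (Pk k) x *\<^sub>R (f x * \<psi> x)) \<in> borel_measurable lborel"
        using borel_measurable_times[OF borel_measurable_integrable[OF f[unfolded set_integrable_def]], of \<psi>] \<psi>m by (simp add: mult.assoc)
      show "AE x in lborel. norm (indicator (Pk k) x *\<^sub>R (f x * \<psi> x)) \<le> norm (\<bar>M1\<bar> * (indicator (Pk k) x *\<^sub>R f x))"
        using b1 by (intro AE_I2) (auto simp: abs_mult mult.commute intro!: mult_right_mono split: split_indicator)
    qed
    have "(LINT x|lborel. indicator B x *\<^sub>R (u x * h x $ i)) + (LINT x|lborel. indicator (Pk k) x *\<^sub>R (G x $ i * \<psi> x)) = 0"
      using z int1 int2[OF Gi] unfolding set_lebesgue_integral_def e by simp
    moreover have "(LINT x|lborel. indicator B x *\<^sub>R (u x * h x $ i)) = - (LINT x|lborel. indicator (Pk k) x *\<^sub>R (fDu i x * \<psi> x))"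
      using w unfolding set_lebesgue_integral_def e2 .
    ultimately have "(LINT x|lborel. indicator (Pk k) x *\<^sub>R (fDu i x * \<psi> x) - indicator (Pk k) x *\<^sub>R (G x $ i * \<psi> x)) = 0"
      using int2[OF Gi] int2[OF fi] by simp
    then show "(LINT x:Pk k|lborel. (fDu i x - G x $ i) * \<psi> x) = 0"
      unfolding set_lebesgue_integral_def by (simp add: algebra_simps)
  qed
  then have "AE x in lborel. \<forall>k. x \<in> Pk k \<longrightarrow> fDu i x - G x $ i = 0" by (subst AE_all_countable) blast
  then show ?thesis
  proof eventually_elim
    case (elim x)
    show ?case
    proof
      assume x: "x \<in> P"
      then have ux: "0 < u x" "x \<in> B" by (auto simp: P_eq)
      then obtain k where "1 / real (Suc k) < u x" using reals_Archimedean[of "u x"] by (auto simp: inverse_eq_divide)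
      then show "fDu i x = G x $ i" using elim ux by (auto simp: Pk_def)
    qed
  qed
qed

lemma Du_eq_G: "AE x in lborel. x \<in> P \<longrightarrow> Du x = G x"
  using fDu_eq_G[of 1] fDu_eq_G[of 2] fDu(3)[of 1] fDu(3)[of 2]
proof eventually_elim
  case (elim x)
  then show ?case using P_subset(2) by (auto simp: vec_eq_iff forall_2 split: split_indicator)
qed

end

section \<open>Regularity of the density\<close>

context subsonic_sol
begin

definition tG :: "real^2 \<Rightarrow> real" where
  "tG x = (norm (G x))\<^sup>2 / (x $ 1)\<^sup>2"

lemma norm2_sq: "(norm (v::real^2))\<^sup>2 = v $ 1 * v $ 1 + v $ 2 * v $ 2"
  by (simp add: power2_norm_eq_inner inner_vec_def UNIV_2)

lemma S_first: "x \<in> S \<Longrightarrow> 0 < x $ 1"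
  using S_subset_U by auto

lemma tG_cont: "continuous_on S tG"
proof -
  have "x $ 1 \<noteq> 0" if "x \<in> S" for x using S_first[OF that] by simp
  then show ?thesis
    unfolding tG_def using G_C1 by (intro continuous_intros) (simp_all add: C1grad_def)
qed

lemma tG_nonneg: "0 \<le> tG x"
  by (simp add: tG_def)

lemma C_second_bound: obtains s1 where "0 \<le> s1" "s1 < smax" "\<And>x. x \<in> C \<Longrightarrow> x $ 2 \<le> s1"
proof -
  have "\<exists>x\<in>C. \<forall>y\<in>C. y $ 2 \<le> x $ 2"
    using \<delta>_pos by (intro continuous_attains_sup compact_cball continuous_intros) auto
  then obtain x where x: "x \<in> C" "\<And>y. y \<in> C \<Longrightarrow> y $ 2 \<le> x $ 2" by blast
  have "x \<in> \<Omega>" using x C_subset_U by blast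
  moreover have "0 \<le> x $ 2" using x(2)[of x0] x0 \<delta>_pos by simp
  ultimately show ?thesis using that[of "x $ 2"] x \<Omega>_lt by blast
qed

lemma rho_cr_mono:
  assumes "0 \<le> s" "s \<le> s'" "s' < smax" shows "rho_cr g \<rho>0 p s \<le> rho_cr g \<rho>0 p s'"
proof (rule ccontr)
  assume "\<not> ?thesis"
  then have "rho_cr g \<rho>0 p s' < rho_cr g \<rho>0 p s" by simp
  then have "\<Phi> (rho_cr g \<rho>0 p s') < \<Phi> (rho_cr g \<rho>0 p s)"
    using \<Phi>_mono rho_cr_eq(1)[of s'] assms by auto
  then show False using rho_cr_eq(2)[of s] rho_cr_eq(2)[of s'] assms g_pos by simp
qed

lemma H0_mono:
  assumes "0 \<le> s" "s \<le> s'" "s' < smax" shows "H 0 s \<le> H 0 s'"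
proof (rule ccontr)
  assume "\<not> ?thesis"
  then have "H 0 s' < H 0 s" by simp
  then have "h (H 0 s') < h (H 0 s)" using h_mono zero_speed_density(4)[of s'] \<rho>0_pos assms by auto
  then show False using zero_speed_density(2)[of s] zero_speed_density(2)[of s'] assms g_pos by simp
qed

lemma subsonic_le_H0:
  assumes "0 \<le> s" "s < smax" "subsonic \<eta> s" "0 \<le> T \<eta> s" shows "\<eta> \<le> H 0 s"
  using subsonic_intermediate[OF assms(1-3) assms(4) order_refl] by (metis order_trans)

lemma subsonic_margin:
  assumes "compact K" "K \<subseteq> \<Omega> \<inter> upper"
  shows "\<exists>\<epsilon>>0. AE y in lebesgue. y \<in> K \<longrightarrow>
           (\<exists>\<eta>. subsonic_density g \<rho>0 p (tfun Du y) (y $ 2) \<eta>) \<and>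
           \<epsilon> \<le> Hfun g \<rho>0 p (tfun Du y) (y $ 2) - rho_cr g \<rho>0 p (y $ 2)"
proof -
  have "\<forall>K. compact K \<and> K \<subseteq> \<Omega> \<inter> upper \<longrightarrow>
        (\<exists>\<epsilon>>0. AE x in lebesgue. x \<in> K \<longrightarrow>
           (\<exists>\<eta>. subsonic_density g \<rho>0 p (tfun Du x) (x $ 2) \<eta>) \<and>
           \<epsilon> \<le> Hfun g \<rho>0 p (tfun Du x) (x $ 2) - rho_cr g \<rho>0 p (x $ 2))"
    using sol unfolding subsonic_variational_solution_def by (elim conjE)
  then show ?thesis using assms by (elim allE[of _ K] impE) (rule conjI)
qed

text \<open>Almost every point near \<open>x\<close> is subsonic with a margin; by compactness the subsonic densities at
  such points accumulate at a subsonic density for \<open>x\<close> itself.\<close>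

lemma S_in_Dom:
  assumes x: "x \<in> P" shows "(tG x, x $ 2) \<in> Dom"
proof -
  obtain r where r: "r > 0" "cball x r \<subseteq> P" using open_P x open_contains_cball by blast
  have "cball x r \<subseteq> \<Omega> \<inter> upper" using r P_subset S_second by (fastforce simp: upper_def intro: less_imp_le)
  then obtain \<epsilon> where \<epsilon>: "\<epsilon> > 0" "AE y in lebesgue. y \<in> cball x r \<longrightarrow>
           (\<exists>\<eta>. subsonic_density g \<rho>0 p (tfun Du y) (y $ 2) \<eta>) \<and>
           \<epsilon> \<le> Hfun g \<rho>0 p (tfun Du y) (y $ 2) - rho_cr g \<rho>0 p (y $ 2)"
    using subsonic_margin[OF compact_cball] by blast
  have P2: "0 < y $ 2" "y $ 2 < smax" if "y \<in> P" for y using that S_second S_smax P_subset by auto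
  obtain s1 where s1: "0 \<le> s1" "s1 < smax" "\<And>x. x \<in> C \<Longrightarrow> x $ 2 \<le> s1" using C_second_bound by blast
  define good where "good y \<eta> \<longleftrightarrow> subsonic \<eta> (y $ 2) \<and> tG y = T \<eta> (y $ 2) \<and> \<epsilon> \<le> \<eta> - rho_cr g \<rho>0 p (y $ 2)" for y \<eta>
  have "AE y in lborel. y \<in> cball x r \<longrightarrow> (\<exists>\<eta>. good y \<eta>)"
    using \<epsilon>(2)[unfolded AE_completion_iff] Du_eq_G
  proof eventually_elim
    case (elim y)
    show ?case
    proof
      assume y: "y \<in> cball x r"
      then have yP: "y \<in> P" using r by blast
      have t: "tfun Du y = tG y" using elim(2) yP by (simp add: tfun_def tG_def)
      obtain \<eta> where "subsonic_density g \<rho>0 p (tG y) (y $ 2) \<eta>" using elim(1) y t by auto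
      then have \<eta>: "subsonic \<eta> (y $ 2)" "tG y = T \<eta> (y $ 2)" using subsonic_density_iff P2[OF yP] by auto
      then have "H (tG y) (y $ 2) = \<eta>" using H_eq[of "y $ 2" \<eta>] P2[OF yP] by simp
      then show "\<exists>\<eta>. good y \<eta>" using \<eta> elim(1) y t unfolding good_def by auto
    qed
  qed
  then obtain N where N: "N \<in> null_sets lborel" "{y \<in> space lborel. \<not> (y \<in> cball x r \<longrightarrow> (\<exists>\<eta>. good y \<eta>))} \<subseteq> N"
    unfolding eventually_ae_filter by blast
  have N2: "\<exists>\<eta>. good y \<eta>" if "y \<in> cball x r" "y \<notin> N" for y
    using subsetD[OF N(2), of y] that by auto
  have dense: "\<exists>y\<in>ball x e. y \<notin> N" if "e > 0" for e
  proof (rule ccontr)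
    assume "\<not> ?thesis"
    then have "ball x e \<subseteq> N" by blast
    moreover have "negligible N" using N(1) negligible_iff_null_sets null_sets_completionI by blast
    ultimately have "negligible (ball x e)" using negligible_subset by blast
    then show False using open_not_negligible[OF open_ball, of x e] that by (simp add: not_le)
  qed
  have "\<exists>y \<eta>. y \<in> cball x r \<and> dist y x < 1 / real (Suc n) \<and> good y \<eta>" for n
  proof -
    obtain y where y: "y \<in> ball x (min r (1 / real (Suc n)))" "y \<notin> N" using dense[of "min r (1 / real (Suc n))"] r by auto
    then have yr: "y \<in> cball x r" by auto
    then obtain e where "good y e" using N2 y by blast
    moreover have "dist y x < 1 / real (Suc n)" using y(1) by (simp add: dist_commute)
    ultimately show ?thesis using yr by blast
  qed
  then obtain Y E where YE: "\<And>n. Y n \<in> cball x r" "\<And>n. dist (Y n) x < 1 / real (Suc n)" "\<And>n. good (Y n) (E n)" by metis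
  have YP: "Y n \<in> P" for n using YE(1) r by blast
  have Yl: "Y \<longlonglongrightarrow> x"
  proof (rule tendsto_dist_iff[THEN iffD2])
    show "(\<lambda>n. dist (Y n) x) \<longlonglongrightarrow> 0"
      by (rule Lim_null_comparison[OF always_eventually LIMSEQ_Suc[OF lim_1_over_n]]) (use YE(2) less_imp_le in auto)
  qed
  define \<rho>c where "\<rho>c = rho_cr g \<rho>0 p 0"
  have smax0: "0 < smax" using s1 by simp
  have \<rho>c: "0 < \<rho>c" unfolding \<rho>c_def using rho_cr_eq(1)[of 0] smax0 by simp
  \<comment> \<open>The margin and the monotonicity of the critical density bound these densities
    from below; from above they are bounded by the density at rest for \<open>s1\<close>, an upper
    bound of the second coordinate on \<open>C\<close>.\<close>
  have Eb: "E n \<in> {\<rho>c + \<epsilon> .. H 0 s1}" for n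
  proof -
    note y = P2[OF YP[of n]]
    have "\<rho>c \<le> rho_cr g \<rho>0 p (Y n $ 2)" unfolding \<rho>c_def using rho_cr_mono[of 0 "Y n $ 2"] y by auto
    moreover have "E n \<le> H 0 (Y n $ 2)"
      using YE(3)[of n] y tG_nonneg[of "Y n"] by (intro subsonic_le_H0) (auto simp: good_def)
    moreover have "Y n $ 2 \<le> s1" using s1(3) P_subset(2) YP by blast
    then have "H 0 (Y n $ 2) \<le> H 0 s1" by (rule H0_mono[OF less_imp_le[OF y(1)] _ s1(2)])
    ultimately show ?thesis using YE(3)[of n] by (auto simp: good_def)
  qed
  obtain \<eta> \<phi> where \<phi>: "\<eta> \<in> {\<rho>c + \<epsilon> .. H 0 s1}" "strict_mono \<phi>" "(E \<circ> \<phi>) \<longlonglongrightarrow> \<eta>"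
    using compact_Icc[of "\<rho>c + \<epsilon>" "H 0 s1"] Eb unfolding compact_def by metis
  have Yl': "(\<lambda>n. Y (\<phi> n)) \<longlonglongrightarrow> x" using LIMSEQ_subseq_LIMSEQ[OF Yl \<phi>(2)] by (simp add: o_def)
  have El: "(\<lambda>n. E (\<phi> n)) \<longlonglongrightarrow> \<eta>" using \<phi>(3) by (simp add: o_def)
  have \<eta>0: "0 < \<eta>" "0 < \<eta> - \<epsilon>" using \<phi>(1) \<rho>c \<epsilon> by auto
  have Y2: "(\<lambda>n. Y (\<phi> n) $ 2) \<longlonglongrightarrow> x $ 2" by (rule tendsto_vec_nth[OF Yl'])
  have tl: "(\<lambda>n. tG (Y (\<phi> n))) \<longlonglongrightarrow> tG x"
  proof -
    have "isCont tG x" using tG_cont open_S x P_subset continuous_on_eq_continuous_at by blast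
    then show ?thesis using isCont_tendsto_compose[OF _ Yl'] by blast
  qed
  have "(\<lambda>n. T (E (\<phi> n)) (Y (\<phi> n) $ 2)) \<longlonglongrightarrow> T \<eta> (x $ 2)"
    unfolding T_def using g_pos \<rho>0_pos
    by (intro tendsto_intros El Y2 isCont_tendsto_compose[OF DERIV_isCont[OF h_deriv[OF \<eta>0(1)]]]) auto
  moreover have "T (E (\<phi> n)) (Y (\<phi> n) $ 2) = tG (Y (\<phi> n))" for n using YE(3)[of "\<phi> n"] by (simp add: good_def)
  ultimately have "tG x = T \<eta> (x $ 2)" using tl LIMSEQ_unique by auto
  moreover have "subsonic \<eta> (x $ 2)"
  proof -
    \<comment> \<open>A limit of subsonic densities could be critical. Carrying the margin
      \<open>\<epsilon>\<close> through the limit excludes this, because \<open>\<Phi>\<close> is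
      strictly increasing.\<close>
    have "g * x $ 2 \<le> \<Phi> (\<eta> - \<epsilon>)"
    proof (rule LIMSEQ_le)
      show "(\<lambda>n. g * Y (\<phi> n) $ 2) \<longlonglongrightarrow> g * x $ 2" by (intro tendsto_intros Y2)
      show "(\<lambda>n. \<Phi> (E (\<phi> n) - \<epsilon>)) \<longlonglongrightarrow> \<Phi> (\<eta> - \<epsilon>)"
        by (intro isCont_tendsto_compose[OF \<Phi>_isCont[OF \<eta>0(2)]] tendsto_intros El)
      have "g * Y (\<phi> n) $ 2 \<le> \<Phi> (E (\<phi> n) - \<epsilon>)" for n
      proof -
        note y = P2[OF YP[of "\<phi> n"]]
        have "rho_cr g \<rho>0 p (Y (\<phi> n) $ 2) \<le> E (\<phi> n) - \<epsilon>" using YE(3)[of "\<phi> n"] by (simp add: good_def)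
        then have "\<Phi> (rho_cr g \<rho>0 p (Y (\<phi> n) $ 2)) \<le> \<Phi> (E (\<phi> n) - \<epsilon>)"
          using \<Phi>_mono[OF rho_cr_eq(1)[OF less_imp_le[OF y(1)] y(2)], of "E (\<phi> n) - \<epsilon>"] by (cases "rho_cr g \<rho>0 p (Y (\<phi> n) $ 2) = E (\<phi> n) - \<epsilon>") auto
        then show ?thesis using rho_cr_eq(2)[of "Y (\<phi> n) $ 2"] y by simp
      qed
      then show "\<exists>N. \<forall>n\<ge>N. g * Y (\<phi> n) $ 2 \<le> \<Phi> (E (\<phi> n) - \<epsilon>)" by blast
    qed
    also have "\<Phi> (\<eta> - \<epsilon>) < \<Phi> \<eta>" using \<Phi>_mono[OF \<eta>0(2), of \<eta>] \<epsilon> by simp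
    finally show ?thesis using \<eta>0 by (simp add: subsonic_def)
  qed
  ultimately show ?thesis using P2[OF x] by (auto simp: Dom_def)
qed

definition \<eta> :: "real^2 \<Rightarrow> real" where
  "\<eta> x = H (tG x) (x $ 2)"

lemma \<eta>_props:
  assumes "x \<in> P"
  shows "subsonic (\<eta> x) (x $ 2)" "T (\<eta> x) (x $ 2) = tG x" "0 < \<eta> x"
    and "0 < x $ 2" "x $ 2 < smax" "0 < x $ 1" "\<delta> \<le> x $ 1"
  using Dom_D[OF S_in_Dom[OF assms]] assms P_subset S_first C_first by (auto simp: \<eta>_def)

text \<open>The critical density at 0 and the density at rest at \<open>s1\<close> serve for all of
  \<open>P\<close> at once, so the bounds persist up to the free boundary.\<close>

lemma \<eta>_bounds: obtains a b where "0 < a" "\<And>x. x \<in> P \<Longrightarrow> a \<le> \<eta> x \<and> \<eta> x \<le> b"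
proof -
  obtain s1 where s1: "0 \<le> s1" "s1 < smax" "\<And>x. x \<in> C \<Longrightarrow> x $ 2 \<le> s1" using C_second_bound by blast
  have r: "0 < rho_cr g \<rho>0 p 0" "\<Phi> (rho_cr g \<rho>0 p 0) = 0" using rho_cr_eq[of 0] s1 by auto
  have "rho_cr g \<rho>0 p 0 \<le> \<eta> x \<and> \<eta> x \<le> H 0 s1" if x: "x \<in> P" for x
  proof
    note e = \<eta>_props[OF x]
    have "\<Phi> (rho_cr g \<rho>0 p 0) < \<Phi> (\<eta> x)" using e g_pos r by (simp add: subsonic_def) (smt (verit) mult_pos_pos)
    then show "rho_cr g \<rho>0 p 0 \<le> \<eta> x" using \<Phi>_less_iff[OF r(1) e(3)] by simp
    have "\<eta> x \<le> H 0 (x $ 2)" using e tG_nonneg[of x] by (intro subsonic_le_H0) auto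
    also have "x $ 2 \<le> s1" using s1(3) P_subset(2) x by blast
    then have "H 0 (x $ 2) \<le> H 0 s1" by (rule H0_mono[OF less_imp_le[OF e(4)] _ s1(2)])
    finally show "\<eta> x \<le> H 0 s1" .
  qed
  then show ?thesis using that r by blast
qed

definition gt :: "real^2 \<Rightarrow> real^2" where
  "gt x = ((G x $ 1) *\<^sub>R gG 1 x + (G x $ 1) *\<^sub>R gG 1 x + ((G x $ 2) *\<^sub>R gG 2 x + (G x $ 2) *\<^sub>R gG 2 x)) /\<^sub>R (x $ 1)\<^sup>2
     - (2 * (norm (G x))\<^sup>2 / (x $ 1) ^ 3) *\<^sub>R axis 1 1"

lemma tG_C1: "C1grad P tG gt"
proof (rule C1grad_transform[OF _ open_P])
  have x1: "x $ 1 \<noteq> 0" if "x \<in> P" for x using \<eta>_props(6)[OF that] by simp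
  show "C1grad P (\<lambda>x. (G x $ 1 * G x $ 1 + G x $ 2 * G x $ 2) * (1 / (x $ 1 * x $ 1)))
     (\<lambda>x. (G x $ 1 * G x $ 1 + G x $ 2 * G x $ 2) *\<^sub>R ((- 1 / (x $ 1 * x $ 1)\<^sup>2) *\<^sub>R ((x $ 1) *\<^sub>R axis 1 1 + (x $ 1) *\<^sub>R axis 1 1))
        + (1 / (x $ 1 * x $ 1)) *\<^sub>R (((G x $ 1) *\<^sub>R gG 1 x + (G x $ 1) *\<^sub>R gG 1 x) + ((G x $ 2) *\<^sub>R gG 2 x + (G x $ 2) *\<^sub>R gG 2 x)))"
    using x1 by (intro C1grad_mult C1grad_add C1grad_inverse gG_P C1grad_nth) auto
  fix x assume x: "x \<in> P"
  show "(G x $ 1 * G x $ 1 + G x $ 2 * G x $ 2) * (1 / (x $ 1 * x $ 1)) = tG x"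
    unfolding tG_def norm2_sq by (simp add: power2_eq_square)
  show "(G x $ 1 * G x $ 1 + G x $ 2 * G x $ 2) *\<^sub>R ((- 1 / (x $ 1 * x $ 1)\<^sup>2) *\<^sub>R ((x $ 1) *\<^sub>R axis 1 1 + (x $ 1) *\<^sub>R axis 1 1))
        + (1 / (x $ 1 * x $ 1)) *\<^sub>R (((G x $ 1) *\<^sub>R gG 1 x + (G x $ 1) *\<^sub>R gG 1 x) + ((G x $ 2) *\<^sub>R gG 2 x + (G x $ 2) *\<^sub>R gG 2 x)) = gt x"
    using x1[OF x] unfolding gt_def norm2_sq
    by (simp add: vec_eq_iff forall_2 axis_def field_simps power2_eq_square power3_eq_cube)
qed

text \<open>Found by differentiating \<open>T (\<eta> x) (x $ 2) = tG x\<close>; the derivative of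
  \<open>T\<close> in its second argument is
  \<open>\<eta>\<^sup>2 / \<rho>0\<^sup>2\<close>.\<close>

definition g\<eta> :: "real^2 \<Rightarrow> real^2" where
  "g\<eta> x = (gt x - ((\<eta> x)\<^sup>2 / \<rho>0\<^sup>2) *\<^sub>R axis 2 1) /\<^sub>R T\<eta> (\<eta> x) (x $ 2)"

lemma \<eta>_C1: "C1grad P \<eta> g\<eta>"
  unfolding C1grad_def
proof (intro conjI ballI)
  fix x assume x: "x \<in> P"
  have t: "(tG has_derivative (\<lambda>v. gt x \<bullet> v)) (at x)" using tG_C1 x by (simp add: C1grad_def)
  have "((\<lambda>x. (tG x, x $ 2)) has_derivative (\<lambda>v. (gt x \<bullet> v, v $ 2))) (at x)"
    by (intro has_derivative_Pair t bounded_linear_imp_has_derivative bounded_linear_vec_nth)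
  from has_derivative_compose[OF this H_has_derivative[OF S_in_Dom[OF x]]]
  have "(\<eta> has_derivative (\<lambda>v. (gt x \<bullet> v - (\<eta> x)\<^sup>2 / \<rho>0\<^sup>2 * v $ 2) / T\<eta> (\<eta> x) (x $ 2))) (at x)"
    unfolding \<eta>_def[abs_def] by simp
  moreover have "(gt x \<bullet> v - (\<eta> x)\<^sup>2 / \<rho>0\<^sup>2 * v $ 2) / T\<eta> (\<eta> x) (x $ 2) = g\<eta> x \<bullet> v" for v
    by (simp add: g\<eta>_def inner_diff_left inner_axis' divide_inverse mult.commute)
  ultimately show "(\<eta> has_derivative (\<lambda>v. g\<eta> x \<bullet> v)) (at x)" by simp
next
  have "isCont \<eta> x" if "x \<in> P" for x
  proof -
    have t: "(tG has_derivative (\<lambda>v. gt x \<bullet> v)) (at x)" using tG_C1 that by (simp add: C1grad_def)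
    have "((\<lambda>x. (tG x, x $ 2)) has_derivative (\<lambda>v. (gt x \<bullet> v, v $ 2))) (at x)"
      by (intro has_derivative_Pair t bounded_linear_imp_has_derivative bounded_linear_vec_nth)
    from has_derivative_continuous[OF has_derivative_compose[OF this H_has_derivative[OF S_in_Dom[OF that]]]]
    show ?thesis unfolding \<eta>_def[abs_def] by simp
  qed
  then have c\<eta>: "continuous_on P \<eta>" by (intro continuous_at_imp_continuous_on ballI)
  have cgt: "continuous_on P gt" using tG_C1 by (simp add: C1grad_def)
  have cT: "continuous_on P (\<lambda>x. T\<eta> (\<eta> x) (x $ 2))"
    unfolding T\<eta>_def using g_pos \<rho>0_pos \<eta>_props(3)
    by (intro continuous_intros c\<eta> continuous_on_compose2[OF continuous_on_\<Phi>]) auto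
  have "T\<eta> (\<eta> x) (x $ 2) \<noteq> 0" if "x \<in> P" for x using T\<eta>_neg \<eta>_props(1)[OF that] by force
  then show "continuous_on P g\<eta>"
    unfolding g\<eta>_def using \<rho>0_pos by (intro continuous_intros c\<eta> cgt cT) auto
qed

lemma \<eta>_cont: "continuous_on P \<eta>" using C1grad_continuous_on[OF \<eta>_C1] .

text \<open>On \<open>P\<close> the energy density \<open>F + \<lambda>\<close> equals \<open>2 t / \<eta> + q\<close>.\<close>

definition q :: "real^2 \<Rightarrow> real" where
  "q x = (p (\<eta> x) - p \<rho>0) / (g * \<rho>0\<^sup>2)"

lemma F_lam_P:
  assumes x: "x \<in> P"
  shows "F (tG x) (x $ 2) + lam g \<rho>0 p (x $ 2) = 2 * tG x / \<eta> x + q x"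
    and "d2F g \<rho>0 p (tG x) (x $ 2) + deriv (lam g \<rho>0 p) (x $ 2) = \<eta> x / \<rho>0\<^sup>2"
  using F_eq[OF S_in_Dom[OF x] tG_nonneg] lam_eq[of "x $ 2"] d2F_eq[OF S_in_Dom[OF x] tG_nonneg] deriv_lam[of "x $ 2"]
    \<eta>_props[OF x]
  by (auto simp: W_def \<eta>_def q_def diff_divide_distrib)

text \<open>At the upper limit \<open>x $ 2\<close> the density is \<open>\<rho>0\<close>, by the
  normalisation \<open>H s s = \<rho>0\<close>. The contributions \<open>W 0 s\<close> and
  \<open>H 0 s\<close> of the lower limit cancel in the difference.\<close>

lemma integrals_P:
  assumes x: "x \<in> P"
  shows "(LBINT \<tau>=0..tG x. deriv (\<lambda>\<sigma>. 1 / H \<sigma> (x $ 2)) \<tau> * \<tau>) - (LBINT \<tau>=0..x $ 2. deriv (\<lambda>\<sigma>. 1 / H \<sigma> (x $ 2)) \<tau> * \<tau>)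
      = x $ 2 / \<rho>0 - tG x / \<eta> x - q x"
    and "(LBINT \<tau>=0..tG x. deriv (\<lambda>s. 1 / H \<tau> s) (x $ 2) * x $ 2) - (LBINT \<tau>=0..x $ 2. deriv (\<lambda>s. 1 / H \<tau> s) (x $ 2) * x $ 2)
      = x $ 2 * (\<eta> x - \<rho>0) / \<rho>0\<^sup>2"
proof -
  note e = \<eta>_props[OF x] and D = S_in_Dom[OF x]
  note d = Dom_diag[OF e(4,5)]
  show "(LBINT \<tau>=0..tG x. deriv (\<lambda>\<sigma>. 1 / H \<sigma> (x $ 2)) \<tau> * \<tau>) - (LBINT \<tau>=0..x $ 2. deriv (\<lambda>\<sigma>. 1 / H \<sigma> (x $ 2)) \<tau> * \<tau>)
      = x $ 2 / \<rho>0 - tG x / \<eta> x - q x"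
    unfolding integral_deriv_inverse_H_t[OF D tG_nonneg] integral_deriv_inverse_H_t[OF d(1) less_imp_le[OF e(4)]]
      F_eq[OF D tG_nonneg] F_eq[OF d(1) less_imp_le[OF e(4)]]
    using d(2) by (simp add: W_def \<eta>_def q_def diff_divide_distrib)
  show "(LBINT \<tau>=0..tG x. deriv (\<lambda>s. 1 / H \<tau> s) (x $ 2) * x $ 2) - (LBINT \<tau>=0..x $ 2. deriv (\<lambda>s. 1 / H \<tau> s) (x $ 2) * x $ 2)
      = x $ 2 * (\<eta> x - \<rho>0) / \<rho>0\<^sup>2"
    unfolding integral_deriv_inverse_H_s[OF D tG_nonneg] integral_deriv_inverse_H_s[OF d(1) less_imp_le[OF e(4)]]
    using d(2) by (simp add: \<eta>_def diff_divide_distrib right_diff_distrib)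
qed

end

section \<open>Bounded continuous functions on the positivity set, and the weak gradient off
  it\<close>

context subsonic_sol
begin

text \<open>Closed under arithmetic, and enough for measurability and integrability on the bounded
  open set \<open>P\<close>, whatever its boundary looks like.\<close>

definition bc :: "(real^2 \<Rightarrow> real) \<Rightarrow> bool" where
  "bc f \<longleftrightarrow> continuous_on P f \<and> (\<exists>M. \<forall>x\<in>P. \<bar>f x\<bar> \<le> M)"

lemma bcI: "continuous_on P f \<Longrightarrow> (\<And>x. x \<in> P \<Longrightarrow> \<bar>f x\<bar> \<le> M) \<Longrightarrow> bc f"
  unfolding bc_def by blast

lemma bc_const: "bc (\<lambda>_. k)"
  by (rule bcI[of _ "\<bar>k\<bar>"]) auto

lemma bc_add: assumes "bc f" "bc k" shows "bc (\<lambda>x. f x + k x)"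
proof -
  obtain M N where M: "\<And>x. x \<in> P \<Longrightarrow> \<bar>f x\<bar> \<le> M" "\<And>x. x \<in> P \<Longrightarrow> \<bar>k x\<bar> \<le> N" using assms by (auto simp: bc_def)
  show ?thesis
  proof (rule bcI[of _ "M + N"])
    fix x assume "x \<in> P"
    then show "\<bar>f x + k x\<bar> \<le> M + N" using M[of x] abs_triangle_ineq[of "f x" "k x"] by linarith
  qed (use assms in \<open>auto simp: bc_def intro!: continuous_intros\<close>)
qed

lemma bc_mult: assumes "bc f" "bc k" shows "bc (\<lambda>x. f x * k x)"
proof -
  obtain M N where M: "\<And>x. x \<in> P \<Longrightarrow> \<bar>f x\<bar> \<le> M" "\<And>x. x \<in> P \<Longrightarrow> \<bar>k x\<bar> \<le> N" using assms by (auto simp: bc_def)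
  show ?thesis
  proof (rule bcI[of _ "M * N"])
    fix x assume x: "x \<in> P"
    show "\<bar>f x * k x\<bar> \<le> M * N" unfolding abs_mult
      using M(1)[OF x] M(2)[OF x] by (intro mult_mono) auto
  qed (use assms in \<open>auto simp: bc_def intro!: continuous_intros\<close>)
qed

lemma bc_minus: assumes "bc f" shows "bc (\<lambda>x. - f x)"
  using bc_mult[OF bc_const[of "-1"] assms] by simp

lemma bc_diff: assumes "bc f" "bc k" shows "bc (\<lambda>x. f x - k x)"
  using bc_add[OF assms(1) bc_minus[OF assms(2)]] by simp

lemma bc_power: assumes "bc f" shows "bc (\<lambda>x. f x ^ n)"
  by (induction n) (auto intro: bc_const bc_mult assms)

lemma bc_cont: assumes "continuous_on C f" shows "bc f"
proof -
  have "compact (f ` C)" by (intro compact_continuous_image assms compact_cball)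
  then obtain M where M: "\<And>y. y \<in> f ` C \<Longrightarrow> \<bar>y\<bar> \<le> M" using compact_imp_bounded bounded_real by metis
  show ?thesis using P_subset(2) M by (intro bcI[of _ M] continuous_on_subset[OF assms]) auto
qed

lemma bc_nth: "bc (\<lambda>x. x $ i)"
  by (intro bc_cont continuous_intros)

lemma bc_u: "bc u"
  using C_subset_U by (intro bc_cont continuous_on_subset[OF u_cont]) auto

lemma bc_inv_x1: "bc (\<lambda>x. 1 / x $ 1)"
proof (rule bc_cont)
  have "x $ 1 \<noteq> 0" if "x \<in> C" for x using C_first[OF that] \<delta>_pos by auto
  then show "continuous_on C (\<lambda>x. 1 / x $ 1)" by (intro continuous_intros) auto
qed

lemma bc_\<eta>: "bc \<eta>" and bc_inv_\<eta>: "bc (\<lambda>x. 1 / \<eta> x)" and bc_tG: "bc tG" and bc_q: "bc q"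
proof -
  obtain a b where ab: "0 < a" "\<And>x. x \<in> P \<Longrightarrow> a \<le> \<eta> x \<and> \<eta> x \<le> b" using \<eta>_bounds by blast
  have pos: "0 < \<eta> x" if "x \<in> P" for x using \<eta>_props(3)[OF that] .
  show e: "bc \<eta>" using ab by (intro bcI[of _ b] \<eta>_cont) force+
  show "bc (\<lambda>x. 1 / \<eta> x)"
  proof (rule bcI[of _ "1 / a"])
    show "continuous_on P (\<lambda>x. 1 / \<eta> x)" using pos by (intro continuous_intros \<eta>_cont) force
    fix x assume x: "x \<in> P"
    show "\<bar>1 / \<eta> x\<bar> \<le> 1 / a" using ab(1) ab(2)[OF x] pos[OF x] by (simp add: frac_le)
  qed
  have comp: "bc (\<lambda>x. f (\<eta> x))" if f: "continuous_on {a..b} f" for f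
  proof -
    have "compact (f ` {a..b})" by (intro compact_continuous_image f compact_Icc)
    then obtain M where M: "\<And>y. y \<in> f ` {a..b} \<Longrightarrow> \<bar>y\<bar> \<le> M" using compact_imp_bounded bounded_real by metis
    show ?thesis
    proof (rule bcI[of _ M])
      show "continuous_on P (\<lambda>x. f (\<eta> x))" by (rule continuous_on_compose2[OF f \<eta>_cont]) (use ab in auto)
    qed (use ab M in auto)
  qed
  have h: "bc (\<lambda>x. h (\<eta> x))"
    using ab(1) by (intro comp continuous_at_imp_continuous_on ballI DERIV_isCont[OF h_deriv]) auto
  have p: "bc (\<lambda>x. p (\<eta> x))"
    using ab(1) by (intro comp continuous_at_imp_continuous_on ballI DERIV_isCont[OF p_deriv]) auto
  \<comment> \<open>The bound for \<open>tG\<close>, and with it the one for the gradient, comes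
    from the Bernoulli equation \<open>tG x = T (\<eta> x) (x $ 2)\<close>, where
    \<open>\<eta>\<close> ranges in a compact interval.\<close>
  have "bc (\<lambda>x. (\<eta> x)\<^sup>2 * (g * x $ 2 - h (\<eta> x)) * (1 / (g * \<rho>0\<^sup>2)))"
    by (intro bc_mult bc_diff bc_power bc_const bc_nth h e)
  moreover have "(\<eta> x)\<^sup>2 * (g * x $ 2 - h (\<eta> x)) * (1 / (g * \<rho>0\<^sup>2)) = tG x" if "x \<in> P" for x
    using \<eta>_props(2)[OF that] by (simp add: T_def)
  ultimately show "bc tG" unfolding bc_def by (metis (no_types, lifting) continuous_on_eq)
  have "bc (\<lambda>x. (p (\<eta> x) - p \<rho>0) * (1 / (g * \<rho>0\<^sup>2)))" by (intro bc_mult bc_diff p bc_const)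
  then show "bc q" by (simp add: q_def[abs_def])
qed

lemma bc_G: "bc (\<lambda>x. G x $ i)"
proof -
  have "bc (\<lambda>x. tG x * (x $ 1)\<^sup>2)" by (intro bc_mult bc_power bc_tG bc_nth)
  then obtain M where M: "\<And>x. x \<in> P \<Longrightarrow> \<bar>tG x * (x $ 1)\<^sup>2\<bar> \<le> M" by (auto simp: bc_def)
  show ?thesis
  proof (rule bcI[of _ "sqrt M"])
    show "continuous_on P (\<lambda>x. G x $ i)" using C1grad_continuous_on[OF gG_P] .
    fix x assume x: "x \<in> P"
    have "(norm (G x))\<^sup>2 = tG x * (x $ 1)\<^sup>2" using \<eta>_props(6)[OF x] by (simp add: tG_def)
    then have "(norm (G x))\<^sup>2 \<le> M" using M[OF x] by simp
    then have "norm (G x) \<le> sqrt M" using real_le_rsqrt by blast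
    then show "\<bar>G x $ i\<bar> \<le> sqrt M" using component_le_norm_cart[of "G x" i] by linarith
  qed
qed

lemma inner_real2: "(v::real^2) \<bullet> w = v $ 1 * w $ 1 + v $ 2 * w $ 2"
  by (simp add: inner_vec_def UNIV_2)

lemma bc_inner:
  fixes f k :: "real^2 \<Rightarrow> real^2"
  assumes "\<And>i. bc (\<lambda>x. f x $ i)" "\<And>i. bc (\<lambda>x. k x $ i)"
  shows "bc (\<lambda>x. f x \<bullet> k x)"
  unfolding inner_real2 by (intro bc_add bc_mult assms)

lemma bc_C1grad: "C1grad UNIV \<psi> g\<psi> \<Longrightarrow> bc \<psi>" "C1grad UNIV \<psi> g\<psi> \<Longrightarrow> bc (\<lambda>x. g\<psi> x $ i)"
proof -
  assume \<psi>: "C1grad UNIV \<psi> g\<psi>"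
  show "bc \<psi>" by (rule bc_cont, rule continuous_on_subset[OF C1grad_continuous_on[OF \<psi>]]) simp
  have "continuous_on UNIV g\<psi>" using \<psi> by (simp add: C1grad_def)
  then have "continuous_on C g\<psi>" by (rule continuous_on_subset) simp
  then show "bc (\<lambda>x. g\<psi> x $ i)" by (intro bc_cont continuous_intros)
qed

lemma bc_measurable: "bc f \<Longrightarrow> (\<lambda>x. indicator P x *\<^sub>R f x) \<in> borel_measurable borel"
  using borel_measurable_continuous_on_indicator[of P f] open_P by (auto simp: bc_def)

lemma bc_integrable: assumes "bc f" shows "set_integrable lborel P f"
proof -
  obtain M where M: "\<And>x. x \<in> P \<Longrightarrow> \<bar>f x\<bar> \<le> M" using assms by (auto simp: bc_def)
  show ?thesis
    unfolding set_integrable_def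
  proof (rule integrable_compact_support[OF bc_measurable[OF assms], where S=P and B="\<bar>M\<bar>"])
    show "bounded P" using bounded_subset[OF bounded_cball P_subset(2)] .
    fix x show "\<bar>indicator P x *\<^sub>R f x\<bar> \<le> \<bar>M\<bar>" using M[of x] by (cases "x \<in> P") auto
  qed auto
qed

lemmas bc_intros = bc_const bc_add bc_mult bc_minus bc_diff bc_power bc_nth bc_u bc_inv_x1 bc_\<eta> bc_inv_\<eta> bc_tG bc_q bc_G

lemma B_open: "open B" and u_cont_B: "continuous_on B u"
  using continuous_on_subset[OF u_cont B_subset_\<Omega>] by auto

text \<open>Boundedness is asked of the divergence of the field and not of its single derivatives:
  those of \<open>V\<close> contain second derivatives of \<open>u\<close>, which may blow up at the
  free boundary.\<close>

lemma positivity_identity: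
  fixes w :: "2 \<Rightarrow> real^2 \<Rightarrow> real" and gw :: "2 \<Rightarrow> real^2 \<Rightarrow> real^2"
  assumes w: "\<And>i. C1grad P (w i) (gw i)" and bw: "\<And>i. bc (w i)" and bd: "bc (\<lambda>x. gw 1 x $ 1 + gw 2 x $ 2)"
    and \<psi>: "C1grad UNIV \<psi> g\<psi>" and K: "compact K" "K \<subseteq> B" "\<And>x. x \<notin> K \<Longrightarrow> \<psi> x = 0"
  shows "(LINT x:P|lborel. \<psi> x * (G x $ 1 * w 1 x + G x $ 2 * w 2 x + u x * (gw 1 x $ 1 + gw 2 x $ 2)))
     = - (LINT x:P|lborel. u x * (g\<psi> x $ 1 * w 1 x + g\<psi> x $ 2 * w 2 x))"
proof -
  have s: "(\<Sum>i\<in>UNIV. f i) = f 1 + f 2" for f :: "2 \<Rightarrow> real" by (simp add: UNIV_2)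
  note b\<psi> = bc_C1grad[OF \<psi>]
  have 1: "bc (\<lambda>x. \<psi> x * (G x $ 1 * w 1 x + G x $ 2 * w 2 x))" by (intro bc_intros b\<psi> bw)
  have 2: "bc (\<lambda>x. u x * (g\<psi> x $ 1 * w 1 x + g\<psi> x $ 2 * w 2 x))" by (intro bc_intros b\<psi> bw)
  have 3: "bc (\<lambda>x. u x * \<psi> x * (gw 1 x $ 1 + gw 2 x $ 2))" by (intro bc_mult bc_u b\<psi> bd)
  note i = bc_integrable[OF 1] bc_integrable[OF 2] bc_integrable[OF 3]
  have "(LINT x:P|lborel. \<psi> x * (G x $ 1 * w 1 x + G x $ 2 * w 2 x)) + (LINT x:P|lborel. u x * (g\<psi> x $ 1 * w 1 x + g\<psi> x $ 2 * w 2 x)) +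
     (LINT x:P|lborel. u x * \<psi> x * (gw 1 x $ 1 + gw 2 x $ 2)) = 0"
    using integral_positivity_set[OF B_open u_cont_B P_eq G_P w C1grad_subset[OF \<psi>] K] i unfolding s by auto
  moreover have "(LINT x:P|lborel. \<psi> x * (G x $ 1 * w 1 x + G x $ 2 * w 2 x + u x * (gw 1 x $ 1 + gw 2 x $ 2)))
    = (LINT x:P|lborel. \<psi> x * (G x $ 1 * w 1 x + G x $ 2 * w 2 x)) + (LINT x:P|lborel. u x * \<psi> x * (gw 1 x $ 1 + gw 2 x $ 2))"
    using i(1,3) by (subst set_integral_add(2)[symmetric]) (auto simp: algebra_simps)
  ultimately show ?thesis by linarith
qed

text \<open>Integration by parts on \<open>P\<close> against a constant field leaves no boundary
  term, and \<open>u\<close> vanishes off \<open>P\<close>. So \<open>G\<close> extended by zero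
  satisfies the identity that defines the weak gradient in all of \<open>B\<close>, and coincides
  with it.\<close>

lemma fDu_zero: "AE x in lborel. x \<in> B \<longrightarrow> fDu i x - indicator P x * G x $ i = 0"
proof (rule fundamental_lemma[OF B_open])
  have PG: "integrable lborel (\<lambda>x. indicator P x * G x $ i)"
    using bc_integrable[OF bc_G[of i]] by (simp add: set_integrable_def)
  show "set_integrable lborel B (\<lambda>x. fDu i x - indicator P x * G x $ i)"
    unfolding set_integrable_def
    by (rule integrable_mult_indicator) (auto intro!: Bochner_Integration.integrable_diff fDu(2) PG)
  fix \<psi> g\<psi> K assume \<psi>: "C1grad UNIV \<psi> g\<psi>" "compact K" "K \<subseteq> B" "\<And>x. x \<notin> K \<Longrightarrow> \<psi> x = 0"
  define w where "w j = (\<lambda>x::real^2. if j = i then 1 else 0 :: real)" for j :: 2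
  have w: "C1grad P (w j) (\<lambda>_. 0)" "bc (w j)" for j unfolding w_def by (auto intro: C1grad_const bc_const)
  have sel: "f 1 * w 1 x + f 2 * w 2 x = f i" for f :: "2 \<Rightarrow> real" and x
    using exhaust_2[of i] by (auto simp: w_def)
  have "(LINT x:P|lborel. \<psi> x * (G x $ i)) = - (LINT x:P|lborel. u x * (g\<psi> x $ i))"
    using positivity_identity[of w "\<lambda>_ _. 0", OF w(1,2) _ \<psi>] bc_const[of 0] sel[of "\<lambda>j. G _ $ j"] sel[of "\<lambda>j. g\<psi> _ $ j"] by simp
  also have "(LINT x:P|lborel. u x * (g\<psi> x $ i)) = (LINT x:B|lborel. u x * (g\<psi> x $ i))"
    unfolding set_lebesgue_integral_def
  proof (intro Bochner_Integration.integral_cong refl)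
    fix x show "indicator P x *\<^sub>R (u x * g\<psi> x $ i) = indicator B x *\<^sub>R (u x * g\<psi> x $ i)"
      using u_zero_off_P[of x] P_subset(1) by (auto split: split_indicator)
  qed
  also have "- \<dots> = (LINT x:B|lborel. fDu i x * \<psi> x)" using weak_gradient_identity[OF \<psi>, of i] by simp
  finally have eq: "(LINT x:P|lborel. \<psi> x * (G x $ i)) = (LINT x:B|lborel. fDu i x * \<psi> x)" .
  have \<psi>m: "\<psi> \<in> borel_measurable borel" using C1grad_measurable[OF \<psi>(1)] by simp
  have "compact (\<psi> ` K)" using C1grad_continuous_on[OF \<psi>(1)] \<psi>(2) by (auto intro!: compact_continuous_image intro: continuous_on_subset)
  then obtain M1 where M1: "\<And>y. y \<in> \<psi> ` K \<Longrightarrow> \<bar>y\<bar> \<le> M1" using compact_imp_bounded bounded_real by metis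
  have b1: "\<bar>\<psi> x\<bar> \<le> \<bar>M1\<bar>" for x using M1[of "\<psi> x"] \<psi>(4)[of x] by (cases "x \<in> K") auto
  have int: "integrable lborel (\<lambda>x. indicator B x *\<^sub>R (fDu i x * \<psi> x))"
  proof (rule Bochner_Integration.integrable_bound)
    show "integrable lborel (\<lambda>x. \<bar>M1\<bar> * fDu i x)" using fDu(2) by simp
    show "(\<lambda>x. indicator B x *\<^sub>R (fDu i x * \<psi> x)) \<in> borel_measurable lborel"
      using fDu(1) \<psi>m by (intro borel_measurable_scaleR borel_measurable_times borel_measurable_indicator) auto
    show "AE x in lborel. norm (indicator B x *\<^sub>R (fDu i x * \<psi> x)) \<le> norm (\<bar>M1\<bar> * fDu i x)"
      using b1 by (intro AE_I2) (auto simp: abs_mult mult.commute intro!: mult_right_mono split: split_indicator)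
  qed
  have int2: "integrable lborel (\<lambda>x. indicator P x *\<^sub>R (\<psi> x * G x $ i))"
    using bc_integrable[OF bc_mult[OF bc_C1grad(1)[OF \<psi>(1)] bc_G[of i]]] by (simp add: set_integrable_def)
  have "(LINT x:B|lborel. (fDu i x - indicator P x * G x $ i) * \<psi> x) =
     (LINT x|lborel. indicator B x *\<^sub>R (fDu i x * \<psi> x) - indicator P x *\<^sub>R (\<psi> x * G x $ i))"
    unfolding set_lebesgue_integral_def
    using P_subset(1) by (intro Bochner_Integration.integral_cong) (auto simp: algebra_simps split: split_indicator)
  also have "\<dots> = 0" using eq int int2 by (simp add: set_lebesgue_integral_def)
  finally show "(LINT x:B|lborel. (fDu i x - indicator P x * G x $ i) * \<psi> x) = 0" .
qed

lemma Du_ae: "AE x in lborel. x \<in> B \<longrightarrow> Du x = indicator P x *\<^sub>R G x"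
  using fDu_zero[of 1] fDu_zero[of 2] fDu(3)[of 1] fDu(3)[of 2]
proof eventually_elim
  case (elim x)
  then show ?case using ball_subset_cball[of x0 \<delta>] by (auto simp: vec_eq_iff forall_2 split: split_indicator)
qed

abbreviation "chi \<equiv> indicat_real {x\<in>\<Omega>. 0 < u x}"

lemma LINT_upper:
  assumes "bc k" "AE x in lborel. indicator A x *\<^sub>R f x = indicator P x *\<^sub>R k x"
  shows "(LINT x:A|lebesgue. f x) = (LINT x:P|lborel. k x)"
  using assms open_P by (intro LINT_lebesgue_eq_lborel bc_measurable) auto

lemma tfun_P: "Du x = G x \<Longrightarrow> tfun Du x = tG x" "Du x = 0 \<Longrightarrow> tfun Du x = 0"
  by (simp_all add: tfun_def tG_def)

lemma F_0: "F 0 s = 0" and d2F_0: "d2F g \<rho>0 p 0 s = 0"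
  by (simp_all add: Ffun_def d2F_def flip: zero_ereal_def)

lemma P_upper: "x \<in> P \<Longrightarrow> x \<in> upper"
  using \<eta>_props(4) by (force simp: upper_def)

lemma chi_B: "x \<in> B \<Longrightarrow> chi x = indicator P x"
  using B_subset_\<Omega> by (auto simp: P_eq split: split_indicator)

end

section \<open>Domain variations\<close>

lemma set_integral_linear_combination:
  fixes f1 f2 f3 f4 :: "'a \<Rightarrow> real"
  assumes "set_integrable M A f1" "set_integrable M A f2" "set_integrable M A f3" "set_integrable M A f4"
  shows "(LINT x:A|M. f1 x - 2 * f2 x + f3 x + f4 x) =
      (LINT x:A|M. f1 x) - 2 * (LINT x:A|M. f2 x) + (LINT x:A|M. f3 x) + (LINT x:A|M. f4 x)"
    and "(LINT x:A|M. f1 x - f2 x + 2 * (f3 x + f4 x)) =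
      (LINT x:A|M. f1 x) - (LINT x:A|M. f2 x) + 2 * ((LINT x:A|M. f3 x) + (LINT x:A|M. f4 x))"
  using assms by (simp_all add: set_integral_add set_integral_diff)

context subsonic_sol
begin

text \<open>On \<open>P\<close> this is the integrand of the functional \<open>I\<close>, by
  \<open>F_lam_P\<close>.\<close>

definition E :: "real^2 \<Rightarrow> real" where
  "E x = x $ 1 * (2 * tG x / \<eta> x + q x)"

lemma bc_E: "bc E"
proof -
  have "bc (\<lambda>x. x $ 1 * (2 * tG x * (1 / \<eta> x) + q x))" by (intro bc_intros)
  then show ?thesis by (simp add: E_def[abs_def])
qed

text \<open>In \<open>B\<close> off \<open>P\<close> every integrand of the domain variation formula
  vanishes almost everywhere, since there \<open>Du = 0\<close>, the characteristic function is 0,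
  and \<open>F\<close> and \<open>d2F\<close> vanish at \<open>t = 0\<close>. On \<open>P\<close>
  the coefficient of the first component of the field reduces to \<open>q\<close>.\<close>

lemma variation_identity:
  fixes \<phi> :: "2 \<Rightarrow> real^2 \<Rightarrow> real" and g\<phi> :: "2 \<Rightarrow> real^2 \<Rightarrow> real^2"
  assumes \<phi>: "\<And>i. C1grad UNIV (\<phi> i) (g\<phi> i)" and K: "compact K" "K \<subseteq> B" "\<And>i x. x \<notin> K \<Longrightarrow> \<phi> i x = 0"
  shows "(LINT x:P|lborel. E x * (g\<phi> 1 x $ 1 + g\<phi> 2 x $ 2)
       - 2 * (1 / \<eta> x * (1 / x $ 1) * (G x $ 1 * (g\<phi> 1 x \<bullet> G x) + G x $ 2 * (g\<phi> 2 x \<bullet> G x)))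
       + q x * \<phi> 1 x + x $ 1 * (\<eta> x / \<rho>0\<^sup>2) * \<phi> 2 x) = 0"
proof -
  define \<Phi>v :: "real^2 \<Rightarrow> real^2" where "\<Phi>v x = (\<chi> i. \<phi> i x)" for x
  define L :: "real^2 \<Rightarrow> real^2 \<Rightarrow> real^2" where "L x h = (\<chi> i. g\<phi> i x \<bullet> h)" for x h
  define D where "D x = Blinfun (L x)" for x
  have bl: "bounded_linear (L x)" for x
    unfolding linear_conv_bounded_linear[symmetric] by (rule linearI) (auto simp: L_def vec_eq_iff inner_add_right)
  have DL: "blinfun_apply (D x) = L x" for x unfolding D_def using bl by (rule bounded_linear_Blinfun_apply)
  have C1: "C1_on \<Omega> \<Phi>v D"
    unfolding C1_on_def
  proof (intro conjI ballI)
    fix x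
    show "(\<Phi>v has_derivative blinfun_apply (D x)) (at x within \<Omega>)"
      unfolding DL
      by (rule has_derivative_vec2) (use \<phi> in \<open>auto simp: \<Phi>v_def L_def C1grad_def intro: has_derivative_at_withinI\<close>)
  next
    have "continuous_on \<Omega> (g\<phi> i)" for i using \<phi>[of i] continuous_on_subset by (auto simp: C1grad_def)
    then show "continuous_on \<Omega> D"
      by (intro continuous_on_blinfun_componentwise) (auto simp: DL L_def intro!: continuous_on_vec_lambda continuous_intros)
  qed
  have cs: "compactly_supported_in \<Omega> \<Phi>v"
    unfolding compactly_supported_in_def using K B_subset_\<Omega> by (intro exI[of _ K]) (auto simp: \<Phi>v_def vec_eq_iff)
  have "K \<subseteq> U" using K(2) B_subset_U by blast
  then have "x \<notin> K" if "x $ 1 = 0" for x using that by auto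
  then have ax: "\<forall>x\<in>\<Omega>. x $ 1 = 0 \<longrightarrow> \<Phi>v x $ 1 = 0" using K(3) by (simp add: \<Phi>v_def)
  have "\<forall>\<phi> D. C1_on \<Omega> \<phi> D \<and> compactly_supported_in \<Omega> \<phi> \<and> (\<forall>x\<in>\<Omega>. x $ 1 = 0 \<longrightarrow> \<phi> x $ 1 = 0) \<longrightarrow>
        domain_variation_formula g \<rho>0 p \<Omega> u Du \<phi> D"
    using sol unfolding subsonic_variational_solution_def by (elim conjE)
  then have "domain_variation_formula g \<rho>0 p \<Omega> u Du \<Phi>v D" using C1 cs ax by blast
  then have dv: "0 = (LINT x:\<Omega> \<inter> upper|lebesgue.
             x $ 1 * (F (tfun Du x) (x $ 2) + lam g \<rho>0 p (x $ 2) * chi x) * trace (matrix (blinfun_apply (D x))))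
        - 2 * (LINT x:\<Omega> \<inter> upper|lebesgue.
             d1F g \<rho>0 p (tfun Du x) (x $ 2) * (1 / x $ 1) * (Du x \<bullet> D x (Du x)))
        + (LINT x:\<Omega> \<inter> upper|lebesgue.
             (F (tfun Du x) (x $ 2) - 2 * d1F g \<rho>0 p (tfun Du x) (x $ 2) * tfun Du x + lam g \<rho>0 p (x $ 2) * chi x) * \<Phi>v x $ 1)
        + (LINT x:\<Omega> \<inter> upper|lebesgue.
             x $ 1 * (d2F g \<rho>0 p (tfun Du x) (x $ 2) + deriv (lam g \<rho>0 p) (x $ 2) * chi x) * \<Phi>v x $ 2)"
    by (simp add: domain_variation_formula_def Let_def)
  have g0: "g\<phi> i x = 0" if "x \<notin> K" for i x
    using C1grad_zero_outside[OF \<phi> compact_imp_closed[OF K(1)] K(3) that] .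
  have tr: "trace (matrix (blinfun_apply (D x))) = g\<phi> 1 x $ 1 + g\<phi> 2 x $ 2" for x
    by (simp add: trace_def matrix_def DL L_def UNIV_2 inner_axis)
  have GD: "v \<bullet> D x v = v $ 1 * (g\<phi> 1 x \<bullet> v) + v $ 2 * (g\<phi> 2 x \<bullet> v)" for x v
    unfolding inner_real2[of v "D x v"] by (simp add: DL L_def)
  note bp = bc_C1grad[OF \<phi>]
  have b1: "bc (\<lambda>x. E x * (g\<phi> 1 x $ 1 + g\<phi> 2 x $ 2))" by (intro bc_intros bc_E bp)
  have b2: "bc (\<lambda>x. 1 / \<eta> x * (1 / x $ 1) * (G x $ 1 * (g\<phi> 1 x \<bullet> G x) + G x $ 2 * (g\<phi> 2 x \<bullet> G x)))"
    by (intro bc_intros bc_inner bp)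
  have b3: "bc (\<lambda>x. q x * \<phi> 1 x)" by (intro bc_intros bp)
  have b4: "bc (\<lambda>x. x $ 1 * (\<eta> x / \<rho>0\<^sup>2) * \<phi> 2 x)"
    unfolding divide_inverse by (intro bc_intros bp)
  have cases_ae: "AE x in lborel. (x \<in> P \<longrightarrow> Du x = G x) \<and> (x \<in> B \<longrightarrow> x \<notin> P \<longrightarrow> Du x = 0)"
    using Du_ae by eventually_elim (use P_subset(1) in auto)
  have reduce: "(LINT x:\<Omega> \<inter> upper|lebesgue. f x) = (LINT x:P|lborel. k x)"
    if "bc k" and inP: "\<And>x. x \<in> P \<Longrightarrow> Du x = G x \<Longrightarrow> f x = k x"
      and inB: "\<And>x. x \<in> B \<Longrightarrow> x \<notin> P \<Longrightarrow> Du x = 0 \<Longrightarrow> f x = 0"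
      and out: "\<And>x. x \<notin> K \<Longrightarrow> f x = 0 \<and> k x = 0" for f k
  proof (rule LINT_upper[OF that(1)])
    show "AE x in lborel. indicator (\<Omega> \<inter> upper) x *\<^sub>R f x = indicator P x *\<^sub>R k x"
      using cases_ae
    proof eventually_elim
      case (elim x)
      consider "x \<in> P" | "x \<in> B" "x \<notin> P" | "x \<notin> B" by blast
      then show ?case
      proof cases
        case 1
        then show ?thesis using inP[of x] elim P_upper[of x] P_subset by auto
      next
        case 2
        then show ?thesis using inB[of x] elim by auto
      next
        case 3
        then have "x \<notin> K" using K by blast
        then show ?thesis using out by simp
      qed
    qed
  qed
  have i1: "(LINT x:\<Omega> \<inter> upper|lebesgue.
             x $ 1 * (F (tfun Du x) (x $ 2) + lam g \<rho>0 p (x $ 2) * chi x) * trace (matrix (blinfun_apply (D x)))) =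
     (LINT x:P|lborel. E x * (g\<phi> 1 x $ 1 + g\<phi> 2 x $ 2))"
  proof (rule reduce[OF b1])
    fix x assume x: "x \<in> P" "Du x = G x"
    then show "x $ 1 * (F (tfun Du x) (x $ 2) + lam g \<rho>0 p (x $ 2) * chi x) * trace (matrix (blinfun_apply (D x))) = E x * (g\<phi> 1 x $ 1 + g\<phi> 2 x $ 2)"
      using tfun_P(1)[OF x(2)] chi_B[of x] P_subset(1) F_lam_P(1)[OF x(1)] by (auto simp: tr E_def)
  next
    fix x assume x: "x \<in> B" "x \<notin> P" "Du x = 0"
    then show "x $ 1 * (F (tfun Du x) (x $ 2) + lam g \<rho>0 p (x $ 2) * chi x) * trace (matrix (blinfun_apply (D x))) = 0"
      using tfun_P(2)[OF x(3)] chi_B[of x] by (simp add: F_0)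
  qed (simp add: tr g0)
  have i2: "(LINT x:\<Omega> \<inter> upper|lebesgue. d1F g \<rho>0 p (tfun Du x) (x $ 2) * (1 / x $ 1) * (Du x \<bullet> D x (Du x))) =
     (LINT x:P|lborel. 1 / \<eta> x * (1 / x $ 1) * (G x $ 1 * (g\<phi> 1 x \<bullet> G x) + G x $ 2 * (g\<phi> 2 x \<bullet> G x)))"
  proof (rule reduce[OF b2])
    fix x assume x: "x \<in> P" "Du x = G x"
    then show "d1F g \<rho>0 p (tfun Du x) (x $ 2) * (1 / x $ 1) * (Du x \<bullet> D x (Du x)) = 1 / \<eta> x * (1 / x $ 1) * (G x $ 1 * (g\<phi> 1 x \<bullet> G x) + G x $ 2 * (g\<phi> 2 x \<bullet> G x))"
      using tfun_P(1)[OF x(2)] by (simp add: GD d1F_def \<eta>_def)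
  qed (simp_all add: GD g0)
  have i3: "(LINT x:\<Omega> \<inter> upper|lebesgue.
             (F (tfun Du x) (x $ 2) - 2 * d1F g \<rho>0 p (tfun Du x) (x $ 2) * tfun Du x + lam g \<rho>0 p (x $ 2) * chi x) * \<Phi>v x $ 1) =
     (LINT x:P|lborel. q x * \<phi> 1 x)"
  proof (rule reduce[OF b3])
    fix x assume x: "x \<in> P" "Du x = G x"
    then have "chi x = 1" using chi_B[of x] P_subset(1) by auto
    then show "(F (tfun Du x) (x $ 2) - 2 * d1F g \<rho>0 p (tfun Du x) (x $ 2) * tfun Du x + lam g \<rho>0 p (x $ 2) * chi x) * \<Phi>v x $ 1 = q x * \<phi> 1 x"
      using tfun_P(1)[OF x(2)] F_lam_P(1)[OF x(1)] by (simp add: d1F_def \<Phi>v_def \<eta>_def[symmetric])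
  next
    fix x assume x: "x \<in> B" "x \<notin> P" "Du x = 0"
    then show "(F (tfun Du x) (x $ 2) - 2 * d1F g \<rho>0 p (tfun Du x) (x $ 2) * tfun Du x + lam g \<rho>0 p (x $ 2) * chi x) * \<Phi>v x $ 1 = 0"
      using tfun_P(2)[OF x(3)] chi_B[of x] by (simp add: F_0)
  qed (simp add: \<Phi>v_def K(3))
  have i4: "(LINT x:\<Omega> \<inter> upper|lebesgue.
             x $ 1 * (d2F g \<rho>0 p (tfun Du x) (x $ 2) + deriv (lam g \<rho>0 p) (x $ 2) * chi x) * \<Phi>v x $ 2) =
     (LINT x:P|lborel. x $ 1 * (\<eta> x / \<rho>0\<^sup>2) * \<phi> 2 x)"
  proof (rule reduce[OF b4])
    fix x assume x: "x \<in> P" "Du x = G x"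
    then have "chi x = 1" using chi_B[of x] P_subset(1) by auto
    then show "x $ 1 * (d2F g \<rho>0 p (tfun Du x) (x $ 2) + deriv (lam g \<rho>0 p) (x $ 2) * chi x) * \<Phi>v x $ 2 = x $ 1 * (\<eta> x / \<rho>0\<^sup>2) * \<phi> 2 x"
      using tfun_P(1)[OF x(2)] F_lam_P(2)[OF x(1)] by (simp add: \<Phi>v_def)
  next
    fix x assume x: "x \<in> B" "x \<notin> P" "Du x = 0"
    then show "x $ 1 * (d2F g \<rho>0 p (tfun Du x) (x $ 2) + deriv (lam g \<rho>0 p) (x $ 2) * chi x) * \<Phi>v x $ 2 = 0"
      using tfun_P(2)[OF x(3)] chi_B[of x] by (simp add: d2F_0)
  qed (simp add: \<Phi>v_def K(3))
  note s = bc_integrable[OF b1] bc_integrable[OF b2] bc_integrable[OF b3] bc_integrable[OF b4]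
  show ?thesis
    using dv unfolding i1 i2 i3 i4 set_integral_linear_combination(1)[OF s] by simp
qed

definition V :: "2 \<Rightarrow> real^2 \<Rightarrow> real" where
  "V i x = G x $ i * (1 / (x $ 1 * \<eta> x))"

definition gV :: "2 \<Rightarrow> real^2 \<Rightarrow> real^2" where
  "gV i x = (G x $ i) *\<^sub>R ((- 1 / (x $ 1 * \<eta> x)\<^sup>2) *\<^sub>R ((x $ 1) *\<^sub>R g\<eta> x + \<eta> x *\<^sub>R axis 1 1)) + (1 / (x $ 1 * \<eta> x)) *\<^sub>R gG i x"

lemma V_C1: "C1grad P (V i) (gV i)"
  unfolding V_def gV_def
  by (intro C1grad_mult C1grad_inverse gG_P C1grad_nth \<eta>_C1) (use \<eta>_props in force)

lemma bc_V: "bc (V i)"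
proof -
  have "bc (\<lambda>x. G x $ i * ((1 / x $ 1) * (1 / \<eta> x)))" by (intro bc_intros)
  then show ?thesis by (simp add: V_def[abs_def])
qed

text \<open>The chain rule applied to \<open>F + lam\<close> as a function of \<open>t\<close> and
  \<open>s\<close>, whose partial derivatives are \<open>1 / \<eta>\<close> and
  \<open>\<eta> / \<rho>0\<^sup>2\<close>; in this form the gradient of \<open>\<eta>\<close> drops
  out.\<close>

definition gE :: "real^2 \<Rightarrow> real^2" where
  "gE x = x $ 1 *\<^sub>R ((1 / \<eta> x) *\<^sub>R gt x + (\<eta> x / \<rho>0\<^sup>2) *\<^sub>R axis 2 1) + (2 * tG x / \<eta> x + q x) *\<^sub>R axis 1 1"

lemma E_C1: "C1grad P E gE"
proof (rule C1grad_transform[OF _ open_P])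
  have pos: "0 < \<eta> x" if "x \<in> P" for x using \<eta>_props(3)[OF that] .
  have cp: "C1grad P (\<lambda>x. p (\<eta> x)) (\<lambda>x. p' (\<eta> x) *\<^sub>R g\<eta> x)"
    by (rule C1grad_compose[OF \<eta>_C1])
       (use pos in \<open>auto intro!: p_deriv continuous_at_imp_continuous_on p'_isCont\<close>)
  show "C1grad P (\<lambda>x. x $ 1 * (2 * (tG x * (1 / \<eta> x)) + (1 / (g * \<rho>0\<^sup>2)) * (p (\<eta> x) + - p \<rho>0)))
    (\<lambda>x. x $ 1 *\<^sub>R ((2 *\<^sub>R (tG x *\<^sub>R ((- 1 / (\<eta> x)\<^sup>2) *\<^sub>R g\<eta> x) + (1 / \<eta> x) *\<^sub>R gt x) + (tG x * (1 / \<eta> x)) *\<^sub>R 0)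
        + ((1 / (g * \<rho>0\<^sup>2)) *\<^sub>R (p' (\<eta> x) *\<^sub>R g\<eta> x + 0) + (p (\<eta> x) + - p \<rho>0) *\<^sub>R 0))
      + (2 * (tG x * (1 / \<eta> x)) + (1 / (g * \<rho>0\<^sup>2)) * (p (\<eta> x) + - p \<rho>0)) *\<^sub>R axis 1 1)"
    by (intro C1grad_mult C1grad_add C1grad_const C1grad_inverse cp \<eta>_C1 tG_C1 C1grad_nth) (use pos in force)
  fix x assume x: "x \<in> P"
  show "x $ 1 * (2 * (tG x * (1 / \<eta> x)) + (1 / (g * \<rho>0\<^sup>2)) * (p (\<eta> x) + - p \<rho>0)) = E x"
    by (simp add: E_def q_def)
  define k where "k = T\<eta> (\<eta> x) (x $ 2)"
  have k: "k \<noteq> 0" using T\<eta>_neg \<eta>_props(1)[OF x] unfolding k_def by force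
  have k_eq: "k = 2 * tG x / \<eta> x - \<eta> x * p' (\<eta> x) / (g * \<rho>0\<^sup>2)"
    using T\<eta>_eq[OF S_in_Dom[OF x]] by (simp add: k_def \<eta>_def)
  \<comment> \<open>The terms with \<open>g\<eta>\<close> in the product rule combine to
    \<open>- k / \<eta>\<close> times it, and \<open>k *\<^sub>R g\<eta> x\<close> is known from
    implicit differentiation.\<close>
  have e: "k *\<^sub>R g\<eta> x = gt x - ((\<eta> x)\<^sup>2 / \<rho>0\<^sup>2) *\<^sub>R axis 2 1"
    using k by (simp add: g\<eta>_def k_def)
  have "2 *\<^sub>R (tG x *\<^sub>R ((- 1 / (\<eta> x)\<^sup>2) *\<^sub>R g\<eta> x) + (1 / \<eta> x) *\<^sub>R gt x) + (1 / (g * \<rho>0\<^sup>2)) *\<^sub>R (p' (\<eta> x) *\<^sub>R g\<eta> x)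
     = (2 / \<eta> x) *\<^sub>R gt x - (1 / \<eta> x) *\<^sub>R (k *\<^sub>R g\<eta> x)"
    unfolding k_eq using pos[OF x] g_pos \<rho>0_pos
    by (simp add: vec_eq_iff field_simps power2_eq_square)
  also have "\<dots> = (1 / \<eta> x) *\<^sub>R gt x + (\<eta> x / \<rho>0\<^sup>2) *\<^sub>R axis 2 1"
    unfolding e using pos[OF x] \<rho>0_pos by (simp add: vec_eq_iff field_simps power2_eq_square)
  finally show "x $ 1 *\<^sub>R ((2 *\<^sub>R (tG x *\<^sub>R ((- 1 / (\<eta> x)\<^sup>2) *\<^sub>R g\<eta> x) + (1 / \<eta> x) *\<^sub>R gt x) + (tG x * (1 / \<eta> x)) *\<^sub>R 0)
        + ((1 / (g * \<rho>0\<^sup>2)) *\<^sub>R (p' (\<eta> x) *\<^sub>R g\<eta> x + 0) + (p (\<eta> x) + - p \<rho>0) *\<^sub>R 0))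
      + (2 * (tG x * (1 / \<eta> x)) + (1 / (g * \<rho>0\<^sup>2)) * (p (\<eta> x) + - p \<rho>0)) *\<^sub>R axis 1 1 = gE x"
    by (simp add: gE_def q_def)
qed

text \<open>The explicit derivative in \<open>x\<^sub>j\<close>, at fixed \<open>v\<close>, of the
  Lagrangian \<open>x\<^sub>1 (F + \<lambda>)(\<bar>v\<bar>\<^sup>2 / x\<^sub>1\<^sup>2;
  x\<^sub>2)\<close>.\<close>

definition Rj :: "2 \<Rightarrow> real^2 \<Rightarrow> real" where
  "Rj j x = (if j = 1 then q x else x $ 1 * (\<eta> x / \<rho>0\<^sup>2))"

lemma bc_Rj: "bc (Rj j)"
proof -
  have "bc (\<lambda>x. x $ 1 * (\<eta> x * (1 / \<rho>0\<^sup>2)))" by (intro bc_intros)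
  then show ?thesis using bc_q exhaust_2[of j] by (auto simp: Rj_def[abs_def])
qed

text \<open>Noether's identity: by the following equation, the domain variation formula for fields in
  direction \<open>j\<close> supported in \<open>P\<close> is the weak form of \<open>\<partial>\<^sub>j u div V = 0\<close>.\<close>

lemma gE_eq:
  assumes x: "x \<in> P"
  shows "gE x $ j = 2 * (V 1 x * gG 1 x $ j + V 2 x * gG 2 x $ j) + Rj j x"
proof -
  note e = \<eta>_props[OF x]
  have t: "tG x * (x $ 1)\<^sup>2 = (norm (G x))\<^sup>2" using e by (simp add: tG_def)
  have gtj: "gt x $ j = 2 * (G x $ 1 * gG 1 x $ j + G x $ 2 * gG 2 x $ j) / (x $ 1)\<^sup>2 - 2 * tG x / x $ 1 * (axis 1 1 :: real^2) $ j"
    using e unfolding gt_def t[symmetric] by (simp add: field_simps power2_eq_square power3_eq_cube)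
  have "x $ 1 * (1 / \<eta> x * gt x $ j) = 2 * (V 1 x * gG 1 x $ j + V 2 x * gG 2 x $ j) - 2 * tG x / \<eta> x * (axis 1 1 :: real^2) $ j"
    unfolding gtj using e by (simp add: V_def field_simps power2_eq_square)
  then show ?thesis
    using exhaust_2[of j] e by (auto simp: gE_def Rj_def axis_def algebra_simps)
qed

lemma divV_times_G: 
  assumes x: "x \<in> P"
  shows "G x $ j * (gV 1 x $ 1 + gV 2 x $ 2) = 0"
proof -
  \<comment> \<open>What multiplies \<open>\<psi>\<close> once its derivatives are removed by the
    two vanishing divergence integrals \<open>z1\<close> and \<open>z2\<close>; by
    \<open>gE_eq\<close> and the symmetry of second derivatives it is twice the product in the
    claim.\<close>
  define k where "k x = - gE x $ j + 2 * ((V 1 x * gG j x $ 1 + G x $ j * gV 1 x $ 1) + (V 2 x * gG j x $ 2 + G x $ j * gV 2 x $ 2)) + Rj j x" for x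
  have cont: "continuous_on P (\<lambda>x. gE x $ j)" "continuous_on P (\<lambda>x. gG i x $ l)" "continuous_on P (\<lambda>x. gV i x $ l)" "continuous_on P (\<lambda>x. G x $ l)"
    "continuous_on P (V i)" "continuous_on P (Rj j)" for i l
  proof -
    have c: "continuous_on P gE" "continuous_on P (gG i)" "continuous_on P (gV i)"
      using E_C1 gG_P[of i] V_C1[of i] by (simp_all add: C1grad_def)
    show "continuous_on P (\<lambda>x. gE x $ j)" "continuous_on P (\<lambda>x. gG i x $ l)" "continuous_on P (\<lambda>x. gV i x $ l)"
      by (intro bounded_linear.continuous_on[OF bounded_linear_vec_nth] c)+
    show "continuous_on P (\<lambda>x. G x $ l)" "continuous_on P (V i)" "continuous_on P (Rj j)"
      using C1grad_continuous_on[OF V_C1[of i]] C1grad_continuous_on[OF gG_P[of l]] bc_Rj[of j]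
      by (simp_all add: bc_def)
  qed
  have "k x = 0"
  proof (rule continuous_zero_if_test_zero[OF open_P _ _ x])
    show "continuous_on P k" unfolding k_def by (intro continuous_intros cont)
    fix \<psi> g\<psi> K assume \<psi>: "C1grad UNIV \<psi> g\<psi>" "compact K" "K \<subseteq> P" "\<And>x. x \<notin> K \<Longrightarrow> \<psi> x = 0"
    have KB: "K \<subseteq> B" using \<psi>(3) P_subset by blast
    have \<psi>P: "C1grad P \<psi> g\<psi>" using C1grad_subset[OF \<psi>(1)] by simp
    define \<phi> where "\<phi> i x = (if i = j then \<psi> x else 0)" for i x
    define g\<phi> where "g\<phi> i x = (if i = j then g\<psi> x else 0)" for i x
    have C: "C1grad UNIV (\<phi> i) (g\<phi> i)" for i
      using \<psi>(1) C1grad_const[of UNIV 0] by (cases "i = j") (simp_all add: \<phi>_def[abs_def] g\<phi>_def[abs_def])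
    have v: "(LINT x:P|lborel. E x * (g\<phi> 1 x $ 1 + g\<phi> 2 x $ 2)
       - 2 * (1 / \<eta> x * (1 / x $ 1) * (G x $ 1 * (g\<phi> 1 x \<bullet> G x) + G x $ 2 * (g\<phi> 2 x \<bullet> G x)))
       + q x * \<phi> 1 x + x $ 1 * (\<eta> x / \<rho>0\<^sup>2) * \<phi> 2 x) = 0"
      by (rule variation_identity[OF C \<psi>(2) KB]) (use \<psi>(4) in \<open>auto simp: \<phi>_def\<close>)
    have v_eq: "E x * (g\<phi> 1 x $ 1 + g\<phi> 2 x $ 2)
       - 2 * (1 / \<eta> x * (1 / x $ 1) * (G x $ 1 * (g\<phi> 1 x \<bullet> G x) + G x $ 2 * (g\<phi> 2 x \<bullet> G x)))
       + q x * \<phi> 1 x + x $ 1 * (\<eta> x / \<rho>0\<^sup>2) * \<phi> 2 x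
       = E x * g\<psi> x $ j - 2 * (V 1 x * G x $ j * g\<psi> x $ 1 + V 2 x * G x $ j * g\<psi> x $ 2) + Rj j x * \<psi> x" for x
      using exhaust_2[of j] by (auto simp: \<phi>_def g\<phi>_def Rj_def V_def inner_real2 algebra_simps)
    have z1: "(LINT x:P|lborel. (\<psi> x *\<^sub>R gE x + E x *\<^sub>R g\<psi> x) $ j) = 0"
      by (rule integral_gradient_zero[OF open_P \<psi>(2,3) _ C1grad_mult[OF \<psi>P E_C1]]) (use \<psi>(4) in simp)
    have z2: "(LINT x:P|lborel. (\<psi> x *\<^sub>R (V i x *\<^sub>R gG j x + (G x $ j) *\<^sub>R gV i x) + (V i x * G x $ j) *\<^sub>R g\<psi> x) $ i) = 0" for i
      by (rule integral_gradient_zero[OF open_P \<psi>(2,3) _ C1grad_mult[OF \<psi>P C1grad_mult[OF V_C1 gG_P]]]) (use \<psi>(4) in simp)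
    \<comment> \<open>Second derivatives of \<open>u\<close> may be unbounded on \<open>P\<close>;
      here the compact support of \<open>\<psi>\<close> inside \<open>P\<close> provides
      integrability.\<close>
    have int: "set_integrable lborel P (\<lambda>x. f x * \<psi> x)" "set_integrable lborel P (\<lambda>x. f x * g\<psi> x $ l)" if f: "continuous_on P f" for f l
    proof -
      have g0: "g\<psi> x = 0" if "x \<notin> K" for x
        using C1grad_zero_outside[OF \<psi>(1) compact_imp_closed[OF \<psi>(2)] \<psi>(4) that] .
      have main: "set_integrable lborel P r" if r: "continuous_on P r" "\<And>x. x \<notin> K \<Longrightarrow> r x = 0" for r :: "real^2 \<Rightarrow> real"
      proof -
        have "compact (r ` K)" by (intro compact_continuous_image continuous_on_subset[OF r(1) \<psi>(3)] \<psi>(2))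
        then obtain M where M: "\<And>y. y \<in> r ` K \<Longrightarrow> \<bar>y\<bar> \<le> M" using compact_imp_bounded bounded_real by metis
        have "bc r"
        proof (rule bcI[OF r(1), of "\<bar>M\<bar>"])
          fix x show "\<bar>r x\<bar> \<le> \<bar>M\<bar>" using M[of "r x"] r(2)[of x] by (cases "x \<in> K") auto
        qed
        then show ?thesis by (rule bc_integrable)
      qed
      have "continuous_on P \<psi>" "continuous_on P (\<lambda>x. g\<psi> x $ l)"
        using C1grad_continuous_on[OF \<psi>P] \<psi>P by (auto simp: C1grad_def intro!: continuous_on_component)
      then show "set_integrable lborel P (\<lambda>x. f x * \<psi> x)" "set_integrable lborel P (\<lambda>x. f x * g\<psi> x $ l)"
        using f \<psi>(4) g0 by (auto intro!: main continuous_intros)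
    qed
    have i1: "set_integrable lborel P (\<lambda>x. (\<psi> x *\<^sub>R gE x + E x *\<^sub>R g\<psi> x) $ j)"
      using set_integral_add(1)[OF int(1)[OF cont(1)] int(2)[OF C1grad_continuous_on[OF E_C1]]] by (simp add: mult.commute)
    have i2: "set_integrable lborel P (\<lambda>x. (\<psi> x *\<^sub>R (V i x *\<^sub>R gG j x + (G x $ j) *\<^sub>R gV i x) + (V i x * G x $ j) *\<^sub>R g\<psi> x) $ i)" for i
    proof -
      have "continuous_on P (\<lambda>x. V i x * gG j x $ i + G x $ j * gV i x $ i)" "continuous_on P (\<lambda>x. V i x * G x $ j)"
        by (intro continuous_intros cont)+
      from set_integral_add(1)[OF int(1)[OF this(1)] int(2)[OF this(2), of i]] show ?thesis by (simp add: mult.commute)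
    qed
    have i3: "set_integrable lborel P (\<lambda>x. E x * g\<psi> x $ j - 2 * (V 1 x * G x $ j * g\<psi> x $ 1 + V 2 x * G x $ j * g\<psi> x $ 2) + Rj j x * \<psi> x)"
      by (intro set_integral_add(1) set_integral_diff(1) set_integrable_mult_right int cont C1grad_continuous_on[OF E_C1] continuous_intros)
    have "(LINT x:P|lborel. (E x * g\<psi> x $ j - 2 * (V 1 x * G x $ j * g\<psi> x $ 1 + V 2 x * G x $ j * g\<psi> x $ 2) + Rj j x * \<psi> x)
        - (\<psi> x *\<^sub>R gE x + E x *\<^sub>R g\<psi> x) $ j
        + 2 * ((\<psi> x *\<^sub>R (V 1 x *\<^sub>R gG j x + (G x $ j) *\<^sub>R gV 1 x) + (V 1 x * G x $ j) *\<^sub>R g\<psi> x) $ 1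
             + (\<psi> x *\<^sub>R (V 2 x *\<^sub>R gG j x + (G x $ j) *\<^sub>R gV 2 x) + (V 2 x * G x $ j) *\<^sub>R g\<psi> x) $ 2)) = 0"
      unfolding set_integral_linear_combination(2)[OF i3 i1 i2 i2] z1 z2 using v[unfolded v_eq] by simp
    then show "(LINT x:P|lborel. k x * \<psi> x) = 0"
      by (simp add: k_def algebra_simps)
  qed
  then have "2 * (G x $ j * (gV 1 x $ 1 + gV 2 x $ 2)) = gE x $ j - 2 * (V 1 x * gG j x $ 1 + V 2 x * gG j x $ 2) - Rj j x"
    by (simp add: k_def algebra_simps)
  also have "\<dots> = 0" using gE_eq[OF x, of j] gG_sym[of x j] P_subset(3) x by auto
  finally show ?thesis by simp
qed

lemma divV_zero:
  assumes x: "x \<in> P"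
  shows "gV 1 x $ 1 + gV 2 x $ 2 = 0"
proof (rule ccontr)
  assume ne: "gV 1 x $ 1 + gV 2 x $ 2 \<noteq> 0"
  have "continuous_on P (\<lambda>x. gV 1 x $ 1 + gV 2 x $ 2)"
    using V_C1[of 1] V_C1[of 2] by (auto simp: C1grad_def intro!: continuous_intros)
  then have o: "open (P \<inter> (\<lambda>x. gV 1 x $ 1 + gV 2 x $ 2) -` (- {0}))" (is "open ?N")
    using open_P by (intro continuous_open_preimage) auto
  have xN: "x \<in> ?N" using x ne by simp
  have G0: "G y = 0" if "y \<in> ?N" for y
    using divV_times_G[of y 1] divV_times_G[of y 2] that by (auto simp: vec_eq_iff forall_2)
  have "gV i x = 0" for i
  proof -
    have "(V i has_derivative (\<lambda>_. 0)) (at x)"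
      by (rule has_derivative_transform_within_open[OF has_derivative_const o xN]) (use G0 in \<open>simp add: V_def\<close>)
    moreover have "(V i has_derivative (\<lambda>h. gV i x \<bullet> h)) (at x)" using V_C1[of i] x by (simp add: C1grad_def)
    ultimately have "(\<lambda>_. 0) = (\<lambda>h. gV i x \<bullet> h)" by (rule has_derivative_unique)
    then have "gV i x \<bullet> gV i x = 0" by metis
    then show ?thesis by simp
  qed
  then show False using ne by simp
qed

end

section \<open>Identities on almost every circle\<close>

text \<open>Integrands containing \<open>Du\<close> need not be Borel on a circle. As
  \<open>hausdorff1\<close> is complete, agreement almost everywhere with a measurable
  \<open>k\<close> makes them measurable.\<close>

lemma integral_cong_AE_complete:
  fixes f k :: "'a \<Rightarrow> real"
  assumes "complete_measure M" and k: "k \<in> borel_measurable M" and eq: "AE x in M. f x = k x"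
  shows "integral\<^sup>L M f = integral\<^sup>L M k"
proof (rule integral_cong_AE[OF _ k eq])
  obtain N where N: "N \<in> null_sets M" "{x \<in> space M. f x \<noteq> k x} \<subseteq> N"
    using eq unfolding eventually_ae_filter by blast
  show "f \<in> borel_measurable M"
  proof (rule measurableI)
    fix S :: "real set" assume S: "S \<in> sets borel"
    have "f -` S \<inter> space M = (k -` S \<inter> space M - N) \<union> (f -` S \<inter> space M \<inter> N)"
      using N(2) by auto
    moreover have "f -` S \<inter> space M \<inter> N \<in> sets M"
      using complete_measure.complete[OF assms(1) Int_lower2 N(1)] .
    moreover have "k -` S \<inter> space M - N \<in> sets M" using measurable_sets[OF k S] N(1) by blast
    ultimately show "f -` S \<inter> space M \<in> sets M" by (metis sets.Un)
  qed simp
qed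

lemma continuous_ae_eq_imp_eq:
  fixes f k :: "real \<Rightarrow> real"
  assumes c: "continuous_on {a<..<b} f" "continuous_on {a<..<b} k"
    and ae: "AE r in lborel. r \<in> {a<..<b} \<longrightarrow> f r = k r" and x: "x \<in> {a<..<b}"
  shows "f x = k x"
proof (rule ccontr)
  assume ne: "f x \<noteq> k x"
  define W where "W = {a<..<b} \<inter> (\<lambda>r. f r - k r) -` (- {0})"
  have oW: "open W" unfolding W_def by (intro continuous_open_preimage continuous_intros c)
  have "AE r in lborel. r \<notin> W" using ae by eventually_elim (auto simp: W_def)
  then have "W \<in> null_sets lborel" using oW AE_iff_null_sets[of W lborel] by (simp add: borel_open)
  then have "negligible W" using negligible_iff_null_sets null_sets_completionI by blast
  then have "W = {}" using open_not_negligible[OF oW] by blast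
  moreover have "x \<in> W" using ne x by (simp add: W_def)
  ultimately show False by blast
qed

context subsonic_sol
begin

text \<open>The indicator of \<open>P\<close> sits in the integrand, here and in \<open>Cc\<close>,
  so that the polar coordinate formulas apply to full discs and circles.\<close>

definition A :: "(real^2 \<Rightarrow> real) \<Rightarrow> real \<Rightarrow> real" where
  "A k r = (LINT x:ball x0 r|lborel. indicator P x * k x)"

definition Cc :: "(real^2 \<Rightarrow> real) \<Rightarrow> real \<Rightarrow> real" where
  "Cc k r = (LINT x:sphere x0 r|hausdorff1. indicator P x * k x)"

lemma bc_borel: "bc k \<Longrightarrow> (\<lambda>x. indicator P x * k x) \<in> borel_measurable borel"
  using bc_measurable by simp

lemma bc_bound: assumes "bc k" obtains M where "\<And>x. \<bar>indicator P x * k x\<bar> \<le> M"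
proof -
  obtain M where M: "\<And>x. x \<in> P \<Longrightarrow> \<bar>k x\<bar> \<le> M" using assms by (auto simp: bc_def)
  have "\<bar>indicator P x * k x\<bar> \<le> \<bar>M\<bar>" for x using M[of x] by (cases "x \<in> P") auto
  then show ?thesis using that by blast
qed

lemma A_integrable: assumes "bc k" shows "set_integrable lborel (ball x0 r) (\<lambda>x. indicator P x * k x)"
proof -
  obtain M where "\<And>x. \<bar>indicator P x * k x\<bar> \<le> M" using bc_bound[OF assms] by blast
  then show ?thesis by (intro set_integrable_bounded[OF bc_borel[OF assms]]) auto
qed

lemma Cc_integrable: assumes "bc k" "0 < r" shows "set_integrable hausdorff1 (sphere x0 r) (\<lambda>x. indicator P x * k x)"
proof -
  obtain M where M: "\<And>x. \<bar>indicator P x * k x\<bar> \<le> M" using bc_bound[OF assms(1)] by blast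
  have mc: "circ x0 r \<in> borel_measurable borel" by (intro borel_measurable_continuous_onI continuous_intros)
  have "set_integrable lborel {0..<2*pi} (\<lambda>\<theta>. indicator P (circ x0 r \<theta>) * k (circ x0 r \<theta>))"
    by (rule set_integrable_bounded[OF measurable_compose[OF mc bc_borel[OF assms(1)]]])
       (auto intro: M bounded_subset[OF bounded_closed_interval[of 0 "2*pi"]])
  then show ?thesis using circle_integrable[OF assms(2) bc_borel[OF assms(1)]] by simp
qed

lemma A_add: "bc f \<Longrightarrow> bc k \<Longrightarrow> A (\<lambda>x. f x + k x) r = A f r + A k r"
  unfolding A_def distrib_left by (rule set_integral_add(2)[OF A_integrable A_integrable])

lemma Cc_add: "0 < r \<Longrightarrow> bc f \<Longrightarrow> bc k \<Longrightarrow> Cc (\<lambda>x. f x + k x) r = Cc f r + Cc k r"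
  unfolding Cc_def distrib_left by (rule set_integral_add(2)[OF Cc_integrable Cc_integrable])

lemma A_cmult: "A (\<lambda>x. a * f x) r = a * A f r"
  unfolding A_def mult.left_commute[of _ a] by simp

lemma Cc_cmult: "Cc (\<lambda>x. a * f x) r = a * Cc f r"
  unfolding Cc_def mult.left_commute[of _ a] by simp

lemma Cc_cong: "(\<And>x. x \<in> P \<Longrightarrow> norm (x - x0) = r \<Longrightarrow> f x = k x) \<Longrightarrow> Cc f r = Cc k r"
  unfolding Cc_def set_lebesgue_integral_def
  by (intro Bochner_Integration.integral_cong refl)
     (auto simp: dist_norm norm_minus_commute split: split_indicator)

lemma radial_identity:
  assumes a: "bc a" and b: "bc b"
    and test: "\<And>e \<sigma>. 0 < e \<Longrightarrow> 0 < \<sigma> \<Longrightarrow> \<sigma> < \<delta>\<^sup>2 \<Longrightarrow>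
      (LINT x:P|lborel. ppart e (\<sigma> - (norm (x - x0))\<^sup>2) * a x) =
      (LINT x:P|lborel. dppart e (\<sigma> - (norm (x - x0))\<^sup>2) * b x)"
  shows "AE r in lborel. r \<in> {0<..<\<delta>} \<longrightarrow> 2 * r * A a r = Cc b r"
proof -
  obtain M where M: "\<And>x. \<bar>indicator P x * a x\<bar> \<le> M" using bc_bound[OF a] by blast
  obtain M' where M': "\<And>x. \<bar>indicator P x * b x\<bar> \<le> M'" using bc_bound[OF b] by blast
  have e: "(LINT x:B|lborel. f x * (indicator P x * k x)) = (LINT x:P|lborel. f x * k x)" for f k :: "real^2 \<Rightarrow> real"
    unfolding set_lebesgue_integral_def using P_subset(1)
    by (intro Bochner_Integration.integral_cong refl) (auto split: split_indicator)
  show ?thesis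
    unfolding A_def Cc_def
  proof (rule radial_test_functions[OF bc_borel[OF a] bc_borel[OF b], where M="max M M'"])
    show "\<bar>indicator P x * a x\<bar> \<le> max M M'" "\<bar>indicator P x * b x\<bar> \<le> max M M'" for x
      using M[of x] M'[of x] by auto
    fix e \<sigma> :: real assume "0 < e" "0 < \<sigma>" "\<sigma> < \<delta>\<^sup>2"
    then show "(LINT x:B|lborel. ppart e (\<sigma> - (norm (x - x0))\<^sup>2) * (indicator P x * a x)) =
      (LINT x:B|lborel. dppart e (\<sigma> - (norm (x - x0))\<^sup>2) * (indicator P x * b x))"
      unfolding e by (rule test)
  qed
qed

lemma A_deriv:
  assumes "bc k" shows "AE r in lborel. r \<in> {0<..<\<delta>} \<longrightarrow> (A k has_real_derivative Cc k r) (at r)"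
proof -
  obtain M where M: "\<And>x. \<bar>indicator P x * k x\<bar> \<le> M" using bc_bound[OF assms] by blast
  show ?thesis
    unfolding A_def[abs_def] Cc_def by (rule AE_ball_integral_deriv[OF bc_borel[OF assms] M])
qed

definition \<zeta> :: "real \<Rightarrow> real \<Rightarrow> real^2 \<Rightarrow> real" where
  "\<zeta> e \<sigma> x = ppart e (\<sigma> - (norm (x - x0))\<^sup>2)"

definition d\<zeta> :: "real \<Rightarrow> real \<Rightarrow> real^2 \<Rightarrow> real" where
  "d\<zeta> e \<sigma> x = dppart e (\<sigma> - (norm (x - x0))\<^sup>2)"

lemma \<zeta>_C1: "0 < e \<Longrightarrow> C1grad UNIV (\<zeta> e \<sigma>) (\<lambda>x. (- 2 * d\<zeta> e \<sigma> x) *\<^sub>R (x - x0))"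
proof -
  assume e: "0 < e"
  have s: "C1grad UNIV (\<lambda>x. \<sigma> - (norm (x - x0))\<^sup>2) (\<lambda>x. (- 2) *\<^sub>R (x - x0))"
    unfolding C1grad_def
  proof (intro conjI ballI)
    fix x
    have "((\<lambda>x. \<sigma> - (x - x0) \<bullet> (x - x0)) has_derivative (\<lambda>h. 0 - ((x - x0) \<bullet> h + h \<bullet> (x - x0)))) (at x)"
      by (auto intro!: derivative_eq_intros)
    then show "((\<lambda>x. \<sigma> - (norm (x - x0))\<^sup>2) has_derivative (\<lambda>h. ((- 2) *\<^sub>R (x - x0)) \<bullet> h)) (at x)"
      by (simp add: power2_norm_eq_inner inner_commute)
  qed (intro continuous_intros)
  have "C1grad UNIV (\<lambda>x. ppart e (\<sigma> - (norm (x - x0))\<^sup>2)) (\<lambda>x. dppart e (\<sigma> - (norm (x - x0))\<^sup>2) *\<^sub>R (- 2) *\<^sub>R (x - x0))"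
    by (rule C1grad_compose[OF s ppart_deriv[OF e] continuous_on_dppart[OF e]])
  then show ?thesis by (simp add: \<zeta>_def[abs_def] d\<zeta>_def mult.commute)
qed

lemma \<zeta>_support:
  assumes "0 < \<sigma>" "\<sigma> < \<delta>\<^sup>2"
  shows "compact (cball x0 (sqrt \<sigma>))" "cball x0 (sqrt \<sigma>) \<subseteq> B" "x \<notin> cball x0 (sqrt \<sigma>) \<Longrightarrow> \<zeta> e \<sigma> x = 0"
proof -
  have "sqrt \<sigma> < \<delta>" using assms \<delta>_pos by (simp add: real_less_lsqrt)
  then show "cball x0 (sqrt \<sigma>) \<subseteq> B" by auto
  assume "x \<notin> cball x0 (sqrt \<sigma>)"
  then have "sqrt \<sigma> < norm (x - x0)" by (simp add: dist_norm norm_minus_commute)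
  then have "(sqrt \<sigma>)\<^sup>2 < (norm (x - x0))\<^sup>2" using assms by (intro power_strict_mono) auto
  then show "\<zeta> e \<sigma> x = 0" using assms unfolding \<zeta>_def by (intro ppart_bounds(4)) simp
qed simp

lemma bc_\<zeta>: "0 < e \<Longrightarrow> bc (\<zeta> e \<sigma>)" and bc_d\<zeta>: "0 < e \<Longrightarrow> bc (d\<zeta> e \<sigma>)"
proof -
  assume e: "0 < e"
  show "bc (\<zeta> e \<sigma>)" by (rule bc_C1grad(1)[OF \<zeta>_C1[OF e]])
  show "bc (d\<zeta> e \<sigma>)" unfolding d\<zeta>_def[abs_def]
    by (intro bc_cont continuous_on_compose2[OF continuous_on_dppart[OF e, of UNIV]] continuous_intros) auto
qed

definition X :: "2 \<Rightarrow> real^2 \<Rightarrow> real" where "X i x = x $ i - x0 $ i"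

lemma bc_X: "bc (X i)" unfolding X_def[abs_def] by (intro bc_intros)

lemma X_sq: "X 1 x * X 1 x + X 2 x * X 2 x = (norm (x - x0))\<^sup>2"
  by (simp add: X_def norm2_sq)

text \<open>\<open>XG\<close> is \<open>r\<close> times the normal derivative of \<open>u\<close> on the circle of radius \<open>r\<close>.\<close>

definition "XG x = X 1 x * G x $ 1 + X 2 x * G x $ 2"
definition "iH x = 1 / x $ 1 * (1 / \<eta> x)"
definition "i0 x = 1 / x $ 1 * (1 / \<rho>0)" for x :: "real^2"
text \<open>The density of the Dirichlet energy, equal to \<open>x $ 1 * tG x / \<eta> x\<close> on
  \<open>P\<close>.\<close>

definition "en x = (G x $ 1 * G x $ 1 + G x $ 2 * G x $ 2) * iH x"
text \<open>This and the next three definitions are the integrands of \<open>K 6\<close>,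
  \<open>K 1\<close>, \<open>K 2\<close> and \<open>K 3\<close> on \<open>P\<close>, in closed
  form.\<close>

definition "f6 x = X 1 x * (1 / x $ 1 * i0 x) * (u x * u x)"
definition "k1 x = x $ 1 * (x $ 2 * (1 / \<rho>0) - tG x * (1 / \<eta> x) - q x)"
definition "k2 x = x $ 1 * (x $ 2 * (\<eta> x - \<rho>0) * (1 / \<rho>0\<^sup>2))"
definition "k3 x = X 1 x * q x"

lemma bc_defs: "bc XG" "bc iH" "bc i0" "bc en" "bc f6" "bc k1" "bc k2" "bc k3"
proof -
  show 1: "bc XG" unfolding XG_def by (intro bc_intros bc_X)
  show 2: "bc iH" unfolding iH_def by (intro bc_intros)
  show 3: "bc i0" unfolding i0_def by (intro bc_intros)
  show "bc en" unfolding en_def by (intro bc_intros 2)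
  show "bc f6" unfolding f6_def by (intro bc_intros bc_X 3)
  show "bc k1" unfolding k1_def by (intro bc_intros)
  show "bc k2" unfolding k2_def by (intro bc_intros)
  show "bc k3" unfolding k3_def by (intro bc_intros bc_X)
qed

lemmas bcs = bc_intros bc_defs bc_X bc_E

text \<open>A radial test function of the squared distance has a gradient along
  \<open>- 2 * (x - x0)\<close>, which paired with \<open>V\<close> gives the normal flux times the
  radius. As \<open>V\<close> is divergence free, \<open>en\<close> is the whole divergence of
  \<open>u V\<close>.\<close>

lemma energy_identity:
  "AE r in lborel. r \<in> {0<..<\<delta>} \<longrightarrow> 2 * r * A en r = Cc (\<lambda>x. 2 * (u x * (XG x * iH x))) r"
proof (rule radial_identity)
  show "bc en" "bc (\<lambda>x. 2 * (u x * (XG x * iH x)))" by (intro bcs)+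
  fix e \<sigma> :: real assume h: "0 < e" "0 < \<sigma>" "\<sigma> < \<delta>\<^sup>2"
  have z: "bc (\<lambda>x. gV 1 x $ 1 + gV 2 x $ 2)"
  proof (rule bcI[of _ 0])
    show "continuous_on P (\<lambda>x. gV 1 x $ 1 + gV 2 x $ 2)"
      by (rule continuous_on_eq[OF continuous_on_const[of _ 0]]) (simp add: divV_zero)
  qed (simp add: divV_zero)
  have "(LINT x:P|lborel. \<zeta> e \<sigma> x * (G x $ 1 * V 1 x + G x $ 2 * V 2 x + u x * (gV 1 x $ 1 + gV 2 x $ 2)))
     = - (LINT x:P|lborel. u x * (((- 2 * d\<zeta> e \<sigma> x) *\<^sub>R (x - x0)) $ 1 * V 1 x + ((- 2 * d\<zeta> e \<sigma> x) *\<^sub>R (x - x0)) $ 2 * V 2 x))"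
    by (rule positivity_identity[OF V_C1 bc_V z \<zeta>_C1[OF h(1)] \<zeta>_support(1,2)[OF h(2,3)] \<zeta>_support(3)[OF h(2,3)]])
  moreover have "(LINT x:P|lborel. \<zeta> e \<sigma> x * (G x $ 1 * V 1 x + G x $ 2 * V 2 x + u x * (gV 1 x $ 1 + gV 2 x $ 2))) = (LINT x:P|lborel. \<zeta> e \<sigma> x * en x)"
    using open_P by (intro set_lebesgue_integral_cong) (auto simp: divV_zero V_def en_def iH_def algebra_simps)
  moreover have "- (LINT x:P|lborel. u x * (((- 2 * d\<zeta> e \<sigma> x) *\<^sub>R (x - x0)) $ 1 * V 1 x + ((- 2 * d\<zeta> e \<sigma> x) *\<^sub>R (x - x0)) $ 2 * V 2 x))
     = (LINT x:P|lborel. d\<zeta> e \<sigma> x * (2 * (u x * (XG x * iH x))))"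
    unfolding set_lebesgue_integral_def integral_minus[symmetric]
    by (intro Bochner_Integration.integral_cong refl) (simp add: V_def XG_def X_def iH_def algebra_simps)
  ultimately show "(LINT x:P|lborel. ppart e (\<sigma> - (norm (x - x0))\<^sup>2) * en x) = (LINT x:P|lborel. dppart e (\<sigma> - (norm (x - x0))\<^sup>2) * (2 * (u x * (XG x * iH x))))"
    by (simp add: \<zeta>_def d\<zeta>_def)
qed

text \<open>The divergence of \<open>u\<^sup>2 (x - x0) / (x\<^sub>1 \<rho>0)\<close>. The dimension
  contributes the factor 2 of the second term; differentiating the weight
  \<open>1 / x\<^sub>1\<close> gives \<open>f6\<close>, the origin of \<open>K 6\<close>.\<close>

definition "aJ x = 2 * (u x * (XG x * i0 x)) + 2 * (u x * u x * i0 x) - f6 x"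

lemma J_identity:
  "AE r in lborel. r \<in> {0<..<\<delta>} \<longrightarrow> 2 * r * A aJ r = Cc (\<lambda>x. 2 * (norm (x - x0))\<^sup>2 * (u x * u x * i0 x)) r"
proof (rule radial_identity)
  show "bc aJ" unfolding aJ_def by (intro bcs)
  have "bc (\<lambda>x. 2 * (X 1 x * X 1 x + X 2 x * X 2 x) * (u x * u x * i0 x))" by (intro bcs)
  then show b: "bc (\<lambda>x. 2 * (norm (x - x0))\<^sup>2 * (u x * u x * i0 x))" unfolding X_sq .
  fix e \<sigma> :: real assume h: "0 < e" "0 < \<sigma>" "\<sigma> < \<delta>\<^sup>2"
  \<comment> \<open>Of the two factors \<open>u\<close> of the field, one is supplied by the cut-off
    in \<open>positivity_identity\<close>, so \<open>w\<close> carries only the other.\<close>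
  define w where "w i x = u x * ((x $ i + - x0 $ i) * (1 / x $ 1 * (1 / \<rho>0)))" for i :: 2 and x :: "real^2"
  define gw where "gw i x = u x *\<^sub>R ((x $ i + - x0 $ i) *\<^sub>R ((1 / x $ 1) *\<^sub>R 0 + (1 / \<rho>0) *\<^sub>R ((- 1 / (x $ 1)\<^sup>2) *\<^sub>R axis 1 1))
      + (1 / x $ 1 * (1 / \<rho>0)) *\<^sub>R (axis i 1 + 0)) + ((x $ i + - x0 $ i) * (1 / x $ 1 * (1 / \<rho>0))) *\<^sub>R G x" for i :: 2 and x :: "real^2"
  have x1: "x $ 1 \<noteq> 0" if "x \<in> P" for x using \<eta>_props(6)[OF that] by simp
  have wC: "C1grad P (w i) (gw i)" for i
    unfolding w_def gw_def
    by (intro C1grad_mult C1grad_add G_P C1grad_nth C1grad_const C1grad_inverse) (use x1 in auto)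
  have bw: "bc (w i)" for i
  proof -
    have "bc (\<lambda>x. u x * (X i x * i0 x))" by (intro bcs)
    then show ?thesis by (simp add: w_def[abs_def] X_def i0_def)
  qed
  have P_sets: "P \<in> sets lborel" using open_P by simp
  have div: "gw 1 x $ 1 + gw 2 x $ 2 = u x * (2 * i0 x - X 1 x * (1 / x $ 1 * i0 x)) + XG x * i0 x" for x
  proof -
    define j c where "j = 1 / x $ 1" and "c = 1 / \<rho>0"
    have i0: "i0 x = j * c" and j2: "- 1 / (x $ 1)\<^sup>2 = - (j * j)"
      by (simp_all add: i0_def j_def c_def power2_eq_square)
    show ?thesis
      unfolding gw_def XG_def X_def i0 j2 j_def[symmetric] c_def[symmetric] by (simp add: axis_def algebra_simps)
  qed
  have w0: "w i x = u x * (X i x * i0 x)" for i x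
    by (simp add: w_def X_def i0_def)
  have bd: "bc (\<lambda>x. gw 1 x $ 1 + gw 2 x $ 2)" unfolding div by (intro bcs)
  have "(LINT x:P|lborel. \<zeta> e \<sigma> x * (G x $ 1 * w 1 x + G x $ 2 * w 2 x + u x * (gw 1 x $ 1 + gw 2 x $ 2)))
     = - (LINT x:P|lborel. u x * (((- 2 * d\<zeta> e \<sigma> x) *\<^sub>R (x - x0)) $ 1 * w 1 x + ((- 2 * d\<zeta> e \<sigma> x) *\<^sub>R (x - x0)) $ 2 * w 2 x))"
    by (rule positivity_identity[OF wC bw bd \<zeta>_C1[OF h(1)] \<zeta>_support(1,2)[OF h(2,3)] \<zeta>_support(3)[OF h(2,3)]])
  moreover have "(LINT x:P|lborel. \<zeta> e \<sigma> x * (G x $ 1 * w 1 x + G x $ 2 * w 2 x + u x * (gw 1 x $ 1 + gw 2 x $ 2))) = (LINT x:P|lborel. \<zeta> e \<sigma> x * aJ x)"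
    unfolding div w0 unfolding aJ_def f6_def XG_def by (intro set_lebesgue_integral_cong[OF P_sets] allI impI) algebra
  moreover have "- (LINT x:P|lborel. u x * (((- 2 * d\<zeta> e \<sigma> x) *\<^sub>R (x - x0)) $ 1 * w 1 x + ((- 2 * d\<zeta> e \<sigma> x) *\<^sub>R (x - x0)) $ 2 * w 2 x))
     = (LINT x:P|lborel. d\<zeta> e \<sigma> x * (2 * (norm (x - x0))\<^sup>2 * (u x * u x * i0 x)))"
    unfolding set_lebesgue_integral_def integral_minus[symmetric] X_sq[symmetric]
    unfolding w0 by (intro Bochner_Integration.integral_cong refl) (simp add: X_def algebra_simps)
  ultimately show "(LINT x:P|lborel. ppart e (\<sigma> - (norm (x - x0))\<^sup>2) * aJ x) = (LINT x:P|lborel. dppart e (\<sigma> - (norm (x - x0))\<^sup>2) * (2 * (norm (x - x0))\<^sup>2 * (u x * u x * i0 x)))"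
    by (simp add: \<zeta>_def d\<zeta>_def)
qed

text \<open>Origin of the exponent 3. The domain variation yields the expression in
  \<open>aN_eq\<close>, with a coefficient 2 from the dimension; its last term, due to the explicit
  dependence on the second coordinate, equals \<open>E - en + k1 + k2\<close> on \<open>P\<close>,
  where \<open>k1\<close> and \<open>k2\<close> vanish wherever
  \<open>\<eta> = \<rho>0\<close>.\<close>

definition "aN x = 3 * E x + (- 3) * en x + (k1 x + (k2 x + k3 x))"

lemma aN_eq: "x \<in> P \<Longrightarrow> aN x = 2 * E x - 2 * en x + k3 x + x $ 1 * (\<eta> x / \<rho>0\<^sup>2) * x $ 2"
proof -
  assume x: "x \<in> P"
  note e = \<eta>_props[OF x]
  have t: "tG x * (x $ 1)\<^sup>2 = (norm (G x))\<^sup>2" using e by (simp add: tG_def)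
  have "en x = x $ 1 * tG x / \<eta> x"
    unfolding en_def norm2_sq[symmetric] t[symmetric] iH_def using e by (simp add: power2_eq_square)
  then show ?thesis
    using e \<rho>0_pos by (simp add: aN_def E_def k1_def k2_def field_simps power2_eq_square)
qed

lemma domain_variation_identity:
  "AE r in lborel. r \<in> {0<..<\<delta>} \<longrightarrow> 2 * r * A aN r = Cc (\<lambda>x. 2 * (norm (x - x0))\<^sup>2 * E x + (- 4) * (XG x * XG x * iH x)) r"
proof (rule radial_identity)
  show baN: "bc aN" unfolding aN_def by (intro bcs)
  have "bc (\<lambda>x. 2 * (X 1 x * X 1 x + X 2 x * X 2 x) * E x + (- 4) * (XG x * XG x * iH x))" by (intro bcs)
  then show bb: "bc (\<lambda>x. 2 * (norm (x - x0))\<^sup>2 * E x + (- 4) * (XG x * XG x * iH x))" unfolding X_sq .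
  fix e \<sigma> :: real assume h: "0 < e" "0 < \<sigma>" "\<sigma> < \<delta>\<^sup>2"
  define \<phi> where "\<phi> i x = \<zeta> e \<sigma> x * (x $ i + - x0 $ i)" for i :: 2 and x :: "real^2"
  define g\<phi> where "g\<phi> i x = \<zeta> e \<sigma> x *\<^sub>R (axis i 1 + 0) + (x $ i + - x0 $ i) *\<^sub>R ((- 2 * d\<zeta> e \<sigma> x) *\<^sub>R (x - x0))" for i :: 2 and x :: "real^2"
  have \<phi>C: "C1grad UNIV (\<phi> i) (g\<phi> i)" for i
    unfolding \<phi>_def g\<phi>_def by (intro C1grad_mult C1grad_add C1grad_nth C1grad_const \<zeta>_C1 h)
  have "(LINT x:P|lborel. E x * (g\<phi> 1 x $ 1 + g\<phi> 2 x $ 2)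
       - 2 * (1 / \<eta> x * (1 / x $ 1) * (G x $ 1 * (g\<phi> 1 x \<bullet> G x) + G x $ 2 * (g\<phi> 2 x \<bullet> G x)))
       + q x * \<phi> 1 x + x $ 1 * (\<eta> x / \<rho>0\<^sup>2) * \<phi> 2 x) = 0"
    by (rule variation_identity[OF \<phi>C \<zeta>_support(1,2)[OF h(2,3)]]) (use \<zeta>_support(3)[OF h(2,3)] in \<open>simp add: \<phi>_def\<close>)
  moreover have "(LINT x:P|lborel. E x * (g\<phi> 1 x $ 1 + g\<phi> 2 x $ 2)
       - 2 * (1 / \<eta> x * (1 / x $ 1) * (G x $ 1 * (g\<phi> 1 x \<bullet> G x) + G x $ 2 * (g\<phi> 2 x \<bullet> G x)))
       + q x * \<phi> 1 x + x $ 1 * (\<eta> x / \<rho>0\<^sup>2) * \<phi> 2 x)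
     = (LINT x:P|lborel. \<zeta> e \<sigma> x * aN x - d\<zeta> e \<sigma> x * (2 * (norm (x - x0))\<^sup>2 * E x + (- 4) * (XG x * XG x * iH x)))"
  proof (rule set_lebesgue_integral_cong)
    show "P \<in> sets lborel" using open_P by simp
    show "\<forall>x. x \<in> P \<longrightarrow> E x * (g\<phi> 1 x $ 1 + g\<phi> 2 x $ 2)
       - 2 * (1 / \<eta> x * (1 / x $ 1) * (G x $ 1 * (g\<phi> 1 x \<bullet> G x) + G x $ 2 * (g\<phi> 2 x \<bullet> G x)))
       + q x * \<phi> 1 x + x $ 1 * (\<eta> x / \<rho>0\<^sup>2) * \<phi> 2 x
     = \<zeta> e \<sigma> x * aN x - d\<zeta> e \<sigma> x * (2 * (norm (x - x0))\<^sup>2 * E x + (- 4) * (XG x * XG x * iH x))"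
    proof (intro allI impI)
      fix x assume x: "x \<in> P"
      define Z D i where "Z = \<zeta> e \<sigma> x" and "D = d\<zeta> e \<sigma> x" and "i = iH x"
      have d: "g\<phi> 1 x $ 1 + g\<phi> 2 x $ 2 = 2 * Z - 2 * D * (norm (x - x0))\<^sup>2"
        unfolding X_sq[symmetric] by (simp add: g\<phi>_def axis_def X_def Z_def D_def algebra_simps)
      have gg: "G x $ 1 * (g\<phi> 1 x \<bullet> G x) + G x $ 2 * (g\<phi> 2 x \<bullet> G x)
         = Z * (G x $ 1 * G x $ 1 + G x $ 2 * G x $ 2) - 2 * D * (XG x * XG x)"
        by (simp add: inner_real2 g\<phi>_def axis_def X_def XG_def Z_def D_def algebra_simps)
      have iH': "1 / \<eta> x * (1 / x $ 1) = i" by (simp add: iH_def i_def)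
      \<comment> \<open>The centre has second coordinate 0, so the second component of the field is
        \<open>Z * x $ 2\<close>; this produces the last term of \<open>aN_eq\<close>.\<close>
      have p1: "\<phi> 1 x = Z * X 1 x" "\<phi> 2 x = Z * x $ 2" using x0 by (simp_all add: \<phi>_def X_def Z_def)
      show "E x * (g\<phi> 1 x $ 1 + g\<phi> 2 x $ 2)
       - 2 * (1 / \<eta> x * (1 / x $ 1) * (G x $ 1 * (g\<phi> 1 x \<bullet> G x) + G x $ 2 * (g\<phi> 2 x \<bullet> G x)))
       + q x * \<phi> 1 x + x $ 1 * (\<eta> x / \<rho>0\<^sup>2) * \<phi> 2 x
     = \<zeta> e \<sigma> x * aN x - d\<zeta> e \<sigma> x * (2 * (norm (x - x0))\<^sup>2 * E x + (- 4) * (XG x * XG x * iH x))"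
        unfolding d gg iH' p1 aN_eq[OF x] Z_def[symmetric] D_def[symmetric] i_def[symmetric] en_def k3_def
        by (simp add: algebra_simps)
    qed
  qed
  moreover have "(LINT x:P|lborel. \<zeta> e \<sigma> x * aN x - d\<zeta> e \<sigma> x * (2 * (norm (x - x0))\<^sup>2 * E x + (- 4) * (XG x * XG x * iH x)))
    = (LINT x:P|lborel. \<zeta> e \<sigma> x * aN x) - (LINT x:P|lborel. d\<zeta> e \<sigma> x * (2 * (norm (x - x0))\<^sup>2 * E x + (- 4) * (XG x * XG x * iH x)))"
    by (rule set_integral_diff(2)[OF bc_integrable[OF bc_mult[OF bc_\<zeta>[OF h(1)] baN]] bc_integrable[OF bc_mult[OF bc_d\<zeta>[OF h(1)] bb]]])
  ultimately show "(LINT x:P|lborel. ppart e (\<sigma> - (norm (x - x0))\<^sup>2) * aN x) = (LINT x:P|lborel. dppart e (\<sigma> - (norm (x - x0))\<^sup>2) * (2 * (norm (x - x0))\<^sup>2 * E x + (- 4) * (XG x * XG x * iH x)))"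
    by (simp add: \<zeta>_def d\<zeta>_def)
qed

section \<open>The boundary integral J at every radius, and the reduction of the integrals in the
  statement\<close>

lemma A_continuous: assumes "bc k" shows "continuous_on {0<..<\<delta>} (A k)"
proof -
  define c where "c \<rho> = indicator {0<..<\<delta>} \<rho> * Cc k \<rho>" for \<rho>
  have ci: "integrable lborel c"
    using integrable_circle_integrals[OF bc_borel[OF assms] A_integrable[OF assms], of \<delta>]
    by (simp add: c_def[abs_def] Cc_def set_integrable_def)
  have si: "set_integrable lborel S c" if "S \<in> sets borel" for S
    unfolding set_integrable_def by (rule integrable_mult_indicator) (use that ci in auto)
  have eq: "A k r = integral {0..r} c" if r: "r \<in> {0<..<\<delta>}" for r
  proof -
    have "A k r = (LINT \<rho>:{0<..<r}|lborel. Cc k \<rho>)"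
      unfolding A_def Cc_def by (rule integral_ball_polar[OF bc_borel[OF assms] A_integrable[OF assms]])
    also have "\<dots> = (LINT \<rho>:{0<..<r}|lborel. c \<rho>)"
      using r by (intro set_lebesgue_integral_cong) (auto simp: c_def)
    also have "\<dots> = (LINT \<rho>:{0..r}|lborel. c \<rho>)"
    proof (rule set_integral_cong_set)
      show "AE x in lborel. (x \<in> {0..r}) = (x \<in> {0<..<r})"
        using AE_lborel_singleton[of 0] AE_lborel_singleton[of r] by eventually_elim auto
    qed (use ci in \<open>auto simp: set_borel_measurable_def\<close>)
    also have "\<dots> = integral {0..r} c" by (rule set_borel_integral_eq_integral(2)[OF si]) simp
    finally show ?thesis .
  qed
  have "c integrable_on {0..\<delta>}" by (rule set_borel_integral_eq_integral(1)[OF si]) simp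
  then have "continuous_on {0..\<delta>} (\<lambda>r. integral {0..r} c)" by (rule indefinite_integral_continuous_1)
  then have "continuous_on {0<..<\<delta>} (\<lambda>r. integral {0..r} c)" by (rule continuous_on_subset) auto
  then show ?thesis by (rule continuous_on_eq) (simp add: eq)
qed

definition "f00 x = u x * u x * i0 x"

lemma f00_continuous: "continuous_on {0<..<\<delta>} (Cc f00)"
proof -
  have cB: "continuous_on B f00"
  proof -
    have "x $ 1 \<noteq> 0" if "x \<in> B" for x using C_first[of x] that \<delta>_pos by auto
    then show ?thesis unfolding f00_def i0_def by (intro continuous_intros u_cont_B) auto
  qed
  have bf: "bc f00" unfolding f00_def by (intro bcs)
  have inB: "circ x0 r \<theta> \<in> B" if "r \<in> {0<..<\<delta>}" for r \<theta>
    using norm_circ[of x0 r \<theta>] that by (simp add: dist_norm norm_minus_commute)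
  have c2: "continuous_on ({0<..<\<delta>} \<times> cbox 0 (2*pi)) (\<lambda>(r, \<theta>). f00 (circ x0 r \<theta>))"
    unfolding case_prod_unfold
    by (intro continuous_on_compose2[OF cB] continuous_intros) (use inB in auto)
  have "continuous_on {0<..<\<delta>} (\<lambda>r. r * integral (cbox 0 (2*pi)) (\<lambda>\<theta>. f00 (circ x0 r \<theta>)))"
    by (intro continuous_intros integral_continuous_on_param c2)
  moreover have "r * integral (cbox 0 (2*pi)) (\<lambda>\<theta>. f00 (circ x0 r \<theta>)) = Cc f00 r" if r: "r \<in> {0<..<\<delta>}" for r
  proof -
    have ind: "indicator P (circ x0 r \<theta>) * f00 (circ x0 r \<theta>) = f00 (circ x0 r \<theta>)" for \<theta>
      using u_zero_off_P[OF inB[OF r, of \<theta>]] by (auto simp: f00_def split: split_indicator)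
    have ct: "continuous_on {0..2*pi} (\<lambda>\<theta>. f00 (circ x0 r \<theta>))"
      by (intro continuous_on_compose2[OF cB] continuous_intros) (use inB[OF r] in auto)
    have "Cc f00 r = r * (LINT \<theta>:{0..<2*pi}|lborel. f00 (circ x0 r \<theta>))"
      unfolding Cc_def using circle_integral[OF _ bc_borel[OF bf], of r x0] r by (simp add: ind)
    also have "(LINT \<theta>:{0..<2*pi}|lborel. f00 (circ x0 r \<theta>)) = (LINT \<theta>:{0..2*pi}|lborel. f00 (circ x0 r \<theta>))"
    proof (rule set_integral_cong_set)
      show "AE x in lborel. (x \<in> {0..2*pi}) = (x \<in> {0..<2*pi})"
        using AE_lborel_singleton[of "2*pi"] by eventually_elim auto
      have m: "(\<lambda>\<theta>. indicator P (circ x0 r \<theta>) * f00 (circ x0 r \<theta>)) \<in> borel_measurable borel"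
        by (rule measurable_compose[OF _ bc_borel[OF bf]]) (intro borel_measurable_continuous_onI continuous_intros)
      show "set_borel_measurable lborel {0..2 * pi} (\<lambda>\<theta>. f00 (circ x0 r \<theta>))"
        "set_borel_measurable lborel {0..<2 * pi} (\<lambda>\<theta>. f00 (circ x0 r \<theta>))"
        using m unfolding ind set_borel_measurable_def by simp_all
    qed
    also have "\<dots> = integral {0..2*pi} (\<lambda>\<theta>. f00 (circ x0 r \<theta>))"
      by (rule set_borel_integral_eq_integral(2)[OF borel_integrable_atLeastAtMost'[OF ct]])
    finally show ?thesis by simp
  qed
  ultimately show ?thesis by (rule continuous_on_eq)
qed

text \<open>Differentiating \<open>J\<close> requires this at all radii near a given one, whereas
  \<open>J_identity\<close> omits a null set of radii; both sides are continuous in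
  \<open>r\<close>.\<close>

lemma J_eq: "r \<in> {0<..<\<delta>} \<Longrightarrow> r * Cc f00 r = A aJ r"
proof (rule continuous_ae_eq_imp_eq[of 0 \<delta> "\<lambda>r. r * Cc f00 r" "A aJ"])
  show "continuous_on {0<..<\<delta>} (\<lambda>r. r * Cc f00 r)" by (intro continuous_intros f00_continuous)
  show "continuous_on {0<..<\<delta>} (A aJ)" by (rule A_continuous) (unfold aJ_def, intro bcs)
  show "AE r in lborel. r \<in> {0<..<\<delta>} \<longrightarrow> r * Cc f00 r = A aJ r"
    using J_identity
  proof eventually_elim
    case (elim r)
    show ?case
    proof
      assume r: "r \<in> {0<..<\<delta>}"
      have "Cc (\<lambda>x. 2 * (norm (x - x0))\<^sup>2 * (u x * u x * i0 x)) r = Cc (\<lambda>x. (2 * r\<^sup>2) * f00 x) r"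
        by (rule Cc_cong) (simp add: f00_def)
      then have "2 * r * A aJ r = 2 * r\<^sup>2 * Cc f00 r" using elim r by (simp add: Cc_cmult)
      then show "r * Cc f00 r = A aJ r" using r by (simp add: power2_eq_square)
    qed
  qed
qed

lemma ball_reduce:
  assumes k: "bc k" and inP: "\<And>x. x \<in> P \<Longrightarrow> Du x = G x \<Longrightarrow> f x = k x"
    and inB: "\<And>x. x \<in> B \<Longrightarrow> x \<notin> P \<Longrightarrow> Du x = 0 \<Longrightarrow> f x = 0" and r: "r \<in> {0<..<\<delta>}"
  shows "(LINT x:ball x0 r \<inter> upper|lebesgue. f x) = A k r"
  unfolding A_def
proof (rule LINT_lebesgue_eq_lborel)
  show "(\<lambda>x. indicator (ball x0 r) x *\<^sub>R (indicator P x * k x)) \<in> borel_measurable borel"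
    using bc_borel[OF k] by (intro borel_measurable_scaleR borel_measurable_indicator) auto
  show "AE x in lborel. indicator (ball x0 r \<inter> upper) x *\<^sub>R f x = indicator (ball x0 r) x *\<^sub>R (indicator P x * k x)"
    using Du_ae
  proof eventually_elim
    case (elim x)
    show ?case
    proof (cases "x \<in> ball x0 r")
      case True
      then have "x \<in> B" using r by auto
      then show ?thesis using elim True inP[of x] inB[of x] P_upper[of x] by (cases "x \<in> P") auto
    qed simp
  qed
qed simp

lemma circle_reduce:
  assumes r: "r \<in> {0<..<\<delta>}" and N: "N \<in> sets borel" "emeasure hausdorff1 (N \<inter> sphere x0 r) = 0"
    and Du: "\<And>x. x \<in> B \<Longrightarrow> x \<notin> N \<Longrightarrow> Du x = indicator P x *\<^sub>R G x"
    and k: "bc k" and inP: "\<And>x. x \<in> P \<Longrightarrow> norm (x - x0) = r \<Longrightarrow> Du x = G x \<Longrightarrow> f x = k x"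
    and inB: "\<And>x. x \<in> B \<Longrightarrow> x \<notin> P \<Longrightarrow> Du x = 0 \<Longrightarrow> f x = 0"
  shows "(LINT x:sphere x0 r \<inter> upper|hausdorff1. f x) = Cc k r"
  unfolding Cc_def set_lebesgue_integral_def
proof (rule integral_cong_AE_complete[OF complete_measure_hausdorff1])
  have sH: "sphere x0 r \<in> sets hausdorff1" by (simp add: closed_in_sets_hausdorff1)
  show "(\<lambda>x. indicator (sphere x0 r) x *\<^sub>R (indicator P x * k x)) \<in> borel_measurable hausdorff1"
    using borel_measurable_hausdorff1[OF bc_borel[OF k]] sH by (intro borel_measurable_scaleR borel_measurable_indicator) auto
  have "N \<inter> sphere x0 r \<in> null_sets hausdorff1"
    using N borel_subset_sets_hausdorff1 sH by (auto simp: null_sets_def)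
  from AE_not_in[OF this]
  show "AE x in hausdorff1. indicator (sphere x0 r \<inter> upper) x *\<^sub>R f x = indicator (sphere x0 r) x *\<^sub>R (indicator P x * k x)"
  proof eventually_elim
    case (elim x)
    show ?case
    proof (cases "x \<in> sphere x0 r")
      case True
      then have xB: "x \<in> B" and nr: "norm (x - x0) = r" using r by (auto simp: dist_norm norm_minus_commute)
      then have "Du x = indicator P x *\<^sub>R G x" using Du elim True by blast
      then show ?thesis using True nr xB inP[of x] inB[of x] P_upper[of x] by (cases "x \<in> P") auto
    qed simp
  qed
qed

lemma circle_reduce_u:
  assumes r: "r \<in> {0<..<\<delta>}" and eq: "\<And>x. x \<in> B \<Longrightarrow> f x = k x" and z: "\<And>x. u x = 0 \<Longrightarrow> f x = 0"
  shows "(LINT x:sphere x0 r|hausdorff1. f x) = Cc k r"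
  unfolding Cc_def set_lebesgue_integral_def
proof (intro Bochner_Integration.integral_cong refl)
  fix x show "indicator (sphere x0 r) x *\<^sub>R f x = indicator (sphere x0 r) x *\<^sub>R (indicator P x * k x)"
    using r eq[of x] z[of x] u_zero_off_P[of x] by (auto split: split_indicator)
qed

end

section \<open>The monotonicity formula\<close>

text \<open>\<open>I\<close>, \<open>J\<close>, \<open>n\<close>, \<open>m\<close>,
  \<open>c\<close>, \<open>w\<close>, \<open>k6\<close> stand for the integrals of \<open>E\<close>,
  \<open>f00\<close>, \<open>cNN\<close>, \<open>cuN\<close>, \<open>c0N\<close>,
  \<open>cuu\<close>, \<open>f6\<close>. The terms with \<open>I\<close> cancel, which fixes the
  power r^3. The coefficient -3 of \<open>m\<close> splits into -6 in the square and 3 in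
  \<open>K 4\<close>; the coefficients 15/2 and -3 of \<open>J\<close> leave the 9/2 of
  \<open>K 5\<close>; \<open>w\<close> is added in the square and subtracted in
  \<open>K 5\<close>.\<close>

lemma frequency_algebra:
  fixes r I J n m c w k1 k2 k3 k6 :: real
  assumes "0 < r"
  shows "((3 * I + - 3 * (m / r) + (k1 + (k2 + k3))) / r + 2 * n / r\<^sup>2) / r^3 - 3 * I / r^4
      - 3/2 * ((2 * c + (2 * J + - 1 * k6)) / r^5) + 15/2 * (J / r^5)
    = 2 * (1 / r^3) * (1 / r\<^sup>2 * n + (- 3 / r\<^sup>2 * m + 9 / (4 * r\<^sup>2) * w))
      + 1 / r^4 * (k1 + k2 + k3 + 3 * (1 / r * m + - 1 / r * c) + 9 / (2 * r) * (J + - 1 * w) + 3 / (2 * r) * k6)"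
proof -
  define v where "v = 1 / r"
  have "r = 1 / v" using assms by (simp add: v_def)
  then show ?thesis by (simp add: power_one_over power_numeral_reduce algebra_simps add_divide_distrib diff_divide_distrib)
qed

context subsonic_sol
begin

lemma ball_terms:
  assumes r: "r \<in> {0<..<\<delta>}"
  shows "(LINT x:ball x0 r \<inter> upper|lebesgue. x $ 1 * (F (tfun Du x) (x $ 2) + lam g \<rho>0 p (x $ 2) * chi x)) = A E r" (is ?I)
    and "(LINT x:ball x0 r \<inter> upper|lebesgue. x $ 1 *
           ((LBINT \<tau>=0..tfun Du x. deriv (\<lambda>\<sigma>. 1 / H \<sigma> (x $ 2)) \<tau> * \<tau>)
            - (LBINT \<tau>=0..x $ 2. deriv (\<lambda>\<sigma>. 1 / H \<sigma> (x $ 2)) \<tau> * \<tau>) * chi x)) = A k1 r" (is ?K1)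
    and "(LINT x:ball x0 r \<inter> upper|lebesgue. x $ 1 *
           ((LBINT \<tau>=0..tfun Du x. deriv (\<lambda>s. 1 / H \<tau> s) (x $ 2) * x $ 2)
            - (LBINT \<tau>=0..x $ 2. deriv (\<lambda>s. 1 / H \<tau> s) (x $ 2) * x $ 2) * chi x)) = A k2 r" (is ?K2)
    and "(LINT x:ball x0 r \<inter> upper|lebesgue. (x $ 1 - x0 $ 1) *
           (F (tfun Du x) (x $ 2) - 2 * tfun Du x / H (tfun Du x) (x $ 2) + lam g \<rho>0 p (x $ 2) * chi x)) = A k3 r" (is ?K3)
proof -
  have P: "chi x = 1 \<and> tfun Du x = tG x" if "x \<in> P" "Du x = G x" for x
    using that P_subset(1) chi_B[of x] tfun_P(1)[of x] by auto
  have Z: "chi x = 0 \<and> tfun Du x = 0" if "x \<in> B" "x \<notin> P" "Du x = 0" for x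
    using that chi_B[of x] tfun_P(2)[of x] by auto
  show ?I
  proof (rule ball_reduce[OF bc_E _ _ r])
    fix x assume h: "x \<in> P" "Du x = G x"
    show "x $ 1 * (F (tfun Du x) (x $ 2) + lam g \<rho>0 p (x $ 2) * chi x) = E x"
      using P[OF h] F_lam_P(1)[OF h(1)] by (simp add: E_def)
  qed (simp add: Z F_0)
  show ?K1
  proof (rule ball_reduce[OF bc_defs(6) _ _ r])
    fix x assume h: "x \<in> P" "Du x = G x"
    show "x $ 1 * ((LBINT \<tau>=0..tfun Du x. deriv (\<lambda>\<sigma>. 1 / H \<sigma> (x $ 2)) \<tau> * \<tau>)
            - (LBINT \<tau>=0..x $ 2. deriv (\<lambda>\<sigma>. 1 / H \<sigma> (x $ 2)) \<tau> * \<tau>) * chi x) = k1 x"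
      using P[OF h] integrals_P(1)[OF h(1)] by (simp add: k1_def)
  qed (simp add: Z flip: zero_ereal_def)
  show ?K2
  proof (rule ball_reduce[OF bc_defs(7) _ _ r])
    fix x assume h: "x \<in> P" "Du x = G x"
    show "x $ 1 * ((LBINT \<tau>=0..tfun Du x. deriv (\<lambda>s. 1 / H \<tau> s) (x $ 2) * x $ 2)
            - (LBINT \<tau>=0..x $ 2. deriv (\<lambda>s. 1 / H \<tau> s) (x $ 2) * x $ 2) * chi x) = k2 x"
      using P[OF h] integrals_P(2)[OF h(1)] by (simp add: k2_def)
  qed (simp add: Z flip: zero_ereal_def)
  show ?K3
  proof (rule ball_reduce[OF bc_defs(8) _ _ r])
    fix x assume h: "x \<in> P" "Du x = G x"
    show "(x $ 1 - x0 $ 1) *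
           (F (tfun Du x) (x $ 2) - 2 * tfun Du x / H (tfun Du x) (x $ 2) + lam g \<rho>0 p (x $ 2) * chi x) = k3 x"
      using P[OF h] F_lam_P(1)[OF h(1)] by (simp add: k3_def X_def \<eta>_def algebra_simps)
  qed (simp add: Z F_0)
qed

text \<open>\<open>Du\<close> is only determined almost everywhere; circles on which it deviates from \<open>\<nabla>u\<close> on a set of
  positive length have to be excluded.\<close>

definition good_circle :: "real \<Rightarrow> bool" where
  "good_circle r \<longleftrightarrow> (\<exists>N\<in>sets borel. emeasure hausdorff1 (N \<inter> sphere x0 r) = 0 \<and>
     (\<forall>x\<in>B - N. Du x = indicator P x *\<^sub>R G x))"

lemma AE_good_circle: "AE r in lborel. r \<in> {0<..<\<delta>} \<longrightarrow> good_circle r"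
proof -
  obtain N where N: "N \<in> null_sets lborel" "{x \<in> space lborel. \<not> (x \<in> B \<longrightarrow> Du x = indicator P x *\<^sub>R G x)} \<subseteq> N"
    using Du_ae unfolding eventually_ae_filter by blast
  have N': "N \<in> sets borel" "\<forall>x\<in>B - N. Du x = indicator P x *\<^sub>R G x" using N by auto
  show ?thesis
    using AE_circle_null_ball[OF N(1), of \<delta> x0]
  proof eventually_elim
    case (elim r)
    then show ?case using N' unfolding good_circle_def by blast
  qed
qed

lemma good_circle_reduce:
  assumes "r \<in> {0<..<\<delta>}" "good_circle r" "bc k"
    and "\<And>x. x \<in> P \<Longrightarrow> norm (x - x0) = r \<Longrightarrow> Du x = G x \<Longrightarrow> f x = k x"
    and "\<And>x. x \<in> B \<Longrightarrow> x \<notin> P \<Longrightarrow> Du x = 0 \<Longrightarrow> f x = 0"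
  shows "(LINT x:sphere x0 r \<inter> upper|hausdorff1. f x) = Cc k r"
proof -
  obtain N where "N \<in> sets borel" "emeasure hausdorff1 (N \<inter> sphere x0 r) = 0"
    "\<forall>x\<in>B - N. Du x = indicator P x *\<^sub>R G x"
    using assms(2) unfolding good_circle_def by blast
  then show ?thesis by (intro circle_reduce[OF assms(1) _ _ _ assms(3-5)]) auto
qed

definition "cNN x = XG x * XG x * iH x"
definition "cuN x = u x * (XG x * iH x)"
definition "c0N x = u x * (XG x * i0 x)"
definition "cuu x = u x * u x * iH x"

lemma bc_circle_terms: "bc cNN" "bc cuN" "bc c0N" "bc cuu" "bc f00" "bc aJ"
  unfolding cNN_def cuN_def c0N_def cuu_def f00_def aJ_def by (intro bcs)+

lemma circle_terms:
  assumes r: "r \<in> {0<..<\<delta>}" and good: "good_circle r"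
  shows "(LINT x:sphere x0 r \<inter> upper|hausdorff1. 1 / (x $ 1 * H (tfun Du x) (x $ 2)) *
             (Du x \<bullet> ((1 / r) *\<^sub>R (x - x0)) - 3/2 * (u x / r))\<^sup>2)
        = 1 / r\<^sup>2 * Cc cNN r + (- 3 / r\<^sup>2 * Cc cuN r + 9 / (4 * r\<^sup>2) * Cc cuu r)" (is "?main = _")
    and "(LINT x:sphere x0 r \<inter> upper|hausdorff1.
             (1 / (x $ 1 * H (tfun Du x) (x $ 2)) - 1 / (x $ 1 * \<rho>0)) * u x * (Du x \<bullet> ((1 / r) *\<^sub>R (x - x0))))
        = 1 / r * Cc cuN r + - 1 / r * Cc c0N r" (is "?K4 = _")
    and "(LINT x:sphere x0 r \<inter> upper|hausdorff1.
             (1 / (x $ 1 * \<rho>0) - 1 / (x $ 1 * H (tfun Du x) (x $ 2))) * (u x)\<^sup>2)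
        = Cc f00 r + - 1 * Cc cuu r" (is "?K5 = _")
proof -
  have r0: "0 < r" using r by simp
  have N: "G x \<bullet> ((1 / r) *\<^sub>R (x - x0)) = 1 / r * XG x" for x
    by (simp add: inner_real2 XG_def X_def algebra_simps)
  have h: "1 / (x $ 1 * H (tfun Du x) (x $ 2)) = iH x" if "Du x = G x" for x
    using tfun_P(1)[OF that] by (simp add: iH_def \<eta>_def)
  have h0: "1 / (x $ 1 * \<rho>0) = i0 x" for x by (simp add: i0_def)
  note b = bc_circle_terms
  have bm: "bc (\<lambda>x. c * k x)" if "bc k" for c k by (intro bc_mult bc_const that)
  have "?main = Cc (\<lambda>x. 1 / r\<^sup>2 * cNN x + (- 3 / r\<^sup>2 * cuN x + 9 / (4 * r\<^sup>2) * cuu x)) r"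
  proof (rule good_circle_reduce[OF r good])
    show "bc (\<lambda>x. 1 / r\<^sup>2 * cNN x + (- 3 / r\<^sup>2 * cuN x + 9 / (4 * r\<^sup>2) * cuu x))" by (intro bc_add bm b)
    fix x assume "Du x = G x"
    then show "1 / (x $ 1 * H (tfun Du x) (x $ 2)) * (Du x \<bullet> ((1 / r) *\<^sub>R (x - x0)) - 3/2 * (u x / r))\<^sup>2
      = 1 / r\<^sup>2 * cNN x + (- 3 / r\<^sup>2 * cuN x + 9 / (4 * r\<^sup>2) * cuu x)"
      using r0 by (simp only: h N) (simp add: cNN_def cuN_def cuu_def field_simps power2_eq_square)
  qed (simp add: u_zero_off_P)
  also have "\<dots> = 1 / r\<^sup>2 * Cc cNN r + (- 3 / r\<^sup>2 * Cc cuN r + 9 / (4 * r\<^sup>2) * Cc cuu r)"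
    by (simp only: Cc_add[OF r0 bm[OF b(1)] bc_add[OF bm[OF b(2)] bm[OF b(4)]]] Cc_add[OF r0 bm[OF b(2)] bm[OF b(4)]] Cc_cmult)
  finally show "?main = 1 / r\<^sup>2 * Cc cNN r + (- 3 / r\<^sup>2 * Cc cuN r + 9 / (4 * r\<^sup>2) * Cc cuu r)" .
  have "?K4 = Cc (\<lambda>x. 1 / r * cuN x + - 1 / r * c0N x) r"
  proof (rule good_circle_reduce[OF r good])
    show "bc (\<lambda>x. 1 / r * cuN x + - 1 / r * c0N x)" by (intro bc_add bm b)
    fix x assume "Du x = G x"
    then show "(1 / (x $ 1 * H (tfun Du x) (x $ 2)) - 1 / (x $ 1 * \<rho>0)) * u x * (Du x \<bullet> ((1 / r) *\<^sub>R (x - x0)))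
      = 1 / r * cuN x + - 1 / r * c0N x"
      by (simp only: h h0 N) (simp add: cuN_def c0N_def algebra_simps)
  qed (simp add: u_zero_off_P)
  also have "\<dots> = 1 / r * Cc cuN r + - 1 / r * Cc c0N r"
    by (simp only: Cc_add[OF r0 bm[OF b(2)] bm[OF b(3)]] Cc_cmult)
  finally show "?K4 = 1 / r * Cc cuN r + - 1 / r * Cc c0N r" .
  have "?K5 = Cc (\<lambda>x. f00 x + - 1 * cuu x) r"
  proof (rule good_circle_reduce[OF r good])
    show "bc (\<lambda>x. f00 x + - 1 * cuu x)" by (intro bc_add bm b)
    fix x assume "Du x = G x"
    then show "(1 / (x $ 1 * \<rho>0) - 1 / (x $ 1 * H (tfun Du x) (x $ 2))) * (u x)\<^sup>2 = f00 x + - 1 * cuu x"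
      by (simp only: h h0) (simp add: f00_def cuu_def power2_eq_square algebra_simps)
  qed (simp add: u_zero_off_P)
  also have "\<dots> = Cc f00 r + - 1 * Cc cuu r"
    by (simp only: Cc_add[OF r0 b(5) bm[OF b(4)]] Cc_cmult)
  finally show "?K5 = Cc f00 r + - 1 * Cc cuu r" .
qed

text \<open>Only \<open>u\<close> occurs in these integrands, so they can be evaluated on every
  circle and not just on good ones.\<close>

lemma circle_terms_u:
  assumes r: "r \<in> {0<..<\<delta>}"
  shows "(LINT x:sphere x0 r|hausdorff1. (u x)\<^sup>2 / (x $ 1 * \<rho>0)) = Cc f00 r"
    and "(LINT x:sphere x0 r|hausdorff1. (x $ 1 - x0 $ 1) / ((x $ 1)\<^sup>2 * \<rho>0) * (u x)\<^sup>2) = Cc f6 r"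
  by (rule circle_reduce_u[OF r]; simp add: f00_def f6_def i0_def X_def power2_eq_square)+

lemma Cc_aJ: "0 < r \<Longrightarrow> Cc aJ r = 2 * Cc c0N r + (2 * Cc f00 r + - 1 * Cc f6 r)"
proof -
  assume r: "0 < r"
  note b = bc_circle_terms bc_defs(5)
  have bm: "bc (\<lambda>x. c * k x)" if "bc k" for c k by (intro bc_mult bc_const that)
  have "Cc aJ r = Cc (\<lambda>x. 2 * c0N x + (2 * f00 x + - 1 * f6 x)) r"
    by (rule Cc_cong) (simp add: aJ_def c0N_def f00_def)
  also have "\<dots> = 2 * Cc c0N r + (2 * Cc f00 r + - 1 * Cc f6 r)"
    by (simp only: Cc_add[OF r bm[OF b(3)] bc_add[OF bm[OF b(5)] bm[OF b(7)]]] Cc_add[OF r bm[OF b(5)] bm[OF b(7)]] Cc_cmult)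
  finally show ?thesis .
qed

lemma A_aN: "A aN r = 3 * A E r + - 3 * A en r + (A k1 r + (A k2 r + A k3 r))"
proof -
  note b = bc_defs(4,6-8) bc_E
  have bm: "bc (\<lambda>x. c * k x)" if "bc k" for c k by (intro bc_mult bc_const that)
  show ?thesis
    unfolding aN_def[abs_def]
    by (simp only: A_add[OF bc_add[OF bm[OF b(5)] bm[OF b(1)]] bc_add[OF b(2) bc_add[OF b(3,4)]]]
      A_add[OF bm[OF b(5)] bm[OF b(1)]] A_add[OF b(2) bc_add[OF b(3,4)]] A_add[OF b(3,4)] A_cmult)
qed

lemma frequency_derivative:
  "AE r in lborel. r \<in> {0<..<\<delta>} \<longrightarrow>
    ((\<lambda>\<rho>. 1 / \<rho>^3 * A E \<rho> - 3/2 * (1 / \<rho>^4) * Cc f00 \<rho>) has_real_derivative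
       2 * (1 / r^3) * (1 / r\<^sup>2 * Cc cNN r + (- 3 / r\<^sup>2 * Cc cuN r + 9 / (4 * r\<^sup>2) * Cc cuu r))
       + 1 / r^4 * (A k1 r + A k2 r + A k3 r + 3 * (1 / r * Cc cuN r + - 1 / r * Cc c0N r)
          + 9 / (2 * r) * (Cc f00 r + - 1 * Cc cuu r) + 3 / (2 * r) * Cc f6 r)) (at r)"
  using A_deriv[OF bc_E] A_deriv[OF bc_circle_terms(6)] energy_identity domain_variation_identity
proof eventually_elim
  case (elim r)
  show ?case
  proof
    assume r: "r \<in> {0<..<\<delta>}"
    then have r0: "0 < r" by simp
    note dE = elim(1)[rule_format, OF r] and dJ = elim(2)[rule_format, OF r]
    have en: "A en r = Cc cuN r / r"
    proof -
      have "Cc (\<lambda>x. 2 * (u x * (XG x * iH x))) r = 2 * Cc cuN r"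
        by (simp only: Cc_cmult cuN_def[abs_def])
      then show ?thesis using elim(3)[rule_format, OF r] r0 by (simp add: field_simps)
    qed
    have "Cc (\<lambda>x. 2 * (norm (x - x0))\<^sup>2 * E x + (- 4) * (XG x * XG x * iH x)) r = Cc (\<lambda>x. 2 * r\<^sup>2 * E x + (- 4) * cNN x) r"
      by (rule Cc_cong) (simp add: cNN_def)
    also have "\<dots> = 2 * r\<^sup>2 * Cc E r + (- 4) * Cc cNN r"
      by (subst Cc_add[OF r0]) (simp_all only: Cc_cmult bc_mult bc_const bc_E bc_circle_terms)
    finally have "2 * r * A aN r = 2 * r\<^sup>2 * Cc E r + (- 4) * Cc cNN r"
      using elim(4)[rule_format, OF r] by simp
    then have CE: "Cc E r = A aN r / r + 2 * Cc cNN r / r\<^sup>2"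
      using r0 by (simp add: field_simps power2_eq_square)
    \<comment> \<open>By \<open>J_eq\<close> the quotient of the boundary integral by r^4 is
      \<open>A aJ r / r^5\<close>; the quotient rule is applied to this area integral.\<close>
    define D where "D = (Cc E r * r^3 - A E r * (3 * r^2)) / (r^3 * r^3) - 3/2 * ((Cc aJ r * r^5 - A aJ r * (5 * r^4)) / (r^5 * r^5))"
    have "((\<lambda>\<rho>. A E \<rho> / \<rho>^3 - 3/2 * (A aJ \<rho> / \<rho>^5)) has_real_derivative D) (at r)"
      unfolding D_def
    proof (intro DERIV_diff DERIV_cmult DERIV_divide dE dJ)
      show "((\<lambda>\<rho>. \<rho>^3) has_real_derivative 3 * r\<^sup>2) (at r)" "((\<lambda>\<rho>. \<rho>^5) has_real_derivative 5 * r^4) (at r)"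
        by (auto intro!: derivative_eq_intros)
    qed (use r0 in auto)
    then have "((\<lambda>\<rho>. 1 / \<rho>^3 * A E \<rho> - 3/2 * (1 / \<rho>^4) * Cc f00 \<rho>) has_real_derivative D) (at r)"
    proof (rule DERIV_cong_ev[THEN iffD1, OF refl _ refl, rotated])
      have "eventually (\<lambda>\<rho>. \<rho> \<in> {0<..<\<delta>}) (nhds r)" using r by (intro eventually_nhds_in_open) auto
      then show "eventually (\<lambda>\<rho>. A E \<rho> / \<rho>^3 - 3/2 * (A aJ \<rho> / \<rho>^5) = 1 / \<rho>^3 * A E \<rho> - 3/2 * (1 / \<rho>^4) * Cc f00 \<rho>) (nhds r)"
      proof eventually_elim
        case (elim \<rho>)
        then show ?case unfolding J_eq[OF elim, symmetric] by (simp add: field_simps power_numeral_reduce)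
      qed
    qed
    moreover have "D = 2 * (1 / r^3) * (1 / r\<^sup>2 * Cc cNN r + (- 3 / r\<^sup>2 * Cc cuN r + 9 / (4 * r\<^sup>2) * Cc cuu r))
       + 1 / r^4 * (A k1 r + A k2 r + A k3 r + 3 * (1 / r * Cc cuN r + - 1 / r * Cc c0N r)
          + 9 / (2 * r) * (Cc f00 r + - 1 * Cc cuu r) + 3 / (2 * r) * Cc f6 r)"
    proof -
      have "D = Cc E r / r^3 - 3 * A E r / r^4 - 3/2 * (Cc aJ r / r^5) + 15/2 * (Cc f00 r / r^5)"
        unfolding D_def J_eq[OF r, symmetric] using r0 by (simp add: field_simps power_numeral_reduce)
      then show ?thesis
        unfolding CE A_aN en Cc_aJ[OF r0] by (simp only: frequency_algebra[OF r0])
    qed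
    ultimately show "((\<lambda>\<rho>. 1 / \<rho>^3 * A E \<rho> - 3/2 * (1 / \<rho>^4) * Cc f00 \<rho>) has_real_derivative
       2 * (1 / r^3) * (1 / r\<^sup>2 * Cc cNN r + (- 3 / r\<^sup>2 * Cc cuN r + 9 / (4 * r\<^sup>2) * Cc cuu r))
       + 1 / r^4 * (A k1 r + A k2 r + A k3 r + 3 * (1 / r * Cc cuN r + - 1 / r * Cc c0N r)
          + 9 / (2 * r) * (Cc f00 r + - 1 * Cc cuu r) + 3 / (2 * r) * Cc f6 r)) (at r)" by simp
  qed
qed

end

theorem proposition4p4:
  fixes g \<rho>0 \<alpha> :: real and p :: "real \<Rightarrow> real"
    and \<Omega> :: "(real^2) set" and u :: "real^2 \<Rightarrow> real" and Du :: "real^2 \<Rightarrow> real^2"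
    and x0 :: "real^2" and \<delta> :: real
    and t chi :: "real^2 \<Rightarrow> real" and H F :: "real \<Rightarrow> real \<Rightarrow> real" and \<Lambda> :: "real \<Rightarrow> real"
    and Hx :: "real^2 \<Rightarrow> real" and \<nu> :: "real \<Rightarrow> real^2 \<Rightarrow> real^2"
    and I J M :: "real \<Rightarrow> real" and K :: "nat \<Rightarrow> real \<Rightarrow> real"
  assumes "equation_of_state g \<rho>0 \<alpha> p"
    and "admissible_domain g \<rho>0 p \<Omega>"
    and "subsonic_variational_solution g \<rho>0 p \<Omega> u Du"
    and "x0 \<in> \<Omega>" "x0 $ 2 = 0" "x0 $ 1 \<noteq> 0"
    and "\<delta> = 1/2 * min (x0 $ 1) (infdist x0 (rel_boundary \<Omega>))"
    and "H = Hfun g \<rho>0 p" "F = Ffun g \<rho>0 p" "\<Lambda> = lam g \<rho>0 p"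
    and "t = (\<lambda>x. (norm (Du x))\<^sup>2 / (x $ 1)\<^sup>2)"
    and "Hx = (\<lambda>x. H (t x) (x $ 2))"
    and "chi = indicat_real {x\<in>\<Omega>. 0 < u x}"
    and "\<nu> = (\<lambda>r x. (1 / r) *\<^sub>R (x - x0))"
    and "I = (\<lambda>r. LINT x:ball x0 r \<inter> upper|lebesgue.
           x $ 1 * (F (t x) (x $ 2) + \<Lambda> (x $ 2) * chi x))"
    and "J = (\<lambda>r. LINT x:sphere x0 r|hausdorff1. (u x)\<^sup>2 / (x $ 1 * \<rho>0))"
    and "M = (\<lambda>r. 1 / r^3 * I r - 3/2 * (1 / r^4) * J r)"
    and "K 1 = (\<lambda>r. LINT x:ball x0 r \<inter> upper|lebesgue. x $ 1 *
           ((LBINT \<tau>=0..t x. deriv (\<lambda>\<sigma>. 1 / H \<sigma> (x $ 2)) \<tau> * \<tau>)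
            - (LBINT \<tau>=0..x $ 2. deriv (\<lambda>\<sigma>. 1 / H \<sigma> (x $ 2)) \<tau> * \<tau>) * chi x))"
    and "K 2 = (\<lambda>r. LINT x:ball x0 r \<inter> upper|lebesgue. x $ 1 *
           ((LBINT \<tau>=0..t x. deriv (\<lambda>s. 1 / H \<tau> s) (x $ 2) * x $ 2)
            - (LBINT \<tau>=0..x $ 2. deriv (\<lambda>s. 1 / H \<tau> s) (x $ 2) * x $ 2) * chi x))"
    and "K 3 = (\<lambda>r. LINT x:ball x0 r \<inter> upper|lebesgue. (x $ 1 - x0 $ 1) *
           (F (t x) (x $ 2) - 2 * t x / Hx x + \<Lambda> (x $ 2) * chi x))"
    and "K 4 = (\<lambda>r. 3 * (LINT x:sphere x0 r \<inter> upper|hausdorff1.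
           (1 / (x $ 1 * Hx x) - 1 / (x $ 1 * \<rho>0)) * u x * (Du x \<bullet> \<nu> r x)))"
    and "K 5 = (\<lambda>r. 9 / (2 * r) * (LINT x:sphere x0 r \<inter> upper|hausdorff1.
           (1 / (x $ 1 * \<rho>0) - 1 / (x $ 1 * Hx x)) * (u x)\<^sup>2))"
    and "K 6 = (\<lambda>r. 3 / (2 * r) * (LINT x:sphere x0 r|hausdorff1.
           (x $ 1 - x0 $ 1) / ((x $ 1)\<^sup>2 * \<rho>0) * (u x)\<^sup>2))"
  shows "AE r in lborel. r \<in> {0<..<\<delta>} \<longrightarrow>
    (M has_real_derivative
       2 * (1 / r^3) * (LINT x:sphere x0 r \<inter> upper|hausdorff1.
           1 / (x $ 1 * Hx x) * (Du x \<bullet> \<nu> r x - 3/2 * (u x / r))\<^sup>2)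
       + (\<Sum>i=1..6. 1 / r^4 * K i r)) (at r)"
proof (cases "0 < \<delta>")
  case False
  then show ?thesis by simp
next
  case True
  interpret subsonic_sol g \<rho>0 \<alpha> p \<Omega> u Du x0 \<delta>
    by unfold_locales (use assms(1-7) True in blast)+
  have t: "t = tfun Du" unfolding assms(11) by (simp add: fun_eq_iff tfun_def)
  note defs = assms(8-10,12-23) t
  \<comment> \<open>Valid at every radius, because neither \<open>I\<close> nor \<open>J\<close>
    involves values of \<open>Du\<close> on a circle. The derivative of \<open>M\<close> at
    \<open>r\<close> presupposes the equation on a neighbourhood of \<open>r\<close>.\<close>
  have M: "M \<rho> = 1 / \<rho>^3 * A E \<rho> - 3/2 * (1 / \<rho>^4) * Cc f00 \<rho>" if "\<rho> \<in> {0<..<\<delta>}" for \<rho>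
    by (simp only: defs ball_terms(1)[OF that] circle_terms_u(1)[OF that])
  show ?thesis
    using frequency_derivative AE_good_circle
  proof eventually_elim
    case (elim r)
    show ?case
    proof
      assume r: "r \<in> {0<..<\<delta>}"
      note good = elim(2)[rule_format, OF r]
      have K: "K 1 r = A k1 r" "K 2 r = A k2 r" "K 3 r = A k3 r"
        "K 4 r = 3 * (1 / r * Cc cuN r + - 1 / r * Cc c0N r)"
        "K 5 r = 9 / (2 * r) * (Cc f00 r + - 1 * Cc cuu r)" "K 6 r = 3 / (2 * r) * Cc f6 r"
        by (simp_all only: defs ball_terms[OF r] circle_terms[OF r good] circle_terms_u[OF r])
      have main: "(LINT x:sphere x0 r \<inter> upper|hausdorff1. 1 / (x $ 1 * Hx x) * (Du x \<bullet> \<nu> r x - 3/2 * (u x / r))\<^sup>2)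
          = 1 / r\<^sup>2 * Cc cNN r + (- 3 / r\<^sup>2 * Cc cuN r + 9 / (4 * r\<^sup>2) * Cc cuu r)"
        by (simp only: defs circle_terms(1)[OF r good])
      have s: "(\<Sum>i=1..6. 1 / r^4 * K i r) = 1 / r^4 * (K 1 r + K 2 r + K 3 r + K 4 r + K 5 r + K 6 r)"
        by (simp add: eval_nat_numeral algebra_simps)
      have ev: "eventually (\<lambda>\<rho>. 1 / \<rho>^3 * A E \<rho> - 3/2 * (1 / \<rho>^4) * Cc f00 \<rho> = M \<rho>) (nhds r)"
        using eventually_nhds_in_open[of "{0<..<\<delta>}" r] r by (auto elim!: eventually_mono simp: M)
      show "(M has_real_derivative 2 * (1 / r^3) * (LINT x:sphere x0 r \<inter> upper|hausdorff1.
           1 / (x $ 1 * Hx x) * (Du x \<bullet> \<nu> r x - 3/2 * (u x / r))\<^sup>2)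
         + (\<Sum>i=1..6. 1 / r^4 * K i r)) (at r)"
        unfolding main s K
        by (rule DERIV_cong_ev[THEN iffD1, OF refl ev refl, OF elim(1)[rule_format, OF r]])
    qed
  qed
qed

end
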